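(* Let $\mathbf{B}$ be the Burnside (bi-set) bicategory of groupoids and $\mathbf{C}$ the correspondence bicategory of groupoids. For groupoids $H,G$ let $\Phi_{H,G}:\mathbf{B}(H,G)\to\mathbf{C}(H,G)$ be the functor sending an admissible $(H,G)$-bi-set $X$ to the correspondence $H\xleftarrow{q}GXH\xrightarrow{p}G$ given by the double translation groupoid with its two projections, and sending an isomorphism $f:X'\to X$ of bi-sets to the class of $(1,t,1)$, where $t:GX'H\to GXH$ is given by $(\gamma,x',\eta)\mapsto(\gamma,f x',\eta)$ on objects and $(g,h)\mapsto(g,h)$ on morphisms. Then there is a morphism of bicategories $\mathbf{B}\to\mathbf{C}$ that is the identity on objects and whose functors on morphism categories are the $\Phi_{H,G}$, and this morphism is a bi-equivalence.
   Context: All groupoids are small; $G_0$ is the object set of $G$. **Bi-sets.** A (left) $G$-set is a functor $X:G\to\mathbf{Set}$, with values $X_\gamma$; for $g:\gamma'\to\gamma$ and $x\in X_{\gamma'}$ write $gx\in X_\gamma$. A right $G$-set is a functor $Y:G^{\mathrm{op}}\to\mathbf{Set}$, with values $Y^\gamma$ and action $y\mapsto yg$. A $G$-set $X$ is free if for all $\gamma,\gamma'\in G_0$ and $x\in X_{\gamma'}$ the map $G(\gamma',\gamma)\to X_\gamma$, $g\mapsto gx$, is injective; it is finitely generated if $\mathrm{colim}_G X$ is finite. An $(H,G)$-bi-set is a functor $X:H^{\mathrm{op}}\times G\to\mathbf{Set}$, with values $X^\eta_\gamma$; it is admissible if for every $\eta\in H_0$ the $G$-set $X^\eta$ is free and finitely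 generated. For a right $H$-set $X$ and left $H$-set $Y$, $X\otimes_H Y=\coprod_{\eta\in H_0}X^\eta\times Y_\eta/\sim$, with $(xh,y)\sim(x,hy)$ (the co-end). **The bicategory $\mathbf{B}$.** Objects are groupoids; $\mathbf{B}(H,G)$ is the groupoid of admissible $(H,G)$-bi-sets and natural isomorphisms. Composition $\mathbf{B}(H,G)\times\mathbf{B}(K,H)\to\mathbf{B}(K,G)$ sends $(X,Y)$ to $X\otimes_HY$, where $(X\otimes_HY)^\kappa_\gamma=X_\gamma\otimes_HY^\kappa$. The identity $1_G$ is $(1_G)^{\gamma'}_\gamma=G(\gamma',\gamma)$; unitors and associator are the canonical ones. **Double translation groupoid.** For an $(H,G)$-bi-set $X$, $GXH$ has object set $\coprod_{(\gamma,\eta)\in G_0\times H_0}X^\eta_\gamma$; a morphism $(\overline\gamma,\overline x,\overline\eta)\to(\gamma,x,\eta)$ is a pair $(g:\overline\gamma\to\gamma,\ h:\overline\eta\to\eta)$ with $g\overline x=xh$ in $X^{\overline\eta}_\gamma$; composition is componentwise. The projections are $p:GXH\to G$ and $q:GXH\to H$. **Weak finite covers.** A functor $q:L\to H$ of groupoids is a fibration if for every $\lambda'\in L_0$ and $h:q\lambda'\to\eta$ there is $l:\lambda'\to\lambda$ in $L$ with $ql=h$. The fiber $q^{-1}\eta$ is the subcategory of objects mapping to $\eta$ and morphisms mapping to $1_\eta$. $q$ is a weak finite cover if it is a fibration and every fiber has at most one morphism between any two objects and has finitely many components. **The bicategory $\mathbf{C}$.** Objects are groupoids. A correspondence from $H$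 to $G$ is a diagram of groupoids $H\xleftarrow{q}L\xrightarrow{p}G$ with $q$ a weak finite cover. A morphism $(q',L',p')\to(q,L,p)$ is an equivalence class of triples $(\phi,t,\theta)$ with $t:L'\to L$ a functor and $\phi:q'\to qt$, $\theta:p'\to pt$ natural transformations; $(\overline\phi,\overline t,\overline\theta)$ and $(\phi,t,\theta)$ are equivalent if there is a natural transformation $\psi:\overline t\to t$ with $q\psi\circ\overline\phi=\phi$ and $p\psi\circ\overline\theta=\theta$. Composition is $(\phi'',t'',\theta'')\circ(\phi',t',\theta')=(\phi''_{t'}\circ\phi',\,t''t',\,\theta''_{t'}\circ\theta')$. $\mathbf{C}(H,G)$ is the groupoid of correspondences from $H$ to $G$ and isomorphisms in this category. Composition $\mathbf{C}(G,F)\times\mathbf{C}(H,G)\to\mathbf{C}(H,F)$ sends $(G\xleftarrow{n}K\xrightarrow{m}F,\ H\xleftarrow{q}L\xrightarrow{p}G)$ to $H\leftarrow K\times_GL\to F$, with $K\times_GL$ the strict pullback and legs the composites of the projections with $q$ and $m$. Since $n$ is a fibration, the strict pullback is equivalent to the iso-comma groupoid (objects $(\kappa,\lambda,\ n\kappa\cong p\lambda)$), and the action of composition on 2-cells is the one induced on iso-comma groupoids by the triples. The identity 1-cell of $G$ is $G\xleftarrow{1}G\xrightarrow{1}G$; associator and unitors are the canonical ones. A morphism of bicategories is meant in the usual (lax functor) sense; it is a bi-equivalence if it is a homomorphism (pseudofunctor) that is an equivalence on each morphism category and surjective on objects up to internal equivalence. *)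

theory Defs
  imports Main "HOL-Library.FuncSet" "HOL-Library.Nat_Bijection"
begin

section \<open>Small sets\<close>

text \<open>
  A HOL type has no sets of sets built in, so "small" is relative to a universe: a type with a
  pairing and with a notion of small subset that is closed under subsets, replacement, small
  unions, and contains the finite sets.  The elements of any model of set theory with the sets
  it contains, or an infinite type with all of its subsets, are such universes; the results are
  stated for an arbitrary one.
\<close>

class universe =
  fixes upair :: "'a \<Rightarrow> 'a \<Rightarrow> 'a"
    and ufst :: "'a \<Rightarrow> 'a"
    and usnd :: "'a \<Rightarrow> 'a"
    and small :: "'a set \<Rightarrow> bool"
  assumes ufst_upair [simp]: "ufst (upair a b) = a"
    and usnd_upair [simp]: "usnd (upair a b) = b"
    and small_finite: "finite A \<Longrightarrow> small A"
    and small_subset: "small A \<Longrightarrow> A' \<subseteq> A \<Longrightarrow> small A'"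
    and small_image: "small A \<Longrightarrow> small (f ` A)"
    and small_UN: "small A \<Longrightarrow> (\<And>x. x \<in> A \<Longrightarrow> small (D x)) \<Longrightarrow> small (\<Union>x\<in>A. D x)"

text \<open>Universes exist: the countable one.\<close>

instantiation nat :: universe
begin
definition upair_nat :: "nat \<Rightarrow> nat \<Rightarrow> nat" where "upair_nat a b = prod_encode (a, b)"
definition ufst_nat :: "nat \<Rightarrow> nat" where "ufst_nat z = fst (prod_decode z)"
definition usnd_nat :: "nat \<Rightarrow> nat" where "usnd_nat z = snd (prod_decode z)"
definition small_nat :: "nat set \<Rightarrow> bool" where "small_nat A = True"
instance by standard (simp_all add: upair_nat_def ufst_nat_def usnd_nat_def small_nat_def)
end

definition utriple :: "'u::universe \<Rightarrow> 'u \<Rightarrow> 'u \<Rightarrow> 'u" where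
  "utriple a b c = upair a (upair b c)"

definition u1 :: "'u::universe \<Rightarrow> 'u" where "u1 z = ufst z"
definition u2 :: "'u::universe \<Rightarrow> 'u" where "u2 z = ufst (usnd z)"
definition u3 :: "'u::universe \<Rightarrow> 'u" where "u3 z = usnd (usnd z)"

text \<open>The equivalence relation generated by a relation.\<close>

definition eqv :: "('a \<times> 'a) set \<Rightarrow> ('a \<times> 'a) set" where
  "eqv r = (r \<union> r\<inverse>)\<^sup>*"


section \<open>Categories, functors, natural transformations\<close>

text \<open>
  Hom-sets are indexed by source and target and need not be disjoint; consequently composition
  and the arrow part of a functor carry the objects as indices.  \<open>Comp C a b c g f\<close> is
  $g \circ f$ for $f : a \to b$ and $g : b \to c$.  Values outside the carriers are irrelevant.
\<close>

record ('o, 'a) cat =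
  Obj :: "'o set"
  Hom :: "'o \<Rightarrow> 'o \<Rightarrow> 'a set"
  Ident :: "'o \<Rightarrow> 'a"
  Comp :: "'o \<Rightarrow> 'o \<Rightarrow> 'o \<Rightarrow> 'a \<Rightarrow> 'a \<Rightarrow> 'a"

record ('o, 'a, 'p, 'b) fctr =
  omap :: "'o \<Rightarrow> 'p"
  amap :: "'o \<Rightarrow> 'o \<Rightarrow> 'a \<Rightarrow> 'b"

locale category =
  fixes C :: "('o, 'a) cat"
  assumes Ident_in_Hom: "a \<in> Obj C \<Longrightarrow> Ident C a \<in> Hom C a a"
    and Comp_in_Hom: "\<lbrakk>a \<in> Obj C; b \<in> Obj C; c \<in> Obj C; f \<in> Hom C a b; g \<in> Hom C b c\<rbrakk>
          \<Longrightarrow> Comp C a b c g f \<in> Hom C a c"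
    and Comp_Ident_left: "\<lbrakk>a \<in> Obj C; b \<in> Obj C; f \<in> Hom C a b\<rbrakk>
          \<Longrightarrow> Comp C a b b (Ident C b) f = f"
    and Comp_Ident_right: "\<lbrakk>a \<in> Obj C; b \<in> Obj C; f \<in> Hom C a b\<rbrakk>
          \<Longrightarrow> Comp C a a b f (Ident C a) = f"
    and Comp_assoc: "\<lbrakk>a \<in> Obj C; b \<in> Obj C; c \<in> Obj C; d \<in> Obj C;
            f \<in> Hom C a b; g \<in> Hom C b c; h \<in> Hom C c d\<rbrakk>
          \<Longrightarrow> Comp C a b d (Comp C b c d h g) f = Comp C a c d h (Comp C a b c g f)"

definition iso_arr :: "('o, 'a) cat \<Rightarrow> 'o \<Rightarrow> 'o \<Rightarrow> 'a \<Rightarrow> bool" where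
  "iso_arr C a b f \<longleftrightarrow> f \<in> Hom C a b \<and>
     (\<exists>g\<in>Hom C b a. Comp C a b a g f = Ident C a \<and> Comp C b a b f g = Ident C b)"

definition inv_arr :: "('o, 'a) cat \<Rightarrow> 'o \<Rightarrow> 'o \<Rightarrow> 'a \<Rightarrow> 'a" where
  "inv_arr C a b f = (THE g. g \<in> Hom C b a \<and>
     Comp C a b a g f = Ident C a \<and> Comp C b a b f g = Ident C b)"

definition isomorphic :: "('o, 'a) cat \<Rightarrow> 'o \<Rightarrow> 'o \<Rightarrow> bool" where
  "isomorphic C a b \<longleftrightarrow> (\<exists>f. iso_arr C a b f)"

locale small_groupoid = category G for G :: "('u::universe, 'u) cat" +
  assumes all_iso: "\<lbrakk>a \<in> Obj G; b \<in> Obj G; f \<in> Hom G a b\<rbrakk> \<Longrightarrow> iso_arr G a b f"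
    and small_Obj: "small (Obj G)"
    and small_Hom: "\<lbrakk>a \<in> Obj G; b \<in> Obj G\<rbrakk> \<Longrightarrow> small (Hom G a b)"

locale is_functor =
  fixes A :: "('o, 'a) cat" and B :: "('p, 'b) cat" and F :: "('o, 'a, 'p, 'b) fctr"
  assumes omap_in_Obj: "a \<in> Obj A \<Longrightarrow> omap F a \<in> Obj B"
    and amap_in_Hom: "\<lbrakk>a \<in> Obj A; b \<in> Obj A; f \<in> Hom A a b\<rbrakk>
          \<Longrightarrow> amap F a b f \<in> Hom B (omap F a) (omap F b)"
    and amap_Ident: "a \<in> Obj A \<Longrightarrow> amap F a a (Ident A a) = Ident B (omap F a)"
    and amap_Comp: "\<lbrakk>a \<in> Obj A; b \<in> Obj A; c \<in> Obj A; f \<in> Hom A a b; g \<in> Hom A b c\<rbrakk>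
          \<Longrightarrow> amap F a c (Comp A a b c g f)
            = Comp B (omap F a) (omap F b) (omap F c) (amap F b c g) (amap F a b f)"

locale nat_trans =
  fixes A :: "('o, 'a) cat" and B :: "('p, 'b) cat"
    and F G :: "('o, 'a, 'p, 'b) fctr" and \<alpha> :: "'o \<Rightarrow> 'b"
  assumes component_in_Hom: "a \<in> Obj A \<Longrightarrow> \<alpha> a \<in> Hom B (omap F a) (omap G a)"
    and naturality: "\<lbrakk>a \<in> Obj A; b \<in> Obj A; f \<in> Hom A a b\<rbrakk>
          \<Longrightarrow> Comp B (omap F a) (omap F b) (omap G b) (\<alpha> b) (amap F a b f)
            = Comp B (omap F a) (omap G a) (omap G b) (amap G a b f) (\<alpha> a)"

definition naturally_isomorphic ::
  "('o, 'a) cat \<Rightarrow> ('p, 'b) cat \<Rightarrow> ('o, 'a, 'p, 'b) fctr \<Rightarrow> ('o, 'a, 'p, 'b) fctr \<Rightarrow> bool" where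
  "naturally_isomorphic A B F G \<longleftrightarrow>
     (\<exists>\<alpha>. nat_trans A B F G \<alpha> \<and> (\<forall>a\<in>Obj A. iso_arr B (omap F a) (omap G a) (\<alpha> a)))"

definition id_fctr :: "('o, 'a, 'o, 'a) fctr" where
  "id_fctr = \<lparr>omap = (\<lambda>a. a), amap = (\<lambda>a b f. f)\<rparr>"

definition comp_fctr ::
  "('p, 'b, 'q, 'c) fctr \<Rightarrow> ('o, 'a, 'p, 'b) fctr \<Rightarrow> ('o, 'a, 'q, 'c) fctr" where
  "comp_fctr K F = \<lparr>omap = (\<lambda>a. omap K (omap F a)),
     amap = (\<lambda>a b f. amap K (omap F a) (omap F b) (amap F a b f))\<rparr>"

definition equivalence_of_categories ::
  "('o, 'a) cat \<Rightarrow> ('p, 'b) cat \<Rightarrow> ('o, 'a, 'p, 'b) fctr \<Rightarrow> bool" where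
  "equivalence_of_categories A B F \<longleftrightarrow> is_functor A B F \<and>
     (\<exists>K. is_functor B A K \<and> naturally_isomorphic A A (comp_fctr K F) id_fctr
                          \<and> naturally_isomorphic B B (comp_fctr F K) id_fctr)"

definition op_cat :: "('o, 'a) cat \<Rightarrow> ('o, 'a) cat" where
  "op_cat C = \<lparr>Obj = Obj C, Hom = (\<lambda>a b. Hom C b a), Ident = Ident C,
     Comp = (\<lambda>a b c g f. Comp C c b a f g)\<rparr>"

definition prod_cat :: "('o, 'a) cat \<Rightarrow> ('p, 'b) cat \<Rightarrow> ('o \<times> 'p, 'a \<times> 'b) cat" where
  "prod_cat C D = \<lparr>Obj = Obj C \<times> Obj D,
     Hom = (\<lambda>(a, a') (b, b'). Hom C a b \<times> Hom D a' b'),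
     Ident = (\<lambda>(a, a'). (Ident C a, Ident D a')),
     Comp = (\<lambda>(a, a') (b, b') (c, c') (g, g') (f, f').
               (Comp C a b c g f, Comp D a' b' c' g' f'))\<rparr>"

definition full_subcat :: "('o, 'a) cat \<Rightarrow> ('o \<Rightarrow> bool) \<Rightarrow> ('o, 'a) cat" where
  "full_subcat C P = C\<lparr>Obj := {x \<in> Obj C. P x}\<rparr>"

definition core :: "('o, 'a) cat \<Rightarrow> ('o, 'a) cat" where
  "core C = C\<lparr>Hom := (\<lambda>a b. {f. iso_arr C a b f})\<rparr>"

definition set_cat :: "('u::universe set, 'u \<Rightarrow> 'u) cat" where
  "set_cat = \<lparr>Obj = {A. small A}, Hom = (\<lambda>A B. A \<rightarrow>\<^sub>E B), Ident = (\<lambda>A. \<lambda>x\<in>A. x),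
     Comp = (\<lambda>A B C g f. compose A g f)\<rparr>"

definition functor_cat ::
  "('o, 'a) cat \<Rightarrow> ('p, 'b) cat \<Rightarrow> (('o, 'a, 'p, 'b) fctr, 'o \<Rightarrow> 'b) cat" where
  "functor_cat A B = \<lparr>Obj = {F. is_functor A B F},
     Hom = (\<lambda>F G. {\<alpha> \<in> extensional (Obj A). nat_trans A B F G \<alpha>}),
     Ident = (\<lambda>F. \<lambda>a\<in>Obj A. Ident B (omap F a)),
     Comp = (\<lambda>F G K \<beta> \<alpha>. \<lambda>a\<in>Obj A. Comp B (omap F a) (omap G a) (omap K a) (\<beta> a) (\<alpha> a))\<rparr>"


section \<open>Bicategories\<close>

text \<open>
  \<open>BHom B H G\<close> is the category of 1-cells from \<open>H\<close> to \<open>G\<close>, and \<open>BComp B K H G\<close> is the functor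
  $B(H,G) \times B(K,H) \to B(K,G)$.  The associator of \<open>X : H \<rightarrow> G\<close>, \<open>Y : K \<rightarrow> H\<close>, \<open>Z : L \<rightarrow> K\<close> is
  \<open>BAssoc B L K H G X Y Z : (X Y) Z \<rightarrow> X (Y Z)\<close>.
\<close>

record ('o, 'm, 'c) bicat =
  BOb :: "'o set"
  BHom :: "'o \<Rightarrow> 'o \<Rightarrow> ('m, 'c) cat"
  BComp :: "'o \<Rightarrow> 'o \<Rightarrow> 'o \<Rightarrow> ('m \<times> 'm, 'c \<times> 'c, 'm, 'c) fctr"
  BUnit :: "'o \<Rightarrow> 'm"
  BAssoc :: "'o \<Rightarrow> 'o \<Rightarrow> 'o \<Rightarrow> 'o \<Rightarrow> 'm \<Rightarrow> 'm \<Rightarrow> 'm \<Rightarrow> 'c"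
  BLUnit :: "'o \<Rightarrow> 'o \<Rightarrow> 'm \<Rightarrow> 'c"
  BRUnit :: "'o \<Rightarrow> 'o \<Rightarrow> 'm \<Rightarrow> 'c"

abbreviation onecells :: "('o, 'm, 'c) bicat \<Rightarrow> 'o \<Rightarrow> 'o \<Rightarrow> 'm set" where
  "onecells B H G \<equiv> Obj (BHom B H G)"

abbreviation twocells :: "('o, 'm, 'c) bicat \<Rightarrow> 'o \<Rightarrow> 'o \<Rightarrow> 'm \<Rightarrow> 'm \<Rightarrow> 'c set" where
  "twocells B H G X Y \<equiv> Hom (BHom B H G) X Y"

abbreviation vcomp ::
  "('o, 'm, 'c) bicat \<Rightarrow> 'o \<Rightarrow> 'o \<Rightarrow> 'm \<Rightarrow> 'm \<Rightarrow> 'm \<Rightarrow> 'c \<Rightarrow> 'c \<Rightarrow> 'c" where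
  "vcomp B H G X Y Z g f \<equiv> Comp (BHom B H G) X Y Z g f"

abbreviation id2 :: "('o, 'm, 'c) bicat \<Rightarrow> 'o \<Rightarrow> 'o \<Rightarrow> 'm \<Rightarrow> 'c" where
  "id2 B H G X \<equiv> Ident (BHom B H G) X"

abbreviation hcomp1 ::
  "('o, 'm, 'c) bicat \<Rightarrow> 'o \<Rightarrow> 'o \<Rightarrow> 'o \<Rightarrow> 'm \<Rightarrow> 'm \<Rightarrow> 'm" where
  "hcomp1 B K H G X Y \<equiv> omap (BComp B K H G) (X, Y)"

text \<open>For \<open>f : X' \<rightarrow> X\<close> and \<open>g : Y' \<rightarrow> Y\<close>:\<close>

abbreviation hcomp2 ::
  "('o, 'm, 'c) bicat \<Rightarrow> 'o \<Rightarrow> 'o \<Rightarrow> 'o \<Rightarrow> 'm \<Rightarrow> 'm \<Rightarrow> 'm \<Rightarrow> 'm \<Rightarrow> 'c \<Rightarrow> 'c \<Rightarrow> 'c" where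
  "hcomp2 B K H G X' X Y' Y f g \<equiv> amap (BComp B K H G) (X', Y') (X, Y) (f, g)"

locale bicategory =
  fixes B :: "('o, 'm, 'c) bicat"
  assumes category_BHom: "\<lbrakk>H \<in> BOb B; G \<in> BOb B\<rbrakk> \<Longrightarrow> category (BHom B H G)"
    and functor_BComp: "\<lbrakk>K \<in> BOb B; H \<in> BOb B; G \<in> BOb B\<rbrakk>
      \<Longrightarrow> is_functor (prod_cat (BHom B H G) (BHom B K H)) (BHom B K G) (BComp B K H G)"
    and BUnit_onecell: "G \<in> BOb B \<Longrightarrow> BUnit B G \<in> onecells B G G"
    and BAssoc_iso:
      "\<lbrakk>L \<in> BOb B; K \<in> BOb B; H \<in> BOb B; G \<in> BOb B;
        X \<in> onecells B H G; Y \<in> onecells B K H; Z \<in> onecells B L K\<rbrakk>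
      \<Longrightarrow> iso_arr (BHom B L G)
            (hcomp1 B L K G (hcomp1 B K H G X Y) Z)
            (hcomp1 B L H G X (hcomp1 B L K H Y Z)) (BAssoc B L K H G X Y Z)"
    and BAssoc_natural:
      "\<lbrakk>L \<in> BOb B; K \<in> BOb B; H \<in> BOb B; G \<in> BOb B;
        X' \<in> onecells B H G; X \<in> onecells B H G; f \<in> twocells B H G X' X;
        Y' \<in> onecells B K H; Y \<in> onecells B K H; g \<in> twocells B K H Y' Y;
        Z' \<in> onecells B L K; Z \<in> onecells B L K; h \<in> twocells B L K Z' Z\<rbrakk>
      \<Longrightarrow> vcomp B L G
            (hcomp1 B L K G (hcomp1 B K H G X' Y') Z')
            (hcomp1 B L K G (hcomp1 B K H G X Y) Z)
            (hcomp1 B L H G X (hcomp1 B L K H Y Z))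
            (BAssoc B L K H G X Y Z)
            (hcomp2 B L K G (hcomp1 B K H G X' Y') (hcomp1 B K H G X Y) Z' Z
               (hcomp2 B K H G X' X Y' Y f g) h)
        = vcomp B L G
            (hcomp1 B L K G (hcomp1 B K H G X' Y') Z')
            (hcomp1 B L H G X' (hcomp1 B L K H Y' Z'))
            (hcomp1 B L H G X (hcomp1 B L K H Y Z))
            (hcomp2 B L H G X' X (hcomp1 B L K H Y' Z') (hcomp1 B L K H Y Z)
               f (hcomp2 B L K H Y' Y Z' Z g h))
            (BAssoc B L K H G X' Y' Z')"
    and BLUnit_iso: "\<lbrakk>H \<in> BOb B; G \<in> BOb B; X \<in> onecells B H G\<rbrakk>
      \<Longrightarrow> iso_arr (BHom B H G) (hcomp1 B H G G (BUnit B G) X) X (BLUnit B H G X)"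
    and BLUnit_natural:
      "\<lbrakk>H \<in> BOb B; G \<in> BOb B; X' \<in> onecells B H G; X \<in> onecells B H G; f \<in> twocells B H G X' X\<rbrakk>
      \<Longrightarrow> vcomp B H G (hcomp1 B H G G (BUnit B G) X') (hcomp1 B H G G (BUnit B G) X) X
            (BLUnit B H G X)
            (hcomp2 B H G G (BUnit B G) (BUnit B G) X' X (id2 B G G (BUnit B G)) f)
        = vcomp B H G (hcomp1 B H G G (BUnit B G) X') X' X f (BLUnit B H G X')"
    and BRUnit_iso: "\<lbrakk>H \<in> BOb B; G \<in> BOb B; X \<in> onecells B H G\<rbrakk>
      \<Longrightarrow> iso_arr (BHom B H G) (hcomp1 B H H G X (BUnit B H)) X (BRUnit B H G X)"
    and BRUnit_natural:
      "\<lbrakk>H \<in> BOb B; G \<in> BOb B; X' \<in> onecells B H G; X \<in> onecells B H G; f \<in> twocells B H G X' X\<rbrakk>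
      \<Longrightarrow> vcomp B H G (hcomp1 B H H G X' (BUnit B H)) (hcomp1 B H H G X (BUnit B H)) X
            (BRUnit B H G X)
            (hcomp2 B H H G X' X (BUnit B H) (BUnit B H) f (id2 B H H (BUnit B H)))
        = vcomp B H G (hcomp1 B H H G X' (BUnit B H)) X' X f (BRUnit B H G X')"
    and triangle:
      "\<lbrakk>K \<in> BOb B; H \<in> BOb B; G \<in> BOb B; X \<in> onecells B H G; Y \<in> onecells B K H\<rbrakk>
      \<Longrightarrow> vcomp B K G
            (hcomp1 B K H G (hcomp1 B H H G X (BUnit B H)) Y)
            (hcomp1 B K H G X (hcomp1 B K H H (BUnit B H) Y))
            (hcomp1 B K H G X Y)
            (hcomp2 B K H G X X (hcomp1 B K H H (BUnit B H) Y) Y (id2 B H G X) (BLUnit B K H Y))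
            (BAssoc B K H H G X (BUnit B H) Y)
        = hcomp2 B K H G (hcomp1 B H H G X (BUnit B H)) X Y Y (BRUnit B H G X) (id2 B K H Y)"
    and pentagon:
      "\<lbrakk>M \<in> BOb B; L \<in> BOb B; K \<in> BOb B; H \<in> BOb B; G \<in> BOb B;
        W \<in> onecells B H G; X \<in> onecells B K H; Y \<in> onecells B L K; Z \<in> onecells B M L\<rbrakk>
      \<Longrightarrow> vcomp B M G
            (hcomp1 B M L G (hcomp1 B L K G (hcomp1 B K H G W X) Y) Z)
            (hcomp1 B M K G (hcomp1 B K H G W X) (hcomp1 B M L K Y Z))
            (hcomp1 B M H G W (hcomp1 B M K H X (hcomp1 B M L K Y Z)))
            (BAssoc B M K H G W X (hcomp1 B M L K Y Z))
            (BAssoc B M L K G (hcomp1 B K H G W X) Y Z)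
        = vcomp B M G
            (hcomp1 B M L G (hcomp1 B L K G (hcomp1 B K H G W X) Y) Z)
            (hcomp1 B M H G W (hcomp1 B M L H (hcomp1 B L K H X Y) Z))
            (hcomp1 B M H G W (hcomp1 B M K H X (hcomp1 B M L K Y Z)))
            (hcomp2 B M H G W W
               (hcomp1 B M L H (hcomp1 B L K H X Y) Z) (hcomp1 B M K H X (hcomp1 B M L K Y Z))
               (id2 B H G W) (BAssoc B M L K H X Y Z))
            (vcomp B M G
               (hcomp1 B M L G (hcomp1 B L K G (hcomp1 B K H G W X) Y) Z)
               (hcomp1 B M L G (hcomp1 B L H G W (hcomp1 B L K H X Y)) Z)
               (hcomp1 B M H G W (hcomp1 B M L H (hcomp1 B L K H X Y) Z))
               (BAssoc B M L H G W (hcomp1 B L K H X Y) Z)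
               (hcomp2 B M L G
                  (hcomp1 B L K G (hcomp1 B K H G W X) Y) (hcomp1 B L H G W (hcomp1 B L K H X Y))
                  Z Z (BAssoc B L K H G W X Y) (id2 B M L Z)))"

text \<open>
  A lax functor; \<open>Mcomp F K H G X Y : F X \<circ> F Y \<rightarrow> F (X \<circ> Y)\<close> and \<open>Munit F G : 1 \<rightarrow> F 1\<close> are
  its structure 2-cells.
\<close>

record ('o, 'm, 'c, 'p, 'n, 'd) bimor =
  Mob :: "'o \<Rightarrow> 'p"
  Mhom :: "'o \<Rightarrow> 'o \<Rightarrow> ('m, 'c, 'n, 'd) fctr"
  Mcomp :: "'o \<Rightarrow> 'o \<Rightarrow> 'o \<Rightarrow> 'm \<Rightarrow> 'm \<Rightarrow> 'd"
  Munit :: "'o \<Rightarrow> 'd"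

locale bicat_morphism = B: bicategory B + C: bicategory C
  for B :: "('o, 'm, 'c) bicat" and C :: "('p, 'n, 'd) bicat" +
  fixes F :: "('o, 'm, 'c, 'p, 'n, 'd) bimor"
  assumes Mob_in: "G \<in> BOb B \<Longrightarrow> Mob F G \<in> BOb C"
    and Mhom_functor: "\<lbrakk>H \<in> BOb B; G \<in> BOb B\<rbrakk>
      \<Longrightarrow> is_functor (BHom B H G) (BHom C (Mob F H) (Mob F G)) (Mhom F H G)"
    and Mcomp_twocell:
      "\<lbrakk>K \<in> BOb B; H \<in> BOb B; G \<in> BOb B; X \<in> onecells B H G; Y \<in> onecells B K H\<rbrakk>
      \<Longrightarrow> Mcomp F K H G X Y \<in> twocells C (Mob F K) (Mob F G)
            (hcomp1 C (Mob F K) (Mob F H) (Mob F G) (omap (Mhom F H G) X) (omap (Mhom F K H) Y))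
            (omap (Mhom F K G) (hcomp1 B K H G X Y))"
    and Munit_twocell: "G \<in> BOb B
      \<Longrightarrow> Munit F G \<in> twocells C (Mob F G) (Mob F G)
            (BUnit C (Mob F G)) (omap (Mhom F G G) (BUnit B G))"
    and Mcomp_natural:
      "\<lbrakk>K \<in> BOb B; H \<in> BOb B; G \<in> BOb B;
        X' \<in> onecells B H G; X \<in> onecells B H G; f \<in> twocells B H G X' X;
        Y' \<in> onecells B K H; Y \<in> onecells B K H; g \<in> twocells B K H Y' Y\<rbrakk>
      \<Longrightarrow> vcomp C (Mob F K) (Mob F G)
            (hcomp1 C (Mob F K) (Mob F H) (Mob F G) (omap (Mhom F H G) X') (omap (Mhom F K H) Y'))
            (hcomp1 C (Mob F K) (Mob F H) (Mob F G) (omap (Mhom F H G) X) (omap (Mhom F K H) Y))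
            (omap (Mhom F K G) (hcomp1 B K H G X Y))
            (Mcomp F K H G X Y)
            (hcomp2 C (Mob F K) (Mob F H) (Mob F G)
               (omap (Mhom F H G) X') (omap (Mhom F H G) X)
               (omap (Mhom F K H) Y') (omap (Mhom F K H) Y)
               (amap (Mhom F H G) X' X f) (amap (Mhom F K H) Y' Y g))
        = vcomp C (Mob F K) (Mob F G)
            (hcomp1 C (Mob F K) (Mob F H) (Mob F G) (omap (Mhom F H G) X') (omap (Mhom F K H) Y'))
            (omap (Mhom F K G) (hcomp1 B K H G X' Y'))
            (omap (Mhom F K G) (hcomp1 B K H G X Y))
            (amap (Mhom F K G) (hcomp1 B K H G X' Y') (hcomp1 B K H G X Y)
               (hcomp2 B K H G X' X Y' Y f g))
            (Mcomp F K H G X' Y')"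
    and Mcomp_assoc:
      "\<lbrakk>L \<in> BOb B; K \<in> BOb B; H \<in> BOb B; G \<in> BOb B;
        X \<in> onecells B H G; Y \<in> onecells B K H; Z \<in> onecells B L K;
        G' = Mob F G; H' = Mob F H; K' = Mob F K; L' = Mob F L;
        FX = omap (Mhom F H G) X; FY = omap (Mhom F K H) Y; FZ = omap (Mhom F L K) Z;
        FXY = omap (Mhom F K G) (hcomp1 B K H G X Y);
        FYZ = omap (Mhom F L H) (hcomp1 B L K H Y Z);
        FXY_Z = omap (Mhom F L G) (hcomp1 B L K G (hcomp1 B K H G X Y) Z);
        FX_YZ = omap (Mhom F L G) (hcomp1 B L H G X (hcomp1 B L K H Y Z))\<rbrakk>
      \<Longrightarrow> vcomp C L' G'
            (hcomp1 C L' K' G' (hcomp1 C K' H' G' FX FY) FZ) FXY_Z FX_YZ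
            (amap (Mhom F L G) (hcomp1 B L K G (hcomp1 B K H G X Y) Z)
               (hcomp1 B L H G X (hcomp1 B L K H Y Z)) (BAssoc B L K H G X Y Z))
            (vcomp C L' G'
               (hcomp1 C L' K' G' (hcomp1 C K' H' G' FX FY) FZ) (hcomp1 C L' K' G' FXY FZ) FXY_Z
               (Mcomp F L K G (hcomp1 B K H G X Y) Z)
               (hcomp2 C L' K' G' (hcomp1 C K' H' G' FX FY) FXY FZ FZ
                  (Mcomp F K H G X Y) (id2 C L' K' FZ)))
        = vcomp C L' G'
            (hcomp1 C L' K' G' (hcomp1 C K' H' G' FX FY) FZ) (hcomp1 C L' H' G' FX FYZ) FX_YZ
            (Mcomp F L H G X (hcomp1 B L K H Y Z))
            (vcomp C L' G'
               (hcomp1 C L' K' G' (hcomp1 C K' H' G' FX FY) FZ)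
               (hcomp1 C L' H' G' FX (hcomp1 C L' K' H' FY FZ))
               (hcomp1 C L' H' G' FX FYZ)
               (hcomp2 C L' H' G' FX FX (hcomp1 C L' K' H' FY FZ) FYZ
                  (id2 C H' G' FX) (Mcomp F L K H Y Z))
               (BAssoc C L' K' H' G' FX FY FZ))"
    and Mcomp_unit_left:
      "\<lbrakk>H \<in> BOb B; G \<in> BOb B; X \<in> onecells B H G;
        G' = Mob F G; H' = Mob F H; FX = omap (Mhom F H G) X;
        F1 = omap (Mhom F G G) (BUnit B G);
        F1X = omap (Mhom F H G) (hcomp1 B H G G (BUnit B G) X)\<rbrakk>
      \<Longrightarrow> vcomp C H' G' (hcomp1 C H' G' G' (BUnit C G') FX) F1X FX
            (amap (Mhom F H G) (hcomp1 B H G G (BUnit B G) X) X (BLUnit B H G X))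
            (vcomp C H' G' (hcomp1 C H' G' G' (BUnit C G') FX) (hcomp1 C H' G' G' F1 FX) F1X
               (Mcomp F H G G (BUnit B G) X)
               (hcomp2 C H' G' G' (BUnit C G') F1 FX FX (Munit F G) (id2 C H' G' FX)))
        = BLUnit C H' G' FX"
    and Mcomp_unit_right:
      "\<lbrakk>H \<in> BOb B; G \<in> BOb B; X \<in> onecells B H G;
        G' = Mob F G; H' = Mob F H; FX = omap (Mhom F H G) X;
        F1 = omap (Mhom F H H) (BUnit B H);
        FX1 = omap (Mhom F H G) (hcomp1 B H H G X (BUnit B H))\<rbrakk>
      \<Longrightarrow> vcomp C H' G' (hcomp1 C H' H' G' FX (BUnit C H')) FX1 FX
            (amap (Mhom F H G) (hcomp1 B H H G X (BUnit B H)) X (BRUnit B H G X))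
            (vcomp C H' G' (hcomp1 C H' H' G' FX (BUnit C H')) (hcomp1 C H' H' G' FX F1) FX1
               (Mcomp F H H G X (BUnit B H))
               (hcomp2 C H' H' G' FX FX (BUnit C H') F1 (id2 C H' G' FX) (Munit F H)))
        = BRUnit C H' G' FX"

locale bicat_homomorphism = bicat_morphism +
  assumes Mcomp_iso:
      "\<lbrakk>K \<in> BOb B; H \<in> BOb B; G \<in> BOb B; X \<in> onecells B H G; Y \<in> onecells B K H\<rbrakk>
      \<Longrightarrow> iso_arr (BHom C (Mob F K) (Mob F G))
            (hcomp1 C (Mob F K) (Mob F H) (Mob F G) (omap (Mhom F H G) X) (omap (Mhom F K H) Y))
            (omap (Mhom F K G) (hcomp1 B K H G X Y)) (Mcomp F K H G X Y)"
    and Munit_iso: "G \<in> BOb B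
      \<Longrightarrow> iso_arr (BHom C (Mob F G) (Mob F G))
            (BUnit C (Mob F G)) (omap (Mhom F G G) (BUnit B G)) (Munit F G)"

definition internally_equivalent :: "('o, 'm, 'c) bicat \<Rightarrow> 'o \<Rightarrow> 'o \<Rightarrow> bool" where
  "internally_equivalent B G H \<longleftrightarrow> (\<exists>f\<in>onecells B G H. \<exists>g\<in>onecells B H G.
     isomorphic (BHom B G G) (hcomp1 B G H G g f) (BUnit B G) \<and>
     isomorphic (BHom B H H) (hcomp1 B H G H f g) (BUnit B H))"

locale bi_equivalence = bicat_homomorphism +
  assumes Mhom_equivalence: "\<lbrakk>H \<in> BOb B; G \<in> BOb B\<rbrakk>
      \<Longrightarrow> equivalence_of_categories (BHom B H G) (BHom C (Mob F H) (Mob F G)) (Mhom F H G)"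
    and Mob_surjective: "G' \<in> BOb C \<Longrightarrow> \<exists>G\<in>BOb B. internally_equivalent C (Mob F G) G'"


section \<open>Sets with groupoid action\<close>

type_synonym 'u grpd = "('u, 'u) cat"
type_synonym 'u gset = "('u, 'u, 'u set, 'u \<Rightarrow> 'u) fctr"
type_synonym 'u biset = "('u \<times> 'u, 'u \<times> 'u, 'u set, 'u \<Rightarrow> 'u) fctr"

definition biset_cat :: "'u::universe grpd \<Rightarrow> 'u grpd \<Rightarrow> ('u biset, 'u \<times> 'u \<Rightarrow> 'u \<Rightarrow> 'u) cat" where
  "biset_cat H G = functor_cat (prod_cat (op_cat H) G) set_cat"

text \<open>The left \<open>G\<close>-set $X^\eta$ and the right \<open>H\<close>-set $X_\gamma$.\<close>

definition upper_part :: "'u grpd \<Rightarrow> 'u biset \<Rightarrow> 'u \<Rightarrow> 'u gset" where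
  "upper_part H X \<eta> = \<lparr>omap = (\<lambda>\<gamma>. omap X (\<eta>, \<gamma>)),
     amap = (\<lambda>\<gamma>' \<gamma> g. amap X (\<eta>, \<gamma>') (\<eta>, \<gamma>) (Ident H \<eta>, g))\<rparr>"

definition lower_part :: "'u grpd \<Rightarrow> 'u biset \<Rightarrow> 'u \<Rightarrow> 'u gset" where
  "lower_part G X \<gamma> = \<lparr>omap = (\<lambda>\<eta>. omap X (\<eta>, \<gamma>)),
     amap = (\<lambda>\<eta> \<eta>' h. amap X (\<eta>, \<gamma>) (\<eta>', \<gamma>) (h, Ident G \<gamma>))\<rparr>"

definition free_gset :: "'u grpd \<Rightarrow> 'u gset \<Rightarrow> bool" where
  "free_gset G X \<longleftrightarrow> (\<forall>\<gamma>\<in>Obj G. \<forall>\<gamma>'\<in>Obj G. \<forall>x\<in>omap X \<gamma>'.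
     inj_on (\<lambda>g. amap X \<gamma>' \<gamma> g x) (Hom G \<gamma>' \<gamma>))"

text \<open>The colimit of a functor to sets, as a quotient of the disjoint union of its values.\<close>

definition colim :: "'u grpd \<Rightarrow> 'u gset \<Rightarrow> ('u \<times> 'u) set set" where
  "colim G X = (SIGMA \<gamma>:Obj G. omap X \<gamma>) //
     eqv {((\<gamma>', x), (\<gamma>, amap X \<gamma>' \<gamma> g x)) | \<gamma>' \<gamma> g x.
            \<gamma>' \<in> Obj G \<and> \<gamma> \<in> Obj G \<and> g \<in> Hom G \<gamma>' \<gamma> \<and> x \<in> omap X \<gamma>'}"

definition finitely_generated :: "'u grpd \<Rightarrow> 'u gset \<Rightarrow> bool" where
  "finitely_generated G X \<longleftrightarrow> finite (colim G X)"

definition admissible :: "'u grpd \<Rightarrow> 'u grpd \<Rightarrow> 'u biset \<Rightarrow> bool" where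
  "admissible H G X \<longleftrightarrow> (\<forall>\<eta>\<in>Obj H. free_gset G (upper_part H X \<eta>) \<and>
                                   finitely_generated G (upper_part H X \<eta>))"

text \<open>
  The tensor product (co-end) of a right \<open>H\<close>-set and a left \<open>H\<close>-set.  An element \<open>(x, y)\<close> of the
  summand \<open>\<eta>\<close> is coded as \<open>utriple \<eta> x y\<close>.  Since the quotient has to be a set of elements of
  the universe again, an equivalence class is realised by a chosen representative:
  \<open>tensor_class H X Y t\<close> is the representative of the class of \<open>t\<close>.
\<close>

definition tensor_rel :: "'u::universe grpd \<Rightarrow> 'u gset \<Rightarrow> 'u gset \<Rightarrow> ('u \<times> 'u) set" where
  "tensor_rel H X Y = eqv {(utriple \<eta>' (amap X \<eta> \<eta>' h x) y, utriple \<eta> x (amap Y \<eta>' \<eta> h y)) | \<eta> \<eta>' h x y.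
     \<eta> \<in> Obj H \<and> \<eta>' \<in> Obj H \<and> h \<in> Hom H \<eta>' \<eta> \<and> x \<in> omap X \<eta> \<and> y \<in> omap Y \<eta>'}"

definition tensor_class :: "'u::universe grpd \<Rightarrow> 'u gset \<Rightarrow> 'u gset \<Rightarrow> 'u \<Rightarrow> 'u" where
  "tensor_class H X Y t = (SOME t'. (t, t') \<in> tensor_rel H X Y)"

definition tensor_set :: "'u::universe grpd \<Rightarrow> 'u gset \<Rightarrow> 'u gset \<Rightarrow> 'u set" where
  "tensor_set H X Y = tensor_class H X Y `
     {utriple \<eta> x y | \<eta> x y. \<eta> \<in> Obj H \<and> x \<in> omap X \<eta> \<and> y \<in> omap Y \<eta>}"


section \<open>The bicategory of bi-sets\<close>

text \<open>For an \<open>(H, G)\<close>-bi-set \<open>X\<close> and a \<open>(K, H)\<close>-bi-set \<open>Y\<close>, the class of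
  \<open>utriple \<eta> x y\<close> in $(X \otimes_H Y)^\kappa_\gamma$.\<close>

definition biset_tensor_class ::
  "'u::universe grpd \<Rightarrow> 'u grpd \<Rightarrow> 'u grpd \<Rightarrow> 'u biset \<Rightarrow> 'u biset \<Rightarrow> 'u \<Rightarrow> 'u \<Rightarrow> 'u \<Rightarrow> 'u" where
  "biset_tensor_class K H G X Y \<kappa> \<gamma> = tensor_class H (lower_part G X \<gamma>) (upper_part K Y \<kappa>)"

definition biset_tensor ::
  "'u::universe grpd \<Rightarrow> 'u grpd \<Rightarrow> 'u grpd \<Rightarrow> 'u biset \<Rightarrow> 'u biset \<Rightarrow> 'u biset" where
  "biset_tensor K H G X Y = \<lparr>
     omap = (\<lambda>(\<kappa>, \<gamma>). tensor_set H (lower_part G X \<gamma>) (upper_part K Y \<kappa>)),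
     amap = (\<lambda>(\<kappa>, \<gamma>) (\<kappa>', \<gamma>') (k, g). \<lambda>z\<in>tensor_set H (lower_part G X \<gamma>) (upper_part K Y \<kappa>).
       biset_tensor_class K H G X Y \<kappa>' \<gamma>'
         (utriple (u1 z) (amap (upper_part H X (u1 z)) \<gamma> \<gamma>' g (u2 z))
                         (amap (lower_part H Y (u1 z)) \<kappa> \<kappa>' k (u3 z))))\<rparr>"

definition biset_tensor_map ::
  "'u::universe grpd \<Rightarrow> 'u grpd \<Rightarrow> 'u grpd \<Rightarrow> 'u biset \<Rightarrow> 'u biset \<Rightarrow> 'u biset \<Rightarrow> 'u biset \<Rightarrow>
   ('u \<times> 'u \<Rightarrow> 'u \<Rightarrow> 'u) \<Rightarrow> ('u \<times> 'u \<Rightarrow> 'u \<Rightarrow> 'u) \<Rightarrow> ('u \<times> 'u \<Rightarrow> 'u \<Rightarrow> 'u)" where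
  "biset_tensor_map K H G X' Y' X Y f g = (\<lambda>(\<kappa>, \<gamma>)\<in>Obj K \<times> Obj G.
     \<lambda>z\<in>omap (biset_tensor K H G X' Y') (\<kappa>, \<gamma>).
       biset_tensor_class K H G X Y \<kappa> \<gamma>
         (utriple (u1 z) (f (u1 z, \<gamma>) (u2 z)) (g (\<kappa>, u1 z) (u3 z))))"

text \<open>$(1_G)^{\gamma'}_\gamma = G(\gamma',\gamma)$\<close>

definition unit_biset :: "'u::universe grpd \<Rightarrow> 'u biset" where
  "unit_biset G = \<lparr>
     omap = (\<lambda>(\<gamma>', \<gamma>). Hom G \<gamma>' \<gamma>),
     amap = (\<lambda>(\<gamma>', \<gamma>) (\<delta>', \<delta>) (k, g). \<lambda>f\<in>Hom G \<gamma>' \<gamma>.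
               Comp G \<delta>' \<gamma> \<delta> g (Comp G \<delta>' \<gamma>' \<gamma> f k))\<rparr>"

text \<open>$[[x,y],z] \mapsto [x,[y,z]]$, $[g,x] \mapsto gx$ and $[x,h] \mapsto xh$\<close>

definition biset_assoc ::
  "'u::universe grpd \<Rightarrow> 'u grpd \<Rightarrow> 'u grpd \<Rightarrow> 'u grpd \<Rightarrow> 'u biset \<Rightarrow> 'u biset \<Rightarrow> 'u biset \<Rightarrow>
   ('u \<times> 'u \<Rightarrow> 'u \<Rightarrow> 'u)" where
  "biset_assoc L K H G X Y Z = (\<lambda>(\<mu>, \<gamma>)\<in>Obj L \<times> Obj G.
     \<lambda>w\<in>omap (biset_tensor L K G (biset_tensor K H G X Y) Z) (\<mu>, \<gamma>).
       biset_tensor_class L H G X (biset_tensor L K H Y Z) \<mu> \<gamma>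
         (utriple (u1 (u2 w)) (u2 (u2 w))
            (biset_tensor_class L K H Y Z \<mu> (u1 (u2 w))
               (utriple (u1 w) (u3 (u2 w)) (u3 w)))))"

definition biset_lunit ::
  "'u::universe grpd \<Rightarrow> 'u grpd \<Rightarrow> 'u biset \<Rightarrow> ('u \<times> 'u \<Rightarrow> 'u \<Rightarrow> 'u)" where
  "biset_lunit H G X = (\<lambda>(\<eta>, \<gamma>)\<in>Obj H \<times> Obj G.
     \<lambda>z\<in>omap (biset_tensor H G G (unit_biset G) X) (\<eta>, \<gamma>).
       amap (upper_part H X \<eta>) (u1 z) \<gamma> (u2 z) (u3 z))"

definition biset_runit ::
  "'u::universe grpd \<Rightarrow> 'u grpd \<Rightarrow> 'u biset \<Rightarrow> ('u \<times> 'u \<Rightarrow> 'u \<Rightarrow> 'u)" where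
  "biset_runit H G X = (\<lambda>(\<eta>, \<gamma>)\<in>Obj H \<times> Obj G.
     \<lambda>z\<in>omap (biset_tensor H H G X (unit_biset H)) (\<eta>, \<gamma>).
       amap (lower_part G X \<gamma>) (u1 z) \<eta> (u3 z) (u2 z))"

definition burnside_bicat ::
  "('u::universe grpd, 'u biset, 'u \<times> 'u \<Rightarrow> 'u \<Rightarrow> 'u) bicat" where
  "burnside_bicat = \<lparr>
     BOb = {G. small_groupoid G},
     BHom = (\<lambda>H G. core (full_subcat (biset_cat H G) (admissible H G))),
     BComp = (\<lambda>K H G. \<lparr>
       omap = (\<lambda>(X, Y). biset_tensor K H G X Y),
       amap = (\<lambda>(X', Y') (X, Y) (f, g). biset_tensor_map K H G X' Y' X Y f g)\<rparr>),
     BUnit = unit_biset,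
     BAssoc = biset_assoc,
     BLUnit = biset_lunit,
     BRUnit = biset_runit\<rparr>"


section \<open>Groupoids of pairs\<close>

text \<open>
  The common form of the double translation groupoid, the strict pullback and the iso-comma
  groupoid: each object \<open>a\<close> has underlying objects \<open>l a\<close> of \<open>A\<close> and \<open>r a\<close> of \<open>B\<close>, the morphisms
  \<open>a \<rightarrow> b\<close> are the pairs \<open>(f : l a \<rightarrow> l b, g : r a \<rightarrow> r b)\<close> satisfying \<open>P a b f g\<close>, and composition
  is componentwise.
\<close>

definition pair_cat ::
  "'u::universe grpd \<Rightarrow> 'u grpd \<Rightarrow> 'u set \<Rightarrow> ('u \<Rightarrow> 'u) \<Rightarrow> ('u \<Rightarrow> 'u) \<Rightarrow>
   ('u \<Rightarrow> 'u \<Rightarrow> 'u \<Rightarrow> 'u \<Rightarrow> bool) \<Rightarrow> 'u grpd" where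
  "pair_cat A B S l r P = \<lparr>
     Obj = S,
     Hom = (\<lambda>a b. {upair f g | f g. f \<in> Hom A (l a) (l b) \<and> g \<in> Hom B (r a) (r b) \<and> P a b f g}),
     Ident = (\<lambda>a. upair (Ident A (l a)) (Ident B (r a))),
     Comp = (\<lambda>a b c v u. upair (Comp A (l a) (l b) (l c) (ufst v) (ufst u))
                               (Comp B (r a) (r b) (r c) (usnd v) (usnd u)))\<rparr>"

definition left_proj :: "('u::universe \<Rightarrow> 'u) \<Rightarrow> ('u, 'u, 'u, 'u) fctr" where
  "left_proj l = \<lparr>omap = l, amap = (\<lambda>a b u. ufst u)\<rparr>"

definition right_proj :: "('u::universe \<Rightarrow> 'u) \<Rightarrow> ('u, 'u, 'u, 'u) fctr" where
  "right_proj r = \<lparr>omap = r, amap = (\<lambda>a b u. usnd u)\<rparr>"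


section \<open>The bicategory of correspondences\<close>

definition fibration :: "'u grpd \<Rightarrow> 'u grpd \<Rightarrow> ('u, 'u, 'u, 'u) fctr \<Rightarrow> bool" where
  "fibration L H q \<longleftrightarrow> (\<forall>\<mu>'\<in>Obj L. \<forall>\<eta>\<in>Obj H. \<forall>h\<in>Hom H (omap q \<mu>') \<eta>.
     \<exists>\<mu>\<in>Obj L. omap q \<mu> = \<eta> \<and> (\<exists>l\<in>Hom L \<mu>' \<mu>. amap q \<mu>' \<mu> l = h))"

definition fiber :: "'u grpd \<Rightarrow> 'u grpd \<Rightarrow> ('u, 'u, 'u, 'u) fctr \<Rightarrow> 'u \<Rightarrow> 'u grpd" where
  "fiber L H q \<eta> = L\<lparr>Obj := {\<mu>\<in>Obj L. omap q \<mu> = \<eta>},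
     Hom := (\<lambda>a b. {l \<in> Hom L a b. amap q a b l = Ident H \<eta>})\<rparr>"

definition components :: "('o, 'a) cat \<Rightarrow> 'o set set" where
  "components C = Obj C // eqv {(a, b). a \<in> Obj C \<and> b \<in> Obj C \<and> Hom C a b \<noteq> {}}"

definition weak_finite_cover :: "'u grpd \<Rightarrow> 'u grpd \<Rightarrow> ('u, 'u, 'u, 'u) fctr \<Rightarrow> bool" where
  "weak_finite_cover L H q \<longleftrightarrow> is_functor L H q \<and> fibration L H q \<and>
     (\<forall>\<eta>\<in>Obj H.
        (\<forall>a\<in>Obj (fiber L H q \<eta>). \<forall>b\<in>Obj (fiber L H q \<eta>).
           \<forall>l\<in>Hom (fiber L H q \<eta>) a b. \<forall>l'\<in>Hom (fiber L H q \<eta>) a b. l = l') \<and>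
        finite (components (fiber L H q \<eta>)))"

text \<open>Diagrams $H \leftarrow L \to G$.\<close>

record 'u span =
  lleg :: "('u, 'u, 'u, 'u) fctr"
  apex :: "'u grpd"
  rleg :: "('u, 'u, 'u, 'u) fctr"

definition correspondence :: "'u::universe grpd \<Rightarrow> 'u grpd \<Rightarrow> 'u span \<Rightarrow> bool" where
  "correspondence H G S \<longleftrightarrow> small_groupoid (apex S) \<and>
     weak_finite_cover (apex S) H (lleg S) \<and> is_functor (apex S) G (rleg S)"

type_synonym 'u triple = "('u \<Rightarrow> 'u) \<times> ('u, 'u, 'u, 'u) fctr \<times> ('u \<Rightarrow> 'u)"

fun is_triple :: "'u grpd \<Rightarrow> 'u grpd \<Rightarrow> 'u span \<Rightarrow> 'u span \<Rightarrow> 'u triple \<Rightarrow> bool" where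
  "is_triple H G S' S (\<phi>, t, \<theta>) \<longleftrightarrow> is_functor (apex S') (apex S) t \<and>
     nat_trans (apex S') H (lleg S') (comp_fctr (lleg S) t) \<phi> \<and>
     nat_trans (apex S') G (rleg S') (comp_fctr (rleg S) t) \<theta>"

fun triple_equiv :: "'u grpd \<Rightarrow> 'u grpd \<Rightarrow> 'u span \<Rightarrow> 'u span \<Rightarrow> 'u triple \<Rightarrow> 'u triple \<Rightarrow> bool" where
  "triple_equiv H G S' S (\<phi>\<^sub>0, t\<^sub>0, \<theta>\<^sub>0) (\<phi>, t, \<theta>) \<longleftrightarrow>
     (\<exists>\<psi>. nat_trans (apex S') (apex S) t\<^sub>0 t \<psi> \<and>
       (\<forall>a\<in>Obj (apex S').
          Comp H (omap (lleg S') a) (omap (lleg S) (omap t\<^sub>0 a)) (omap (lleg S) (omap t a))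
            (amap (lleg S) (omap t\<^sub>0 a) (omap t a) (\<psi> a)) (\<phi>\<^sub>0 a) = \<phi> a \<and>
          Comp G (omap (rleg S') a) (omap (rleg S) (omap t\<^sub>0 a)) (omap (rleg S) (omap t a))
            (amap (rleg S) (omap t\<^sub>0 a) (omap t a) (\<psi> a)) (\<theta>\<^sub>0 a) = \<theta> a))"

definition triple_class ::
  "'u grpd \<Rightarrow> 'u grpd \<Rightarrow> 'u span \<Rightarrow> 'u span \<Rightarrow> 'u triple \<Rightarrow> 'u triple set" where
  "triple_class H G S' S u = {v. is_triple H G S' S v \<and> triple_equiv H G S' S v u}"

text \<open>The composite of \<open>(\<phi>', t', \<theta>') : S\<^sub>1 \<rightarrow> S\<^sub>2\<close> followed by \<open>(\<phi>'', t'', \<theta>'') : S\<^sub>2 \<rightarrow> S\<^sub>3\<close>.\<close>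

fun triple_comp ::
  "'u grpd \<Rightarrow> 'u grpd \<Rightarrow> 'u span \<Rightarrow> 'u span \<Rightarrow> 'u span \<Rightarrow> 'u triple \<Rightarrow> 'u triple \<Rightarrow> 'u triple" where
  "triple_comp H G S\<^sub>1 S\<^sub>2 S\<^sub>3 (\<phi>'', t'', \<theta>'') (\<phi>', t', \<theta>') =
     (\<lambda>a. Comp H (omap (lleg S\<^sub>1) a) (omap (lleg S\<^sub>2) (omap t' a))
                 (omap (lleg S\<^sub>3) (omap t'' (omap t' a))) (\<phi>'' (omap t' a)) (\<phi>' a),
      comp_fctr t'' t',
      \<lambda>a. Comp G (omap (rleg S\<^sub>1) a) (omap (rleg S\<^sub>2) (omap t' a))
                 (omap (rleg S\<^sub>3) (omap t'' (omap t' a))) (\<theta>'' (omap t' a)) (\<theta>' a))"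

text \<open>The triple \<open>(1, t, 1)\<close>, for \<open>t\<close> commuting strictly with the legs.\<close>

definition strict_triple ::
  "'u grpd \<Rightarrow> 'u grpd \<Rightarrow> 'u span \<Rightarrow> ('u, 'u, 'u, 'u) fctr \<Rightarrow> 'u triple" where
  "strict_triple H G S' t =
     (\<lambda>a. Ident H (omap (lleg S') a), t, \<lambda>a. Ident G (omap (rleg S') a))"

definition corr_cat :: "'u::universe grpd \<Rightarrow> 'u grpd \<Rightarrow> ('u span, 'u triple set) cat" where
  "corr_cat H G = \<lparr>
     Obj = {S. correspondence H G S},
     Hom = (\<lambda>S' S. {triple_class H G S' S u | u. is_triple H G S' S u}),
     Ident = (\<lambda>S. triple_class H G S S (strict_triple H G S id_fctr)),
     Comp = (\<lambda>S\<^sub>1 S\<^sub>2 S\<^sub>3 d c. \<Union>v\<in>d. \<Union>u\<in>c. triple_class H G S\<^sub>1 S\<^sub>3 (triple_comp H G S\<^sub>1 S\<^sub>2 S\<^sub>3 v u))\<rparr>"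

text \<open>
  In the following \<open>A\<close> is $G \xleftarrow{n} K \xrightarrow{m} F$ and \<open>B\<close> is
  $H \xleftarrow{q} L \xrightarrow{p} G$.  The strict pullback has the objects
  \<open>upair \<kappa> \<mu>\<close>, the iso-comma groupoid the objects \<open>utriple \<kappa> \<mu> i\<close> with $i : n\kappa \to p\mu$.
\<close>

definition pullback_span :: "'u::universe span \<Rightarrow> 'u span \<Rightarrow> 'u span" where
  "pullback_span A B = \<lparr>
     lleg = comp_fctr (lleg B) (right_proj usnd),
     apex = pair_cat (apex A) (apex B)
       {upair \<kappa> \<mu> | \<kappa> \<mu>. \<kappa> \<in> Obj (apex A) \<and> \<mu> \<in> Obj (apex B) \<and> omap (lleg A) \<kappa> = omap (rleg B) \<mu>}
       ufst usnd
       (\<lambda>a b k l. amap (lleg A) (ufst a) (ufst b) k = amap (rleg B) (usnd a) (usnd b) l),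
     rleg = comp_fctr (rleg A) (left_proj ufst)\<rparr>"

definition isocomma_span :: "'u::universe grpd \<Rightarrow> 'u span \<Rightarrow> 'u span \<Rightarrow> 'u span" where
  "isocomma_span G A B = \<lparr>
     lleg = comp_fctr (lleg B) (right_proj u2),
     apex = pair_cat (apex A) (apex B)
       {utriple \<kappa> \<mu> i | \<kappa> \<mu> i. \<kappa> \<in> Obj (apex A) \<and> \<mu> \<in> Obj (apex B) \<and>
          i \<in> Hom G (omap (lleg A) \<kappa>) (omap (rleg B) \<mu>)}
       u1 u2
       (\<lambda>a b k l.
          Comp G (omap (lleg A) (u1 a)) (omap (rleg B) (u2 a)) (omap (rleg B) (u2 b))
            (amap (rleg B) (u2 a) (u2 b) l) (u3 a)
        = Comp G (omap (lleg A) (u1 a)) (omap (lleg A) (u1 b)) (omap (rleg B) (u2 b))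
            (u3 b) (amap (lleg A) (u1 a) (u1 b) k)),
     rleg = comp_fctr (rleg A) (left_proj u1)\<rparr>"

text \<open>The inclusion \<open>(\<kappa>, \<mu>) \<mapsto> (\<kappa>, \<mu>, 1)\<close>, an equivalence if \<open>n\<close> is a fibration.\<close>

definition pullback_incl ::
  "'u::universe grpd \<Rightarrow> 'u grpd \<Rightarrow> 'u grpd \<Rightarrow> 'u span \<Rightarrow> 'u span \<Rightarrow> 'u triple" where
  "pullback_incl H G F A B = strict_triple H F (pullback_span A B)
     \<lparr>omap = (\<lambda>a. utriple (ufst a) (usnd a) (Ident G (omap (lleg A) (ufst a)))),
      amap = (\<lambda>a b f. f)\<rparr>"

text \<open>
  Triples \<open>(\<phi>, t, \<theta>) : A' \<rightarrow> A\<close> and \<open>(\<chi>, s, \<omega>) : B' \<rightarrow> B\<close> induce a triple of iso-comma groupoids,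
  whose functor sends \<open>(\<kappa>, \<mu>, i)\<close> to
  $(t\kappa, s\mu, \omega_\mu \circ i \circ \phi_\kappa^{-1})$.
\<close>

fun isocomma_triple ::
  "'u::universe grpd \<Rightarrow> 'u span \<Rightarrow> 'u span \<Rightarrow> 'u span \<Rightarrow> 'u span \<Rightarrow> 'u triple \<Rightarrow> 'u triple \<Rightarrow> 'u triple" where
  "isocomma_triple G A' A B' B (\<phi>, t, \<theta>) (\<chi>, s, \<omega>) =
     (\<lambda>a. \<chi> (u2 a),
      \<lparr>omap = (\<lambda>a. utriple (omap t (u1 a)) (omap s (u2 a))
         (Comp G (omap (lleg A) (omap t (u1 a))) (omap (rleg B') (u2 a)) (omap (rleg B) (omap s (u2 a)))
            (\<omega> (u2 a))
            (Comp G (omap (lleg A) (omap t (u1 a))) (omap (lleg A') (u1 a)) (omap (rleg B') (u2 a))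
               (u3 a)
               (inv_arr G (omap (lleg A') (u1 a)) (omap (lleg A) (omap t (u1 a))) (\<phi> (u1 a)))))),
       amap = (\<lambda>a b f. upair (amap t (u1 a) (u1 b) (ufst f)) (amap s (u2 a) (u2 b) (usnd f)))\<rparr>,
      \<lambda>a. \<theta> (u1 a))"

text \<open>
  The horizontal composite of the classes \<open>c : A' \<rightarrow> A\<close> and \<open>d : B' \<rightarrow> B\<close> is the class, unique
  because the inclusions are equivalences, that corresponds to the induced triple of iso-comma
  groupoids: the class of those \<open>w\<close> making the square with the inclusions commute.
\<close>

definition corr_hcomp ::
  "'u::universe grpd \<Rightarrow> 'u grpd \<Rightarrow> 'u grpd \<Rightarrow> 'u span \<Rightarrow> 'u span \<Rightarrow> 'u span \<Rightarrow> 'u span \<Rightarrow>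
   'u triple set \<Rightarrow> 'u triple set \<Rightarrow> 'u triple set" where
  "corr_hcomp H G F A' B' A B c d =
     {w. is_triple H F (pullback_span A' B') (pullback_span A B) w \<and>
       (\<exists>u\<in>c. \<exists>v\<in>d. triple_equiv H F (pullback_span A' B') (isocomma_span G A B)
          (triple_comp H F (pullback_span A' B') (pullback_span A B) (isocomma_span G A B)
             (pullback_incl H G F A B) w)
          (triple_comp H F (pullback_span A' B') (isocomma_span G A' B') (isocomma_span G A B)
             (isocomma_triple G A' A B' B u v) (pullback_incl H G F A' B')))}"

definition unit_span :: "'u grpd \<Rightarrow> 'u span" where
  "unit_span G = \<lparr>lleg = id_fctr, apex = G, rleg = id_fctr\<rparr>"

text \<open>The associator is the class of \<open>(1, t, 1)\<close> for the reassociation \<open>t\<close>, the unitors are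
  the classes of \<open>(1, t, 1)\<close> for the projections \<open>t\<close>.\<close>

definition corr_assoc ::
  "'u::universe grpd \<Rightarrow> 'u grpd \<Rightarrow> 'u grpd \<Rightarrow> 'u grpd \<Rightarrow> 'u span \<Rightarrow> 'u span \<Rightarrow> 'u span \<Rightarrow>
   'u triple set" where
  "corr_assoc L K H G X Y Z =
     triple_class L G (pullback_span (pullback_span X Y) Z) (pullback_span X (pullback_span Y Z))
       (strict_triple L G (pullback_span (pullback_span X Y) Z)
          \<lparr>omap = (\<lambda>a. upair (ufst (ufst a)) (upair (usnd (ufst a)) (usnd a))),
           amap = (\<lambda>a b f. upair (ufst (ufst f)) (upair (usnd (ufst f)) (usnd f)))\<rparr>)"

definition corr_lunit :: "'u::universe grpd \<Rightarrow> 'u grpd \<Rightarrow> 'u span \<Rightarrow> 'u triple set" where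
  "corr_lunit H G X = triple_class H G (pullback_span (unit_span G) X) X
     (strict_triple H G (pullback_span (unit_span G) X) (right_proj usnd))"

definition corr_runit :: "'u::universe grpd \<Rightarrow> 'u grpd \<Rightarrow> 'u span \<Rightarrow> 'u triple set" where
  "corr_runit H G X = triple_class H G (pullback_span X (unit_span H)) X
     (strict_triple H G (pullback_span X (unit_span H)) (left_proj ufst))"

definition correspondence_bicat :: "('u::universe grpd, 'u span, 'u triple set) bicat" where
  "correspondence_bicat = \<lparr>
     BOb = {G. small_groupoid G},
     BHom = (\<lambda>H G. core (corr_cat H G)),
     BComp = (\<lambda>H G F. \<lparr>
       omap = (\<lambda>(A, B). pullback_span A B),
       amap = (\<lambda>(A', B') (A, B) (c, d). corr_hcomp H G F A' B' A B c d)\<rparr>),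
     BUnit = unit_span,
     BAssoc = corr_assoc,
     BLUnit = corr_lunit,
     BRUnit = corr_runit\<rparr>"


section \<open>The functors from bi-sets to correspondences\<close>

text \<open>The double translation groupoid \<open>GXH\<close>; its objects are \<open>utriple \<gamma> x \<eta>\<close>.\<close>

definition translation_groupoid :: "'u::universe grpd \<Rightarrow> 'u grpd \<Rightarrow> 'u biset \<Rightarrow> 'u grpd" where
  "translation_groupoid H G X = pair_cat G H
     {utriple \<gamma> x \<eta> | \<gamma> x \<eta>. \<gamma> \<in> Obj G \<and> \<eta> \<in> Obj H \<and> x \<in> omap X (\<eta>, \<gamma>)}
     u1 u3
     (\<lambda>a b g h. amap (upper_part H X (u3 a)) (u1 a) (u1 b) g (u2 a)
              = amap (lower_part G X (u1 b)) (u3 b) (u3 a) h (u2 b))"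

definition translation_span :: "'u::universe grpd \<Rightarrow> 'u grpd \<Rightarrow> 'u biset \<Rightarrow> 'u span" where
  "translation_span H G X =
     \<lparr>lleg = right_proj u3, apex = translation_groupoid H G X, rleg = left_proj u1\<rparr>"

definition Phi ::
  "'u::universe grpd \<Rightarrow> 'u grpd \<Rightarrow> ('u biset, 'u \<times> 'u \<Rightarrow> 'u \<Rightarrow> 'u, 'u span, 'u triple set) fctr" where
  "Phi H G = \<lparr>
     omap = translation_span H G,
     amap = (\<lambda>X' X f. triple_class H G (translation_span H G X') (translation_span H G X)
       (strict_triple H G (translation_span H G X')
          \<lparr>omap = (\<lambda>a. utriple (u1 a) (f (u3 a, u1 a) (u2 a)) (u3 a)), amap = (\<lambda>a b m. m)\<rparr>))\<rparr>"

end

theory Submission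
  imports Defs
begin

text \<open>
  The left leg \<open>q\<close> of a correspondence is a faithful functor.  Hence two triples with the same source
  and target are equivalent as soon as the required arrows \<open>\<psi>\<^sub>a\<close> exist one object at a time, and a
  triple is determined by a family of objects with two families of arrows; naturality and
  functoriality are automatic.  All structure 2-cells of the two bicategories and of the
  pseudofunctor are classes of triples \<open>(1, t, 1)\<close>, and two such classes are equal when the functors
  \<open>t\<close> agree on objects, so that coherence becomes a comparison of objects.  A general 2-cell becomes
  of this form after composition with the isomorphism from a correspondence
  $H \leftarrow L \to G$ to the translation groupoid of the bi-set
  $G(p-,-) \otimes_L H(-,q-)$, which also shows that the functors \<open>\<Phi>\<close> are essentially surjective.
\<close>

section \<open>Groupoids\<close>

text \<open>Faithfulness of the left leg is the uniqueness half of the fiber condition: if q f = q g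
  for parallel f and g, then g^-1 f lies in a fiber. For bi-sets it is freeness: in
  \<open>GXH\<close> an arrow (g, h) with given ends satisfies g x = x' h, so h determines g. In the
  same way finite generation of X at \<eta> says that the fiber over \<eta> has finitely many
  components. The obstacle is horizontal composition of correspondences. It is given by transport
  along the inclusion of the strict pullback into the iso-comma groupoid, so for general triples it
  depends on chosen lifts, and naturality of the associator and the unitors cannot be read off on
  objects. Replacing the target by the translation groupoid of the tensor product removes this: a
  class [\<theta>^-1, \<phi>] absorbs the two natural transformations of a triple. For bi-sets
  everything rests on the middle category being a groupoid: the relation (x h, y) ~ (x, h y) is then
  already an equivalence relation, and an equality [x, y] = [x', y'] is witnessed by a single
  arrow.\<close>

lemmas (in category) [simp] = Ident_in_Hom Comp_in_Hom Comp_Ident_left Comp_Ident_right Comp_assoc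

lemmas (in is_functor) [simp] = omap_in_Obj amap_in_Hom amap_Ident amap_Comp

text \<open>Composites are kept right-nested, so a commuting square is recognised inside a longer
  composite when it is also available with a further arrow \<open>r\<close> at its source
  end.\<close>

lemma (in category) Comp_eq_extend:
  assumes "Comp C a b c g f = Comp C a b' c g' f'"
    and "x \<in> Obj C" "a \<in> Obj C" "b \<in> Obj C" "b' \<in> Obj C" "c \<in> Obj C"
    and "f \<in> Hom C a b" "g \<in> Hom C b c" "f' \<in> Hom C a b'" "g' \<in> Hom C b' c" "r \<in> Hom C x a"
  shows "Comp C x b c g (Comp C x a b f r) = Comp C x b' c g' (Comp C x a b' f' r)"
  using assms by (metis Comp_assoc)

lemma (in category) section_cancel:
  assumes "Comp C a b a g f = Ident C a"
    and "x \<in> Obj C" "a \<in> Obj C" "b \<in> Obj C" "f \<in> Hom C a b" "g \<in> Hom C b a" "r \<in> Hom C x a"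
  shows "Comp C x b a g (Comp C x a b f r) = r"
  using assms by (metis Comp_assoc Comp_Ident_left)

text \<open>Size is left out, so that the algebra of pullback, iso-comma and translation groupoids
  can be set up separately from any smallness argument.\<close>

locale groupoid = category +
  assumes arr_iso: "\<lbrakk>a \<in> Obj C; b \<in> Obj C; f \<in> Hom C a b\<rbrakk> \<Longrightarrow> iso_arr C a b f"

sublocale small_groupoid \<subseteq> groupoid G
  by unfold_locales (rule all_iso)

lemma iso_arr_in_Hom: "iso_arr C a b f \<Longrightarrow> f \<in> Hom C a b"
  by (simp add: iso_arr_def)

lemma (in category) inv_arr_eqI:
  assumes "a \<in> Obj C" "b \<in> Obj C" "f \<in> Hom C a b" "g \<in> Hom C b a"
    and "Comp C a b a g f = Ident C a" "Comp C b a b f g = Ident C b"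
  shows "inv_arr C a b f = g"
  unfolding inv_arr_def
proof (rule the_equality)
  fix h assume h: "h \<in> Hom C b a \<and> Comp C a b a h f = Ident C a \<and> Comp C b a b f h = Ident C b"
  then show "h = g" using section_cancel[OF assms(5,2,1,2,3,4), of h] assms by simp
qed (use assms in auto)

lemma (in category) iso_arr_inv:
  assumes "a \<in> Obj C" "b \<in> Obj C" "iso_arr C a b f"
  shows "f \<in> Hom C a b" "inv_arr C a b f \<in> Hom C b a"
    "Comp C a b a (inv_arr C a b f) f = Ident C a" "Comp C b a b f (inv_arr C a b f) = Ident C b"
proof -
  obtain g where g: "f \<in> Hom C a b" "g \<in> Hom C b a"
      "Comp C a b a g f = Ident C a" "Comp C b a b f g = Ident C b"
    using assms(3) unfolding iso_arr_def by blast
  then have "inv_arr C a b f = g" using assms inv_arr_eqI by blast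
  then show "f \<in> Hom C a b" "inv_arr C a b f \<in> Hom C b a"
    "Comp C a b a (inv_arr C a b f) f = Ident C a" "Comp C b a b f (inv_arr C a b f) = Ident C b"
    using g by auto
qed

lemma (in category) iso_arr_cancel:
  assumes "iso_arr C b c g" "Comp C a b c g f = Comp C a b c g f'"
    and "a \<in> Obj C" "b \<in> Obj C" "c \<in> Obj C" "f \<in> Hom C a b" "f' \<in> Hom C a b"
  shows "f = f'"
proof -
  note i = iso_arr_inv[OF assms(4,5,1)]
  show ?thesis using section_cancel[OF i(3) assms(3,4,5) i(1,2)] assms(2,6,7) by metis
qed

lemma (in category) iso_arr_Ident: "a \<in> Obj C \<Longrightarrow> iso_arr C a a (Ident C a)"
  unfolding iso_arr_def by auto

lemma (in category) iso_arr_Comp: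
  assumes "iso_arr C a b f" "iso_arr C b c g" "a \<in> Obj C" "b \<in> Obj C" "c \<in> Obj C"
  shows "iso_arr C a c (Comp C a b c g f)"
proof -
  obtain f' where f: "f \<in> Hom C a b" "f' \<in> Hom C b a"
      "Comp C a b a f' f = Ident C a" "Comp C b a b f f' = Ident C b"
    using assms(1) unfolding iso_arr_def by blast
  obtain g' where g: "g \<in> Hom C b c" "g' \<in> Hom C c b"
      "Comp C b c b g' g = Ident C b" "Comp C c b c g g' = Ident C c"
    using assms(2) unfolding iso_arr_def by blast
  have 1: "Comp C a c b g' (Comp C a b c g f) = f" using f g assms by (intro section_cancel)
  have 2: "Comp C c a b f (Comp C c b a f' g') = g'" using f g assms by (intro section_cancel)
  show ?thesis unfolding iso_arr_def
    using f g assms 1 2 by (auto intro!: bexI[of _ "Comp C c b a f' g'"])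
qed

lemma (in category) iso_arr_inv_arr:
  assumes "iso_arr C a b f" "a \<in> Obj C" "b \<in> Obj C"
  shows "iso_arr C b a (inv_arr C a b f)"
  using iso_arr_inv[OF assms(2,3,1)] unfolding iso_arr_def by auto

context groupoid
begin

lemma inv_in_Hom [simp]: "\<lbrakk>a \<in> Obj C; b \<in> Obj C; f \<in> Hom C a b\<rbrakk> \<Longrightarrow> inv_arr C a b f \<in> Hom C b a"
  and inv_left [simp]: "\<lbrakk>a \<in> Obj C; b \<in> Obj C; f \<in> Hom C a b\<rbrakk>
    \<Longrightarrow> Comp C a b a (inv_arr C a b f) f = Ident C a"
  and inv_right [simp]: "\<lbrakk>a \<in> Obj C; b \<in> Obj C; f \<in> Hom C a b\<rbrakk>
    \<Longrightarrow> Comp C b a b f (inv_arr C a b f) = Ident C b"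
  by (simp_all add: iso_arr_inv arr_iso)

lemma inv_left_cancel [simp]:
  "\<lbrakk>x \<in> Obj C; a \<in> Obj C; b \<in> Obj C; f \<in> Hom C a b; g \<in> Hom C x a\<rbrakk>
    \<Longrightarrow> Comp C x b a (inv_arr C a b f) (Comp C x a b f g) = g"
  by (metis Comp_assoc inv_in_Hom inv_left Comp_Ident_left)

lemma inv_right_cancel [simp]:
  "\<lbrakk>x \<in> Obj C; a \<in> Obj C; b \<in> Obj C; f \<in> Hom C a b; g \<in> Hom C x b\<rbrakk>
    \<Longrightarrow> Comp C x a b f (Comp C x b a (inv_arr C a b f) g) = g"
  by (metis Comp_assoc inv_in_Hom inv_right Comp_Ident_left)

lemma cancel_left:
  "\<lbrakk>Comp C a b c g f = Comp C a b c g f'; a \<in> Obj C; b \<in> Obj C; c \<in> Obj C;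
     f \<in> Hom C a b; f' \<in> Hom C a b; g \<in> Hom C b c\<rbrakk> \<Longrightarrow> f = f'"
  by (metis inv_left_cancel)

lemma cancel_right:
  assumes "Comp C a b c g f = Comp C a b c g' f" and [simp]: "a \<in> Obj C" "b \<in> Obj C" "c \<in> Obj C"
    "f \<in> Hom C a b" "g \<in> Hom C b c" "g' \<in> Hom C b c"
  shows "g = g'"
proof -
  have "g = Comp C b a c (Comp C a b c g f) (inv_arr C a b f)" by simp
  also have "\<dots> = g'" unfolding assms(1) by simp
  finally show ?thesis .
qed

lemma comp_eq_iff_left:
  assumes [simp]: "a \<in> Obj C" "b \<in> Obj C" "c \<in> Obj C" "f \<in> Hom C a b" "g \<in> Hom C b c" "h \<in> Hom C a c"
  shows "Comp C a b c g f = h \<longleftrightarrow> f = Comp C a c b (inv_arr C b c g) h"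
  by auto

lemma inv_Ident [simp]: "a \<in> Obj C \<Longrightarrow> inv_arr C a a (Ident C a) = Ident C a"
  by (rule inv_arr_eqI) auto

lemma inv_inv [simp]:
  "\<lbrakk>a \<in> Obj C; b \<in> Obj C; f \<in> Hom C a b\<rbrakk> \<Longrightarrow> inv_arr C b a (inv_arr C a b f) = f"
  by (rule inv_arr_eqI) auto

lemma inv_Comp:
  "\<lbrakk>a \<in> Obj C; b \<in> Obj C; c \<in> Obj C; f \<in> Hom C a b; g \<in> Hom C b c\<rbrakk>
    \<Longrightarrow> inv_arr C a c (Comp C a b c g f) = Comp C c b a (inv_arr C a b f) (inv_arr C b c g)"
  by (rule inv_arr_eqI) auto

end

lemma groupoid_functor_inv:
  assumes "groupoid A" "groupoid B" "is_functor A B F" "a \<in> Obj A" "b \<in> Obj A" "f \<in> Hom A a b"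
  shows "amap F b a (inv_arr A a b f) = inv_arr B (omap F a) (omap F b) (amap F a b f)"
proof -
  interpret A: groupoid A by fact
  interpret B: groupoid B by fact
  interpret F: is_functor A B F by fact
  show ?thesis
    by (rule B.inv_arr_eqI[symmetric]) (use assms in \<open>auto simp flip: F.amap_Comp\<close>)
qed

lemma comp_fctr_simps [simp]:
  "omap (comp_fctr K F) a = omap K (omap F a)"
  "amap (comp_fctr K F) a b f = amap K (omap F a) (omap F b) (amap F a b f)"
  by (simp_all add: comp_fctr_def)

lemma id_fctr_simps [simp]: "omap id_fctr a = a" "amap id_fctr a b f = f"
  by (simp_all add: id_fctr_def)

lemma is_functor_id: "is_functor A A id_fctr"
  by unfold_locales auto

lemma is_functor_comp:
  assumes "is_functor A B F" "is_functor B D K"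
  shows "is_functor A D (comp_fctr K F)"
proof -
  interpret F: is_functor A B F by fact
  interpret K: is_functor B D K by fact
  show ?thesis by unfold_locales auto
qed

section \<open>Cores, full subcategories and equivalences\<close>

lemma core_simps [simp]:
  "Obj (core C) = Obj C" "Hom (core C) a b = {f. iso_arr C a b f}"
  "Ident (core C) = Ident C" "Comp (core C) = Comp C"
  by (simp_all add: core_def)

lemma category_core: assumes "category C" shows "category (core C)"
proof -
  interpret category C by fact
  show ?thesis by unfold_locales (auto simp: iso_arr_Ident iso_arr_Comp iso_arr_in_Hom)
qed

text \<open>The inverse of an isomorphism is an isomorphism, hence already an arrow of the
  core.\<close>

lemma iso_arr_core: assumes "category C" "a \<in> Obj C" "b \<in> Obj C"
  shows "iso_arr (core C) a b f \<longleftrightarrow> iso_arr C a b f"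
proof -
  interpret category C by fact
  show ?thesis
    using iso_arr_inv[OF assms(2,3)] iso_arr_inv_arr[OF _ assms(2,3)]
    by (auto simp: iso_arr_def[of "core C"] intro!: exI[of _ "inv_arr C a b f"])
qed

lemma functor_iso_arr:
  assumes "category A" "is_functor A B F" "a \<in> Obj A" "b \<in> Obj A" "iso_arr A a b f"
  shows "iso_arr B (omap F a) (omap F b) (amap F a b f)"
proof -
  interpret A: category A by fact
  interpret F: is_functor A B F by fact
  note i = A.iso_arr_inv[OF assms(3-5)]
  show ?thesis unfolding iso_arr_def
    by (auto intro!: bexI[of _ "amap F b a (inv_arr A a b f)"] simp: assms i simp flip: F.amap_Comp)
qed

lemma is_functor_core:
  assumes "category A" "is_functor A B F"
  shows "is_functor (core A) (core B) F"
proof -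
  interpret A: category A by fact
  interpret F: is_functor A B F by fact
  show ?thesis using functor_iso_arr[OF assms] by unfold_locales (auto simp: iso_arr_in_Hom)
qed

lemma prod_cat_simps [simp]:
  "Obj (prod_cat C D) = Obj C \<times> Obj D"
  "Hom (prod_cat C D) (a, a') (b, b') = Hom C a b \<times> Hom D a' b'"
  "Ident (prod_cat C D) (a, a') = (Ident C a, Ident D a')"
  "Comp (prod_cat C D) (a, a') (b, b') (c, c') (g, g') (f, f')
    = (Comp C a b c g f, Comp D a' b' c' g' f')"
  by (simp_all add: prod_cat_def)

lemma category_prod: assumes "category C" "category D" shows "category (prod_cat C D)"
proof -
  interpret C: category C by fact
  interpret D: category D by fact
  show ?thesis by unfold_locales auto
qed

text \<open>Horizontal composition is constructed on all 2-cells, whereas the hom categories of both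
  bicategories are cores. A pair of isomorphisms is an isomorphism of the product, so a functor on
  the product restricts.\<close>

lemma is_functor_prod_core:
  assumes C: "category C" and D: "category D" and F: "is_functor (prod_cat C D) E F"
  shows "is_functor (prod_cat (core C) (core D)) (core E) F"
proof -
  interpret C: category C by fact
  interpret D: category D by fact
  interpret F: is_functor "core (prod_cat C D)" "core E" F
    using is_functor_core[OF category_prod[OF C D] F] .
  have iso: "iso_arr (prod_cat C D) (a, a') (b, b') (f, f')"
    if "iso_arr C a b f" "iso_arr D a' b' f'" for a b f a' b' f'
    using that by (fastforce simp: iso_arr_def)
  show ?thesis
  proof
    fix a b f assume "a \<in> Obj (prod_cat (core C) (core D))" "b \<in> Obj (prod_cat (core C) (core D))"
      "f \<in> Hom (prod_cat (core C) (core D)) a b"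
    then show "amap F a b f \<in> Hom (core E) (omap F a) (omap F b)"
      using F.amap_in_Hom[of a b f] iso by (cases a; cases b; cases f) auto
  next
    fix a assume "a \<in> Obj (prod_cat (core C) (core D))"
    then show "omap F a \<in> Obj (core E)" using F.omap_in_Obj[of a] by auto
  next
    fix a assume "a \<in> Obj (prod_cat (core C) (core D))"
    then show "amap F a a (Ident (prod_cat (core C) (core D)) a) = Ident (core E) (omap F a)"
      using F.amap_Ident[of a] by (cases a) auto
  next
    fix a b c f g assume "a \<in> Obj (prod_cat (core C) (core D))" "b \<in> Obj (prod_cat (core C) (core D))"
      "c \<in> Obj (prod_cat (core C) (core D))"
      "f \<in> Hom (prod_cat (core C) (core D)) a b" "g \<in> Hom (prod_cat (core C) (core D)) b c"
    then show "amap F a c (Comp (prod_cat (core C) (core D)) a b c g f) =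
       Comp (core E) (omap F a) (omap F b) (omap F c) (amap F b c g) (amap F a b f)"
      using F.amap_Comp[of a b c f g] iso
      by (cases a; cases b; cases c; cases f; cases g) auto
  qed
qed

lemma full_subcat_simps [simp]:
  "Obj (full_subcat C P) = {x \<in> Obj C. P x}" "Hom (full_subcat C P) = Hom C"
  "Ident (full_subcat C P) = Ident C" "Comp (full_subcat C P) = Comp C"
  by (simp_all add: full_subcat_def)

lemma category_full_subcat: assumes "category C" shows "category (full_subcat C P)"
proof -
  interpret category C by fact
  show ?thesis by unfold_locales auto
qed

lemma iso_arr_full_subcat [simp]: "iso_arr (full_subcat C P) = iso_arr C"
  by (simp add: iso_arr_def fun_eq_iff)

section \<open>Equivalences from full, faithful and essentially surjective functors\<close>

lemma ff_reflects_iso: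
  assumes A: "category A" and F: "is_functor A B F"
    and full: "\<And>a b g. \<lbrakk>a \<in> Obj A; b \<in> Obj A; g \<in> Hom B (omap F a) (omap F b)\<rbrakk>
      \<Longrightarrow> \<exists>f\<in>Hom A a b. amap F a b f = g"
    and faithful: "\<And>a b f f'. \<lbrakk>a \<in> Obj A; b \<in> Obj A; f \<in> Hom A a b; f' \<in> Hom A a b;
      amap F a b f = amap F a b f'\<rbrakk> \<Longrightarrow> f = f'"
    and ab: "a \<in> Obj A" "b \<in> Obj A" "f \<in> Hom A a b"
    and iso: "iso_arr B (omap F a) (omap F b) (amap F a b f)"
  shows "iso_arr A a b f"
proof -
  interpret A: category A by fact
  interpret F: is_functor A B F by fact
  obtain h where h: "h \<in> Hom B (omap F b) (omap F a)"
    "Comp B (omap F a) (omap F b) (omap F a) h (amap F a b f) = Ident B (omap F a)"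
    "Comp B (omap F b) (omap F a) (omap F b) (amap F a b f) h = Ident B (omap F b)"
    using iso unfolding iso_arr_def by blast
  obtain k where k: "k \<in> Hom A b a" "amap F b a k = h" using full[OF ab(2,1) h(1)] by blast
  have "Comp A a b a k f = Ident A a" by (rule faithful[OF ab(1,1)]) (use ab k h in auto)
  moreover have "Comp A b a b f k = Ident A b" by (rule faithful[OF ab(2,2)]) (use ab k h in auto)
  ultimately show ?thesis using ab k unfolding iso_arr_def by blast
qed

text \<open>The definition of equivalence asks for a quasi-inverse. It is built by choice:
  \<open>s\<close> selects an object over each b, \<open>e\<close> the isomorphism F (s b)
  \<rightarrow> b with inverse \<open>i\<close>, and \<open>l\<close> lifts arrows by
  fullness.\<close>

lemma equivalence_of_categoriesI:
  assumes A: "category A" and B: "category B" and F: "is_functor A B F"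
    and full: "\<And>a b g. \<lbrakk>a \<in> Obj A; b \<in> Obj A; g \<in> Hom B (omap F a) (omap F b)\<rbrakk>
      \<Longrightarrow> \<exists>f\<in>Hom A a b. amap F a b f = g"
    and faithful: "\<And>a b f f'. \<lbrakk>a \<in> Obj A; b \<in> Obj A; f \<in> Hom A a b; f' \<in> Hom A a b;
      amap F a b f = amap F a b f'\<rbrakk> \<Longrightarrow> f = f'"
    and surj: "\<And>b. b \<in> Obj B \<Longrightarrow> \<exists>a\<in>Obj A. \<exists>e. iso_arr B (omap F a) b e"
  shows "equivalence_of_categories A B F"
proof -
  interpret A: category A by fact
  interpret B: category B by fact
  interpret F: is_functor A B F by fact
  obtain s e where s [simp]: "\<And>b. b \<in> Obj B \<Longrightarrow> s b \<in> Obj A"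
    and e: "\<And>b. b \<in> Obj B \<Longrightarrow> iso_arr B (omap F (s b)) b (e b)"
    using surj by metis
  define i where "i b = inv_arr B (omap F (s b)) b (e b)" for b
  have e_in [simp]: "e b \<in> Hom B (omap F (s b)) b" and i_in [simp]: "i b \<in> Hom B b (omap F (s b))"
    and ie [simp]: "Comp B (omap F (s b)) b (omap F (s b)) (i b) (e b) = Ident B (omap F (s b))"
    and ei [simp]: "Comp B b (omap F (s b)) b (e b) (i b) = Ident B b"
    if "b \<in> Obj B" for b
    unfolding i_def using B.iso_arr_inv[OF _ _ e[OF that]] that by auto
  have eiC [simp]: "Comp B x (omap F (s b)) b (e b) (Comp B x b (omap F (s b)) (i b) r) = r"
    if "b \<in> Obj B" "x \<in> Obj B" "r \<in> Hom B x b" for b x r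
    by (rule B.section_cancel) (use that in auto)
  have ieC [simp]: "Comp B x b (omap F (s b)) (i b) (Comp B x (omap F (s b)) b (e b) r) = r"
    if "b \<in> Obj B" "x \<in> Obj B" "r \<in> Hom B x (omap F (s b))" for b x r
    by (rule B.section_cancel) (use that in auto)
  define l where "l a b g = (SOME f. f \<in> Hom A a b \<and> amap F a b f = g)" for a b g
  have l [simp]: "l a b g \<in> Hom A a b" "amap F a b (l a b g) = g"
    if "a \<in> Obj A" "b \<in> Obj A" "g \<in> Hom B (omap F a) (omap F b)" for a b g
    using someI_ex[of "\<lambda>f. f \<in> Hom A a b \<and> amap F a b f = g"] full[OF that] by (auto simp: l_def)
  \<comment> \<open>An arrow g : b \<rightarrow> c goes to the lift of i_c g e_b; the functor laws
    are then checked after applying the faithful \<open>F\<close>.\<close>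
  define K where "K = \<lparr>omap = s, amap = (\<lambda>b c g. l (s b) (s c)
    (Comp B (omap F (s b)) b (omap F (s c)) (Comp B b c (omap F (s c)) (i c) g) (e b)))\<rparr>"
  have K_simps [simp]: "omap K b = s b" "amap K b c g = l (s b) (s c)
    (Comp B (omap F (s b)) b (omap F (s c)) (Comp B b c (omap F (s c)) (i c) g) (e b))" for b c g
    by (simp_all add: K_def)
  have K: "is_functor B A K"
  proof
    fix b assume "b \<in> Obj B"
    then show "amap K b b (Ident B b) = Ident A (omap K b)"
      by (intro faithful[of "s b" "s b"]) auto
  next
    fix a b c f g assume "a \<in> Obj B" "b \<in> Obj B" "c \<in> Obj B" "f \<in> Hom B a b" "g \<in> Hom B b c"
    then show "amap K a c (Comp B a b c g f) =
       Comp A (omap K a) (omap K b) (omap K c) (amap K b c g) (amap K a b f)"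
      by (intro faithful[of "s a" "s c"]) auto
  qed auto
  have "naturally_isomorphic B B (comp_fctr F K) id_fctr"
    unfolding naturally_isomorphic_def using e by (intro exI[of _ e] conjI) (unfold_locales, auto)
  moreover have "naturally_isomorphic A A (comp_fctr K F) id_fctr"
    unfolding naturally_isomorphic_def
  proof (intro exI conjI ballI)
    let ?\<alpha> = "\<lambda>a. l (s (omap F a)) a (e (omap F a))"
    show "nat_trans A A (comp_fctr K F) id_fctr ?\<alpha>"
    proof
      fix a b f assume "a \<in> Obj A" "b \<in> Obj A" "f \<in> Hom A a b"
      then show "Comp A (omap (comp_fctr K F) a) (omap (comp_fctr K F) b) (omap id_fctr b) (?\<alpha> b)
            (amap (comp_fctr K F) a b f) =
           Comp A (omap (comp_fctr K F) a) (omap id_fctr a) (omap id_fctr b) (amap id_fctr a b f) (?\<alpha> a)"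
        by (intro faithful[of "s (omap F a)" b]) auto
    qed auto
    fix a assume "a \<in> Obj A"
    then show "iso_arr A (omap (comp_fctr K F) a) (omap id_fctr a) (?\<alpha> a)"
      by (intro ff_reflects_iso[OF A F full faithful]) (auto intro: e)
  qed
  ultimately show ?thesis unfolding equivalence_of_categories_def using F K by blast
qed

text \<open>Two opposite sides of a commuting square may be inverted. In this form naturality of
  \<phi> passes to its inverse.\<close>

lemma (in groupoid) square_inv:
  assumes "Comp C a a' b' g' f = Comp C a b b' f' g" and [simp]: "a \<in> Obj C" "a' \<in> Obj C" "b \<in> Obj C" "b' \<in> Obj C"
    "f \<in> Hom C a a'" "f' \<in> Hom C b b'" "g \<in> Hom C a b" "g' \<in> Hom C a' b'"
  shows "Comp C b a a' f (inv_arr C a b g) = Comp C b b' a' (inv_arr C a' b' g') f'"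
proof -
  have "f = Comp C a b' a' (inv_arr C a' b' g') (Comp C a b b' f' g)"
    by (simp flip: assms(1))
  then show ?thesis by simp
qed

section \<open>Spans with faithful left leg and their triples\<close>

abbreviation "Ob S \<equiv> Obj (apex S)"
abbreviation "Ar S \<equiv> Hom (apex S)"
abbreviation "Ide S \<equiv> Ident (apex S)"
abbreviation "Cp S \<equiv> Comp (apex S)"
abbreviation "Lo S \<equiv> omap (lleg S)"
abbreviation "La S \<equiv> amap (lleg S)"
abbreviation "Ro S \<equiv> omap (rleg S)"
abbreviation "Ra S \<equiv> amap (rleg S)"

declare is_triple.simps [simp del] triple_equiv.simps [simp del]

text \<open>What the calculus of triples rests on: groupoids and a faithful left leg. This class of
  spans is closed under strict pullbacks and iso-comma spans; the latter occur as the targets that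
  define horizontal composition.\<close>

locale faithful_span = H: groupoid H + G: groupoid G + A: groupoid "apex S" +
  q: is_functor "apex S" H "lleg S" + p: is_functor "apex S" G "rleg S"
  for H G :: "'u::universe grpd" and S :: "'u span" +
  assumes faithful: "\<lbrakk>a \<in> Ob S; b \<in> Ob S; f \<in> Ar S a b; g \<in> Ar S a b; La S a b f = La S a b g\<rbrakk> \<Longrightarrow> f = g"
begin

text \<open>The form in which faithfulness is applied: the images of f and g are compared after
  composition with a structure arrow \<open>r\<close> (usually a component of \<phi>), which cancels
  because \<open>H\<close> is a groupoid.\<close>

lemma faithful_cancel:
  assumes "Comp H x (Lo S a) (Lo S b) (La S a b f) r = Comp H x (Lo S a) (Lo S b) (La S a b g) r"
    and "a \<in> Ob S" "b \<in> Ob S" "f \<in> Ar S a b" "g \<in> Ar S a b" "x \<in> Obj H" "r \<in> Hom H x (Lo S a)"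
  shows "f = g"
  by (rule faithful[OF assms(2-5)], rule H.cancel_right[OF assms(1)]) (use assms in auto)

lemmas functor_inv = groupoid_functor_inv[OF A.groupoid_axioms H.groupoid_axioms q.is_functor_axioms]
  groupoid_functor_inv[OF A.groupoid_axioms G.groupoid_axioms p.is_functor_axioms]

end

text \<open>One half of a triple, with the composite functor q t written out;
  \<open>span_triple\<close> uses it once for each leg with a common t. Read from left to right, the
  naturality square moves \<phi> to the source end of a composite.\<close>

locale leg_trans = A': category A' + A: category A + H: groupoid H +
  q': is_functor A' H q' + q: is_functor A H q + t: is_functor A' A t
  for A' A H :: "'u::universe grpd" and q' q t :: "('u, 'u, 'u, 'u) fctr" and \<phi> :: "'u \<Rightarrow> 'u" +
  assumes in_Hom [simp]: "a \<in> Obj A' \<Longrightarrow> \<phi> a \<in> Hom H (omap q' a) (omap q (omap t a))"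
    and nat [simp]: "\<lbrakk>a \<in> Obj A'; b \<in> Obj A'; f \<in> Hom A' a b\<rbrakk> \<Longrightarrow>
      Comp H (omap q' a) (omap q' b) (omap q (omap t b)) (\<phi> b) (amap q' a b f) =
      Comp H (omap q' a) (omap q (omap t a)) (omap q (omap t b))
        (amap q (omap t a) (omap t b) (amap t a b f)) (\<phi> a)"
begin

lemma nat_extend [simp]:
  "\<lbrakk>a \<in> Obj A'; b \<in> Obj A'; f \<in> Hom A' a b; x \<in> Obj H; r \<in> Hom H x (omap q' a)\<rbrakk> \<Longrightarrow>
    Comp H x (omap q' b) (omap q (omap t b)) (\<phi> b) (Comp H x (omap q' a) (omap q' b) (amap q' a b f) r) =
    Comp H x (omap q (omap t a)) (omap q (omap t b))
      (amap q (omap t a) (omap t b) (amap t a b f)) (Comp H x (omap q' a) (omap q (omap t a)) (\<phi> a) r)"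
  by (rule H.Comp_eq_extend[OF nat]) auto

end

locale span_triple = S': faithful_span H G S' + S: faithful_span H G S +
  l: leg_trans "apex S'" "apex S" H "lleg S'" "lleg S" t \<phi> +
  r: leg_trans "apex S'" "apex S" G "rleg S'" "rleg S" t \<theta>
  for H G :: "'u::universe grpd" and S' S :: "'u span" and \<phi> t \<theta>

lemma leg_trans_iff:
  assumes "category A'" "category A" "groupoid H" "is_functor A' H q'" "is_functor A H q"
  shows "leg_trans A' A H q' q t \<phi> \<longleftrightarrow> is_functor A' A t \<and> nat_trans A' H q' (comp_fctr q t) \<phi>"
  using assms by (auto simp: leg_trans_def leg_trans_axioms_def nat_trans_def)

lemma is_triple_iff:
  assumes "faithful_span H G S'" "faithful_span H G S"
  shows "is_triple H G S' S (\<phi>, t, \<theta>) \<longleftrightarrow> span_triple H G S' S \<phi> t \<theta>"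
proof -
  interpret S': faithful_span H G S' by fact
  interpret S: faithful_span H G S by fact
  show ?thesis
    unfolding span_triple_def is_triple.simps
      leg_trans_iff[OF S'.A.category_axioms S.A.category_axioms S'.H.groupoid_axioms
        S'.q.is_functor_axioms S.q.is_functor_axioms]
      leg_trans_iff[OF S'.A.category_axioms S.A.category_axioms S'.G.groupoid_axioms
        S'.p.is_functor_axioms S.p.is_functor_axioms]
    using assms by blast
qed

text \<open>Since the left leg of the target is faithful, the naturality condition in
  \<^const>\<open>triple_equiv\<close> is automatic.\<close>

fun pointwise_equiv :: "'u::universe grpd \<Rightarrow> 'u grpd \<Rightarrow> 'u span \<Rightarrow> 'u span \<Rightarrow> 'u triple \<Rightarrow> 'u triple \<Rightarrow> bool"
  where "pointwise_equiv H G S' S (\<phi>\<^sub>0, t\<^sub>0, \<theta>\<^sub>0) (\<phi>, t, \<theta>) \<longleftrightarrow>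
    (\<forall>a\<in>Ob S'. \<exists>m\<in>Ar S (omap t\<^sub>0 a) (omap t a).
       Comp H (Lo S' a) (Lo S (omap t\<^sub>0 a)) (Lo S (omap t a)) (La S (omap t\<^sub>0 a) (omap t a) m) (\<phi>\<^sub>0 a) = \<phi> a \<and>
       Comp G (Ro S' a) (Ro S (omap t\<^sub>0 a)) (Ro S (omap t a)) (Ra S (omap t\<^sub>0 a) (omap t a) m) (\<theta>\<^sub>0 a) = \<theta> a)"

declare pointwise_equiv.simps [simp del]

lemma triple_equiv_iff:
  assumes F: "faithful_span H G S'" "faithful_span H G S"
    and u: "is_triple H G S' S u" and v: "is_triple H G S' S v"
  shows "triple_equiv H G S' S u v \<longleftrightarrow> pointwise_equiv H G S' S u v"
proof -
  obtain \<phi>0 t0 \<theta>0 where u0: "u = (\<phi>0, t0, \<theta>0)" by (cases u)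
  obtain \<phi> t \<theta> where v0: "v = (\<phi>, t, \<theta>)" by (cases v)
  interpret u: span_triple H G S' S \<phi>0 t0 \<theta>0 using u is_triple_iff[OF F] unfolding u0 by blast
  interpret v: span_triple H G S' S \<phi> t \<theta> using v is_triple_iff[OF F] unfolding v0 by blast
  show ?thesis
  proof
    assume "triple_equiv H G S' S u v"
    then show "pointwise_equiv H G S' S u v"
      unfolding u0 v0 triple_equiv.simps pointwise_equiv.simps nat_trans_def by blast
  next
    assume "pointwise_equiv H G S' S u v"
    then obtain \<psi> where \<psi>: "\<And>a. a \<in> Ob S' \<Longrightarrow> \<psi> a \<in> Ar S (omap t0 a) (omap t a)"
      "\<And>a. a \<in> Ob S' \<Longrightarrow> Comp H (Lo S' a) (Lo S (omap t0 a)) (Lo S (omap t a)) (La S (omap t0 a) (omap t a) (\<psi> a)) (\<phi>0 a) = \<phi> a"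
      "\<And>a. a \<in> Ob S' \<Longrightarrow> Comp G (Ro S' a) (Ro S (omap t0 a)) (Ro S (omap t a)) (Ra S (omap t0 a) (omap t a) (\<psi> a)) (\<theta>0 a) = \<theta> a"
      unfolding u0 v0 pointwise_equiv.simps by metis
    have "nat_trans (apex S') (apex S) t0 t \<psi>"
    proof
      fix a b f assume ab [simp]: "a \<in> Ob S'" "b \<in> Ob S'" "f \<in> Ar S' a b"
      note [simp] = \<psi>(1)[OF ab(1)] \<psi>(1)[OF ab(2)]
      show "Cp S (omap t0 a) (omap t0 b) (omap t b) (\<psi> b) (amap t0 a b f) =
        Cp S (omap t0 a) (omap t a) (omap t b) (amap t a b f) (\<psi> a)"
      \<comment> \<open>After applying the left leg and precomposing with the invertible
        \<open>\<phi>0 a\<close>, both sides equal \<phi>_b composed with the image of f in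
        H.\<close>
      proof (rule u.S.faithful_cancel)
        have "Comp H (Lo S' a) (Lo S (omap t0 a)) (Lo S (omap t b))
          (La S (omap t0 a) (omap t b) (Cp S (omap t0 a) (omap t0 b) (omap t b) (\<psi> b) (amap t0 a b f))) (\<phi>0 a)
          = Comp H (Lo S' a) (Lo S (omap t0 b)) (Lo S (omap t b)) (La S (omap t0 b) (omap t b) (\<psi> b))
              (Comp H (Lo S' a) (Lo S' b) (Lo S (omap t0 b)) (\<phi>0 b) (La S' a b f))"
          by simp
        also have "\<dots> = Comp H (Lo S' a) (Lo S' b) (Lo S (omap t b)) (\<phi> b) (La S' a b f)"
          using ab by (simp del: u.l.nat v.l.nat flip: \<psi>(2))
        also have "\<dots> = Comp H (Lo S' a) (Lo S (omap t0 a)) (Lo S (omap t b))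
          (La S (omap t0 a) (omap t b) (Cp S (omap t0 a) (omap t a) (omap t b) (amap t a b f) (\<psi> a))) (\<phi>0 a)"
          using ab by (simp add: \<psi>(2))
        finally show "Comp H (Lo S' a) (Lo S (omap t0 a)) (Lo S (omap t b))
          (La S (omap t0 a) (omap t b) (Cp S (omap t0 a) (omap t0 b) (omap t b) (\<psi> b) (amap t0 a b f))) (\<phi>0 a) = \<dots>" .
      qed auto
    qed (rule \<psi>(1))
    then show "triple_equiv H G S' S u v"
      unfolding u0 v0 triple_equiv.simps using \<psi> by blast
  qed
qed

text \<open>Identity arrows serve as \<psi>. \<open>pointwise_equiv\<close> sees the functors
  through their values on objects, which is why a comparison of 2-cells can stop there.\<close>

lemma pointwise_equiv_cong:
  assumes "is_triple H G S' S (\<phi>, t, \<theta>)" and F: "faithful_span H G S'" "faithful_span H G S"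
    and "\<And>a. a \<in> Ob S' \<Longrightarrow> omap t' a = omap t a \<and> \<phi>' a = \<phi> a \<and> \<theta>' a = \<theta> a"
  shows "pointwise_equiv H G S' S (\<phi>, t, \<theta>) (\<phi>', t', \<theta>')"
proof -
  interpret u: span_triple H G S' S \<phi> t \<theta> using assms is_triple_iff[OF F] by blast
  show ?thesis unfolding pointwise_equiv.simps
  proof
    fix a assume [simp]: "a \<in> Ob S'"
    show "\<exists>m\<in>Ar S (omap t a) (omap t' a).
       Comp H (Lo S' a) (Lo S (omap t a)) (Lo S (omap t' a)) (La S (omap t a) (omap t' a) m) (\<phi> a) = \<phi>' a \<and>
       Comp G (Ro S' a) (Ro S (omap t a)) (Ro S (omap t' a)) (Ra S (omap t a) (omap t' a) m) (\<theta> a) = \<theta>' a"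
      by (rule bexI[of _ "Ide S (omap t a)"]) (simp_all add: assms(4))
  qed
qed

lemma pointwise_equiv_refl:
  assumes "is_triple H G S' S u" "faithful_span H G S'" "faithful_span H G S"
  shows "pointwise_equiv H G S' S u u"
  by (cases u) (use assms in \<open>auto intro: pointwise_equiv_cong\<close>)

lemma pointwise_equiv_sym:
  assumes F: "faithful_span H G S'" "faithful_span H G S"
    and u: "is_triple H G S' S u" and v: "is_triple H G S' S v" and uv: "pointwise_equiv H G S' S u v"
  shows "pointwise_equiv H G S' S v u"
proof -
  obtain \<phi>0 t0 \<theta>0 where u0: "u = (\<phi>0, t0, \<theta>0)" by (cases u)
  obtain \<phi> t \<theta> where v0: "v = (\<phi>, t, \<theta>)" by (cases v)
  interpret u: span_triple H G S' S \<phi>0 t0 \<theta>0 using u is_triple_iff[OF F] unfolding u0 by blast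
  interpret v: span_triple H G S' S \<phi> t \<theta> using v is_triple_iff[OF F] unfolding v0 by blast
  show ?thesis unfolding u0 v0 pointwise_equiv.simps
  proof
    fix a assume a [simp]: "a \<in> Ob S'"
    obtain m where m [simp]: "m \<in> Ar S (omap t0 a) (omap t a)"
      and e: "Comp H (Lo S' a) (Lo S (omap t0 a)) (Lo S (omap t a)) (La S (omap t0 a) (omap t a) m) (\<phi>0 a) = \<phi> a"
       "Comp G (Ro S' a) (Ro S (omap t0 a)) (Ro S (omap t a)) (Ra S (omap t0 a) (omap t a) m) (\<theta>0 a) = \<theta> a"
      using uv a unfolding u0 v0 pointwise_equiv.simps by blast
    show "\<exists>m\<in>Ar S (omap t a) (omap t0 a).
       Comp H (Lo S' a) (Lo S (omap t a)) (Lo S (omap t0 a)) (La S (omap t a) (omap t0 a) m) (\<phi> a) = \<phi>0 a \<and>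
       Comp G (Ro S' a) (Ro S (omap t a)) (Ro S (omap t0 a)) (Ra S (omap t a) (omap t0 a) m) (\<theta> a) = \<theta>0 a"
      by (rule bexI[of _ "inv_arr (apex S) (omap t0 a) (omap t a) m"])
        (auto simp: u.S.functor_inv simp flip: e)
  qed
qed

lemma pointwise_equiv_trans:
  assumes F: "faithful_span H G S'" "faithful_span H G S"
    and u: "is_triple H G S' S u" and v: "is_triple H G S' S v" and w: "is_triple H G S' S w"
    and uv: "pointwise_equiv H G S' S u v" and vw: "pointwise_equiv H G S' S v w"
  shows "pointwise_equiv H G S' S u w"
proof -
  obtain \<phi>0 t0 \<theta>0 where u0: "u = (\<phi>0, t0, \<theta>0)" by (cases u)
  obtain \<phi> t \<theta> where v0: "v = (\<phi>, t, \<theta>)" by (cases v)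
  obtain \<phi>1 t1 \<theta>1 where w0: "w = (\<phi>1, t1, \<theta>1)" by (cases w)
  interpret u: span_triple H G S' S \<phi>0 t0 \<theta>0 using u is_triple_iff[OF F] unfolding u0 by blast
  interpret v: span_triple H G S' S \<phi> t \<theta> using v is_triple_iff[OF F] unfolding v0 by blast
  interpret w: span_triple H G S' S \<phi>1 t1 \<theta>1 using w is_triple_iff[OF F] unfolding w0 by blast
  show ?thesis unfolding u0 w0 pointwise_equiv.simps
  proof
    fix a assume a [simp]: "a \<in> Ob S'"
    obtain m where m [simp]: "m \<in> Ar S (omap t0 a) (omap t a)"
      and e: "\<phi> a = Comp H (Lo S' a) (Lo S (omap t0 a)) (Lo S (omap t a)) (La S (omap t0 a) (omap t a) m) (\<phi>0 a)"
       "\<theta> a = Comp G (Ro S' a) (Ro S (omap t0 a)) (Ro S (omap t a)) (Ra S (omap t0 a) (omap t a) m) (\<theta>0 a)"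
      using uv a unfolding u0 v0 pointwise_equiv.simps by metis
    obtain n where n [simp]: "n \<in> Ar S (omap t a) (omap t1 a)"
      and e': "Comp H (Lo S' a) (Lo S (omap t a)) (Lo S (omap t1 a)) (La S (omap t a) (omap t1 a) n) (\<phi> a) = \<phi>1 a"
       "Comp G (Ro S' a) (Ro S (omap t a)) (Ro S (omap t1 a)) (Ra S (omap t a) (omap t1 a) n) (\<theta> a) = \<theta>1 a"
      using vw a unfolding v0 w0 pointwise_equiv.simps by blast
    show "\<exists>m\<in>Ar S (omap t0 a) (omap t1 a).
       Comp H (Lo S' a) (Lo S (omap t0 a)) (Lo S (omap t1 a)) (La S (omap t0 a) (omap t1 a) m) (\<phi>0 a) = \<phi>1 a \<and>
       Comp G (Ro S' a) (Ro S (omap t0 a)) (Ro S (omap t1 a)) (Ra S (omap t0 a) (omap t1 a) m) (\<theta>0 a) = \<theta>1 a"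
      by (rule bexI[of _ "Cp S (omap t0 a) (omap t a) (omap t1 a) n m"]) (auto simp: e simp flip: e')
  qed
qed

text \<open>Likewise functoriality of \<open>t\<close> is automatic.\<close>

lemma span_triple_exI:
  assumes F: "faithful_span H G S'" "faithful_span H G S"
    and T: "\<And>a. a \<in> Ob S' \<Longrightarrow> T a \<in> Ob S" "\<And>a. a \<in> Ob S' \<Longrightarrow> \<phi> a \<in> Hom H (Lo S' a) (Lo S (T a))"
      "\<And>a. a \<in> Ob S' \<Longrightarrow> \<theta> a \<in> Hom G (Ro S' a) (Ro S (T a))"
    and ex: "\<And>a b f. \<lbrakk>a \<in> Ob S'; b \<in> Ob S'; f \<in> Ar S' a b\<rbrakk> \<Longrightarrow> \<exists>g\<in>Ar S (T a) (T b).
      Comp H (Lo S' a) (Lo S (T a)) (Lo S (T b)) (La S (T a) (T b) g) (\<phi> a)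
        = Comp H (Lo S' a) (Lo S' b) (Lo S (T b)) (\<phi> b) (La S' a b f) \<and>
      Comp G (Ro S' a) (Ro S (T a)) (Ro S (T b)) (Ra S (T a) (T b) g) (\<theta> a)
        = Comp G (Ro S' a) (Ro S' b) (Ro S (T b)) (\<theta> b) (Ra S' a b f)"
  shows "\<exists>t. omap t = T \<and> is_triple H G S' S (\<phi>, t, \<theta>)"
proof -
  interpret S': faithful_span H G S' by fact
  interpret S: faithful_span H G S by fact
  obtain t where t: "\<And>a b f. \<lbrakk>a \<in> Ob S'; b \<in> Ob S'; f \<in> Ar S' a b\<rbrakk> \<Longrightarrow> t a b f \<in> Ar S (T a) (T b)"
    "\<And>a b f. \<lbrakk>a \<in> Ob S'; b \<in> Ob S'; f \<in> Ar S' a b\<rbrakk> \<Longrightarrow>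
      Comp H (Lo S' a) (Lo S (T a)) (Lo S (T b)) (La S (T a) (T b) (t a b f)) (\<phi> a)
        = Comp H (Lo S' a) (Lo S' b) (Lo S (T b)) (\<phi> b) (La S' a b f) \<and>
      Comp G (Ro S' a) (Ro S (T a)) (Ro S (T b)) (Ra S (T a) (T b) (t a b f)) (\<theta> a)
        = Comp G (Ro S' a) (Ro S' b) (Ro S (T b)) (\<theta> b) (Ra S' a b f)"
    using ex by metis
  let ?t = "\<lparr>omap = T, amap = t\<rparr>"
  have tf: "is_functor (apex S') (apex S) ?t"
  proof
    fix a assume [simp]: "a \<in> Ob S'"
    show "amap ?t a a (Ide S' a) = Ide S (omap ?t a)"
      by simp (rule S.faithful_cancel[where x = "Lo S' a" and r = "\<phi> a" and a = "T a" and b = "T a"], use T t in auto)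
  next
    fix a b c f g assume abc [simp]: "a \<in> Ob S'" "b \<in> Ob S'" "c \<in> Ob S'" "f \<in> Ar S' a b" "g \<in> Ar S' b c"
    note [simp] = T t(1)
    show "amap ?t a c (Cp S' a b c g f) = Cp S (omap ?t a) (omap ?t b) (omap ?t c) (amap ?t b c g) (amap ?t a b f)"
      unfolding fctr.simps
    \<comment> \<open>Precomposed with \<open>\<phi> a\<close>, the left legs of both sides equal
      \<phi>_c composed with the image of g f, by the defining equations of the chosen
      arrows.\<close>
    proof (rule S.faithful_cancel[where x = "Lo S' a" and r = "\<phi> a"])
      have "Comp H (Lo S' a) (Lo S (T a)) (Lo S (T c)) (La S (T a) (T c) (t a c (Cp S' a b c g f))) (\<phi> a)
        = Comp H (Lo S' a) (Lo S' c) (Lo S (T c)) (\<phi> c)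
            (Comp H (Lo S' a) (Lo S' b) (Lo S' c) (La S' b c g) (La S' a b f))"
        using t(2)[of a c "Cp S' a b c g f"] by simp
      also have "\<dots> = Comp H (Lo S' a) (Lo S' b) (Lo S (T c))
         (Comp H (Lo S' b) (Lo S (T b)) (Lo S (T c)) (La S (T b) (T c) (t b c g)) (\<phi> b)) (La S' a b f)"
        using t(2)[of b c g] by simp
      also have "\<dots> = Comp H (Lo S' a) (Lo S (T a)) (Lo S (T c))
         (La S (T a) (T c) (Cp S (T a) (T b) (T c) (t b c g) (t a b f))) (\<phi> a)"
        using t(2)[of a b f] by simp
      finally show "Comp H (Lo S' a) (Lo S (T a)) (Lo S (T c)) (La S (T a) (T c) (t a c (Cp S' a b c g f))) (\<phi> a)
        = \<dots>" .
    qed auto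
  qed (use T t in auto)
  have "is_triple H G S' S (\<phi>, ?t, \<theta>)"
    using tf t T by (auto simp: nat_trans_def is_triple.simps)
  then show ?thesis by (intro exI[of _ ?t]) auto
qed

section \<open>Vertical composition of classes of triples\<close>

lemma is_triple_comp:
  assumes F: "faithful_span H G S1" "faithful_span H G S2" "faithful_span H G S3"
    and u: "is_triple H G S1 S2 u" and v: "is_triple H G S2 S3 v"
  shows "is_triple H G S1 S3 (triple_comp H G S1 S2 S3 v u)"
proof -
  obtain \<phi> t \<theta> where u0: "u = (\<phi>, t, \<theta>)" by (cases u)
  obtain \<chi> s \<omega> where v0: "v = (\<chi>, s, \<omega>)" by (cases v)
  interpret u: span_triple H G S1 S2 \<phi> t \<theta> using u is_triple_iff[OF F(1,2)] unfolding u0 by blast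
  interpret v: span_triple H G S2 S3 \<chi> s \<omega> using v is_triple_iff[OF F(2,3)] unfolding v0 by blast
  show ?thesis unfolding u0 v0 triple_comp.simps is_triple_iff[OF F(1,3)]
    by unfold_locales auto
qed

text \<open>The witness for the composites is the Godement product of the two given witnesses: s(m)
  followed by the arrow n chosen at t' a.\<close>

lemma pointwise_equiv_comp:
  assumes F: "faithful_span H G S1" "faithful_span H G S2" "faithful_span H G S3"
    and u: "is_triple H G S1 S2 u" "is_triple H G S1 S2 u'" "pointwise_equiv H G S1 S2 u u'"
    and v: "is_triple H G S2 S3 v" "is_triple H G S2 S3 v'" "pointwise_equiv H G S2 S3 v v'"
  shows "pointwise_equiv H G S1 S3 (triple_comp H G S1 S2 S3 v u) (triple_comp H G S1 S2 S3 v' u')"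
proof -
  obtain \<phi> t \<theta> \<phi>' t' \<theta>' where u0: "u = (\<phi>, t, \<theta>)" "u' = (\<phi>', t', \<theta>')" by (cases u; cases u')
  obtain \<chi> s \<omega> \<chi>' s' \<omega>' where v0: "v = (\<chi>, s, \<omega>)" "v' = (\<chi>', s', \<omega>')" by (cases v; cases v')
  interpret u: span_triple H G S1 S2 \<phi> t \<theta> using u is_triple_iff[OF F(1,2)] unfolding u0 by blast
  interpret v: span_triple H G S2 S3 \<chi> s \<omega> using v is_triple_iff[OF F(2,3)] unfolding v0 by blast
  interpret u': span_triple H G S1 S2 \<phi>' t' \<theta>' using u is_triple_iff[OF F(1,2)] unfolding u0 by blast
  interpret v': span_triple H G S2 S3 \<chi>' s' \<omega>' using v is_triple_iff[OF F(2,3)] unfolding v0 by blast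
  show ?thesis unfolding u0 v0 triple_comp.simps pointwise_equiv.simps
  proof
    fix a assume a [simp]: "a \<in> Ob S1"
    obtain m where m [simp]: "m \<in> Ar S2 (omap t a) (omap t' a)"
      and e: "\<phi>' a = Comp H (Lo S1 a) (Lo S2 (omap t a)) (Lo S2 (omap t' a)) (La S2 (omap t a) (omap t' a) m) (\<phi> a)"
       "\<theta>' a = Comp G (Ro S1 a) (Ro S2 (omap t a)) (Ro S2 (omap t' a)) (Ra S2 (omap t a) (omap t' a) m) (\<theta> a)"
      using u(3) a unfolding u0 pointwise_equiv.simps by metis
    have "omap t' a \<in> Ob S2" by simp
    then obtain n where n [simp]: "n \<in> Ar S3 (omap s (omap t' a)) (omap s' (omap t' a))"
      and e': "\<chi>' (omap t' a) = Comp H (Lo S2 (omap t' a)) (Lo S3 (omap s (omap t' a))) (Lo S3 (omap s' (omap t' a)))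
          (La S3 (omap s (omap t' a)) (omap s' (omap t' a)) n) (\<chi> (omap t' a))"
       "\<omega>' (omap t' a) = Comp G (Ro S2 (omap t' a)) (Ro S3 (omap s (omap t' a))) (Ro S3 (omap s' (omap t' a)))
          (Ra S3 (omap s (omap t' a)) (omap s' (omap t' a)) n) (\<omega> (omap t' a))"
      using v(3) unfolding v0 pointwise_equiv.simps by metis
    show "\<exists>m\<in>Ar S3 (omap (comp_fctr s t) a) (omap (comp_fctr s' t') a).
      Comp H (Lo S1 a) (Lo S3 (omap (comp_fctr s t) a)) (Lo S3 (omap (comp_fctr s' t') a))
        (La S3 (omap (comp_fctr s t) a) (omap (comp_fctr s' t') a) m)
        (Comp H (Lo S1 a) (Lo S2 (omap t a)) (Lo S3 (omap s (omap t a))) (\<chi> (omap t a)) (\<phi> a))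
      = Comp H (Lo S1 a) (Lo S2 (omap t' a)) (Lo S3 (omap s' (omap t' a))) (\<chi>' (omap t' a)) (\<phi>' a) \<and>
      Comp G (Ro S1 a) (Ro S3 (omap (comp_fctr s t) a)) (Ro S3 (omap (comp_fctr s' t') a))
        (Ra S3 (omap (comp_fctr s t) a) (omap (comp_fctr s' t') a) m)
        (Comp G (Ro S1 a) (Ro S2 (omap t a)) (Ro S3 (omap s (omap t a))) (\<omega> (omap t a)) (\<theta> a))
      = Comp G (Ro S1 a) (Ro S2 (omap t' a)) (Ro S3 (omap s' (omap t' a))) (\<omega>' (omap t' a)) (\<theta>' a)"
      by (rule bexI[of _ "Cp S3 (omap s (omap t a)) (omap s (omap t' a)) (omap s' (omap t' a)) n
          (amap s (omap t a) (omap t' a) m)"]) (auto simp: e e')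
  qed
qed

text \<open>Because \<open>pointwise_equiv\<close> is reflexive, symmetric and transitive on
  triples, an equality of 2-cells becomes a condition on one object at a time.\<close>

lemma triple_class_eq_iff:
  assumes F: "faithful_span H G S'" "faithful_span H G S"
    and u: "is_triple H G S' S u" and v: "is_triple H G S' S v"
  shows "triple_class H G S' S u = triple_class H G S' S v \<longleftrightarrow> pointwise_equiv H G S' S u v"
proof
  assume "triple_class H G S' S u = triple_class H G S' S v"
  moreover have "u \<in> triple_class H G S' S u"
    using u pointwise_equiv_refl[OF u F] triple_equiv_iff[OF F u u] by (simp add: triple_class_def)
  ultimately show "pointwise_equiv H G S' S u v"
    using triple_equiv_iff[OF F u v] by (auto simp: triple_class_def)
next
  assume uv: "pointwise_equiv H G S' S u v"
  then show "triple_class H G S' S u = triple_class H G S' S v"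
    using pointwise_equiv_trans[OF F _ u v _ uv]
      pointwise_equiv_trans[OF F _ v u _ pointwise_equiv_sym[OF F u v uv]]
    by (auto simp: triple_class_def triple_equiv_iff[OF F] u v)
qed

lemma mem_triple_class:
  assumes F: "faithful_span H G S'" "faithful_span H G S" and u: "is_triple H G S' S u"
  shows "v \<in> triple_class H G S' S u \<longleftrightarrow> is_triple H G S' S v \<and> pointwise_equiv H G S' S v u"
  unfolding triple_class_def using triple_equiv_iff[OF F _ u] by blast

text \<open>Composition of classes is defined as a union over all representatives. All members of
  the union are the same class by the congruence property, and the union is over nonempty
  sets.\<close>

lemma corr_comp_class:
  assumes F: "faithful_span H G S1" "faithful_span H G S2" "faithful_span H G S3"
    and u: "is_triple H G S1 S2 u" and v: "is_triple H G S2 S3 v"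
  shows "Comp (corr_cat H G) S1 S2 S3 (triple_class H G S2 S3 v) (triple_class H G S1 S2 u)
    = triple_class H G S1 S3 (triple_comp H G S1 S2 S3 v u)"
proof -
  have "triple_class H G S1 S3 (triple_comp H G S1 S2 S3 v' u')
      = triple_class H G S1 S3 (triple_comp H G S1 S2 S3 v u)"
    if "v' \<in> triple_class H G S2 S3 v" "u' \<in> triple_class H G S1 S2 u" for u' v'
    using that unfolding mem_triple_class[OF F(1,2) u] mem_triple_class[OF F(2,3) v]
    by (simp add: triple_class_eq_iff[OF F(1,3)] is_triple_comp[OF F] pointwise_equiv_comp[OF F] u v)
  then have "(\<Union>v'\<in>triple_class H G S2 S3 v. \<Union>u'\<in>triple_class H G S1 S2 u.
       triple_class H G S1 S3 (triple_comp H G S1 S2 S3 v' u'))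
     = (\<Union>v'\<in>triple_class H G S2 S3 v. \<Union>u'\<in>triple_class H G S1 S2 u.
       triple_class H G S1 S3 (triple_comp H G S1 S2 S3 v u))"
    by (intro SUP_cong refl)
  moreover have "v \<in> triple_class H G S2 S3 v" "u \<in> triple_class H G S1 S2 u"
    unfolding mem_triple_class[OF F(1,2) u] mem_triple_class[OF F(2,3) v]
    using u v pointwise_equiv_refl F by blast+
  then have "triple_class H G S2 S3 v \<noteq> {}" "triple_class H G S1 S2 u \<noteq> {}" by blast+
  ultimately show ?thesis by (simp add: corr_cat_def)
qed

lemma corr_cat_simps [simp]:
  "Obj (corr_cat H G) = {S. correspondence H G S}"
  "Hom (corr_cat H G) S' S = {triple_class H G S' S u | u. is_triple H G S' S u}"
  "Ident (corr_cat H G) S = triple_class H G S S (strict_triple H G S id_fctr)"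
  by (simp_all add: corr_cat_def)

section \<open>Strict maps\<close>

definition strict_map :: "'u::universe span \<Rightarrow> 'u span \<Rightarrow> ('u, 'u, 'u, 'u) fctr \<Rightarrow> bool" where
  "strict_map S' S t \<longleftrightarrow> is_functor (apex S') (apex S) t \<and>
    (\<forall>a\<in>Ob S'. Lo S (omap t a) = Lo S' a \<and> Ro S (omap t a) = Ro S' a) \<and>
    (\<forall>a\<in>Ob S'. \<forall>b\<in>Ob S'. \<forall>f\<in>Ar S' a b. La S (omap t a) (omap t b) (amap t a b f) = La S' a b f \<and>
       Ra S (omap t a) (omap t b) (amap t a b f) = Ra S' a b f)"

definition strict_class :: "'u::universe grpd \<Rightarrow> 'u grpd \<Rightarrow> 'u span \<Rightarrow> 'u span \<Rightarrow> ('u, 'u, 'u, 'u) fctr \<Rightarrow>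
    'u triple set" where
  "strict_class H G S' S t = triple_class H G S' S (strict_triple H G S' t)"

lemma strict_mapD:
  assumes "strict_map S' S t"
  shows "is_functor (apex S') (apex S) t" "a \<in> Ob S' \<Longrightarrow> Lo S (omap t a) = Lo S' a"
    "a \<in> Ob S' \<Longrightarrow> Ro S (omap t a) = Ro S' a"
  using assms by (auto simp: strict_map_def)

lemma is_triple_strict:
  assumes F: "faithful_span H G S'" "faithful_span H G S" and t: "strict_map S' S t"
  shows "is_triple H G S' S (strict_triple H G S' t)"
proof -
  interpret S': faithful_span H G S' by fact
  interpret S: faithful_span H G S by fact
  show ?thesis using t by (auto simp: strict_triple_def strict_map_def nat_trans_def is_triple.simps)
qed

lemma strict_map_id: "strict_map S S id_fctr"
  by (auto simp: strict_map_def is_functor_id)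

lemma strict_map_comp: "strict_map S1 S2 t \<Longrightarrow> strict_map S2 S3 s \<Longrightarrow> strict_map S1 S3 (comp_fctr s t)"
  unfolding strict_map_def by (auto intro: is_functor_comp simp: is_functor.omap_in_Obj is_functor.amap_in_Hom)

text \<open>Coherence laws of correspondences end here: for strict maps the arrow part is fixed by
  its image under the faithful left leg, so the object parts decide.\<close>

lemma strict_class_eqI:
  assumes F: "faithful_span H G S'" "faithful_span H G S"
    and t: "strict_map S' S t" "strict_map S' S s" "\<And>a. a \<in> Ob S' \<Longrightarrow> omap t a = omap s a"
  shows "strict_class H G S' S t = strict_class H G S' S s"
  unfolding strict_class_def triple_class_eq_iff[OF F is_triple_strict[OF F t(1)] is_triple_strict[OF F t(2)]]
  using is_triple_strict[OF F t(1)] unfolding strict_triple_def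
  by (rule pointwise_equiv_cong[OF _ F]) (simp add: t)

lemma strict_class_comp:
  assumes F: "faithful_span H G S1" "faithful_span H G S2" "faithful_span H G S3"
    and t: "strict_map S1 S2 t" "strict_map S2 S3 s"
  shows "Comp (corr_cat H G) S1 S2 S3 (strict_class H G S2 S3 s) (strict_class H G S1 S2 t)
    = strict_class H G S1 S3 (comp_fctr s t)"
proof -
  interpret F1: faithful_span H G S1 by fact
  interpret F3: faithful_span H G S3 by fact
  note st = is_triple_strict[OF F(1,3) strict_map_comp[OF t]]
  note ts = is_triple_strict[OF F(1,2) t(1)] is_triple_strict[OF F(2,3) t(2)]
  show ?thesis
    unfolding strict_class_def corr_comp_class[OF F ts] triple_class_eq_iff[OF F(1,3) is_triple_comp[OF F ts] st]
    by (rule pointwise_equiv_sym[OF F(1,3) st is_triple_comp[OF F ts]])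
      (use st F1.H.Comp_Ident_left[of "Lo S1 _" "Lo S1 _"] F1.G.Comp_Ident_left[of "Ro S1 _" "Ro S1 _"] in \<open>auto simp: strict_triple_def strict_mapD[OF t(1)] strict_mapD[OF t(2)] is_functor.omap_in_Obj[OF strict_mapD(1)[OF t(1)]]
        intro!: pointwise_equiv_cong F\<close>)
qed

lemma strict_class_in_Hom:
  assumes "faithful_span H G S'" "faithful_span H G S" "strict_map S' S t"
  shows "strict_class H G S' S t \<in> Hom (corr_cat H G) S' S"
  using is_triple_strict[OF assms] unfolding strict_class_def corr_cat_simps by blast

text \<open>If q f = q g, then g^-1 f is an endomorphism of a that q sends to an identity, hence an
  arrow of the fiber over q a, where it must coincide with the identity of a.\<close>

lemma correspondence_faithful:
  assumes "small_groupoid H" "small_groupoid G" "correspondence H G S"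
  shows "faithful_span H G S"
proof -
  interpret H: small_groupoid H by fact
  interpret G: small_groupoid G by fact
  interpret A: small_groupoid "apex S" using assms by (simp add: correspondence_def)
  interpret q: is_functor "apex S" H "lleg S" using assms by (simp add: correspondence_def weak_finite_cover_def)
  interpret p: is_functor "apex S" G "rleg S" using assms by (simp add: correspondence_def)
  show ?thesis
  proof
    fix a b f g assume ab [simp]: "a \<in> Ob S" "b \<in> Ob S" "f \<in> Ar S a b" "g \<in> Ar S a b" and e: "La S a b f = La S a b g"
    let ?l = "Cp S a b a (inv_arr (apex S) a b g) f"
    have "La S a a ?l = Ident H (Lo S a)"
      by (simp add: e groupoid_functor_inv[OF A.groupoid_axioms H.groupoid_axioms q.is_functor_axioms])
    then have "?l \<in> Hom (fiber (apex S) H (lleg S) (Lo S a)) a a"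
      "Ide S a \<in> Hom (fiber (apex S) H (lleg S) (Lo S a)) a a"
      "a \<in> Obj (fiber (apex S) H (lleg S) (Lo S a))"
      by (auto simp: fiber_def)
    then have "?l = Ide S a"
      using assms(3) unfolding correspondence_def weak_finite_cover_def by (meson ab(1) q.omap_in_Obj)
    then show "f = g" by (subst (asm) A.comp_eq_iff_left) auto
  qed
qed

section \<open>The hom categories of correspondences\<close>

lemma category_corr_cat:
  assumes G: "small_groupoid H" "small_groupoid G"
  shows "category (corr_cat H G)"
proof -
  note F = correspondence_faithful[OF G]
  have id: "is_triple H G S S (strict_triple H G S id_fctr)" if "correspondence H G S" for S
    by (rule is_triple_strict[OF F F strict_map_id]) (use that in auto)
  show ?thesis
  proof
    fix a assume "a \<in> Obj (corr_cat H G)"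
    then show "Ident (corr_cat H G) a \<in> Hom (corr_cat H G) a a"
      using id unfolding corr_cat_simps by blast
  next
    fix a b c f g assume "a \<in> Obj (corr_cat H G)" "b \<in> Obj (corr_cat H G)" "c \<in> Obj (corr_cat H G)"
      "f \<in> Hom (corr_cat H G) a b" "g \<in> Hom (corr_cat H G) b c"
    then obtain u v where F': "faithful_span H G a" "faithful_span H G b" "faithful_span H G c"
      and u: "is_triple H G a b u" "f = triple_class H G a b u"
      and v: "is_triple H G b c v" "g = triple_class H G b c v" by (auto simp: F)
    show "Comp (corr_cat H G) a b c g f \<in> Hom (corr_cat H G) a c"
      unfolding u v corr_comp_class[OF F' u(1) v(1)] corr_cat_simps using is_triple_comp[OF F' u(1) v(1)] by blast
  next
    fix S' S c assume "S' \<in> Obj (corr_cat H G)" "S \<in> Obj (corr_cat H G)" "c \<in> Hom (corr_cat H G) S' S"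
    then obtain \<phi> t \<theta> where S: "correspondence H G S'" "correspondence H G S"
      and u: "is_triple H G S' S (\<phi>, t, \<theta>)" and c: "c = triple_class H G S' S (\<phi>, t, \<theta>)" by auto
    note F' = F[OF S(1)] F[OF S(2)]
    interpret u: span_triple H G S' S \<phi> t \<theta> using is_triple_iff[OF F'] u by blast
    show "Comp (corr_cat H G) S' S S (Ident (corr_cat H G) S) c = c"
      using is_triple_comp[OF F' F'(2) u id[OF S(2)]]
      unfolding c corr_cat_simps corr_comp_class[OF F' F'(2) u id[OF S(2)]]
      unfolding
        triple_class_eq_iff[OF F' is_triple_comp[OF F' F'(2) u id[OF S(2)]] u]
      unfolding strict_triple_def triple_comp.simps
      by (rule pointwise_equiv_cong[OF _ F']) auto
    show "Comp (corr_cat H G) S' S' S c (Ident (corr_cat H G) S') = c"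
      using is_triple_comp[OF F'(1) F' id[OF S(1)] u]
      unfolding c corr_cat_simps corr_comp_class[OF F'(1) F' id[OF S(1)] u]
      unfolding
        triple_class_eq_iff[OF F' is_triple_comp[OF F'(1) F' id[OF S(1)] u] u]
      unfolding strict_triple_def triple_comp.simps
      by (rule pointwise_equiv_cong[OF _ F']) auto
  next
    fix S1 S2 S3 S4 c d e assume "S1 \<in> Obj (corr_cat H G)" "S2 \<in> Obj (corr_cat H G)"
      "S3 \<in> Obj (corr_cat H G)" "S4 \<in> Obj (corr_cat H G)" and cde: "c \<in> Hom (corr_cat H G) S1 S2"
      "d \<in> Hom (corr_cat H G) S2 S3" "e \<in> Hom (corr_cat H G) S3 S4"
    then have F': "faithful_span H G S1" "faithful_span H G S2" "faithful_span H G S3" "faithful_span H G S4"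
      using F by auto
    obtain \<phi> t \<theta> where u: "is_triple H G S1 S2 (\<phi>, t, \<theta>)" "c = triple_class H G S1 S2 (\<phi>, t, \<theta>)"
      using cde by auto
    obtain \<phi>' t' \<theta>' where v: "is_triple H G S2 S3 (\<phi>', t', \<theta>')" "d = triple_class H G S2 S3 (\<phi>', t', \<theta>')"
      using cde by auto
    obtain \<phi>'' t'' \<theta>'' where w: "is_triple H G S3 S4 (\<phi>'', t'', \<theta>'')" "e = triple_class H G S3 S4 (\<phi>'', t'', \<theta>'')"
      using cde by auto
    interpret u: span_triple H G S1 S2 \<phi> t \<theta> using is_triple_iff[OF F'(1,2)] u by blast
    interpret v: span_triple H G S2 S3 \<phi>' t' \<theta>' using is_triple_iff[OF F'(2,3)] v by blast
    interpret w: span_triple H G S3 S4 \<phi>'' t'' \<theta>'' using is_triple_iff[OF F'(3,4)] w by blast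
    note t12 = is_triple_comp[OF F'(1,2,3) u(1) v(1)] and t23 = is_triple_comp[OF F'(2,3,4) v(1) w(1)]
    note t1 = is_triple_comp[OF F'(1,2,4) u(1) t23] and t2 = is_triple_comp[OF F'(1,3,4) t12 w(1)]
    show "Comp (corr_cat H G) S1 S2 S4 (Comp (corr_cat H G) S2 S3 S4 e d) c
      = Comp (corr_cat H G) S1 S3 S4 e (Comp (corr_cat H G) S1 S2 S3 d c)"
      using t1
      unfolding u v w corr_comp_class[OF F'(1,2,3) u(1) v(1)] corr_comp_class[OF F'(2,3,4) v(1) w(1)]
        corr_comp_class[OF F'(1,2,4) u(1) t23] corr_comp_class[OF F'(1,3,4) t12 w(1)]
        triple_class_eq_iff[OF F'(1,4) t1 t2]
      unfolding triple_comp.simps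
      by (rule pointwise_equiv_cong[OF _ F'(1,4)]) auto
  qed
qed

text \<open>The functor \<open>t\<close> is automatically faithful, since q t is isomorphic to the
  faithful q'; with fullness and essential surjectivity it is an equivalence. The inverse triple is
  built from chosen preimages \<open>s b\<close> with arrows \<open>e b\<close> from t (s b) to
  b.\<close>

lemma iso_arr_corrI:
  assumes F: "faithful_span H G S'" "faithful_span H G S" and u: "is_triple H G S' S (\<phi>, t, \<theta>)"
    and full: "\<And>a b g. \<lbrakk>a \<in> Ob S'; b \<in> Ob S'; g \<in> Ar S (omap t a) (omap t b)\<rbrakk> \<Longrightarrow> \<exists>f\<in>Ar S' a b. amap t a b f = g"
    and surj: "\<And>b. b \<in> Ob S \<Longrightarrow> \<exists>a\<in>Ob S'. Ar S (omap t a) b \<noteq> {}"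
  shows "iso_arr (corr_cat H G) S' S (triple_class H G S' S (\<phi>, t, \<theta>))"
proof -
  interpret u: span_triple H G S' S \<phi> t \<theta> using is_triple_iff[OF F] u by blast
  obtain s e where s [simp]: "\<And>b. b \<in> Ob S \<Longrightarrow> s b \<in> Ob S'"
    and e [simp]: "\<And>b. b \<in> Ob S \<Longrightarrow> e b \<in> Ar S (omap t (s b)) b"
    using surj unfolding ex_in_conv[symmetric] by metis
  \<comment> \<open>The inverse of the composite q' (s b) \<rightarrow> q (t (s b)) \<rightarrow> q
    b. With this choice \<open>e b\<close> itself witnesses that the composite on \<open>S\<close>
    is equivalent to the identity.\<close>
  define \<phi>i where "\<phi>i b = inv_arr H (Lo S' (s b)) (Lo S b) (Comp H (Lo S' (s b)) (Lo S (omap t (s b))) (Lo S b)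
      (La S (omap t (s b)) b (e b)) (\<phi> (s b)))" for b
  define \<theta>i where "\<theta>i b = inv_arr G (Ro S' (s b)) (Ro S b) (Comp G (Ro S' (s b)) (Ro S (omap t (s b))) (Ro S b)
      (Ra S (omap t (s b)) b (e b)) (\<theta> (s b)))" for b
  have i: "\<phi>i b \<in> Hom H (Lo S b) (Lo S' (s b))" "\<theta>i b \<in> Hom G (Ro S b) (Ro S' (s b))" if "b \<in> Ob S" for b
    unfolding \<phi>i_def \<theta>i_def using that by auto
  have "\<exists>r. omap r = s \<and> is_triple H G S S' (\<phi>i, r, \<theta>i)"
  proof (rule span_triple_exI[OF F(2,1)])
    fix a b f assume [simp]: "a \<in> Ob S" "b \<in> Ob S" "f \<in> Ar S a b"
    \<comment> \<open>The lift of the path t (s a) \<rightarrow> a \<rightarrow> b \<rightarrow> t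
      (s b) whose outer arrows are \<open>e a\<close> and the inverse of \<open>e b\<close>.\<close>
    obtain g where g [simp]: "g \<in> Ar S' (s a) (s b)" and tg [simp]: "amap t (s a) (s b) g =
        Cp S (omap t (s a)) b (omap t (s b)) (inv_arr (apex S) (omap t (s b)) b (e b))
          (Cp S (omap t (s a)) a b f (e a))"
      using full[of "s a" "s b" "Cp S (omap t (s a)) b (omap t (s b)) (inv_arr (apex S) (omap t (s b)) b (e b))
          (Cp S (omap t (s a)) a b f (e a))"] by auto
    show "\<exists>g\<in>Ar S' (s a) (s b).
      Comp H (Lo S a) (Lo S' (s a)) (Lo S' (s b)) (La S' (s a) (s b) g) (\<phi>i a) =
      Comp H (Lo S a) (Lo S b) (Lo S' (s b)) (\<phi>i b) (La S a b f) \<and>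
      Comp G (Ro S a) (Ro S' (s a)) (Ro S' (s b)) (Ra S' (s a) (s b) g) (\<theta>i a) =
      Comp G (Ro S a) (Ro S b) (Ro S' (s b)) (\<theta>i b) (Ra S a b f)"
    proof (intro bexI[OF _ g] conjI)
      show "Comp H (Lo S a) (Lo S' (s a)) (Lo S' (s b)) (La S' (s a) (s b) g) (\<phi>i a) =
        Comp H (Lo S a) (Lo S b) (Lo S' (s b)) (\<phi>i b) (La S a b f)"
        unfolding \<phi>i_def by (rule u.S'.H.square_inv) (auto simp: u.S.functor_inv)
      show "Comp G (Ro S a) (Ro S' (s a)) (Ro S' (s b)) (Ra S' (s a) (s b) g) (\<theta>i a) =
        Comp G (Ro S a) (Ro S b) (Ro S' (s b)) (\<theta>i b) (Ra S a b f)"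
        unfolding \<theta>i_def by (rule u.S'.G.square_inv) (auto simp: u.S.functor_inv)
    qed
  qed (use i in auto)
  then obtain r where r [simp]: "omap r = s" and v: "is_triple H G S S' (\<phi>i, r, \<theta>i)" by blast
  note id = is_triple_strict[OF F(1,1) strict_map_id] is_triple_strict[OF F(2,2) strict_map_id]
  have 1: "Comp (corr_cat H G) S' S S' (triple_class H G S S' (\<phi>i, r, \<theta>i)) (triple_class H G S' S (\<phi>, t, \<theta>))
      = Ident (corr_cat H G) S'"
    unfolding corr_comp_class[OF F F(1) u v] corr_cat_simps triple_class_eq_iff[OF F(1,1) is_triple_comp[OF F F(1) u v] id(1)]
    unfolding strict_triple_def triple_comp.simps pointwise_equiv.simps
  proof
    fix a assume [simp]: "a \<in> Ob S'"
    \<comment> \<open>Fullness brings \<open>e\<close> at t a back to an arrow of \<open>S'\<close>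
      with target a. This arrow witnesses the other inverse law.\<close>
    obtain l where l [simp]: "l \<in> Ar S' (s (omap t a)) a" "amap t (s (omap t a)) a l = e (omap t a)"
      using full[of "s (omap t a)" a "e (omap t a)"] by auto
    have "\<phi>i (omap t a) = inv_arr H (Lo S' (s (omap t a))) (Lo S (omap t a))
        (Comp H (Lo S' (s (omap t a))) (Lo S' a) (Lo S (omap t a)) (\<phi> a) (La S' (s (omap t a)) a l))"
      unfolding \<phi>i_def by (subst u.l.nat) (use l in auto)
    then have "Comp H (Lo S' a) (Lo S' (s (omap t a))) (Lo S' a) (La S' (s (omap t a)) a l)
         (Comp H (Lo S' a) (Lo S (omap t a)) (Lo S' (s (omap t a))) (\<phi>i (omap t a)) (\<phi> a)) = Ident H (Lo S' a)"
      by (simp add: u.S'.H.inv_Comp del: u.l.nat)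
    moreover have "\<theta>i (omap t a) = inv_arr G (Ro S' (s (omap t a))) (Ro S (omap t a))
        (Comp G (Ro S' (s (omap t a))) (Ro S' a) (Ro S (omap t a)) (\<theta> a) (Ra S' (s (omap t a)) a l))"
      unfolding \<theta>i_def by (subst u.r.nat) (use l in auto)
    then have "Comp G (Ro S' a) (Ro S' (s (omap t a))) (Ro S' a) (Ra S' (s (omap t a)) a l)
         (Comp G (Ro S' a) (Ro S (omap t a)) (Ro S' (s (omap t a))) (\<theta>i (omap t a)) (\<theta> a)) = Ident G (Ro S' a)"
      by (simp add: u.S'.G.inv_Comp del: u.r.nat)
    ultimately show "\<exists>m\<in>Ar S' (omap (comp_fctr r t) a) (omap id_fctr a).
      Comp H (Lo S' a) (Lo S' (omap (comp_fctr r t) a)) (Lo S' (omap id_fctr a))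
        (La S' (omap (comp_fctr r t) a) (omap id_fctr a) m)
        (Comp H (Lo S' a) (Lo S (omap t a)) (Lo S' (omap r (omap t a))) (\<phi>i (omap t a)) (\<phi> a)) = Ident H (Lo S' a) \<and>
      Comp G (Ro S' a) (Ro S' (omap (comp_fctr r t) a)) (Ro S' (omap id_fctr a))
        (Ra S' (omap (comp_fctr r t) a) (omap id_fctr a) m)
        (Comp G (Ro S' a) (Ro S (omap t a)) (Ro S' (omap r (omap t a))) (\<theta>i (omap t a)) (\<theta> a)) = Ident G (Ro S' a)"
      using l by auto
  qed
  have 2: "Comp (corr_cat H G) S S' S (triple_class H G S' S (\<phi>, t, \<theta>)) (triple_class H G S S' (\<phi>i, r, \<theta>i))
      = Ident (corr_cat H G) S"
    unfolding corr_comp_class[OF F(2,1,2) v u] corr_cat_simps triple_class_eq_iff[OF F(2,2) is_triple_comp[OF F(2,1,2) v u] id(2)]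
    unfolding strict_triple_def triple_comp.simps pointwise_equiv.simps
  proof
    fix b assume [simp]: "b \<in> Ob S"
    show "\<exists>m\<in>Ar S (omap (comp_fctr t r) b) (omap id_fctr b).
      Comp H (Lo S b) (Lo S (omap (comp_fctr t r) b)) (Lo S (omap id_fctr b))
        (La S (omap (comp_fctr t r) b) (omap id_fctr b) m)
        (Comp H (Lo S b) (Lo S' (omap r b)) (Lo S (omap t (omap r b))) (\<phi> (omap r b)) (\<phi>i b)) = Ident H (Lo S b) \<and>
      Comp G (Ro S b) (Ro S (omap (comp_fctr t r) b)) (Ro S (omap id_fctr b))
        (Ra S (omap (comp_fctr t r) b) (omap id_fctr b) m)
        (Comp G (Ro S b) (Ro S' (omap r b)) (Ro S (omap t (omap r b))) (\<theta> (omap r b)) (\<theta>i b)) = Ident G (Ro S b)"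
      by (rule bexI[of _ "e b"]) (auto simp: \<phi>i_def \<theta>i_def u.S'.H.inv_Comp u.S'.G.inv_Comp)
  qed
  show ?thesis unfolding iso_arr_def using 1 2 u v unfolding corr_cat_simps by blast
qed

section \<open>Pullbacks and iso-comma groupoids\<close>

text \<open>The index objects of an arrow are often known only up to equality.\<close>

lemma (in is_functor) amap_in_Hom_eq [simp]:
  "\<lbrakk>a \<in> Obj A; b \<in> Obj A; f \<in> Hom A a b; x = omap F a; y = omap F b\<rbrakk> \<Longrightarrow> amap F a b f \<in> Hom B x y"
  by simp

context leg_trans
begin

lemma in_Hom_eq [simp]:
  "\<lbrakk>a \<in> Obj A'; x = omap q' a; y = omap q (omap t a)\<rbrakk> \<Longrightarrow> \<phi> a \<in> Hom H x y"
  by simp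

lemma nat_eq [simp]:
  "\<lbrakk>a \<in> Obj A'; b \<in> Obj A'; f \<in> Hom A' a b; x = omap q' a; y = omap q' b; z = omap q (omap t b)\<rbrakk> \<Longrightarrow>
      Comp H x y z (\<phi> b) (amap q' a b f) =
      Comp H (omap q' a) (omap q (omap t a)) (omap q (omap t b))
        (amap q (omap t a) (omap t b) (amap t a b f)) (\<phi> a)"
  by simp

lemma nat_extend_eq [simp]:
  "\<lbrakk>a \<in> Obj A'; b \<in> Obj A'; f \<in> Hom A' a b; x \<in> Obj H; r \<in> Hom H x (omap q' a);
    x' = omap q' a; y = omap q' b; z = omap q (omap t b)\<rbrakk> \<Longrightarrow>
    Comp H x y z (\<phi> b) (Comp H x x' y (amap q' a b f) r) =
    Comp H x (omap q (omap t a)) (omap q (omap t b))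
      (amap q (omap t a) (omap t b) (amap t a b f)) (Comp H x (omap q' a) (omap q (omap t a)) (\<phi> a) r)"
  by simp

end

lemma upair_eq_iff [simp]: "upair a b = upair c d \<longleftrightarrow> a = c \<and> b = d"
  by (metis ufst_upair usnd_upair)

lemma utriple_simps [simp]:
  "u1 (utriple a b c) = a" "u2 (utriple a b c) = b" "u3 (utriple a b c) = c"
  "utriple a b c = utriple a' b' c' \<longleftrightarrow> a = a' \<and> b = b' \<and> c = c'"
  by (simp_all add: utriple_def u1_def u2_def u3_def)

lemma small_upair:
  assumes "small X" "small Y"
  shows "small {upair x y | x y. x \<in> X \<and> y \<in> Y \<and> Q x y}"
proof (rule small_subset)
  show "small (\<Union>x\<in>X. upair x ` Y)" using assms by (intro small_UN small_image)
qed auto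

lemma small_utriple:
  assumes "small X" "small Y" "\<And>x y. x \<in> X \<Longrightarrow> y \<in> Y \<Longrightarrow> small (Z x y)"
  shows "small {utriple x z y | x z y. x \<in> X \<and> y \<in> Y \<and> z \<in> Z x y}"
proof (rule small_subset)
  show "small (\<Union>x\<in>X. \<Union>y\<in>Y. (\<lambda>z. utriple x z y) ` Z x y)" using assms by (intro small_UN small_image)
qed auto

lemma pair_cat_simps [simp]:
  "Obj (pair_cat A B S l r P) = S"
  "Ident (pair_cat A B S l r P) a = upair (Ident A (l a)) (Ident B (r a))"
  "Comp (pair_cat A B S l r P) a b c v u = upair (Comp A (l a) (l b) (l c) (ufst v) (ufst u))
                               (Comp B (r a) (r b) (r c) (usnd v) (usnd u))"
  "u \<in> Hom (pair_cat A B S l r P) a b \<longleftrightarrow>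
    (\<exists>f g. u = upair f g \<and> f \<in> Hom A (l a) (l b) \<and> g \<in> Hom B (r a) (r b) \<and> P a b f g)"
  by (auto simp: pair_cat_def)

lemma proj_simps [simp]:
  "omap (left_proj l) a = l a" "amap (left_proj l) a b u = ufst u"
  "omap (right_proj r) a = r a" "amap (right_proj r) a b u = usnd u"
  by (simp_all add: left_proj_def right_proj_def)

text \<open>Strict pullbacks, iso-comma groupoids and translation groupoids are all subject to this
  criterion: closure of \<open>P\<close> under identities, composites and inverses.\<close>

lemma groupoid_pair_cat:
  assumes A: "groupoid A" and B: "groupoid B"
    and S: "\<And>a. a \<in> S \<Longrightarrow> l a \<in> Obj A" "\<And>a. a \<in> S \<Longrightarrow> r a \<in> Obj B"
    and id: "\<And>a. a \<in> S \<Longrightarrow> P a a (Ident A (l a)) (Ident B (r a))"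
    and comp: "\<And>a b c f f' g g'. \<lbrakk>a \<in> S; b \<in> S; c \<in> S; f \<in> Hom A (l a) (l b); f' \<in> Hom A (l b) (l c);
       g \<in> Hom B (r a) (r b); g' \<in> Hom B (r b) (r c); P a b f g; P b c f' g'\<rbrakk>
       \<Longrightarrow> P a c (Comp A (l a) (l b) (l c) f' f) (Comp B (r a) (r b) (r c) g' g)"
    and inv: "\<And>a b f g. \<lbrakk>a \<in> S; b \<in> S; f \<in> Hom A (l a) (l b); g \<in> Hom B (r a) (r b); P a b f g\<rbrakk>
       \<Longrightarrow> P b a (inv_arr A (l a) (l b) f) (inv_arr B (r a) (r b) g)"
  shows "groupoid (pair_cat A B S l r P)"
proof -
  interpret A: groupoid A by fact
  interpret B: groupoid B by fact
  have c: "category (pair_cat A B S l r P)"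
    by unfold_locales (use S id comp in auto)
  interpret category "pair_cat A B S l r P" by fact
  show ?thesis
  proof
    fix a b u assume ab: "a \<in> Obj (pair_cat A B S l r P)" "b \<in> Obj (pair_cat A B S l r P)"
      and "u \<in> Hom (pair_cat A B S l r P) a b"
    then obtain f g where u: "u = upair f g" "f \<in> Hom A (l a) (l b)" "g \<in> Hom B (r a) (r b)" "P a b f g"
      by auto
    then show "iso_arr (pair_cat A B S l r P) a b u"
      unfolding iso_arr_def using ab S inv[of a b f g]
      by (intro conjI bexI[of _ "upair (inv_arr A (l a) (l b) f) (inv_arr B (r a) (r b) g)"]) auto
  qed
qed

lemma small_groupoid_pair_cat:
  assumes "groupoid (pair_cat A B S l r P)" "small_groupoid A" "small_groupoid B"
    and S: "\<And>a. a \<in> S \<Longrightarrow> l a \<in> Obj A" "\<And>a. a \<in> S \<Longrightarrow> r a \<in> Obj B" and "small S"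
  shows "small_groupoid (pair_cat A B S l r P)"
proof -
  interpret groupoid "pair_cat A B S l r P" by fact
  interpret A: small_groupoid A by fact
  interpret B: small_groupoid B by fact
  have "small {upair f g | f g. f \<in> Hom A (l a) (l b) \<and> g \<in> Hom B (r a) (r b) \<and> P a b f g}"
    if "a \<in> S" "b \<in> S" for a b
    using that by (intro small_upair A.small_Hom B.small_Hom S)
  then show ?thesis
    using assms arr_iso by unfold_locales (auto simp: pair_cat_def)
qed

lemma is_functor_proj:
  assumes "\<And>a. a \<in> S \<Longrightarrow> l a \<in> Obj A" "\<And>a. a \<in> S \<Longrightarrow> r a \<in> Obj B"
  shows "is_functor (pair_cat A B S l r P) A (left_proj l)" "is_functor (pair_cat A B S l r P) B (right_proj r)"
  by (unfold_locales; use assms in auto)+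

section \<open>Strict pullbacks of spans\<close>

lemma pullback_simps [simp]:
  "upair \<kappa> \<mu> \<in> Ob (pullback_span A B) \<longleftrightarrow> \<kappa> \<in> Ob A \<and> \<mu> \<in> Ob B \<and> Lo A \<kappa> = Ro B \<mu>"
  "u \<in> Ar (pullback_span A B) a b \<longleftrightarrow> (\<exists>k l. u = upair k l \<and> k \<in> Ar A (ufst a) (ufst b) \<and>
      l \<in> Ar B (usnd a) (usnd b) \<and> La A (ufst a) (ufst b) k = Ra B (usnd a) (usnd b) l)"
  "Cp (pullback_span A B) a b c v u = upair (Cp A (ufst a) (ufst b) (ufst c) (ufst v) (ufst u))
      (Cp B (usnd a) (usnd b) (usnd c) (usnd v) (usnd u))"
  "Ide (pullback_span A B) a = upair (Ide A (ufst a)) (Ide B (usnd a))"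
  "Lo (pullback_span A B) a = Lo B (usnd a)" "La (pullback_span A B) a b u = La B (usnd a) (usnd b) (usnd u)"
  "Ro (pullback_span A B) a = Ro A (ufst a)" "Ra (pullback_span A B) a b u = Ra A (ufst a) (ufst b) (ufst u)"
  by (auto simp: pullback_span_def)

lemma pullback_ObE:
  assumes "a \<in> Ob (pullback_span A B)"
  obtains \<kappa> \<mu> where "a = upair \<kappa> \<mu>" "\<kappa> \<in> Ob A" "\<mu> \<in> Ob B" "Lo A \<kappa> = Ro B \<mu>"
  using assms by (auto simp: pullback_span_def)

text \<open>Let (k, l) and (k', l') have the same left leg. Faithfulness of the left leg of
  \<open>B\<close> gives l = l'. Then k and k' have the same image in G, namely that of l, and
  faithfulness of the left leg of \<open>A\<close> gives k = k'.\<close>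

lemma pullback_faithful:
  assumes A: "faithful_span G F A" and B: "faithful_span H G B"
  shows "faithful_span H F (pullback_span A B)"
proof -
  interpret A: faithful_span G F A by fact
  interpret B: faithful_span H G B by fact
  have "groupoid (apex (pullback_span A B))"
    unfolding pullback_span_def span.simps
  proof (rule groupoid_pair_cat[OF A.A.groupoid_axioms B.A.groupoid_axioms], goal_cases)
    case (4 a b c f f' g g') then show ?case by (auto simp del: upair_eq_iff)
  next
    case (5 a b f g) then show ?case by (auto simp: A.functor_inv B.functor_inv)
  qed auto
  then interpret groupoid "apex (pullback_span A B)" .
  have p: "is_functor (apex (pullback_span A B)) (apex A) (left_proj ufst)"
    "is_functor (apex (pullback_span A B)) (apex B) (right_proj usnd)"
    unfolding pullback_span_def span.simps by (rule is_functor_proj; auto)+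
  interpret l: is_functor "apex (pullback_span A B)" H "lleg (pullback_span A B)"
    using is_functor_comp[OF p(2) B.q.is_functor_axioms] by (simp add: pullback_span_def)
  interpret r: is_functor "apex (pullback_span A B)" F "rleg (pullback_span A B)"
    using is_functor_comp[OF p(1) A.p.is_functor_axioms] by (simp add: pullback_span_def)
  show ?thesis
  proof
    fix a b f g assume "a \<in> Ob (pullback_span A B)" "b \<in> Ob (pullback_span A B)"
      "f \<in> Ar (pullback_span A B) a b" "g \<in> Ar (pullback_span A B) a b"
      "La (pullback_span A B) a b f = La (pullback_span A B) a b g"
    then show "f = g" by (auto elim!: pullback_ObE) (metis A.faithful B.faithful)+
  qed
qed

section \<open>Iso-comma spans\<close>

lemma isocomma_simps [simp]:
  "utriple \<kappa> \<mu> i \<in> Ob (isocomma_span G A B) \<longleftrightarrow> \<kappa> \<in> Ob A \<and> \<mu> \<in> Ob B \<and> i \<in> Hom G (Lo A \<kappa>) (Ro B \<mu>)"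
  "u \<in> Ar (isocomma_span G A B) a b \<longleftrightarrow> (\<exists>k l. u = upair k l \<and> k \<in> Ar A (u1 a) (u1 b) \<and>
      l \<in> Ar B (u2 a) (u2 b) \<and>
      Comp G (Lo A (u1 a)) (Ro B (u2 a)) (Ro B (u2 b)) (Ra B (u2 a) (u2 b) l) (u3 a)
      = Comp G (Lo A (u1 a)) (Lo A (u1 b)) (Ro B (u2 b)) (u3 b) (La A (u1 a) (u1 b) k))"
  "Cp (isocomma_span G A B) a b c v u = upair (Cp A (u1 a) (u1 b) (u1 c) (ufst v) (ufst u))
      (Cp B (u2 a) (u2 b) (u2 c) (usnd v) (usnd u))"
  "Ide (isocomma_span G A B) a = upair (Ide A (u1 a)) (Ide B (u2 a))"
  "Lo (isocomma_span G A B) a = Lo B (u2 a)" "La (isocomma_span G A B) a b u = La B (u2 a) (u2 b) (usnd u)"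
  "Ro (isocomma_span G A B) a = Ro A (u1 a)" "Ra (isocomma_span G A B) a b u = Ra A (u1 a) (u1 b) (ufst u)"
  by (auto simp: isocomma_span_def)

lemma ex_isocomma_arr:
  "(\<exists>m\<in>Ar (isocomma_span G A B) a b. Q m) \<longleftrightarrow> (\<exists>k l. k \<in> Ar A (u1 a) (u1 b) \<and> l \<in> Ar B (u2 a) (u2 b) \<and>
      Comp G (Lo A (u1 a)) (Ro B (u2 a)) (Ro B (u2 b)) (Ra B (u2 a) (u2 b) l) (u3 a)
      = Comp G (Lo A (u1 a)) (Lo A (u1 b)) (Ro B (u2 b)) (u3 b) (La A (u1 a) (u1 b) k) \<and> Q (upair k l))"
  unfolding Bex_def isocomma_simps by blast

lemma isocomma_ObE:
  assumes "a \<in> Ob (isocomma_span G A B)"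
  obtains \<kappa> \<mu> i where "a = utriple \<kappa> \<mu> i" "\<kappa> \<in> Ob A" "\<mu> \<in> Ob B" "i \<in> Hom G (Lo A \<kappa>) (Ro B \<mu>)"
  using assms by (auto simp: isocomma_span_def)

text \<open>As for the strict pullback, except that the images of k and k' in G are first compared
  after composition with the third component i' of the target, which is then cancelled.\<close>

lemma isocomma_faithful:
  assumes A: "faithful_span G F A" and B: "faithful_span H G B"
  shows "faithful_span H F (isocomma_span G A B)"
proof -
  interpret A: faithful_span G F A by fact
  interpret B: faithful_span H G B by fact
  have "groupoid (apex (isocomma_span G A B))"
    unfolding isocomma_span_def span.simps
  proof (rule groupoid_pair_cat[OF A.A.groupoid_axioms B.A.groupoid_axioms], goal_cases)
    case (4 a b c f f' g g')
    then obtain i i' i'' where abc: "u3 a = i" "i \<in> Hom G (Lo A (u1 a)) (Ro B (u2 a))" "u3 b = i'"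
      "i' \<in> Hom G (Lo A (u1 b)) (Ro B (u2 b))" "u3 c = i''" "i'' \<in> Hom G (Lo A (u1 c)) (Ro B (u2 c))"
      "u1 a \<in> Ob A" "u2 a \<in> Ob B" "u1 b \<in> Ob A" "u2 b \<in> Ob B" "u1 c \<in> Ob A" "u2 c \<in> Ob B" by auto
    have "Comp G (Lo A (u1 a)) (Ro B (u2 a)) (Ro B (u2 c)) (Ra B (u2 a) (u2 c) (Cp B (u2 a) (u2 b) (u2 c) g' g)) i
      = Comp G (Lo A (u1 a)) (Ro B (u2 b)) (Ro B (u2 c)) (Ra B (u2 b) (u2 c) g')
          (Comp G (Lo A (u1 a)) (Ro B (u2 a)) (Ro B (u2 b)) (Ra B (u2 a) (u2 b) g) i)"
      using 4 abc by simp
    also have "\<dots> = Comp G (Lo A (u1 a)) (Lo A (u1 b)) (Ro B (u2 c))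
        (Comp G (Lo A (u1 b)) (Ro B (u2 b)) (Ro B (u2 c)) (Ra B (u2 b) (u2 c) g') i') (La A (u1 a) (u1 b) f)"
      using 4(4-8) abc unfolding 4(8)[unfolded abc] by simp
    also have "\<dots> = Comp G (Lo A (u1 a)) (Lo A (u1 c)) (Ro B (u2 c)) i''
       (La A (u1 a) (u1 c) (Cp A (u1 a) (u1 b) (u1 c) f' f))"
      using 4(4-7) abc unfolding 4(9)[unfolded abc] by simp
    finally show ?case unfolding abc .
  next
    case (5 a b f g)
    then obtain i i' where ab: "u3 a = i" "i \<in> Hom G (Lo A (u1 a)) (Ro B (u2 a))" "u3 b = i'"
      "i' \<in> Hom G (Lo A (u1 b)) (Ro B (u2 b))"
      "u1 a \<in> Ob A" "u2 a \<in> Ob B" "u1 b \<in> Ob A" "u2 b \<in> Ob B" by auto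
    have "Comp G (Lo A (u1 b)) (Lo A (u1 a)) (Ro B (u2 a)) i (inv_arr G (Lo A (u1 a)) (Lo A (u1 b)) (La A (u1 a) (u1 b) f))
      = Comp G (Lo A (u1 b)) (Ro B (u2 b)) (Ro B (u2 a)) (inv_arr G (Ro B (u2 a)) (Ro B (u2 b)) (Ra B (u2 a) (u2 b) g)) i'"
      by (rule A.H.square_inv) (use 5 ab in auto)
    then show ?case unfolding ab by (simp add: A.functor_inv B.functor_inv 5 ab)
  qed auto
  then interpret groupoid "apex (isocomma_span G A B)" .
  have p: "is_functor (apex (isocomma_span G A B)) (apex A) (left_proj u1)"
    "is_functor (apex (isocomma_span G A B)) (apex B) (right_proj u2)"
    unfolding isocomma_span_def span.simps by (rule is_functor_proj; auto)+
  interpret l: is_functor "apex (isocomma_span G A B)" H "lleg (isocomma_span G A B)"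
    using is_functor_comp[OF p(2) B.q.is_functor_axioms] by (simp add: isocomma_span_def)
  interpret r: is_functor "apex (isocomma_span G A B)" F "rleg (isocomma_span G A B)"
    using is_functor_comp[OF p(1) A.p.is_functor_axioms] by (simp add: isocomma_span_def)
  show ?thesis
  proof
    fix a b f g assume ab: "a \<in> Ob (isocomma_span G A B)" "b \<in> Ob (isocomma_span G A B)"
      "f \<in> Ar (isocomma_span G A B) a b" "g \<in> Ar (isocomma_span G A B) a b"
      "La (isocomma_span G A B) a b f = La (isocomma_span G A B) a b g"
    obtain \<kappa> \<mu> i where a: "a = utriple \<kappa> \<mu> i" "\<kappa> \<in> Ob A" "\<mu> \<in> Ob B" "i \<in> Hom G (Lo A \<kappa>) (Ro B \<mu>)"
      using ab(1) by (rule isocomma_ObE)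
    obtain \<kappa>' \<mu>' i' where b: "b = utriple \<kappa>' \<mu>' i'" "\<kappa>' \<in> Ob A" "\<mu>' \<in> Ob B" "i' \<in> Hom G (Lo A \<kappa>') (Ro B \<mu>')"
      using ab(2) by (rule isocomma_ObE)
    obtain k l where f: "f = upair k l" "k \<in> Ar A \<kappa> \<kappa>'" "l \<in> Ar B \<mu> \<mu>'"
      and kl: "Comp G (Lo A \<kappa>) (Ro B \<mu>) (Ro B \<mu>') (Ra B \<mu> \<mu>' l) i = Comp G (Lo A \<kappa>) (Lo A \<kappa>') (Ro B \<mu>') i' (La A \<kappa> \<kappa>' k)"
      using ab(3) a b by auto
    obtain k' l' where g: "g = upair k' l'" "k' \<in> Ar A \<kappa> \<kappa>'" "l' \<in> Ar B \<mu> \<mu>'"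
      and kl': "Comp G (Lo A \<kappa>) (Ro B \<mu>) (Ro B \<mu>') (Ra B \<mu> \<mu>' l') i = Comp G (Lo A \<kappa>) (Lo A \<kappa>') (Ro B \<mu>') i' (La A \<kappa> \<kappa>' k')"
      using ab(4) a b by auto
    have l: "l = l'" using ab(5) f g a b by (auto intro: B.faithful)
    have "La A \<kappa> \<kappa>' k = La A \<kappa> \<kappa>' k'"
      by (rule A.H.cancel_left[of "Lo A \<kappa>" "Lo A \<kappa>'" "Ro B \<mu>'" i']) (use kl kl' l a b f g in auto)
    then show "f = g" using l f g a b A.faithful by auto
  qed
qed

section \<open>Horizontal composition of triples\<close>

text \<open>A pointwise form of the square defining \<^const>\<open>corr_hcomp\<close>.  The arrow \<open>j\<close> stands for
  \<open>\<phi>\<^sub>\<kappa>\<inverse> \<circ> n k = \<omega>\<^sub>\<mu>\<inverse> \<circ> p l\<close>.\<close>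

fun hcomp_rel :: "'u::universe grpd \<Rightarrow> 'u grpd \<Rightarrow> 'u grpd \<Rightarrow> 'u span \<Rightarrow> 'u span \<Rightarrow> 'u span \<Rightarrow> 'u span \<Rightarrow>
   'u triple \<Rightarrow> 'u triple \<Rightarrow> 'u triple \<Rightarrow> bool" where
  "hcomp_rel H G F A' B' A B (\<phi>, t, \<theta>) (\<chi>, s, \<omega>) (\<xi>, r, \<zeta>) \<longleftrightarrow>
    (\<forall>\<kappa>' \<mu>'. \<kappa>' \<in> Ob A' \<and> \<mu>' \<in> Ob B' \<and> Lo A' \<kappa>' = Ro B' \<mu>' \<longrightarrow>
      (\<exists>\<kappa> \<mu> k l j. omap r (upair \<kappa>' \<mu>') = upair \<kappa> \<mu> \<and> \<kappa> \<in> Ob A \<and> \<mu> \<in> Ob B \<and> Lo A \<kappa> = Ro B \<mu> \<and>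
        k \<in> Ar A \<kappa> (omap t \<kappa>') \<and> l \<in> Ar B \<mu> (omap s \<mu>') \<and> j \<in> Hom G (Ro B \<mu>) (Ro B' \<mu>') \<and>
        Comp G (Ro B \<mu>) (Ro B' \<mu>') (Lo A (omap t \<kappa>')) (\<phi> \<kappa>') j = La A \<kappa> (omap t \<kappa>') k \<and>
        Comp G (Ro B \<mu>) (Ro B' \<mu>') (Ro B (omap s \<mu>')) (\<omega> \<mu>') j = Ra B \<mu> (omap s \<mu>') l \<and>
        Comp H (Lo B' \<mu>') (Lo B \<mu>) (Lo B (omap s \<mu>')) (La B \<mu> (omap s \<mu>') l) (\<xi> (upair \<kappa>' \<mu>')) = \<chi> \<mu>' \<and>
        Comp F (Ro A' \<kappa>') (Ro A \<kappa>) (Ro A (omap t \<kappa>')) (Ra A \<kappa> (omap t \<kappa>') k) (\<zeta> (upair \<kappa>' \<mu>')) = \<theta> \<kappa>'))"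

declare hcomp_rel.simps [simp del]

text \<open>The substance is that the pair (t k, s l) is compatible with the new third components
  \<omega> i \<phi>^-1. This uses naturality of \<omega>, then the condition on (k, l), then
  naturality of \<phi> in its inverted form.\<close>

lemma is_triple_isocomma_triple:
  assumes A: "faithful_span G F A'" "faithful_span G F A" and B: "faithful_span H G B'" "faithful_span H G B"
    and u: "is_triple G F A' A u" and v: "is_triple H G B' B v"
  shows "is_triple H F (isocomma_span G A' B') (isocomma_span G A B) (isocomma_triple G A' A B' B u v)"
proof -
  obtain \<phi> t \<theta> \<chi> s \<omega> where uv: "u = (\<phi>, t, \<theta>)" "v = (\<chi>, s, \<omega>)" by (cases u; cases v)
  interpret u: span_triple G F A' A \<phi> t \<theta> using u is_triple_iff[OF A] unfolding uv by blast
  interpret v: span_triple H G B' B \<chi> s \<omega> using v is_triple_iff[OF B] unfolding uv by blast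
  note F = isocomma_faithful[OF A(1) B(1)] isocomma_faithful[OF A(2) B(2)]
  interpret S': faithful_span H F "isocomma_span G A' B'" by fact
  interpret S: faithful_span H F "isocomma_span G A B" by fact
  show ?thesis unfolding uv isocomma_triple.simps is_triple_iff[OF F]
  proof (unfold_locales, goal_cases)
    case (1 a) then show ?case by (auto elim!: isocomma_ObE)
  next
    case (2 a b f)
    obtain \<kappa> \<mu> i where a: "a = utriple \<kappa> \<mu> i" and [simp]: "\<kappa> \<in> Ob A'" "\<mu> \<in> Ob B'" "i \<in> Hom G (Lo A' \<kappa>) (Ro B' \<mu>)"
      using 2(1) by (rule isocomma_ObE)
    obtain \<kappa>' \<mu>' i' where b: "b = utriple \<kappa>' \<mu>' i'" and [simp]: "\<kappa>' \<in> Ob A'" "\<mu>' \<in> Ob B'" "i' \<in> Hom G (Lo A' \<kappa>') (Ro B' \<mu>')"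
      using 2(2) by (rule isocomma_ObE)
    obtain k l where f: "f = upair k l" and [simp]: "k \<in> Ar A' \<kappa> \<kappa>'" "l \<in> Ar B' \<mu> \<mu>'"
      and kl: "Comp G (Lo A' \<kappa>) (Ro B' \<mu>) (Ro B' \<mu>') (Ra B' \<mu> \<mu>' l) i = Comp G (Lo A' \<kappa>) (Lo A' \<kappa>') (Ro B' \<mu>') i' (La A' \<kappa> \<kappa>' k)"
      using 2(3) a b by auto
    let ?i = "inv_arr G (Lo A' \<kappa>) (Lo A (omap t \<kappa>)) (\<phi> \<kappa>)" and ?i' = "inv_arr G (Lo A' \<kappa>') (Lo A (omap t \<kappa>')) (\<phi> \<kappa>')"
    have "Comp G (Lo A (omap t \<kappa>)) (Ro B (omap s \<mu>)) (Ro B (omap s \<mu>')) (Ra B (omap s \<mu>) (omap s \<mu>') (amap s \<mu> \<mu>' l))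
        (Comp G (Lo A (omap t \<kappa>)) (Ro B' \<mu>) (Ro B (omap s \<mu>)) (\<omega> \<mu>) (Comp G (Lo A (omap t \<kappa>)) (Lo A' \<kappa>) (Ro B' \<mu>) i ?i))
      = Comp G (Lo A (omap t \<kappa>)) (Ro B' \<mu>') (Ro B (omap s \<mu>')) (\<omega> \<mu>') (Comp G (Lo A (omap t \<kappa>)) (Lo A' \<kappa>) (Ro B' \<mu>')
          (Comp G (Lo A' \<kappa>) (Ro B' \<mu>) (Ro B' \<mu>') (Ra B' \<mu> \<mu>' l) i) ?i)"
      by simp
    also have "\<dots> = Comp G (Lo A (omap t \<kappa>)) (Ro B' \<mu>') (Ro B (omap s \<mu>')) (\<omega> \<mu>') (Comp G (Lo A (omap t \<kappa>)) (Lo A' \<kappa>') (Ro B' \<mu>')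
          i' (Comp G (Lo A (omap t \<kappa>)) (Lo A' \<kappa>) (Lo A' \<kappa>') (La A' \<kappa> \<kappa>' k) ?i))"
      unfolding kl by simp
    also have "Comp G (Lo A (omap t \<kappa>)) (Lo A' \<kappa>) (Lo A' \<kappa>') (La A' \<kappa> \<kappa>' k) ?i
      = Comp G (Lo A (omap t \<kappa>)) (Lo A (omap t \<kappa>')) (Lo A' \<kappa>') ?i' (La A (omap t \<kappa>) (omap t \<kappa>') (amap t \<kappa> \<kappa>' k))"
      by (rule u.S'.H.square_inv) auto
    finally show ?case unfolding a b f by simp
  next
    case (3 a) then show ?case by (auto elim!: isocomma_ObE)
  next
    case (4 a b c f g) then show ?case by (auto elim!: isocomma_ObE)
  next
    case (5 a) then show ?case by (auto elim!: isocomma_ObE)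
  next
    case (6 a b f) then show ?case by (auto elim!: isocomma_ObE)
  next
    case (7 a) then show ?case by (auto elim!: isocomma_ObE)
  next
    case (8 a b f) then show ?case by (auto elim!: isocomma_ObE)
  qed
qed

lemma strict_map_incl:
  assumes A: "faithful_span G F A" and B: "faithful_span H G B"
  shows "strict_map (pullback_span A B) (isocomma_span G A B)
     \<lparr>omap = (\<lambda>a. utriple (ufst a) (usnd a) (Ident G (Lo A (ufst a)))), amap = (\<lambda>a b f. f)\<rparr>"
proof -
  interpret A: faithful_span G F A by fact
  interpret B: faithful_span H G B by fact
  show ?thesis
    unfolding strict_map_def is_functor_def by (auto elim!: pullback_ObE)
qed

text \<open>At (\<kappa>', \<mu>') the two sides of the square have the values (\<kappa>, \<mu>, 1)
  and (t \<kappa>', s \<mu>', \<omega> \<phi>^-1). An arrow between them is a pair (k, l) with p l =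
  \<omega> \<phi>^-1 (n k), that is, a pair for which n k = \<phi> j and p l = \<omega> j with a
  common j. After this lemma the iso-comma groupoid is replaced by the relation.\<close>

lemma triple_equiv_iff_hcomp_rel:
  assumes A: "faithful_span G F A'" "faithful_span G F A" and B: "faithful_span H G B'" "faithful_span H G B"
    and u: "is_triple G F A' A u" and v: "is_triple H G B' B v"
    and w: "is_triple H F (pullback_span A' B') (pullback_span A B) w"
  shows "triple_equiv H F (pullback_span A' B') (isocomma_span G A B)
          (triple_comp H F (pullback_span A' B') (pullback_span A B) (isocomma_span G A B)
             (pullback_incl H G F A B) w)
          (triple_comp H F (pullback_span A' B') (isocomma_span G A' B') (isocomma_span G A B)
             (isocomma_triple G A' A B' B u v) (pullback_incl H G F A' B'))
    \<longleftrightarrow> hcomp_rel H G F A' B' A B u v w" (is "?L \<longleftrightarrow> ?R")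
proof -
  note F = pullback_faithful[OF A(1) B(1)] pullback_faithful[OF A(2) B(2)]
    isocomma_faithful[OF A(1) B(1)] isocomma_faithful[OF A(2) B(2)]
  obtain \<phi> t \<theta> \<chi> s \<omega> \<xi> r \<zeta> where uvw: "u = (\<phi>, t, \<theta>)" "v = (\<chi>, s, \<omega>)" "w = (\<xi>, r, \<zeta>)" by (cases u; cases v; cases w)
  interpret u: span_triple G F A' A \<phi> t \<theta> using u is_triple_iff[OF A] unfolding uvw by blast
  interpret v: span_triple H G B' B \<chi> s \<omega> using v is_triple_iff[OF B] unfolding uvw by blast
  interpret w: span_triple H F "pullback_span A' B'" "pullback_span A B" \<xi> r \<zeta>
    using w is_triple_iff[OF F(1,2)] unfolding uvw by blast
  have i: "is_triple H F (pullback_span A' B') (isocomma_span G A' B') (pullback_incl H G F A' B')"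
    "is_triple H F (pullback_span A B) (isocomma_span G A B) (pullback_incl H G F A B)"
    unfolding pullback_incl_def
    using is_triple_strict[OF F(1,3) strict_map_incl[OF A(1) B(1)]]
      is_triple_strict[OF F(2,4) strict_map_incl[OF A(2) B(2)]] by blast+
  have eq: "?L \<longleftrightarrow> pointwise_equiv H F (pullback_span A' B') (isocomma_span G A B)
          (triple_comp H F (pullback_span A' B') (pullback_span A B) (isocomma_span G A B)
             (pullback_incl H G F A B) w)
          (triple_comp H F (pullback_span A' B') (isocomma_span G A' B') (isocomma_span G A B)
             (isocomma_triple G A' A B' B u v) (pullback_incl H G F A' B'))"
    by (intro triple_equiv_iff is_triple_comp F w i is_triple_isocomma_triple A B u v)
  have P: "(\<exists>m\<in>Ar (isocomma_span G A B) (utriple (ufst (omap r a)) (usnd (omap r a)) (Ident G (Lo A (ufst (omap r a)))))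
         (utriple (omap t \<kappa>') (omap s \<mu>') (Comp G (Lo A (omap t \<kappa>')) (Ro B' \<mu>') (Ro B (omap s \<mu>')) (\<omega> \<mu>')
           (Comp G (Lo A (omap t \<kappa>')) (Lo A' \<kappa>') (Ro B' \<mu>') (Ident G (Lo A' \<kappa>')) (inv_arr G (Lo A' \<kappa>') (Lo A (omap t \<kappa>')) (\<phi> \<kappa>'))))).
         Comp H (Lo B' \<mu>') (Lo B (usnd (omap r a))) (Lo B (omap s \<mu>')) (La B (usnd (omap r a)) (omap s \<mu>') (usnd m))
            (Comp H (Lo B' \<mu>') (Lo B (usnd (omap r a))) (Lo B (usnd (omap r a))) (Ident H (Lo B (usnd (omap r a)))) (\<xi> a))
          = Comp H (Lo B' \<mu>') (Lo B' \<mu>') (Lo B (omap s \<mu>')) (\<chi> \<mu>') (Ident H (Lo B' \<mu>')) \<and>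
         Comp F (Ro A' \<kappa>') (Ro A (ufst (omap r a))) (Ro A (omap t \<kappa>')) (Ra A (ufst (omap r a)) (omap t \<kappa>') (ufst m))
            (Comp F (Ro A' \<kappa>') (Ro A (ufst (omap r a))) (Ro A (ufst (omap r a))) (Ident F (Ro A (ufst (omap r a)))) (\<zeta> a))
          = Comp F (Ro A' \<kappa>') (Ro A' \<kappa>') (Ro A (omap t \<kappa>')) (\<theta> \<kappa>') (Ident F (Ro A' \<kappa>')))
    \<longleftrightarrow> (\<exists>\<kappa> \<mu> k l j. omap r a = upair \<kappa> \<mu> \<and> \<kappa> \<in> Ob A \<and> \<mu> \<in> Ob B \<and> Lo A \<kappa> = Ro B \<mu> \<and>
        k \<in> Ar A \<kappa> (omap t \<kappa>') \<and> l \<in> Ar B \<mu> (omap s \<mu>') \<and> j \<in> Hom G (Ro B \<mu>) (Ro B' \<mu>') \<and>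
        Comp G (Ro B \<mu>) (Ro B' \<mu>') (Lo A (omap t \<kappa>')) (\<phi> \<kappa>') j = La A \<kappa> (omap t \<kappa>') k \<and>
        Comp G (Ro B \<mu>) (Ro B' \<mu>') (Ro B (omap s \<mu>')) (\<omega> \<mu>') j = Ra B \<mu> (omap s \<mu>') l \<and>
        Comp H (Lo B' \<mu>') (Lo B \<mu>) (Lo B (omap s \<mu>')) (La B \<mu> (omap s \<mu>') l) (\<xi> a) = \<chi> \<mu>' \<and>
        Comp F (Ro A' \<kappa>') (Ro A \<kappa>) (Ro A (omap t \<kappa>')) (Ra A \<kappa> (omap t \<kappa>') k) (\<zeta> a) = \<theta> \<kappa>')"
    (is "?P \<longleftrightarrow> ?Q")
    if [simp]: "\<kappa>' \<in> Ob A'" "\<mu>' \<in> Ob B'" "Lo A' \<kappa>' = Ro B' \<mu>'" and a: "a = upair \<kappa>' \<mu>'" for \<kappa>' \<mu>' a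
  proof -
    have [simp]: "a \<in> Ob (pullback_span A' B')" using a by simp
    have "omap r a \<in> Ob (pullback_span A B)" by simp
    then obtain \<kappa> \<mu> where ra [simp]: "omap r a = upair \<kappa> \<mu>" and [simp]: "\<kappa> \<in> Ob A" "\<mu> \<in> Ob B" "Lo A \<kappa> = Ro B \<mu>"
      by (rule pullback_ObE)
    have [simp]: "\<xi> a \<in> Hom H (Lo B' \<mu>') (Lo B \<mu>)" "\<zeta> a \<in> Hom F (Ro A' \<kappa>') (Ro A \<kappa>)"
      using w.l.in_Hom[of a] w.r.in_Hom[of a] unfolding pullback_simps ra by (simp_all add: a)
    \<comment> \<open>The common factor is j = \<phi>^-1 (n k); the equation for p l is then the
      compatibility condition of the iso-comma groupoid.\<close>
    have e: "Ra B \<mu> (omap s \<mu>') l = Comp G (Ro B \<mu>) (Lo A (omap t \<kappa>')) (Ro B (omap s \<mu>'))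
        (Comp G (Lo A (omap t \<kappa>')) (Ro B' \<mu>') (Ro B (omap s \<mu>')) (\<omega> \<mu>')
           (inv_arr G (Ro B' \<mu>') (Lo A (omap t \<kappa>')) (\<phi> \<kappa>'))) (La A \<kappa> (omap t \<kappa>') k)
      \<longleftrightarrow> (\<exists>j. j \<in> Hom G (Ro B \<mu>) (Ro B' \<mu>') \<and>
        Comp G (Ro B \<mu>) (Ro B' \<mu>') (Lo A (omap t \<kappa>')) (\<phi> \<kappa>') j = La A \<kappa> (omap t \<kappa>') k \<and>
        Comp G (Ro B \<mu>) (Ro B' \<mu>') (Ro B (omap s \<mu>')) (\<omega> \<mu>') j = Ra B \<mu> (omap s \<mu>') l)" (is "?x \<longleftrightarrow> ?y")
      if [simp]: "k \<in> Ar A \<kappa> (omap t \<kappa>')" "l \<in> Ar B \<mu> (omap s \<mu>')" for k l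
    proof
      assume ?x
      then show ?y
        by (intro exI[of _ "Comp G (Ro B \<mu>) (Lo A (omap t \<kappa>')) (Ro B' \<mu>')
          (inv_arr G (Ro B' \<mu>') (Lo A (omap t \<kappa>')) (\<phi> \<kappa>')) (La A \<kappa> (omap t \<kappa>') k)"]) simp
    next
      assume ?y
      then obtain j where j [simp]: "j \<in> Hom G (Ro B \<mu>) (Ro B' \<mu>')"
        and "La A \<kappa> (omap t \<kappa>') k = Comp G (Ro B \<mu>) (Ro B' \<mu>') (Lo A (omap t \<kappa>')) (\<phi> \<kappa>') j"
        "Ra B \<mu> (omap s \<mu>') l = Comp G (Ro B \<mu>) (Ro B' \<mu>') (Ro B (omap s \<mu>')) (\<omega> \<mu>') j" by metis
      then show ?x by simp
    qed
    have "?P \<longleftrightarrow> (\<exists>k l. k \<in> Ar A \<kappa> (omap t \<kappa>') \<and> l \<in> Ar B \<mu> (omap s \<mu>') \<and>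
        Ra B \<mu> (omap s \<mu>') l = Comp G (Ro B \<mu>) (Lo A (omap t \<kappa>')) (Ro B (omap s \<mu>'))
        (Comp G (Lo A (omap t \<kappa>')) (Ro B' \<mu>') (Ro B (omap s \<mu>')) (\<omega> \<mu>')
           (inv_arr G (Ro B' \<mu>') (Lo A (omap t \<kappa>')) (\<phi> \<kappa>'))) (La A \<kappa> (omap t \<kappa>') k) \<and>
        Comp H (Lo B' \<mu>') (Lo B \<mu>) (Lo B (omap s \<mu>')) (La B \<mu> (omap s \<mu>') l) (\<xi> a) = \<chi> \<mu>' \<and>
        Comp F (Ro A' \<kappa>') (Ro A \<kappa>) (Ro A (omap t \<kappa>')) (Ra A \<kappa> (omap t \<kappa>') k) (\<zeta> a) = \<theta> \<kappa>')"
      unfolding ex_isocomma_arr ra utriple_simps ufst_upair usnd_upair by (intro ex_cong1 conj_cong refl) simp_all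
    also have "\<dots> \<longleftrightarrow> (\<exists>k l. k \<in> Ar A \<kappa> (omap t \<kappa>') \<and> l \<in> Ar B \<mu> (omap s \<mu>') \<and>
        (\<exists>j. j \<in> Hom G (Ro B \<mu>) (Ro B' \<mu>') \<and>
        Comp G (Ro B \<mu>) (Ro B' \<mu>') (Lo A (omap t \<kappa>')) (\<phi> \<kappa>') j = La A \<kappa> (omap t \<kappa>') k \<and>
        Comp G (Ro B \<mu>) (Ro B' \<mu>') (Ro B (omap s \<mu>')) (\<omega> \<mu>') j = Ra B \<mu> (omap s \<mu>') l) \<and>
        Comp H (Lo B' \<mu>') (Lo B \<mu>) (Lo B (omap s \<mu>')) (La B \<mu> (omap s \<mu>') l) (\<xi> a) = \<chi> \<mu>' \<and>
        Comp F (Ro A' \<kappa>') (Ro A \<kappa>) (Ro A (omap t \<kappa>')) (Ra A \<kappa> (omap t \<kappa>') k) (\<zeta> a) = \<theta> \<kappa>')"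
      using e by blast
    also have "\<dots> \<longleftrightarrow> ?Q" by auto
    finally show ?thesis .
  qed
  have O: "(\<forall>a\<in>Ob (pullback_span A' B'). Q a) \<longleftrightarrow>
     (\<forall>\<kappa>' \<mu>'. \<kappa>' \<in> Ob A' \<and> \<mu>' \<in> Ob B' \<and> Lo A' \<kappa>' = Ro B' \<mu>' \<longrightarrow> Q (upair \<kappa>' \<mu>'))" for Q
    by (auto elim!: pullback_ObE)
  show ?thesis
    unfolding eq unfolding uvw pullback_incl_def strict_triple_def isocomma_triple.simps triple_comp.simps
      pointwise_equiv.simps hcomp_rel.simps O
    by (intro all_cong1 imp_cong refl) (use P in simp)
qed

lemma hcomp_relE:
  assumes "hcomp_rel H G F A' B' A B (\<phi>, t, \<theta>) (\<chi>, s, \<omega>) (\<xi>, r, \<zeta>)"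
    and "\<kappa>' \<in> Ob A'" "\<mu>' \<in> Ob B'" "Lo A' \<kappa>' = Ro B' \<mu>'"
  obtains \<kappa> \<mu> k l j where "omap r (upair \<kappa>' \<mu>') = upair \<kappa> \<mu>" "\<kappa> \<in> Ob A" "\<mu> \<in> Ob B" "Lo A \<kappa> = Ro B \<mu>"
        "k \<in> Ar A \<kappa> (omap t \<kappa>')" "l \<in> Ar B \<mu> (omap s \<mu>')" "j \<in> Hom G (Ro B \<mu>) (Ro B' \<mu>')"
        "La A \<kappa> (omap t \<kappa>') k = Comp G (Ro B \<mu>) (Ro B' \<mu>') (Lo A (omap t \<kappa>')) (\<phi> \<kappa>') j"
        "Ra B \<mu> (omap s \<mu>') l = Comp G (Ro B \<mu>) (Ro B' \<mu>') (Ro B (omap s \<mu>')) (\<omega> \<mu>') j"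
        "\<chi> \<mu>' = Comp H (Lo B' \<mu>') (Lo B \<mu>) (Lo B (omap s \<mu>')) (La B \<mu> (omap s \<mu>') l) (\<xi> (upair \<kappa>' \<mu>'))"
        "\<theta> \<kappa>' = Comp F (Ro A' \<kappa>') (Ro A \<kappa>) (Ro A (omap t \<kappa>')) (Ra A \<kappa> (omap t \<kappa>') k) (\<zeta> (upair \<kappa>' \<mu>'))"
  using assms unfolding hcomp_rel.simps by metis

text \<open>The witnesses are transported along the three equivalences: k becomes m k e1, l becomes
  n l e2, and j is precomposed with the common image of e1 and e2 in G.\<close>

lemma hcomp_rel_cong:
  assumes A: "faithful_span G F A'" "faithful_span G F A" and B: "faithful_span H G B'" "faithful_span H G B"
    and u: "is_triple G F A' A u" "is_triple G F A' A u'" "pointwise_equiv G F A' A u u'"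
    and v: "is_triple H G B' B v" "is_triple H G B' B v'" "pointwise_equiv H G B' B v v'"
    and w: "is_triple H F (pullback_span A' B') (pullback_span A B) w"
      "is_triple H F (pullback_span A' B') (pullback_span A B) w'"
      "pointwise_equiv H F (pullback_span A' B') (pullback_span A B) w' w"
    and rel: "hcomp_rel H G F A' B' A B u v w"
  shows "hcomp_rel H G F A' B' A B u' v' w'"
proof -
  note F = pullback_faithful[OF A(1) B(1)] pullback_faithful[OF A(2) B(2)]
  obtain \<phi> t \<theta> \<chi> s \<omega> \<xi> r \<zeta> where uvw: "u = (\<phi>, t, \<theta>)" "v = (\<chi>, s, \<omega>)" "w = (\<xi>, r, \<zeta>)" by (cases u; cases v; cases w)
  obtain \<phi>1 t1 \<theta>1 \<chi>1 s1 \<omega>1 \<xi>1 r1 \<zeta>1 where uvw': "u' = (\<phi>1, t1, \<theta>1)" "v' = (\<chi>1, s1, \<omega>1)" "w' = (\<xi>1, r1, \<zeta>1)"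
    by (cases u'; cases v'; cases w')
  interpret u: span_triple G F A' A \<phi> t \<theta> using u is_triple_iff[OF A] unfolding uvw by blast
  interpret v: span_triple H G B' B \<chi> s \<omega> using v is_triple_iff[OF B] unfolding uvw by blast
  interpret w: span_triple H F "pullback_span A' B'" "pullback_span A B" \<xi> r \<zeta>
    using w is_triple_iff[OF F(1,2)] unfolding uvw by blast
  interpret u1: span_triple G F A' A \<phi>1 t1 \<theta>1 using u is_triple_iff[OF A] unfolding uvw' by blast
  interpret v1: span_triple H G B' B \<chi>1 s1 \<omega>1 using v is_triple_iff[OF B] unfolding uvw' by blast
  interpret w1: span_triple H F "pullback_span A' B'" "pullback_span A B" \<xi>1 r1 \<zeta>1
    using w is_triple_iff[OF F(1,2)] unfolding uvw' by blast
  show ?thesis unfolding uvw' hcomp_rel.simps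
  proof (intro allI impI, elim conjE)
    fix \<kappa>' \<mu>' assume a [simp]: "\<kappa>' \<in> Ob A'" "\<mu>' \<in> Ob B'" "Lo A' \<kappa>' = Ro B' \<mu>'"
    let ?a = "upair \<kappa>' \<mu>'"
    have ao: "?a \<in> Ob (pullback_span A' B')" by simp
    obtain \<kappa> \<mu> k l j where [simp]: "omap r ?a = upair \<kappa> \<mu>" "\<kappa> \<in> Ob A" "\<mu> \<in> Ob B" "Lo A \<kappa> = Ro B \<mu>"
        "k \<in> Ar A \<kappa> (omap t \<kappa>')" "l \<in> Ar B \<mu> (omap s \<mu>')" "j \<in> Hom G (Ro B \<mu>) (Ro B' \<mu>')"
        and e: "La A \<kappa> (omap t \<kappa>') k = Comp G (Ro B \<mu>) (Ro B' \<mu>') (Lo A (omap t \<kappa>')) (\<phi> \<kappa>') j"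
        "Ra B \<mu> (omap s \<mu>') l = Comp G (Ro B \<mu>) (Ro B' \<mu>') (Ro B (omap s \<mu>')) (\<omega> \<mu>') j"
        "\<chi> \<mu>' = Comp H (Lo B' \<mu>') (Lo B \<mu>) (Lo B (omap s \<mu>')) (La B \<mu> (omap s \<mu>') l) (\<xi> ?a)"
        "\<theta> \<kappa>' = Comp F (Ro A' \<kappa>') (Ro A \<kappa>) (Ro A (omap t \<kappa>')) (Ra A \<kappa> (omap t \<kappa>') k) (\<zeta> ?a)"
      using hcomp_relE[OF rel[unfolded uvw] a] .
    obtain m where [simp]: "m \<in> Ar A (omap t \<kappa>') (omap t1 \<kappa>')" and m:
      "\<phi>1 \<kappa>' = Comp G (Ro B' \<mu>') (Lo A (omap t \<kappa>')) (Lo A (omap t1 \<kappa>')) (La A (omap t \<kappa>') (omap t1 \<kappa>') m) (\<phi> \<kappa>')"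
      "\<theta>1 \<kappa>' = Comp F (Ro A' \<kappa>') (Ro A (omap t \<kappa>')) (Ro A (omap t1 \<kappa>')) (Ra A (omap t \<kappa>') (omap t1 \<kappa>') m) (\<theta> \<kappa>')"
      using u(3) a unfolding uvw uvw' pointwise_equiv.simps by metis
    obtain n where [simp]: "n \<in> Ar B (omap s \<mu>') (omap s1 \<mu>')" and n:
      "\<chi>1 \<mu>' = Comp H (Lo B' \<mu>') (Lo B (omap s \<mu>')) (Lo B (omap s1 \<mu>')) (La B (omap s \<mu>') (omap s1 \<mu>') n) (\<chi> \<mu>')"
      "\<omega>1 \<mu>' = Comp G (Ro B' \<mu>') (Ro B (omap s \<mu>')) (Ro B (omap s1 \<mu>')) (Ra B (omap s \<mu>') (omap s1 \<mu>') n) (\<omega> \<mu>')"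
      using v(3) a unfolding uvw uvw' pointwise_equiv.simps by metis
    have "omap r1 ?a \<in> Ob (pullback_span A B)" using ao by simp
    then obtain \<kappa>1 \<mu>1 where [simp]: "omap r1 ?a = upair \<kappa>1 \<mu>1" "\<kappa>1 \<in> Ob A" "\<mu>1 \<in> Ob B" "Lo A \<kappa>1 = Ro B \<mu>1"
      by (rule pullback_ObE)
    have "\<exists>e\<in>Ar (pullback_span A B) (upair \<kappa>1 \<mu>1) (upair \<kappa> \<mu>).
      Comp H (Lo B' \<mu>') (Lo B \<mu>1) (Lo B \<mu>) (La B \<mu>1 \<mu> (usnd e)) (\<xi>1 ?a) = \<xi> ?a \<and>
      Comp F (Ro A' \<kappa>') (Ro A \<kappa>1) (Ro A \<kappa>) (Ra A \<kappa>1 \<kappa> (ufst e)) (\<zeta>1 ?a) = \<zeta> ?a"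
      using w(3) ao unfolding uvw uvw' pointwise_equiv.simps
      by (auto simp del: pullback_simps(1) pullback_simps(2) dest!: bspec[where x = ?a])
    then obtain e1 e2 where [simp]: "e1 \<in> Ar A \<kappa>1 \<kappa>" "e2 \<in> Ar B \<mu>1 \<mu>" "La A \<kappa>1 \<kappa> e1 = Ra B \<mu>1 \<mu> e2"
      and ee: "\<xi> ?a = Comp H (Lo B' \<mu>') (Lo B \<mu>1) (Lo B \<mu>) (La B \<mu>1 \<mu> e2) (\<xi>1 ?a)"
      "\<zeta> ?a = Comp F (Ro A' \<kappa>') (Ro A \<kappa>1) (Ro A \<kappa>) (Ra A \<kappa>1 \<kappa> e1) (\<zeta>1 ?a)"
      by auto
    have [simp]: "\<xi>1 ?a \<in> Hom H (Lo B' \<mu>') (Lo B \<mu>1)" "\<zeta>1 ?a \<in> Hom F (Ro A' \<kappa>') (Ro A \<kappa>1)"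
      using w1.l.in_Hom[OF ao] w1.r.in_Hom[OF ao] by auto
    show "\<exists>\<kappa> \<mu> k l j. omap r1 ?a = upair \<kappa> \<mu> \<and> \<kappa> \<in> Ob A \<and> \<mu> \<in> Ob B \<and> Lo A \<kappa> = Ro B \<mu> \<and>
        k \<in> Ar A \<kappa> (omap t1 \<kappa>') \<and> l \<in> Ar B \<mu> (omap s1 \<mu>') \<and> j \<in> Hom G (Ro B \<mu>) (Ro B' \<mu>') \<and>
        Comp G (Ro B \<mu>) (Ro B' \<mu>') (Lo A (omap t1 \<kappa>')) (\<phi>1 \<kappa>') j = La A \<kappa> (omap t1 \<kappa>') k \<and>
        Comp G (Ro B \<mu>) (Ro B' \<mu>') (Ro B (omap s1 \<mu>')) (\<omega>1 \<mu>') j = Ra B \<mu> (omap s1 \<mu>') l \<and>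
        Comp H (Lo B' \<mu>') (Lo B \<mu>) (Lo B (omap s1 \<mu>')) (La B \<mu> (omap s1 \<mu>') l) (\<xi>1 (upair \<kappa>' \<mu>')) = \<chi>1 \<mu>' \<and>
        Comp F (Ro A' \<kappa>') (Ro A \<kappa>) (Ro A (omap t1 \<kappa>')) (Ra A \<kappa> (omap t1 \<kappa>') k) (\<zeta>1 (upair \<kappa>' \<mu>')) = \<theta>1 \<kappa>'"
      apply (rule exI[of _ \<kappa>1], rule exI[of _ \<mu>1])
      apply (rule exI[of _ "Cp A \<kappa>1 (omap t \<kappa>') (omap t1 \<kappa>') m (Cp A \<kappa>1 \<kappa> (omap t \<kappa>') k e1)"])
      apply (rule exI[of _ "Cp B \<mu>1 (omap s \<mu>') (omap s1 \<mu>') n (Cp B \<mu>1 \<mu> (omap s \<mu>') l e2)"])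
      apply (rule exI[of _ "Comp G (Ro B \<mu>1) (Ro B \<mu>) (Ro B' \<mu>') j (Ra B \<mu>1 \<mu> e2)"])
      by (simp add: e m n ee)
  qed
qed

text \<open>For two solutions with witnesses (k, l, j) and (k1, l1, j1), the arrows k1^-1 k and
  l1^-1 l both have the image j1^-1 j in G. They therefore form an arrow of the strict pullback, and
  this arrow compares the solutions.\<close>

lemma hcomp_rel_unique:
  assumes A: "faithful_span G F A'" "faithful_span G F A" and B: "faithful_span H G B'" "faithful_span H G B"
    and u: "is_triple G F A' A u" and v: "is_triple H G B' B v"
    and w: "is_triple H F (pullback_span A' B') (pullback_span A B) w"
      "is_triple H F (pullback_span A' B') (pullback_span A B) w'"
    and rel: "hcomp_rel H G F A' B' A B u v w" "hcomp_rel H G F A' B' A B u v w'"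
  shows "pointwise_equiv H F (pullback_span A' B') (pullback_span A B) w w'"
proof -
  note F = pullback_faithful[OF A(1) B(1)] pullback_faithful[OF A(2) B(2)]
  obtain \<phi> t \<theta> \<chi> s \<omega> \<xi> r \<zeta> \<xi>1 r1 \<zeta>1 where uvw: "u = (\<phi>, t, \<theta>)" "v = (\<chi>, s, \<omega>)" "w = (\<xi>, r, \<zeta>)" "w' = (\<xi>1, r1, \<zeta>1)"
    by (cases u; cases v; cases w; cases w')
  interpret u: span_triple G F A' A \<phi> t \<theta> using u is_triple_iff[OF A] unfolding uvw by blast
  interpret v: span_triple H G B' B \<chi> s \<omega> using v is_triple_iff[OF B] unfolding uvw by blast
  interpret w: span_triple H F "pullback_span A' B'" "pullback_span A B" \<xi> r \<zeta>
    using w is_triple_iff[OF F(1,2)] unfolding uvw by blast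
  interpret w1: span_triple H F "pullback_span A' B'" "pullback_span A B" \<xi>1 r1 \<zeta>1
    using w is_triple_iff[OF F(1,2)] unfolding uvw by blast
  show ?thesis unfolding uvw pointwise_equiv.simps
  proof
    fix a assume ao: "a \<in> Ob (pullback_span A' B')"
    then obtain \<kappa>' \<mu>' where a: "a = upair \<kappa>' \<mu>'" and a' [simp]: "\<kappa>' \<in> Ob A'" "\<mu>' \<in> Ob B'" "Lo A' \<kappa>' = Ro B' \<mu>'"
      by (rule pullback_ObE)
    obtain \<kappa> \<mu> k l j where ra [simp]: "omap r a = upair \<kappa> \<mu>" and [simp]: "\<kappa> \<in> Ob A" "\<mu> \<in> Ob B" "Lo A \<kappa> = Ro B \<mu>"
        "k \<in> Ar A \<kappa> (omap t \<kappa>')" "l \<in> Ar B \<mu> (omap s \<mu>')" "j \<in> Hom G (Ro B \<mu>) (Ro B' \<mu>')"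
        and e: "La A \<kappa> (omap t \<kappa>') k = Comp G (Ro B \<mu>) (Ro B' \<mu>') (Lo A (omap t \<kappa>')) (\<phi> \<kappa>') j"
        "Ra B \<mu> (omap s \<mu>') l = Comp G (Ro B \<mu>) (Ro B' \<mu>') (Ro B (omap s \<mu>')) (\<omega> \<mu>') j"
        "\<chi> \<mu>' = Comp H (Lo B' \<mu>') (Lo B \<mu>) (Lo B (omap s \<mu>')) (La B \<mu> (omap s \<mu>') l) (\<xi> a)"
        "\<theta> \<kappa>' = Comp F (Ro A' \<kappa>') (Ro A \<kappa>) (Ro A (omap t \<kappa>')) (Ra A \<kappa> (omap t \<kappa>') k) (\<zeta> a)"
      using hcomp_relE[OF rel(1)[unfolded uvw] a', folded a] .
    obtain \<kappa>1 \<mu>1 k1 l1 j1 where r1a [simp]: "omap r1 a = upair \<kappa>1 \<mu>1" and [simp]: "\<kappa>1 \<in> Ob A" "\<mu>1 \<in> Ob B" "Lo A \<kappa>1 = Ro B \<mu>1"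
        "k1 \<in> Ar A \<kappa>1 (omap t \<kappa>')" "l1 \<in> Ar B \<mu>1 (omap s \<mu>')" "j1 \<in> Hom G (Ro B \<mu>1) (Ro B' \<mu>')"
        and e1: "La A \<kappa>1 (omap t \<kappa>') k1 = Comp G (Ro B \<mu>1) (Ro B' \<mu>') (Lo A (omap t \<kappa>')) (\<phi> \<kappa>') j1"
        "Ra B \<mu>1 (omap s \<mu>') l1 = Comp G (Ro B \<mu>1) (Ro B' \<mu>') (Ro B (omap s \<mu>')) (\<omega> \<mu>') j1"
        "\<chi> \<mu>' = Comp H (Lo B' \<mu>') (Lo B \<mu>1) (Lo B (omap s \<mu>')) (La B \<mu>1 (omap s \<mu>') l1) (\<xi>1 a)"
        "\<theta> \<kappa>' = Comp F (Ro A' \<kappa>') (Ro A \<kappa>1) (Ro A (omap t \<kappa>')) (Ra A \<kappa>1 (omap t \<kappa>') k1) (\<zeta>1 a)"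
      using hcomp_relE[OF rel(2)[unfolded uvw] a', folded a] .
    have [simp]: "\<xi> a \<in> Hom H (Lo B' \<mu>') (Lo B \<mu>)" "\<zeta> a \<in> Hom F (Ro A' \<kappa>') (Ro A \<kappa>)"
      "\<xi>1 a \<in> Hom H (Lo B' \<mu>') (Lo B \<mu>1)" "\<zeta>1 a \<in> Hom F (Ro A' \<kappa>') (Ro A \<kappa>1)"
      using w.l.in_Hom[OF ao] w.r.in_Hom[OF ao] w1.l.in_Hom[OF ao] w1.r.in_Hom[OF ao] by (simp_all, simp_all add: a)
    let ?k = "Cp A \<kappa> (omap t \<kappa>') \<kappa>1 (inv_arr (apex A) \<kappa>1 (omap t \<kappa>') k1) k"
    let ?l = "Cp B \<mu> (omap s \<mu>') \<mu>1 (inv_arr (apex B) \<mu>1 (omap s \<mu>') l1) l"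
    have "La A \<kappa> \<kappa>1 ?k = Comp G (Ro B \<mu>) (Ro B' \<mu>') (Ro B \<mu>1) (inv_arr G (Ro B \<mu>1) (Ro B' \<mu>') j1) j"
      by (simp add: u.S.functor_inv e e1 u.S'.H.inv_Comp)
    moreover have "Ra B \<mu> \<mu>1 ?l = Comp G (Ro B \<mu>) (Ro B' \<mu>') (Ro B \<mu>1) (inv_arr G (Ro B \<mu>1) (Ro B' \<mu>') j1) j"
      by (simp add: v.S.functor_inv e e1 u.S'.H.inv_Comp)
    ultimately have 1: "upair ?k ?l \<in> Ar (pullback_span A B) (upair \<kappa> \<mu>) (upair \<kappa>1 \<mu>1)"
      by simp
    have 2: "Comp H (Lo B' \<mu>') (Lo B \<mu>) (Lo B \<mu>1) (La B \<mu> \<mu>1 ?l) (\<xi> a) = \<xi>1 a"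
      by (simp add: v.S.functor_inv e1(3) flip: e(3))
    have 3: "Comp F (Ro A' \<kappa>') (Ro A \<kappa>) (Ro A \<kappa>1) (Ra A \<kappa> \<kappa>1 ?k) (\<zeta> a) = \<zeta>1 a"
      by (simp add: u.S.functor_inv e1(4) flip: e(4))
    have aa: "ufst a = \<kappa>'" "usnd a = \<mu>'" by (simp_all add: a)
    show "\<exists>m\<in>Ar (pullback_span A B) (omap r a) (omap r1 a).
      Comp H (Lo (pullback_span A' B') a) (Lo (pullback_span A B) (omap r a)) (Lo (pullback_span A B) (omap r1 a))
        (La (pullback_span A B) (omap r a) (omap r1 a) m) (\<xi> a) = \<xi>1 a \<and>
      Comp F (Ro (pullback_span A' B') a) (Ro (pullback_span A B) (omap r a)) (Ro (pullback_span A B) (omap r1 a))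
        (Ra (pullback_span A B) (omap r a) (omap r1 a) m) (\<zeta> a) = \<zeta>1 a"
      unfolding ra r1a pullback_simps(5-8) aa ufst_upair usnd_upair
      using 2 3 by (intro bexI[OF _ 1]) (simp only: ufst_upair usnd_upair)
  qed
qed

text \<open>The pair (t \<kappa>', s \<mu>') lies in the iso-comma groupoid, but in general not in
  the strict pullback. The fibration property moves t \<kappa>' along \<omega> \<phi>^-1 to an
  object K with n K = p (s \<mu>'); the arrow \<open>e\<close> of this move is absorbed into the
  right leg.\<close>

lemma hcomp_rel_exists:
  assumes A: "faithful_span G F A'" "faithful_span G F A" and B: "faithful_span H G B'" "faithful_span H G B"
    and u: "is_triple G F A' A u" and v: "is_triple H G B' B v"
    and fib: "fibration (apex A) G (lleg A)"
  shows "\<exists>w. is_triple H F (pullback_span A' B') (pullback_span A B) w \<and> hcomp_rel H G F A' B' A B u v w"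
proof -
  note F = pullback_faithful[OF A(1) B(1)] pullback_faithful[OF A(2) B(2)]
  obtain \<phi> t \<theta> \<chi> s \<omega> where uv: "u = (\<phi>, t, \<theta>)" "v = (\<chi>, s, \<omega>)" by (cases u; cases v)
  interpret u: span_triple G F A' A \<phi> t \<theta> using u is_triple_iff[OF A] unfolding uv by blast
  interpret v: span_triple H G B' B \<chi> s \<omega> using v is_triple_iff[OF B] unfolding uv by blast
  interpret F1: faithful_span H F "pullback_span A' B'" by fact
  interpret F2: faithful_span H F "pullback_span A B" by fact
  \<comment> \<open>The arrow \<omega> \<phi>^-1 from n (t \<kappa>') to p (s \<mu>'), which is the
    third component of the object to be made strict.\<close>
  define h where "h a = Comp G (Lo A (omap t (ufst a))) (Lo A' (ufst a)) (Ro B (omap s (usnd a))) (\<omega> (usnd a))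
      (inv_arr G (Lo A' (ufst a)) (Lo A (omap t (ufst a))) (\<phi> (ufst a)))" for a
  have "\<exists>\<kappa> e. \<kappa> \<in> Ob A \<and> Lo A \<kappa> = Ro B (omap s (usnd a)) \<and> e \<in> Ar A (omap t (ufst a)) \<kappa> \<and>
      La A (omap t (ufst a)) \<kappa> e = h a" if ao: "a \<in> Ob (pullback_span A' B')" for a
  proof -
    obtain \<kappa>' \<mu>' where a: "a = upair \<kappa>' \<mu>'" and [simp]: "\<kappa>' \<in> Ob A'" "\<mu>' \<in> Ob B'" "Lo A' \<kappa>' = Ro B' \<mu>'"
      using ao by (rule pullback_ObE)
    have "h a \<in> Hom G (Lo A (omap t \<kappa>')) (Ro B (omap s \<mu>'))" unfolding a h_def by simp
    moreover have "omap t \<kappa>' \<in> Ob A" "Ro B (omap s \<mu>') \<in> Obj G" by simp_all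
    ultimately show ?thesis
      using fib unfolding fibration_def a ufst_upair usnd_upair by blast
  qed
  then obtain K e where K: "\<And>a. a \<in> Ob (pullback_span A' B') \<Longrightarrow> K a \<in> Ob A \<and> Lo A (K a) = Ro B (omap s (usnd a))"
    and e: "\<And>a. a \<in> Ob (pullback_span A' B') \<Longrightarrow> e a \<in> Ar A (omap t (ufst a)) (K a)"
    and eh: "\<And>a. a \<in> Ob (pullback_span A' B') \<Longrightarrow> La A (omap t (ufst a)) (K a) (e a) = h a"
    by metis
  have "\<exists>r. omap r = (\<lambda>a. upair (K a) (omap s (usnd a))) \<and> is_triple H F (pullback_span A' B') (pullback_span A B)
    (\<lambda>a. \<chi> (usnd a), r, \<lambda>a. Comp F (Ro A' (ufst a)) (Ro A (omap t (ufst a))) (Ro A (K a))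
        (Ra A (omap t (ufst a)) (K a) (e a)) (\<theta> (ufst a)))"
  proof (rule span_triple_exI[OF F])
    fix a b f assume ab: "a \<in> Ob (pullback_span A' B')" "b \<in> Ob (pullback_span A' B')" and f: "f \<in> Ar (pullback_span A' B') a b"
    obtain \<kappa>1 \<mu>1 where a: "a = upair \<kappa>1 \<mu>1" and [simp]: "\<kappa>1 \<in> Ob A'" "\<mu>1 \<in> Ob B'" "Lo A' \<kappa>1 = Ro B' \<mu>1"
      using ab(1) by (rule pullback_ObE)
    obtain \<kappa>2 \<mu>2 where b: "b = upair \<kappa>2 \<mu>2" and [simp]: "\<kappa>2 \<in> Ob A'" "\<mu>2 \<in> Ob B'" "Lo A' \<kappa>2 = Ro B' \<mu>2"
      using ab(2) by (rule pullback_ObE)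
    obtain k l where f: "f = upair k l" and [simp]: "k \<in> Ar A' \<kappa>1 \<kappa>2" "l \<in> Ar B' \<mu>1 \<mu>2"
      and kl: "La A' \<kappa>1 \<kappa>2 k = Ra B' \<mu>1 \<mu>2 l" using f a b by auto
    have [simp]: "K a \<in> Ob A" "Lo A (K a) = Ro B (omap s \<mu>1)" "e a \<in> Ar A (omap t \<kappa>1) (K a)"
      "K b \<in> Ob A" "Lo A (K b) = Ro B (omap s \<mu>2)" "e b \<in> Ar A (omap t \<kappa>2) (K b)"
      using K[OF ab(1)] e[OF ab(1)] K[OF ab(2)] e[OF ab(2)] unfolding a b by auto
    have La: "La A (omap t \<kappa>1) (K a) (e a) = Comp G (Lo A (omap t \<kappa>1)) (Ro B' \<mu>1) (Ro B (omap s \<mu>1)) (\<omega> \<mu>1)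
        (inv_arr G (Ro B' \<mu>1) (Lo A (omap t \<kappa>1)) (\<phi> \<kappa>1))"
      "La A (omap t \<kappa>2) (K b) (e b) = Comp G (Lo A (omap t \<kappa>2)) (Ro B' \<mu>2) (Ro B (omap s \<mu>2)) (\<omega> \<mu>2)
        (inv_arr G (Ro B' \<mu>2) (Lo A (omap t \<kappa>2)) (\<phi> \<kappa>2))"
      using eh[OF ab(1)] eh[OF ab(2)] unfolding a b h_def by simp_all
    have aa: "ufst a = \<kappa>1" "usnd a = \<mu>1" "ufst b = \<kappa>2" "usnd b = \<mu>2" by (simp_all add: a b)
    \<comment> \<open>The arrow t k conjugated by the chosen lifts. Its image in G is \<omega> (p'
      l) \<omega>^-1 = p (s l), so that it pairs with s l in the strict pullback.\<close>
    let ?g = "Cp A (K a) (omap t \<kappa>2) (K b) (e b) (Cp A (K a) (omap t \<kappa>1) (omap t \<kappa>2) (amap t \<kappa>1 \<kappa>2 k)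
       (inv_arr (apex A) (omap t \<kappa>1) (K a) (e a)))"
    let ?i = "inv_arr G (Ro B' \<mu>1) (Ro B (omap s \<mu>1)) (\<omega> \<mu>1)"
    have N: "Comp G (Ro B (omap s \<mu>1)) (Lo A (omap t \<kappa>1)) (Lo A (omap t \<kappa>2))
         (La A (omap t \<kappa>1) (omap t \<kappa>2) (amap t \<kappa>1 \<kappa>2 k)) (Comp G (Ro B (omap s \<mu>1)) (Ro B' \<mu>1) (Lo A (omap t \<kappa>1)) (\<phi> \<kappa>1) ?i)
      = Comp G (Ro B (omap s \<mu>1)) (Ro B' \<mu>2) (Lo A (omap t \<kappa>2)) (\<phi> \<kappa>2) (Comp G (Ro B (omap s \<mu>1)) (Ro B' \<mu>1) (Ro B' \<mu>2) (La A' \<kappa>1 \<kappa>2 k) ?i)"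
      using u.l.nat_extend[of \<kappa>1 \<kappa>2 k "Ro B (omap s \<mu>1)" ?i] by simp
    have "La A (K a) (K b) ?g = Comp G (Ro B (omap s \<mu>1)) (Ro B' \<mu>2) (Ro B (omap s \<mu>2)) (\<omega> \<mu>2)
        (Comp G (Ro B (omap s \<mu>1)) (Lo A (omap t \<kappa>2)) (Ro B' \<mu>2) (inv_arr G (Ro B' \<mu>2) (Lo A (omap t \<kappa>2)) (\<phi> \<kappa>2))
        (Comp G (Ro B (omap s \<mu>1)) (Lo A (omap t \<kappa>1)) (Lo A (omap t \<kappa>2))
         (La A (omap t \<kappa>1) (omap t \<kappa>2) (amap t \<kappa>1 \<kappa>2 k)) (Comp G (Ro B (omap s \<mu>1)) (Ro B' \<mu>1) (Lo A (omap t \<kappa>1)) (\<phi> \<kappa>1) ?i)))"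
      by (simp add: La u.S.functor_inv u.S'.H.inv_Comp)
    also have "\<dots> = Comp G (Ro B (omap s \<mu>1)) (Ro B' \<mu>2) (Ro B (omap s \<mu>2)) (\<omega> \<mu>2)
        (Comp G (Ro B (omap s \<mu>1)) (Ro B' \<mu>1) (Ro B' \<mu>2) (Ra B' \<mu>1 \<mu>2 l) ?i)"
      unfolding N by (simp add: kl del: v.r.nat_extend v.r.nat_extend_eq)
    also have "\<dots> = Ra B (omap s \<mu>1) (omap s \<mu>2) (amap s \<mu>1 \<mu>2 l)" by simp
    finally have g: "La A (K a) (K b) ?g = Ra B (omap s \<mu>1) (omap s \<mu>2) (amap s \<mu>1 \<mu>2 l)" .
    show "\<exists>g\<in>Ar (pullback_span A B) (upair (K a) (omap s (usnd a))) (upair (K b) (omap s (usnd b))).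
      Comp H (Lo (pullback_span A' B') a) (Lo (pullback_span A B) (upair (K a) (omap s (usnd a))))
        (Lo (pullback_span A B) (upair (K b) (omap s (usnd b))))
        (La (pullback_span A B) (upair (K a) (omap s (usnd a))) (upair (K b) (omap s (usnd b))) g) (\<chi> (usnd a))
      = Comp H (Lo (pullback_span A' B') a) (Lo (pullback_span A' B') b) (Lo (pullback_span A B) (upair (K b) (omap s (usnd b))))
         (\<chi> (usnd b)) (La (pullback_span A' B') a b f) \<and>
      Comp F (Ro (pullback_span A' B') a) (Ro (pullback_span A B) (upair (K a) (omap s (usnd a))))
        (Ro (pullback_span A B) (upair (K b) (omap s (usnd b))))
        (Ra (pullback_span A B) (upair (K a) (omap s (usnd a))) (upair (K b) (omap s (usnd b))) g)
        (Comp F (Ro A' (ufst a)) (Ro A (omap t (ufst a))) (Ro A (K a)) (Ra A (omap t (ufst a)) (K a) (e a)) (\<theta> (ufst a)))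
      = Comp F (Ro (pullback_span A' B') a) (Ro (pullback_span A' B') b) (Ro (pullback_span A B) (upair (K b) (omap s (usnd b))))
         (Comp F (Ro A' (ufst b)) (Ro A (omap t (ufst b))) (Ro A (K b)) (Ra A (omap t (ufst b)) (K b) (e b)) (\<theta> (ufst b)))
         (Ra (pullback_span A' B') a b f)"
    proof (rule bexI)
      show "upair ?g (amap s \<mu>1 \<mu>2 l) \<in> Ar (pullback_span A B) (upair (K a) (omap s (usnd a))) (upair (K b) (omap s (usnd b)))"
        unfolding pullback_simps aa ufst_upair usnd_upair
        by (rule exI[of _ ?g], rule exI[of _ "amap s \<mu>1 \<mu>2 l"], intro conjI g) simp_all
    qed (simp add: f aa u.S.functor_inv)
  next
    fix a assume a: "a \<in> Ob (pullback_span A' B')"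
    show "upair (K a) (omap s (usnd a)) \<in> Ob (pullback_span A B)"
      "Comp F (Ro A' (ufst a)) (Ro A (omap t (ufst a))) (Ro A (K a)) (Ra A (omap t (ufst a)) (K a) (e a)) (\<theta> (ufst a))
       \<in> Hom F (Ro (pullback_span A' B') a) (Ro (pullback_span A B) (upair (K a) (omap s (usnd a))))"
      "\<chi> (usnd a) \<in> Hom H (Lo (pullback_span A' B') a) (Lo (pullback_span A B) (upair (K a) (omap s (usnd a))))"
      using K[OF a] e[OF a] a by (auto elim!: pullback_ObE)
  qed
  then obtain r where r: "omap r = (\<lambda>a. upair (K a) (omap s (usnd a)))" and w: "is_triple H F (pullback_span A' B') (pullback_span A B)
    (\<lambda>a. \<chi> (usnd a), r, \<lambda>a. Comp F (Ro A' (ufst a)) (Ro A (omap t (ufst a))) (Ro A (K a))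
        (Ra A (omap t (ufst a)) (K a) (e a)) (\<theta> (ufst a)))" by blast
  have "hcomp_rel H G F A' B' A B u v (\<lambda>a. \<chi> (usnd a), r, \<lambda>a. Comp F (Ro A' (ufst a)) (Ro A (omap t (ufst a))) (Ro A (K a))
        (Ra A (omap t (ufst a)) (K a) (e a)) (\<theta> (ufst a)))"
    unfolding uv hcomp_rel.simps
  proof (intro allI impI, elim conjE)
    fix \<kappa>' \<mu>' assume [simp]: "\<kappa>' \<in> Ob A'" "\<mu>' \<in> Ob B'" "Lo A' \<kappa>' = Ro B' \<mu>'"
    let ?a = "upair \<kappa>' \<mu>'"
    have ao: "?a \<in> Ob (pullback_span A' B')" by simp
    have [simp]: "K ?a \<in> Ob A" "Lo A (K ?a) = Ro B (omap s \<mu>')" "e ?a \<in> Ar A (omap t \<kappa>') (K ?a)"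
      using K[OF ao] e[OF ao] by auto
    have La: "La A (omap t \<kappa>') (K ?a) (e ?a) = Comp G (Lo A (omap t \<kappa>')) (Ro B' \<mu>') (Ro B (omap s \<mu>')) (\<omega> \<mu>')
        (inv_arr G (Ro B' \<mu>') (Lo A (omap t \<kappa>')) (\<phi> \<kappa>'))"
      using eh[OF ao] unfolding h_def by simp
    show "\<exists>\<kappa> \<mu> k l j. omap r ?a = upair \<kappa> \<mu> \<and> \<kappa> \<in> Ob A \<and> \<mu> \<in> Ob B \<and> Lo A \<kappa> = Ro B \<mu> \<and>
        k \<in> Ar A \<kappa> (omap t \<kappa>') \<and> l \<in> Ar B \<mu> (omap s \<mu>') \<and> j \<in> Hom G (Ro B \<mu>) (Ro B' \<mu>') \<and>
        Comp G (Ro B \<mu>) (Ro B' \<mu>') (Lo A (omap t \<kappa>')) (\<phi> \<kappa>') j = La A \<kappa> (omap t \<kappa>') k \<and>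
        Comp G (Ro B \<mu>) (Ro B' \<mu>') (Ro B (omap s \<mu>')) (\<omega> \<mu>') j = Ra B \<mu> (omap s \<mu>') l \<and>
        Comp H (Lo B' \<mu>') (Lo B \<mu>) (Lo B (omap s \<mu>')) (La B \<mu> (omap s \<mu>') l) (\<chi> (usnd ?a)) = \<chi> \<mu>' \<and>
        Comp F (Ro A' \<kappa>') (Ro A \<kappa>) (Ro A (omap t \<kappa>')) (Ra A \<kappa> (omap t \<kappa>') k) (Comp F (Ro A' (ufst ?a)) (Ro A (omap t (ufst ?a))) (Ro A (K ?a))
        (Ra A (omap t (ufst ?a)) (K ?a) (e ?a)) (\<theta> (ufst ?a))) = \<theta> \<kappa>'"
      \<comment> \<open>Since \<open>e\<close> lies over \<omega> \<phi>^-1, the arrows k = e^-1 and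
        l = 1 share the factor j = \<omega>^-1.\<close>
      apply (rule exI[of _ "K ?a"], rule exI[of _ "omap s \<mu>'"])
      apply (rule exI[of _ "inv_arr (apex A) (omap t \<kappa>') (K ?a) (e ?a)"])
      apply (rule exI[of _ "Ide B (omap s \<mu>')"])
      apply (rule exI[of _ "inv_arr G (Ro B' \<mu>') (Ro B (omap s \<mu>')) (\<omega> \<mu>')"])
      by (simp add: r u.S.functor_inv La u.S'.H.inv_Comp)
  qed
  then show ?thesis using w by blast
qed

text \<open>The interchange law at the level of witnesses. If (k, l, j) belongs to the first square
  and (k1, l1, j1) to the second, then t1(k) k1, s1(l) l1 and j j1 belong to the composite, by
  naturality of \<phi>1 at k and of \<omega>1 at l.\<close>

lemma hcomp_rel_comp:
  assumes A: "faithful_span G F A1" "faithful_span G F A2" "faithful_span G F A3"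
    and B: "faithful_span H G B1" "faithful_span H G B2" "faithful_span H G B3"
    and u: "is_triple G F A1 A2 u" "is_triple G F A2 A3 u'" and v: "is_triple H G B1 B2 v" "is_triple H G B2 B3 v'"
    and w: "is_triple H F (pullback_span A1 B1) (pullback_span A2 B2) w"
      "is_triple H F (pullback_span A2 B2) (pullback_span A3 B3) w'"
    and rel: "hcomp_rel H G F A1 B1 A2 B2 u v w" "hcomp_rel H G F A2 B2 A3 B3 u' v' w'"
  shows "hcomp_rel H G F A1 B1 A3 B3 (triple_comp G F A1 A2 A3 u' u) (triple_comp H G B1 B2 B3 v' v)
    (triple_comp H F (pullback_span A1 B1) (pullback_span A2 B2) (pullback_span A3 B3) w' w)"
proof -
  note F = pullback_faithful[OF A(1) B(1)] pullback_faithful[OF A(2) B(2)] pullback_faithful[OF A(3) B(3)]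
  obtain \<phi> t \<theta> \<chi> s \<omega> \<xi> r \<zeta> where uvw: "u = (\<phi>, t, \<theta>)" "v = (\<chi>, s, \<omega>)" "w = (\<xi>, r, \<zeta>)" by (cases u; cases v; cases w)
  obtain \<phi>1 t1 \<theta>1 \<chi>1 s1 \<omega>1 \<xi>1 r1 \<zeta>1 where uvw': "u' = (\<phi>1, t1, \<theta>1)" "v' = (\<chi>1, s1, \<omega>1)" "w' = (\<xi>1, r1, \<zeta>1)"
    by (cases u'; cases v'; cases w')
  interpret u: span_triple G F A1 A2 \<phi> t \<theta> using u is_triple_iff[OF A(1,2)] unfolding uvw by blast
  interpret v: span_triple H G B1 B2 \<chi> s \<omega> using v is_triple_iff[OF B(1,2)] unfolding uvw by blast
  interpret w: span_triple H F "pullback_span A1 B1" "pullback_span A2 B2" \<xi> r \<zeta>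
    using w is_triple_iff[OF F(1,2)] unfolding uvw by blast
  interpret u1: span_triple G F A2 A3 \<phi>1 t1 \<theta>1 using u is_triple_iff[OF A(2,3)] unfolding uvw' by blast
  interpret v1: span_triple H G B2 B3 \<chi>1 s1 \<omega>1 using v is_triple_iff[OF B(2,3)] unfolding uvw' by blast
  interpret w1: span_triple H F "pullback_span A2 B2" "pullback_span A3 B3" \<xi>1 r1 \<zeta>1
    using w is_triple_iff[OF F(2,3)] unfolding uvw' by blast
  show ?thesis unfolding uvw uvw' triple_comp.simps hcomp_rel.simps
  proof (intro allI impI, elim conjE)
    fix \<kappa>' \<mu>' assume a [simp]: "\<kappa>' \<in> Ob A1" "\<mu>' \<in> Ob B1" "Lo A1 \<kappa>' = Ro B1 \<mu>'"
    let ?a = "upair \<kappa>' \<mu>'"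
    have ao: "?a \<in> Ob (pullback_span A1 B1)" by simp
    obtain \<kappa> \<mu> k l j where ra [simp]: "omap r ?a = upair \<kappa> \<mu>" and b [simp]: "\<kappa> \<in> Ob A2" "\<mu> \<in> Ob B2" "Lo A2 \<kappa> = Ro B2 \<mu>" and [simp]:
        "k \<in> Ar A2 \<kappa> (omap t \<kappa>')" "l \<in> Ar B2 \<mu> (omap s \<mu>')" "j \<in> Hom G (Ro B2 \<mu>) (Ro B1 \<mu>')"
        and e: "La A2 \<kappa> (omap t \<kappa>') k = Comp G (Ro B2 \<mu>) (Ro B1 \<mu>') (Lo A2 (omap t \<kappa>')) (\<phi> \<kappa>') j"
        "Ra B2 \<mu> (omap s \<mu>') l = Comp G (Ro B2 \<mu>) (Ro B1 \<mu>') (Ro B2 (omap s \<mu>')) (\<omega> \<mu>') j"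
        "\<chi> \<mu>' = Comp H (Lo B1 \<mu>') (Lo B2 \<mu>) (Lo B2 (omap s \<mu>')) (La B2 \<mu> (omap s \<mu>') l) (\<xi> ?a)"
        "\<theta> \<kappa>' = Comp F (Ro A1 \<kappa>') (Ro A2 \<kappa>) (Ro A2 (omap t \<kappa>')) (Ra A2 \<kappa> (omap t \<kappa>') k) (\<zeta> ?a)"
      using hcomp_relE[OF rel(1)[unfolded uvw] a] .
    let ?b = "upair \<kappa> \<mu>"
    have bo: "?b \<in> Ob (pullback_span A2 B2)" by simp
    obtain \<kappa>1 \<mu>1 k1 l1 j1 where [simp]: "omap r1 ?b = upair \<kappa>1 \<mu>1" "\<kappa>1 \<in> Ob A3" "\<mu>1 \<in> Ob B3" "Lo A3 \<kappa>1 = Ro B3 \<mu>1"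
        "k1 \<in> Ar A3 \<kappa>1 (omap t1 \<kappa>)" "l1 \<in> Ar B3 \<mu>1 (omap s1 \<mu>)" "j1 \<in> Hom G (Ro B3 \<mu>1) (Ro B2 \<mu>)"
        and e1: "La A3 \<kappa>1 (omap t1 \<kappa>) k1 = Comp G (Ro B3 \<mu>1) (Ro B2 \<mu>) (Lo A3 (omap t1 \<kappa>)) (\<phi>1 \<kappa>) j1"
        "Ra B3 \<mu>1 (omap s1 \<mu>) l1 = Comp G (Ro B3 \<mu>1) (Ro B2 \<mu>) (Ro B3 (omap s1 \<mu>)) (\<omega>1 \<mu>) j1"
        "\<chi>1 \<mu> = Comp H (Lo B2 \<mu>) (Lo B3 \<mu>1) (Lo B3 (omap s1 \<mu>)) (La B3 \<mu>1 (omap s1 \<mu>) l1) (\<xi>1 ?b)"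
        "\<theta>1 \<kappa> = Comp F (Ro A2 \<kappa>) (Ro A3 \<kappa>1) (Ro A3 (omap t1 \<kappa>)) (Ra A3 \<kappa>1 (omap t1 \<kappa>) k1) (\<zeta>1 ?b)"
      using hcomp_relE[OF rel(2)[unfolded uvw'] b] .
    have [simp]: "\<xi> ?a \<in> Hom H (Lo B1 \<mu>') (Lo B2 \<mu>)" "\<zeta> ?a \<in> Hom F (Ro A1 \<kappa>') (Ro A2 \<kappa>)"
      "\<xi>1 ?b \<in> Hom H (Lo B2 \<mu>) (Lo B3 \<mu>1)" "\<zeta>1 ?b \<in> Hom F (Ro A2 \<kappa>) (Ro A3 \<kappa>1)"
      using w.l.in_Hom[OF ao] w.r.in_Hom[OF ao] w1.l.in_Hom[OF bo] w1.r.in_Hom[OF bo] by auto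
    let ?k = "Cp A3 \<kappa>1 (omap t1 \<kappa>) (omap t1 (omap t \<kappa>')) (amap t1 \<kappa> (omap t \<kappa>') k) k1"
    let ?l = "Cp B3 \<mu>1 (omap s1 \<mu>) (omap s1 (omap s \<mu>')) (amap s1 \<mu> (omap s \<mu>') l) l1"
    let ?j = "Comp G (Ro B3 \<mu>1) (Ro B2 \<mu>) (Ro B1 \<mu>') j j1"
    have 1: "Comp G (Ro B3 \<mu>1) (Ro B1 \<mu>') (Lo A3 (omap t1 (omap t \<kappa>')))
        (Comp G (Lo A1 \<kappa>') (Lo A2 (omap t \<kappa>')) (Lo A3 (omap t1 (omap t \<kappa>'))) (\<phi>1 (omap t \<kappa>')) (\<phi> \<kappa>')) ?j
      = La A3 \<kappa>1 (omap t1 (omap t \<kappa>')) ?k"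
    proof -
      have "Comp G (Ro B3 \<mu>1) (Ro B1 \<mu>') (Lo A3 (omap t1 (omap t \<kappa>')))
          (Comp G (Lo A1 \<kappa>') (Lo A2 (omap t \<kappa>')) (Lo A3 (omap t1 (omap t \<kappa>'))) (\<phi>1 (omap t \<kappa>')) (\<phi> \<kappa>')) ?j
        = Comp G (Ro B3 \<mu>1) (Lo A2 (omap t \<kappa>')) (Lo A3 (omap t1 (omap t \<kappa>'))) (\<phi>1 (omap t \<kappa>'))
           (Comp G (Ro B3 \<mu>1) (Ro B2 \<mu>) (Lo A2 (omap t \<kappa>')) (Comp G (Ro B2 \<mu>) (Ro B1 \<mu>') (Lo A2 (omap t \<kappa>')) (\<phi> \<kappa>') j) j1)"
        by simp
      also have "\<dots> = La A3 \<kappa>1 (omap t1 (omap t \<kappa>')) ?k" unfolding e(1)[symmetric] by (simp add: e1)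
      finally show ?thesis .
    qed
    have 2: "Comp G (Ro B3 \<mu>1) (Ro B1 \<mu>') (Ro B3 (omap s1 (omap s \<mu>')))
        (Comp G (Ro B1 \<mu>') (Ro B2 (omap s \<mu>')) (Ro B3 (omap s1 (omap s \<mu>'))) (\<omega>1 (omap s \<mu>')) (\<omega> \<mu>')) ?j
      = Ra B3 \<mu>1 (omap s1 (omap s \<mu>')) ?l"
    proof -
      have "Comp G (Ro B3 \<mu>1) (Ro B1 \<mu>') (Ro B3 (omap s1 (omap s \<mu>')))
          (Comp G (Ro B1 \<mu>') (Ro B2 (omap s \<mu>')) (Ro B3 (omap s1 (omap s \<mu>'))) (\<omega>1 (omap s \<mu>')) (\<omega> \<mu>')) ?j
        = Comp G (Ro B3 \<mu>1) (Ro B2 (omap s \<mu>')) (Ro B3 (omap s1 (omap s \<mu>'))) (\<omega>1 (omap s \<mu>'))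
           (Comp G (Ro B3 \<mu>1) (Ro B2 \<mu>) (Ro B2 (omap s \<mu>')) (Comp G (Ro B2 \<mu>) (Ro B1 \<mu>') (Ro B2 (omap s \<mu>')) (\<omega> \<mu>') j) j1)"
        by simp
      also have "\<dots> = Ra B3 \<mu>1 (omap s1 (omap s \<mu>')) ?l" unfolding e(2)[symmetric] by (simp add: e1)
      finally show ?thesis .
    qed
    show "\<exists>\<kappa> \<mu> k l j. omap (comp_fctr r1 r) ?a = upair \<kappa> \<mu> \<and> \<kappa> \<in> Ob A3 \<and> \<mu> \<in> Ob B3 \<and> Lo A3 \<kappa> = Ro B3 \<mu> \<and>
        k \<in> Ar A3 \<kappa> (omap (comp_fctr t1 t) \<kappa>') \<and> l \<in> Ar B3 \<mu> (omap (comp_fctr s1 s) \<mu>') \<and> j \<in> Hom G (Ro B3 \<mu>) (Ro B1 \<mu>') \<and>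
        Comp G (Ro B3 \<mu>) (Ro B1 \<mu>') (Lo A3 (omap (comp_fctr t1 t) \<kappa>'))
          (Comp G (Lo A1 \<kappa>') (Lo A2 (omap t \<kappa>')) (Lo A3 (omap t1 (omap t \<kappa>'))) (\<phi>1 (omap t \<kappa>')) (\<phi> \<kappa>')) j
          = La A3 \<kappa> (omap (comp_fctr t1 t) \<kappa>') k \<and>
        Comp G (Ro B3 \<mu>) (Ro B1 \<mu>') (Ro B3 (omap (comp_fctr s1 s) \<mu>'))
          (Comp G (Ro B1 \<mu>') (Ro B2 (omap s \<mu>')) (Ro B3 (omap s1 (omap s \<mu>'))) (\<omega>1 (omap s \<mu>')) (\<omega> \<mu>')) j
          = Ra B3 \<mu> (omap (comp_fctr s1 s) \<mu>') l \<and>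
        Comp H (Lo B1 \<mu>') (Lo B3 \<mu>) (Lo B3 (omap (comp_fctr s1 s) \<mu>')) (La B3 \<mu> (omap (comp_fctr s1 s) \<mu>') l)
         (Comp H (Lo (pullback_span A1 B1) ?a) (Lo (pullback_span A2 B2) (omap r ?a)) (Lo (pullback_span A3 B3) (omap r1 (omap r ?a)))
           (\<xi>1 (omap r ?a)) (\<xi> ?a))
         = Comp H (Lo B1 \<mu>') (Lo B2 (omap s \<mu>')) (Lo B3 (omap s1 (omap s \<mu>'))) (\<chi>1 (omap s \<mu>')) (\<chi> \<mu>') \<and>
        Comp F (Ro A1 \<kappa>') (Ro A3 \<kappa>) (Ro A3 (omap (comp_fctr t1 t) \<kappa>')) (Ra A3 \<kappa> (omap (comp_fctr t1 t) \<kappa>') k)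
         (Comp F (Ro (pullback_span A1 B1) ?a) (Ro (pullback_span A2 B2) (omap r ?a)) (Ro (pullback_span A3 B3) (omap r1 (omap r ?a)))
           (\<zeta>1 (omap r ?a)) (\<zeta> ?a))
         = Comp F (Ro A1 \<kappa>') (Ro A2 (omap t \<kappa>')) (Ro A3 (omap t1 (omap t \<kappa>'))) (\<theta>1 (omap t \<kappa>')) (\<theta> \<kappa>')"
      apply (rule exI[of _ \<kappa>1], rule exI[of _ \<mu>1], rule exI[of _ ?k], rule exI[of _ ?l], rule exI[of _ ?j])
      apply (intro conjI)
      using 1 2 by (simp_all add: e(3,4) e1(3,4) del: u1.S.q.amap_Comp v1.S.p.amap_Comp)
  qed
qed

section \<open>Horizontal composition of strict maps\<close>

definition pullback_map :: "('u::universe, 'u, 'u, 'u) fctr \<Rightarrow> ('u, 'u, 'u, 'u) fctr \<Rightarrow> ('u, 'u, 'u, 'u) fctr" where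
  "pullback_map t s = \<lparr>omap = (\<lambda>a. upair (omap t (ufst a)) (omap s (usnd a))),
     amap = (\<lambda>a b f. upair (amap t (ufst a) (ufst b) (ufst f)) (amap s (usnd a) (usnd b) (usnd f)))\<rparr>"

lemma pullback_map_simps [simp]:
  "omap (pullback_map t s) a = upair (omap t (ufst a)) (omap s (usnd a))"
  "amap (pullback_map t s) a b f = upair (amap t (ufst a) (ufst b) (ufst f)) (amap s (usnd a) (usnd b) (usnd f))"
  by (simp_all add: pullback_map_def)

lemma strict_map_pullback:
  assumes t: "strict_map A' A t" and s: "strict_map B' B s"
  shows "strict_map (pullback_span A' B') (pullback_span A B) (pullback_map t s)"
proof -
  interpret t: is_functor "apex A'" "apex A" t using t by (simp add: strict_map_def)
  interpret s: is_functor "apex B'" "apex B" s using s by (simp add: strict_map_def)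
  have "is_functor (apex (pullback_span A' B')) (apex (pullback_span A B)) (pullback_map t s)"
    using t s unfolding strict_map_def by unfold_locales (auto elim!: pullback_ObE)
  then show ?thesis using t s by (auto simp: strict_map_def elim!: pullback_ObE)
qed

text \<open>Strict maps preserve the equation defining the pullback, so the identities serve as k, l
  and j.\<close>

lemma hcomp_rel_strict:
  assumes A: "faithful_span G F A'" "faithful_span G F A" and B: "faithful_span H G B'" "faithful_span H G B"
    and t: "strict_map A' A t" and s: "strict_map B' B s"
  shows "hcomp_rel H G F A' B' A B (strict_triple G F A' t) (strict_triple H G B' s)
    (strict_triple H F (pullback_span A' B') (pullback_map t s))"
proof -
  interpret A: faithful_span G F A by fact
  interpret A': faithful_span G F A' by fact
  interpret B: faithful_span H G B by fact
  interpret B': faithful_span H G B' by fact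
  interpret t: is_functor "apex A'" "apex A" t using t by (simp add: strict_map_def)
  interpret s: is_functor "apex B'" "apex B" s using s by (simp add: strict_map_def)
  show ?thesis unfolding strict_triple_def hcomp_rel.simps
  proof (intro allI impI, elim conjE)
    fix \<kappa>' \<mu>' assume a [simp]: "\<kappa>' \<in> Ob A'" "\<mu>' \<in> Ob B'" "Lo A' \<kappa>' = Ro B' \<mu>'"
    note [simp] = strict_mapD(2,3)[OF t a(1)] strict_mapD(2,3)[OF s a(2)]
    show "\<exists>\<kappa> \<mu> k l j. omap (pullback_map t s) (upair \<kappa>' \<mu>') = upair \<kappa> \<mu> \<and> \<kappa> \<in> Ob A \<and> \<mu> \<in> Ob B \<and> Lo A \<kappa> = Ro B \<mu> \<and>
        k \<in> Ar A \<kappa> (omap t \<kappa>') \<and> l \<in> Ar B \<mu> (omap s \<mu>') \<and> j \<in> Hom G (Ro B \<mu>) (Ro B' \<mu>') \<and>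
        Comp G (Ro B \<mu>) (Ro B' \<mu>') (Lo A (omap t \<kappa>')) (Ident G (Lo A' \<kappa>')) j = La A \<kappa> (omap t \<kappa>') k \<and>
        Comp G (Ro B \<mu>) (Ro B' \<mu>') (Ro B (omap s \<mu>')) (Ident G (Ro B' \<mu>')) j = Ra B \<mu> (omap s \<mu>') l \<and>
        Comp H (Lo B' \<mu>') (Lo B \<mu>) (Lo B (omap s \<mu>')) (La B \<mu> (omap s \<mu>') l) (Ident H (Lo (pullback_span A' B') (upair \<kappa>' \<mu>')))
         = Ident H (Lo B' \<mu>') \<and>
        Comp F (Ro A' \<kappa>') (Ro A \<kappa>) (Ro A (omap t \<kappa>')) (Ra A \<kappa> (omap t \<kappa>') k) (Ident F (Ro (pullback_span A' B') (upair \<kappa>' \<mu>')))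
         = Ident F (Ro A' \<kappa>')"
      apply (rule exI[of _ "omap t \<kappa>'"], rule exI[of _ "omap s \<mu>'"], rule exI[of _ "Ide A (omap t \<kappa>')"],
          rule exI[of _ "Ide B (omap s \<mu>')"], rule exI[of _ "Ident G (Ro B' \<mu>')"])
      using B'.p.omap_in_Obj[OF a(2)] B'.q.omap_in_Obj[OF a(2)] A'.p.omap_in_Obj[OF a(1)]
      by simp
  qed
qed

text \<open>One related representative \<open>w\<close> determines the horizontal composite:
  congruence puts every triple equivalent to \<open>w\<close> into the defining set, and uniqueness
  shows that the set contains nothing else.\<close>

lemma corr_hcomp_class:
  assumes A: "faithful_span G F A'" "faithful_span G F A" and B: "faithful_span H G B'" "faithful_span H G B"
    and u: "is_triple G F A' A u" and v: "is_triple H G B' B v"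
    and w: "is_triple H F (pullback_span A' B') (pullback_span A B) w" "hcomp_rel H G F A' B' A B u v w"
  shows "corr_hcomp H G F A' B' A B (triple_class G F A' A u) (triple_class H G B' B v)
    = triple_class H F (pullback_span A' B') (pullback_span A B) w"
proof -
  note F = pullback_faithful[OF A(1) B(1)] pullback_faithful[OF A(2) B(2)]
  have uv: "u \<in> triple_class G F A' A u" "v \<in> triple_class H G B' B v"
    using pointwise_equiv_refl[OF u A] pointwise_equiv_refl[OF v B] u v
    by (simp_all add: mem_triple_class[OF A u] mem_triple_class[OF B v])
  have "w' \<in> corr_hcomp H G F A' B' A B (triple_class G F A' A u) (triple_class H G B' B v)
    \<longleftrightarrow> is_triple H F (pullback_span A' B') (pullback_span A B) w' \<and>
        pointwise_equiv H F (pullback_span A' B') (pullback_span A B) w' w" for w'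
  proof (cases "is_triple H F (pullback_span A' B') (pullback_span A B) w'")
    case w': True
    show ?thesis
    proof
      assume "w' \<in> corr_hcomp H G F A' B' A B (triple_class G F A' A u) (triple_class H G B' B v)"
      then obtain u' v' where u': "u' \<in> triple_class G F A' A u" and v': "v' \<in> triple_class H G B' B v"
        and t: "triple_equiv H F (pullback_span A' B') (isocomma_span G A B)
          (triple_comp H F (pullback_span A' B') (pullback_span A B) (isocomma_span G A B)
             (pullback_incl H G F A B) w')
          (triple_comp H F (pullback_span A' B') (isocomma_span G A' B') (isocomma_span G A B)
             (isocomma_triple G A' A B' B u' v') (pullback_incl H G F A' B'))"
        unfolding corr_hcomp_def by blast
      have u'': "is_triple G F A' A u'" "pointwise_equiv G F A' A u' u" using u' mem_triple_class[OF A u] by auto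
      have v'': "is_triple H G B' B v'" "pointwise_equiv H G B' B v' v" using v' mem_triple_class[OF B v] by auto
      have "hcomp_rel H G F A' B' A B u' v' w'"
        using t unfolding triple_equiv_iff_hcomp_rel[OF A B u''(1) v''(1) w'] .
      then have "hcomp_rel H G F A' B' A B u v w'"
        using hcomp_rel_cong[OF A B u''(1) u u''(2) v''(1) v v''(2) w' w' pointwise_equiv_refl[OF w' F]] by blast
      then show "is_triple H F (pullback_span A' B') (pullback_span A B) w' \<and>
        pointwise_equiv H F (pullback_span A' B') (pullback_span A B) w' w"
        using w' hcomp_rel_unique[OF A B u v w' w(1) _ w(2)] by blast
    next
      assume "is_triple H F (pullback_span A' B') (pullback_span A B) w' \<and>
        pointwise_equiv H F (pullback_span A' B') (pullback_span A B) w' w"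
      then have "hcomp_rel H G F A' B' A B u v w'"
        using hcomp_rel_cong[OF A B u u pointwise_equiv_refl[OF u A] v v pointwise_equiv_refl[OF v B] w(1) w' _ w(2)]
        by blast
      then show "w' \<in> corr_hcomp H G F A' B' A B (triple_class G F A' A u) (triple_class H G B' B v)"
        unfolding corr_hcomp_def using triple_equiv_iff_hcomp_rel[OF A B u v w'] w' uv by blast
    qed
  qed (simp add: corr_hcomp_def)
  then show ?thesis by (auto simp: mem_triple_class[OF F w(1)])
qed

text \<open>Together with \<open>strict_class_comp\<close> this makes strict classes closed under
  both compositions, so a coherence diagram of strict classes collapses to a comparison of two
  strict maps.\<close>

lemma corr_hcomp_strict:
  assumes A: "faithful_span G F A'" "faithful_span G F A" and B: "faithful_span H G B'" "faithful_span H G B"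
    and t: "strict_map A' A t" and s: "strict_map B' B s"
  shows "corr_hcomp H G F A' B' A B (strict_class G F A' A t) (strict_class H G B' B s)
    = strict_class H F (pullback_span A' B') (pullback_span A B) (pullback_map t s)"
  unfolding strict_class_def
  by (intro corr_hcomp_class[OF A B] is_triple_strict strict_map_pullback hcomp_rel_strict
      pullback_faithful[OF A(1) B(1)] pullback_faithful[OF A(2) B(2)] A B t s)

section \<open>Finiteness and the pullback of correspondences\<close>

lemma equiv_eqv: "equiv UNIV (eqv r)"
  unfolding eqv_def
  by (intro equivI refl_rtrancl trans_rtrancl sym_rtrancl) (auto intro: symI)

text \<open>Finiteness of components and of colimits is handled through finite sets of
  representatives, which can be combined across pullbacks and tensor products.\<close>

lemma finite_quotient_eqv_iff:
  "finite (A // eqv r) \<longleftrightarrow> (\<exists>R. finite R \<and> R \<subseteq> A \<and> (\<forall>a\<in>A. \<exists>b\<in>R. (a, b) \<in> eqv r))"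
proof
  assume fin: "finite (A // eqv r)"
  have "\<forall>c\<in>A // eqv r. \<exists>b\<in>A. c = eqv r `` {b}" by (auto elim: quotientE)
  then obtain f where f: "\<And>c. c \<in> A // eqv r \<Longrightarrow> f c \<in> A \<and> c = eqv r `` {f c}" by metis
  have "\<exists>b\<in>f ` (A // eqv r). (a, b) \<in> eqv r" if "a \<in> A" for a
    using f[OF quotientI[OF that, of "eqv r"]] quotientI[OF that, of "eqv r"]
      eq_equiv_class_iff[OF equiv_eqv, of a _ r] by auto
  then show "\<exists>R. finite R \<and> R \<subseteq> A \<and> (\<forall>a\<in>A. \<exists>b\<in>R. (a, b) \<in> eqv r)"
    using fin f by (intro exI[of _ "f ` (A // eqv r)"]) auto
next
  assume "\<exists>R. finite R \<and> R \<subseteq> A \<and> (\<forall>a\<in>A. \<exists>b\<in>R. (a, b) \<in> eqv r)"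
  then obtain R where R: "finite R" "\<forall>a\<in>A. \<exists>b\<in>R. (a, b) \<in> eqv r" by blast
  have "A // eqv r \<subseteq> (\<lambda>b. eqv r `` {b}) ` R"
  proof
    fix c assume "c \<in> A // eqv r"
    then obtain a where "a \<in> A" "c = eqv r `` {a}" by (rule quotientE)
    then show "c \<in> (\<lambda>b. eqv r `` {b}) ` R"
      using R(2) eq_equiv_class_iff[OF equiv_eqv, of a _ r] by blast
  qed
  then show "finite (A // eqv r)" using R(1) finite_surj by blast
qed

text \<open>An upper bound for a generated equivalence. In a groupoid the generating relations for
  fibers, tensor products and colimits are contained in explicit equivalence relations
  \<open>E\<close> given by a single arrow, and this lemma identifies the generated relation with
  \<open>E\<close> on the carrier.\<close>

lemma eqv_mono_equivp:
  assumes "(a, b) \<in> eqv r" "a \<in> A" and r: "\<And>x y. (x, y) \<in> r \<Longrightarrow> x \<in> A \<and> y \<in> A \<and> E x y"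
    and E: "\<And>x. x \<in> A \<Longrightarrow> E x x" "\<And>x y. x \<in> A \<Longrightarrow> y \<in> A \<Longrightarrow> E x y \<Longrightarrow> E y x"
      "\<And>x y z. x \<in> A \<Longrightarrow> y \<in> A \<Longrightarrow> z \<in> A \<Longrightarrow> E x y \<Longrightarrow> E y z \<Longrightarrow> E x z"
  shows "b \<in> A \<and> E a b"
  using assms(1) unfolding eqv_def
proof (induction rule: rtrancl_induct)
  case base then show ?case using assms(2) E(1) by blast
next
  case (step y z) then show ?case using r E assms(2) by blast
qed

lemma in_eqv: "(a, b) \<in> r \<Longrightarrow> (a, b) \<in> eqv r"
  by (auto simp: eqv_def)

lemma finite_components_fiber_iff:
  assumes L: "groupoid L" and H: "groupoid H" and q: "is_functor L H q" and \<eta>: "\<eta> \<in> Obj H"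
  shows "finite (components (fiber L H q \<eta>)) \<longleftrightarrow>
    (\<exists>R. finite R \<and> R \<subseteq> {a \<in> Obj L. omap q a = \<eta>} \<and>
      (\<forall>a\<in>Obj L. omap q a = \<eta> \<longrightarrow> (\<exists>b\<in>R. \<exists>l\<in>Hom L a b. amap q a b l = Ident H \<eta>)))"
proof -
  interpret L: groupoid L by fact
  interpret H: groupoid H by fact
  interpret q: is_functor L H q by fact
  let ?A = "{a \<in> Obj L. omap q a = \<eta>}" and ?E = "\<lambda>a b. \<exists>l\<in>Hom L a b. amap q a b l = Ident H \<eta>"
  have ob: "Obj (fiber L H q \<eta>) = ?A" and ho: "\<And>a b. Hom (fiber L H q \<eta>) a b \<noteq> {} \<longleftrightarrow> ?E a b"
    by (auto simp: fiber_def)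
  let ?r = "{(a, b). a \<in> ?A \<and> b \<in> ?A \<and> Hom (fiber L H q \<eta>) a b \<noteq> {}}"
  have E: "(a, b) \<in> eqv ?r \<longleftrightarrow> ?E a b" if "a \<in> ?A" "b \<in> ?A" for a b
  proof
    assume "(a, b) \<in> eqv ?r"
    then have "b \<in> ?A \<and> ?E a b"
    proof (rule eqv_mono_equivp[OF _ that(1)], goal_cases)
      case (1 x y) then show ?case using ho by auto
    next
      case (2 x) then show ?case by (auto intro!: bexI[of _ "Ident L x"])
    next
      case (3 x y)
      then obtain l where "l \<in> Hom L x y" "amap q x y l = Ident H \<eta>" by blast
      then show ?case using 3 \<eta> groupoid_functor_inv[OF L H q, of x y l]
        by (intro bexI[of _ "inv_arr L x y l"]) auto
    next
      case (4 x y z)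
      then obtain l m where "l \<in> Hom L x y" "amap q x y l = Ident H \<eta>" "m \<in> Hom L y z" "amap q y z m = Ident H \<eta>" by blast
      then show ?case using 4 \<eta> by (intro bexI[of _ "Comp L x y z m l"]) auto
    qed
    then show "?E a b" ..
  next
    assume "?E a b" then show "(a, b) \<in> eqv ?r" using that ho by (intro in_eqv) auto
  qed
  show ?thesis unfolding components_def ob finite_quotient_eqv_iff
    by (intro ex_cong1 conj_cong refl) (use E in blast)
qed

text \<open>To lift an arrow h of H, lift it through \<open>B\<close> to l and then lift the image
  of l in G through \<open>A\<close>. Representatives of the fiber over \<eta> are the pairs of a
  representative \<mu> for \<open>B\<close> over \<eta> and a representative for \<open>A\<close>
  over the image of \<mu> in G.\<close>

lemma correspondence_pullback:
  assumes G: "small_groupoid F" "small_groupoid G" "small_groupoid H"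
    and A: "correspondence G F A" and B: "correspondence H G B"
  shows "correspondence H F (pullback_span A B)"
proof -
  note fA = correspondence_faithful[OF G(2,1) A] and fB = correspondence_faithful[OF G(3,2) B]
  interpret A: faithful_span G F A by fact
  interpret B: faithful_span H G B by fact
  interpret P: faithful_span H F "pullback_span A B" using pullback_faithful[OF fA fB] .
  interpret A': small_groupoid "apex A" using A by (simp add: correspondence_def)
  interpret B': small_groupoid "apex B" using B by (simp add: correspondence_def)
  have cA: "fibration (apex A) G (lleg A)" "\<And>\<gamma>. \<gamma> \<in> Obj G \<Longrightarrow> finite (components (fiber (apex A) G (lleg A) \<gamma>))"
    using A by (auto simp: correspondence_def weak_finite_cover_def)
  have cB: "fibration (apex B) H (lleg B)" "\<And>\<eta>. \<eta> \<in> Obj H \<Longrightarrow> finite (components (fiber (apex B) H (lleg B) \<eta>))"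
    using B by (auto simp: correspondence_def weak_finite_cover_def)
  have lift: "\<exists>\<kappa>'\<in>Ob A. Lo A \<kappa>' = Ro B \<mu>' \<and> (\<exists>k\<in>Ar A \<kappa> \<kappa>'. La A \<kappa> \<kappa>' k = Ra B \<mu> \<mu>' l)"
    if "\<kappa> \<in> Ob A" "\<mu> \<in> Ob B" "\<mu>' \<in> Ob B" "Lo A \<kappa> = Ro B \<mu>" "l \<in> Ar B \<mu> \<mu>'" for \<kappa> \<mu> \<mu>' l
    using cA(1) that unfolding fibration_def by (metis B.p.amap_in_Hom B.p.omap_in_Obj)
  have "small_groupoid (apex (pullback_span A B))"
    unfolding pullback_span_def span.simps
  proof (rule small_groupoid_pair_cat)
    show "small {upair \<kappa> \<mu> |\<kappa> \<mu>. \<kappa> \<in> Ob A \<and> \<mu> \<in> Ob B \<and> Lo A \<kappa> = Ro B \<mu>}"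
      by (intro small_upair A'.small_Obj B'.small_Obj)
  qed (use P.A.groupoid_axioms A'.small_groupoid_axioms B'.small_groupoid_axioms in \<open>auto simp: pullback_span_def\<close>)
  moreover have "fibration (apex (pullback_span A B)) H (lleg (pullback_span A B))"
    unfolding fibration_def
  proof (intro ballI)
    fix a \<eta> h assume "a \<in> Ob (pullback_span A B)" and h: "\<eta> \<in> Obj H" "h \<in> Hom H (Lo (pullback_span A B) a) \<eta>"
    then obtain \<kappa> \<mu> where a: "a = upair \<kappa> \<mu>" "\<kappa> \<in> Ob A" "\<mu> \<in> Ob B" "Lo A \<kappa> = Ro B \<mu>" by (elim pullback_ObE)
    obtain \<mu>' l where l: "\<mu>' \<in> Ob B" "Lo B \<mu>' = \<eta>" "l \<in> Ar B \<mu> \<mu>'" "La B \<mu> \<mu>' l = h"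
      using cB(1)[unfolded fibration_def, rule_format, OF a(3) h(1), of h] h(2) a(1) by auto
    obtain \<kappa>' k where k: "\<kappa>' \<in> Ob A" "Lo A \<kappa>' = Ro B \<mu>'" "k \<in> Ar A \<kappa> \<kappa>'" "La A \<kappa> \<kappa>' k = Ra B \<mu> \<mu>' l"
      using lift[OF a(2,3) l(1) a(4) l(3)] by blast
    show "\<exists>b\<in>Ob (pullback_span A B). Lo (pullback_span A B) b = \<eta> \<and>
        (\<exists>f\<in>Ar (pullback_span A B) a b. La (pullback_span A B) a b f = h)"
      using a l k by (intro bexI[of _ "upair \<kappa>' \<mu>'"] conjI bexI[of _ "upair k l"]) auto
  qed
  moreover have "finite (components (fiber (apex (pullback_span A B)) H (lleg (pullback_span A B)) \<eta>))" if \<eta>: "\<eta> \<in> Obj H" for \<eta>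
  proof -
    obtain R where "finite R \<and> R \<subseteq> {a \<in> Ob B. Lo B a = \<eta>} \<and>
      (\<forall>a\<in>Ob B. Lo B a = \<eta> \<longrightarrow> (\<exists>b\<in>R. \<exists>l\<in>Ar B a b. La B a b l = Ident H \<eta>))"
      using cB(2)[OF \<eta>]
      unfolding finite_components_fiber_iff[OF B.A.groupoid_axioms B.H.groupoid_axioms B.q.is_functor_axioms \<eta>]
      by (rule exE)
    then have R: "finite R" "R \<subseteq> {a \<in> Ob B. Lo B a = \<eta>}"
      "\<And>a. a \<in> Ob B \<Longrightarrow> Lo B a = \<eta> \<Longrightarrow> \<exists>b\<in>R. \<exists>l\<in>Ar B a b. La B a b l = Ident H \<eta>"
      by simp_all
    have "\<exists>Q. finite Q \<and> Q \<subseteq> {a \<in> Ob A. Lo A a = \<gamma>} \<and>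
      (\<forall>a\<in>Ob A. Lo A a = \<gamma> \<longrightarrow> (\<exists>b\<in>Q. \<exists>l\<in>Ar A a b. La A a b l = Ident G \<gamma>))" if "\<gamma> \<in> Obj G" for \<gamma>
      using cA(2)[OF that]
      unfolding finite_components_fiber_iff[OF A.A.groupoid_axioms A.H.groupoid_axioms A.q.is_functor_axioms that] .
    from bchoice[OF ballI[OF this]]
    obtain Q where "\<forall>\<gamma>\<in>Obj G. finite (Q \<gamma>) \<and> Q \<gamma> \<subseteq> {a \<in> Ob A. Lo A a = \<gamma>} \<and>
      (\<forall>a\<in>Ob A. Lo A a = \<gamma> \<longrightarrow> (\<exists>b\<in>Q \<gamma>. \<exists>l\<in>Ar A a b. La A a b l = Ident G \<gamma>))" by (rule exE)
    then have Q: "\<And>\<gamma>. \<gamma> \<in> Obj G \<Longrightarrow> finite (Q \<gamma>) \<and> Q \<gamma> \<subseteq> {a \<in> Ob A. Lo A a = \<gamma>} \<and>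
      (\<forall>a\<in>Ob A. Lo A a = \<gamma> \<longrightarrow> (\<exists>b\<in>Q \<gamma>. \<exists>l\<in>Ar A a b. La A a b l = Ident G \<gamma>))" by (rule bspec)
    let ?R = "\<Union>\<mu>\<in>R. (\<lambda>\<kappa>. upair \<kappa> \<mu>) ` Q (Ro B \<mu>)"
    show ?thesis
      unfolding finite_components_fiber_iff[OF P.A.groupoid_axioms B.H.groupoid_axioms P.q.is_functor_axioms \<eta>]
    proof (intro exI[of _ ?R] conjI ballI impI)
      show "finite ?R" using R Q by (intro finite_UN_I finite_imageI) auto
      show "?R \<subseteq> {a \<in> Ob (pullback_span A B). Lo (pullback_span A B) a = \<eta>}"
      proof
        fix x assume "x \<in> ?R"
        then obtain \<mu> \<kappa> where x: "x = upair \<kappa> \<mu>" "\<mu> \<in> R" "\<kappa> \<in> Q (Ro B \<mu>)" by auto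
        then have "\<mu> \<in> Ob B" "Lo B \<mu> = \<eta>" using R(2) by auto
        then show "x \<in> {a \<in> Ob (pullback_span A B). Lo (pullback_span A B) a = \<eta>}"
          using Q[of "Ro B \<mu>"] x by auto
      qed
      fix a assume a: "a \<in> Ob (pullback_span A B)" "Lo (pullback_span A B) a = \<eta>"
      then obtain \<kappa> \<mu> where a': "a = upair \<kappa> \<mu>" "\<kappa> \<in> Ob A" "\<mu> \<in> Ob B" "Lo A \<kappa> = Ro B \<mu>" by (elim pullback_ObE)
      then have "Lo B \<mu> = \<eta>" using a by simp
      from R(3)[OF a'(3) this] obtain \<mu>' l
        where l: "\<mu>' \<in> R" "l \<in> Ar B \<mu> \<mu>'" "La B \<mu> \<mu>' l = Ident H \<eta>" by blast
      have \<mu>' [simp]: "\<mu>' \<in> Ob B" using l R by auto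
      obtain \<kappa>' k where k: "\<kappa>' \<in> Ob A" "Lo A \<kappa>' = Ro B \<mu>'" "k \<in> Ar A \<kappa> \<kappa>'" "La A \<kappa> \<kappa>' k = Ra B \<mu> \<mu>' l"
        using lift[OF a'(2,3) \<mu>' a'(4) l(2)] by blast
      obtain \<kappa>'' k' where k': "\<kappa>'' \<in> Q (Ro B \<mu>')" "k' \<in> Ar A \<kappa>' \<kappa>''" "La A \<kappa>' \<kappa>'' k' = Ident G (Ro B \<mu>')"
        using Q[of "Ro B \<mu>'"] k by auto
      have k'': "\<kappa>'' \<in> Ob A" "Lo A \<kappa>'' = Ro B \<mu>'" using Q[of "Ro B \<mu>'"] k' by auto
      show "\<exists>b\<in>?R. \<exists>f\<in>Ar (pullback_span A B) a b. La (pullback_span A B) a b f = Ident H \<eta>"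
      \<comment> \<open>Here l moves \<mu> to its representative, k lifts the image of l, and k'
        moves \<kappa>' to a representative inside the fiber. Since k' lies over an identity, k' k
        still has the same image in G as l.\<close>
      proof (rule bexI[of _ "upair \<kappa>'' \<mu>'"], rule bexI[of _ "upair (Cp A \<kappa> \<kappa>' \<kappa>'' k' k) l"])
        show "upair (Cp A \<kappa> \<kappa>' \<kappa>'' k' k) l \<in> Ar (pullback_span A B) a (upair \<kappa>'' \<mu>')"
          using a' k k' k'' l by (simp add: A.H.Comp_Ident_left)
      qed (use l k' a' in auto)
    qed
  qed
  moreover have "l = l'" if "l \<in> Hom (fiber (apex (pullback_span A B)) H (lleg (pullback_span A B)) \<eta>) a b"
    "l' \<in> Hom (fiber (apex (pullback_span A B)) H (lleg (pullback_span A B)) \<eta>) a b"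
    "a \<in> Obj (fiber (apex (pullback_span A B)) H (lleg (pullback_span A B)) \<eta>)"
    "b \<in> Obj (fiber (apex (pullback_span A B)) H (lleg (pullback_span A B)) \<eta>)" for l l' a b \<eta>
    using that P.faithful[of a b l l'] unfolding fiber_def by (simp del: pullback_simps)
  ultimately show ?thesis
    unfolding correspondence_def weak_finite_cover_def
    using P.p.is_functor_axioms P.q.is_functor_axioms by blast
qed

section \<open>Bi-sets\<close>

lemma op_cat_simps [simp]:
  "Obj (op_cat C) = Obj C" "Hom (op_cat C) a b = Hom C b a" "Ident (op_cat C) = Ident C"
  "Comp (op_cat C) a b c g f = Comp C c b a f g"
  by (simp_all add: op_cat_def)

lemma category_op_cat: assumes "category C" shows "category (op_cat C)"
proof -
  interpret category C by fact
  show ?thesis by unfold_locales auto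
qed

lemma set_cat_simps [simp]:
  "Obj set_cat = {A. small A}" "Hom set_cat A B = A \<rightarrow>\<^sub>E B" "Ident set_cat A = (\<lambda>x\<in>A. x)"
  "Comp set_cat A B C g f = compose A g f"
  by (simp_all add: set_cat_def)

lemma category_set_cat: "category set_cat"
  by unfold_locales (auto simp: compose_def fun_eq_iff restrict_def PiE_iff extensional_def Pi_iff)

lemma functor_cat_simps [simp]:
  "Obj (functor_cat A B) = {F. is_functor A B F}"
  "Hom (functor_cat A B) F G = {\<alpha> \<in> extensional (Obj A). nat_trans A B F G \<alpha>}"
  "Ident (functor_cat A B) F = (\<lambda>a\<in>Obj A. Ident B (omap F a))"
  "Comp (functor_cat A B) F G K \<beta> \<alpha> = (\<lambda>a\<in>Obj A. Comp B (omap F a) (omap G a) (omap K a) (\<beta> a) (\<alpha> a))"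
  by (simp_all add: functor_cat_def)

lemma category_functor_cat: assumes "category A" "category B" shows "category (functor_cat A B)"
proof -
  interpret A: category A by fact
  interpret B: category B by fact
  have F: "is_functor A B F \<Longrightarrow> a \<in> Obj A \<Longrightarrow> omap F a \<in> Obj B"
    "is_functor A B F \<Longrightarrow> a \<in> Obj A \<Longrightarrow> b \<in> Obj A \<Longrightarrow> f \<in> Hom A a b \<Longrightarrow> amap F a b f \<in> Hom B (omap F a) (omap F b)"
    for F a b f by (simp_all add: is_functor_def)
  have \<alpha>: "nat_trans A B F G \<alpha> \<Longrightarrow> a \<in> Obj A \<Longrightarrow> \<alpha> a \<in> Hom B (omap F a) (omap G a)" for F G \<alpha> a
    by (simp add: nat_trans_def)
  have e: "\<alpha> = \<beta>" if "\<alpha> \<in> extensional (Obj A)" "\<beta> \<in> extensional (Obj A)" "\<And>a. a \<in> Obj A \<Longrightarrow> \<alpha> a = \<beta> a" for \<alpha> \<beta> :: "'a \<Rightarrow> 'd"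
    using that by (rule extensionalityI)
  show ?thesis
  proof
    fix F assume "F \<in> Obj (functor_cat A B)"
    then show "Ident (functor_cat A B) F \<in> Hom (functor_cat A B) F F"
      by (auto simp: nat_trans_def F)
  next
    fix F G K \<alpha> \<beta> assume "F \<in> Obj (functor_cat A B)" "G \<in> Obj (functor_cat A B)" "K \<in> Obj (functor_cat A B)"
      and "\<alpha> \<in> Hom (functor_cat A B) F G" "\<beta> \<in> Hom (functor_cat A B) G K"
    then have *: "is_functor A B F" "is_functor A B G" "is_functor A B K" "nat_trans A B F G \<alpha>" "nat_trans A B G K \<beta>"
      by auto
    have "Comp B (omap F a) (omap F b) (omap K b) (Comp B (omap F b) (omap G b) (omap K b) (\<beta> b) (\<alpha> b)) (amap F a b f)
       = Comp B (omap F a) (omap K a) (omap K b) (amap K a b f) (Comp B (omap F a) (omap G a) (omap K a) (\<beta> a) (\<alpha> a))"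
      if ab: "a \<in> Obj A" "b \<in> Obj A" "f \<in> Hom A a b" for a b f
    proof -
      have "Comp B (omap F a) (omap F b) (omap K b) (Comp B (omap F b) (omap G b) (omap K b) (\<beta> b) (\<alpha> b)) (amap F a b f)
        = Comp B (omap F a) (omap G b) (omap K b) (\<beta> b) (Comp B (omap F a) (omap F b) (omap G b) (\<alpha> b) (amap F a b f))"
        using * ab by (simp add: F \<alpha>)
      also have "\<dots> = Comp B (omap F a) (omap G b) (omap K b) (\<beta> b) (Comp B (omap F a) (omap G a) (omap G b) (amap G a b f) (\<alpha> a))"
        using nat_trans.naturality[OF *(4) ab] by simp
      also have "\<dots> = Comp B (omap F a) (omap G a) (omap K b) (Comp B (omap G a) (omap G b) (omap K b) (\<beta> b) (amap G a b f)) (\<alpha> a)"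
        using * ab by (simp add: F \<alpha>)
      also have "\<dots> = Comp B (omap F a) (omap G a) (omap K b) (Comp B (omap G a) (omap K a) (omap K b) (amap K a b f) (\<beta> a)) (\<alpha> a)"
        using nat_trans.naturality[OF *(5) ab] by simp
      also have "\<dots> = Comp B (omap F a) (omap K a) (omap K b) (amap K a b f) (Comp B (omap F a) (omap G a) (omap K a) (\<beta> a) (\<alpha> a))"
        using * ab by (simp add: F \<alpha>)
      finally show ?thesis .
    qed
    then show "Comp (functor_cat A B) F G K \<beta> \<alpha> \<in> Hom (functor_cat A B) F K"
      using * by (auto simp: nat_trans_def[of A B F K] F \<alpha>)
  qed (auto intro!: e simp: F \<alpha>)
qed

text \<open>In \<open>ract G X \<gamma> \<eta> \<eta>' h x\<close> the arrow is \<open>h : \<eta>' \<rightarrow> \<eta>\<close>.\<close>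

abbreviation lact :: "'u::universe grpd \<Rightarrow> 'u biset \<Rightarrow> 'u \<Rightarrow> 'u \<Rightarrow> 'u \<Rightarrow> 'u \<Rightarrow> 'u \<Rightarrow> 'u" where
  "lact H X \<eta> \<gamma> \<gamma>' g x \<equiv> amap (upper_part H X \<eta>) \<gamma> \<gamma>' g x"

abbreviation ract :: "'u::universe grpd \<Rightarrow> 'u biset \<Rightarrow> 'u \<Rightarrow> 'u \<Rightarrow> 'u \<Rightarrow> 'u \<Rightarrow> 'u \<Rightarrow> 'u" where
  "ract G X \<gamma> \<eta> \<eta>' h x \<equiv> amap (lower_part G X \<gamma>) \<eta> \<eta>' h x"

lemma part_simps [simp]:
  "omap (upper_part H X \<eta>) \<gamma> = omap X (\<eta>, \<gamma>)" "omap (lower_part G X \<gamma>) \<eta> = omap X (\<eta>, \<gamma>)"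
  by (simp_all add: upper_part_def lower_part_def)

lemma lact_eq: "lact H X \<eta> \<gamma> \<gamma>' g x = amap X (\<eta>, \<gamma>) (\<eta>, \<gamma>') (Ident H \<eta>, g) x"
  and ract_eq: "ract G X \<gamma> \<eta> \<eta>' h x = amap X (\<eta>, \<gamma>) (\<eta>', \<gamma>) (h, Ident G \<gamma>) x"
  by (simp_all add: upper_part_def lower_part_def)

section \<open>One-sided actions of a bi-set\<close>

locale biset = H: groupoid H + G: groupoid G + X: is_functor "prod_cat (op_cat H) G" set_cat X
  for H G :: "'u::universe grpd" and X :: "'u biset"
begin

lemma small_El: "\<lbrakk>\<eta> \<in> Obj H; \<gamma> \<in> Obj G\<rbrakk> \<Longrightarrow> small (omap X (\<eta>, \<gamma>))"
  using X.omap_in_Obj[of "(\<eta>, \<gamma>)"] by simp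

lemma act_funcset: "\<lbrakk>\<eta> \<in> Obj H; \<eta>' \<in> Obj H; \<gamma> \<in> Obj G; \<gamma>' \<in> Obj G; h \<in> Hom H \<eta>' \<eta>; g \<in> Hom G \<gamma> \<gamma>'\<rbrakk>
    \<Longrightarrow> amap X (\<eta>, \<gamma>) (\<eta>', \<gamma>') (h, g) \<in> omap X (\<eta>, \<gamma>) \<rightarrow>\<^sub>E omap X (\<eta>', \<gamma>')"
  using X.amap_in_Hom[of "(\<eta>, \<gamma>)" "(\<eta>', \<gamma>')" "(h, g)"] by simp

lemma act_in: "\<lbrakk>\<eta> \<in> Obj H; \<eta>' \<in> Obj H; \<gamma> \<in> Obj G; \<gamma>' \<in> Obj G; h \<in> Hom H \<eta>' \<eta>; g \<in> Hom G \<gamma> \<gamma>';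
    x \<in> omap X (\<eta>, \<gamma>)\<rbrakk> \<Longrightarrow> amap X (\<eta>, \<gamma>) (\<eta>', \<gamma>') (h, g) x \<in> omap X (\<eta>', \<gamma>')"
  using act_funcset by blast

lemma act_Ident: "\<lbrakk>\<eta> \<in> Obj H; \<gamma> \<in> Obj G; x \<in> omap X (\<eta>, \<gamma>)\<rbrakk> \<Longrightarrow> amap X (\<eta>, \<gamma>) (\<eta>, \<gamma>) (Ident H \<eta>, Ident G \<gamma>) x = x"
  using X.amap_Ident[of "(\<eta>, \<gamma>)"] by simp

lemma act_Comp: "\<lbrakk>\<eta> \<in> Obj H; \<eta>' \<in> Obj H; \<eta>'' \<in> Obj H; \<gamma> \<in> Obj G; \<gamma>' \<in> Obj G; \<gamma>'' \<in> Obj G;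
    h \<in> Hom H \<eta>' \<eta>; h' \<in> Hom H \<eta>'' \<eta>'; g \<in> Hom G \<gamma> \<gamma>'; g' \<in> Hom G \<gamma>' \<gamma>''; x \<in> omap X (\<eta>, \<gamma>)\<rbrakk>
  \<Longrightarrow> amap X (\<eta>', \<gamma>') (\<eta>'', \<gamma>'') (h', g') (amap X (\<eta>, \<gamma>) (\<eta>', \<gamma>') (h, g) x)
    = amap X (\<eta>, \<gamma>) (\<eta>'', \<gamma>'') (Comp H \<eta>'' \<eta>' \<eta> h h', Comp G \<gamma> \<gamma>' \<gamma>'' g' g) x"
  using X.amap_Comp[of "(\<eta>, \<gamma>)" "(\<eta>', \<gamma>')" "(\<eta>'', \<gamma>'')" "(h, g)" "(h', g')"] by (simp add: compose_eq)

text \<open>The rules bring iterated actions to a normal form: the action of a composite is split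
  into two actions, and right actions are moved outside left actions.\<close>

lemma lact_in [simp]: "\<lbrakk>\<eta> \<in> Obj H; \<gamma> \<in> Obj G; \<gamma>' \<in> Obj G; g \<in> Hom G \<gamma> \<gamma>'; x \<in> omap X (\<eta>, \<gamma>)\<rbrakk>
    \<Longrightarrow> lact H X \<eta> \<gamma> \<gamma>' g x \<in> omap X (\<eta>, \<gamma>')"
  and ract_in [simp]: "\<lbrakk>\<eta> \<in> Obj H; \<eta>' \<in> Obj H; \<gamma> \<in> Obj G; h \<in> Hom H \<eta>' \<eta>; x \<in> omap X (\<eta>, \<gamma>)\<rbrakk>
    \<Longrightarrow> ract G X \<gamma> \<eta> \<eta>' h x \<in> omap X (\<eta>', \<gamma>)"
  and lact_Ident [simp]: "\<lbrakk>\<eta> \<in> Obj H; \<gamma> \<in> Obj G; x \<in> omap X (\<eta>, \<gamma>)\<rbrakk> \<Longrightarrow> lact H X \<eta> \<gamma> \<gamma> (Ident G \<gamma>) x = x"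
  and ract_Ident [simp]: "\<lbrakk>\<eta> \<in> Obj H; \<gamma> \<in> Obj G; x \<in> omap X (\<eta>, \<gamma>)\<rbrakk> \<Longrightarrow> ract G X \<gamma> \<eta> \<eta> (Ident H \<eta>) x = x"
  and lact_Comp [simp]: "\<lbrakk>\<eta> \<in> Obj H; \<gamma> \<in> Obj G; \<gamma>' \<in> Obj G; \<gamma>'' \<in> Obj G; g \<in> Hom G \<gamma> \<gamma>'; g' \<in> Hom G \<gamma>' \<gamma>'';
     x \<in> omap X (\<eta>, \<gamma>)\<rbrakk> \<Longrightarrow>
     lact H X \<eta> \<gamma> \<gamma>'' (Comp G \<gamma> \<gamma>' \<gamma>'' g' g) x = lact H X \<eta> \<gamma>' \<gamma>'' g' (lact H X \<eta> \<gamma> \<gamma>' g x)"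
  and ract_Comp [simp]: "\<lbrakk>\<gamma> \<in> Obj G; \<eta> \<in> Obj H; \<eta>' \<in> Obj H; \<eta>'' \<in> Obj H; h \<in> Hom H \<eta>' \<eta>; h' \<in> Hom H \<eta>'' \<eta>';
     x \<in> omap X (\<eta>, \<gamma>)\<rbrakk> \<Longrightarrow>
     ract G X \<gamma> \<eta> \<eta>'' (Comp H \<eta>'' \<eta>' \<eta> h h') x = ract G X \<gamma> \<eta>' \<eta>'' h' (ract G X \<gamma> \<eta> \<eta>' h x)"
  and lact_ract [simp]: "\<lbrakk>\<eta> \<in> Obj H; \<eta>' \<in> Obj H; \<gamma> \<in> Obj G; \<gamma>' \<in> Obj G; h \<in> Hom H \<eta>' \<eta>; g \<in> Hom G \<gamma> \<gamma>';
     x \<in> omap X (\<eta>, \<gamma>)\<rbrakk> \<Longrightarrow>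
     lact H X \<eta>' \<gamma> \<gamma>' g (ract G X \<gamma> \<eta> \<eta>' h x) = ract G X \<gamma>' \<eta> \<eta>' h (lact H X \<eta> \<gamma> \<gamma>' g x)"
  and act_eq: "\<lbrakk>\<eta> \<in> Obj H; \<eta>' \<in> Obj H; \<gamma> \<in> Obj G; \<gamma>' \<in> Obj G; h \<in> Hom H \<eta>' \<eta>; g \<in> Hom G \<gamma> \<gamma>';
     x \<in> omap X (\<eta>, \<gamma>)\<rbrakk> \<Longrightarrow>
     amap X (\<eta>, \<gamma>) (\<eta>', \<gamma>') (h, g) x = ract G X \<gamma>' \<eta> \<eta>' h (lact H X \<eta> \<gamma> \<gamma>' g x)"
  unfolding lact_eq ract_eq by (simp_all add: act_in act_Ident act_Comp)

lemma lact_inv [simp]: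
  assumes "\<eta> \<in> Obj H" "\<gamma> \<in> Obj G" "\<gamma>' \<in> Obj G" "g \<in> Hom G \<gamma> \<gamma>'"
  shows "x \<in> omap X (\<eta>, \<gamma>) \<Longrightarrow> lact H X \<eta> \<gamma>' \<gamma> (inv_arr G \<gamma> \<gamma>' g) (lact H X \<eta> \<gamma> \<gamma>' g x) = x"
    "y \<in> omap X (\<eta>, \<gamma>') \<Longrightarrow> lact H X \<eta> \<gamma> \<gamma>' g (lact H X \<eta> \<gamma>' \<gamma> (inv_arr G \<gamma> \<gamma>' g) y) = y"
  using assms by (simp_all del: lact_Comp flip: lact_Comp)

lemma ract_inv [simp]:
  assumes "\<gamma> \<in> Obj G" "\<eta> \<in> Obj H" "\<eta>' \<in> Obj H" "h \<in> Hom H \<eta>' \<eta>"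
  shows "x \<in> omap X (\<eta>, \<gamma>) \<Longrightarrow> ract G X \<gamma> \<eta>' \<eta> (inv_arr H \<eta>' \<eta> h) (ract G X \<gamma> \<eta> \<eta>' h x) = x"
    "y \<in> omap X (\<eta>', \<gamma>) \<Longrightarrow> ract G X \<gamma> \<eta> \<eta>' h (ract G X \<gamma> \<eta>' \<eta> (inv_arr H \<eta>' \<eta> h) y) = y"
  using assms by (simp_all del: ract_Comp flip: ract_Comp)

end

lemma bisetI:
  assumes "groupoid H" "groupoid G"
    and small: "\<And>\<eta> \<gamma>. \<lbrakk>\<eta> \<in> Obj H; \<gamma> \<in> Obj G\<rbrakk> \<Longrightarrow> small (omap X (\<eta>, \<gamma>))"
    and act: "\<And>\<eta> \<eta>' \<gamma> \<gamma>' h g. \<lbrakk>\<eta> \<in> Obj H; \<eta>' \<in> Obj H; \<gamma> \<in> Obj G; \<gamma>' \<in> Obj G; h \<in> Hom H \<eta>' \<eta>; g \<in> Hom G \<gamma> \<gamma>'\<rbrakk>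
      \<Longrightarrow> amap X (\<eta>, \<gamma>) (\<eta>', \<gamma>') (h, g) \<in> omap X (\<eta>, \<gamma>) \<rightarrow>\<^sub>E omap X (\<eta>', \<gamma>')"
    and id: "\<And>\<eta> \<gamma> x. \<lbrakk>\<eta> \<in> Obj H; \<gamma> \<in> Obj G; x \<in> omap X (\<eta>, \<gamma>)\<rbrakk> \<Longrightarrow> amap X (\<eta>, \<gamma>) (\<eta>, \<gamma>) (Ident H \<eta>, Ident G \<gamma>) x = x"
    and comp: "\<And>\<eta> \<eta>' \<eta>'' \<gamma> \<gamma>' \<gamma>'' h h' g g' x. \<lbrakk>\<eta> \<in> Obj H; \<eta>' \<in> Obj H; \<eta>'' \<in> Obj H; \<gamma> \<in> Obj G; \<gamma>' \<in> Obj G; \<gamma>'' \<in> Obj G;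
      h \<in> Hom H \<eta>' \<eta>; h' \<in> Hom H \<eta>'' \<eta>'; g \<in> Hom G \<gamma> \<gamma>'; g' \<in> Hom G \<gamma>' \<gamma>''; x \<in> omap X (\<eta>, \<gamma>)\<rbrakk>
      \<Longrightarrow> amap X (\<eta>, \<gamma>) (\<eta>'', \<gamma>'') (Comp H \<eta>'' \<eta>' \<eta> h h', Comp G \<gamma> \<gamma>' \<gamma>'' g' g) x
        = amap X (\<eta>', \<gamma>') (\<eta>'', \<gamma>'') (h', g') (amap X (\<eta>, \<gamma>) (\<eta>', \<gamma>') (h, g) x)"
  shows "biset H G X"
proof -
  interpret H: groupoid H by fact
  interpret G: groupoid G by fact
  show ?thesis
  proof
    fix p assume "p \<in> Obj (prod_cat (op_cat H) G)"
    then obtain \<eta> \<gamma> where p: "p = (\<eta>, \<gamma>)" "\<eta> \<in> Obj H" "\<gamma> \<in> Obj G" by auto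
    then show "omap X p \<in> Obj set_cat" using small by simp
    show "amap X p p (Ident (prod_cat (op_cat H) G) p) = Ident set_cat (omap X p)"
    \<comment> \<open>Arrows of \<open>set_cat\<close> are extensional functions, so the equality is
      also checked off the carrier, where both sides are undefined.\<close>
    proof (rule ext)
      fix x
      have a: "amap X (\<eta>, \<gamma>) (\<eta>, \<gamma>) (Ident H \<eta>, Ident G \<gamma>) \<in> omap X (\<eta>, \<gamma>) \<rightarrow>\<^sub>E omap X (\<eta>, \<gamma>)"
        using p by (intro act) auto
      show "amap X p p (Ident (prod_cat (op_cat H) G) p) x = Ident set_cat (omap X p) x"
        using id[OF p(2,3), of x] PiE_arb[OF a, of x] p(1) by (cases "x \<in> omap X (\<eta>, \<gamma>)") simp_all
    qed
  next
    fix p p' f assume "p \<in> Obj (prod_cat (op_cat H) G)" "p' \<in> Obj (prod_cat (op_cat H) G)"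
      "f \<in> Hom (prod_cat (op_cat H) G) p p'"
    then show "amap X p p' f \<in> Hom set_cat (omap X p) (omap X p')"
      using act by (cases p; cases p'; cases f) auto
  next
    fix p p' p'' f g assume *: "p \<in> Obj (prod_cat (op_cat H) G)" "p' \<in> Obj (prod_cat (op_cat H) G)"
      "p'' \<in> Obj (prod_cat (op_cat H) G)"
      "f \<in> Hom (prod_cat (op_cat H) G) p p'" "g \<in> Hom (prod_cat (op_cat H) G) p' p''"
    show "amap X p p'' (Comp (prod_cat (op_cat H) G) p p' p'' g f)
      = Comp set_cat (omap X p) (omap X p') (omap X p'') (amap X p' p'' g) (amap X p p' f)"
    proof (rule ext)
      fix x
      obtain \<eta> \<gamma> \<eta>' \<gamma>' \<eta>'' \<gamma>'' h g1 h' g2 where p: "p = (\<eta>, \<gamma>)" "p' = (\<eta>', \<gamma>')" "p'' = (\<eta>'', \<gamma>'')" "f = (h, g1)" "g = (h', g2)"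
        by (cases p; cases p'; cases p''; cases f; cases g)
      have a: "amap X (\<eta>, \<gamma>) (\<eta>'', \<gamma>'') (Comp H \<eta>'' \<eta>' \<eta> h h', Comp G \<gamma> \<gamma>' \<gamma>'' g2 g1) \<in> omap X (\<eta>, \<gamma>) \<rightarrow>\<^sub>E omap X (\<eta>'', \<gamma>'')"
        by (rule act) (use * p in auto)
      show "amap X p p'' (Comp (prod_cat (op_cat H) G) p p' p'' g f) x
        = Comp set_cat (omap X p) (omap X p') (omap X p'') (amap X p' p'' g) (amap X p p' f) x"
        using comp[of \<eta> \<eta>' \<eta>'' \<gamma> \<gamma>' \<gamma>'' h h' g1 g2 x] * p PiE_arb[OF a, of x]
        by (cases "x \<in> omap X (\<eta>, \<gamma>)") (simp_all add: compose_def)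
    qed
  qed
qed

section \<open>Morphisms of bi-sets as equivariant families of maps\<close>

lemma biset_cat_simps:
  "Obj (biset_cat H G) = {X. is_functor (prod_cat (op_cat H) G) set_cat X}"
  "Ident (biset_cat H G) X = (\<lambda>p\<in>Obj H \<times> Obj G. \<lambda>x\<in>omap X p. x)"
  "Comp (biset_cat H G) X Y Z g f = (\<lambda>p\<in>Obj H \<times> Obj G. compose (omap X p) (g p) (f p))"
  by (simp_all add: biset_cat_def)

lemma category_biset_cat: "groupoid H \<Longrightarrow> groupoid G \<Longrightarrow> category (biset_cat H G)"
  unfolding biset_cat_def
  by (intro category_functor_cat category_prod category_op_cat category_set_cat) (simp_all add: groupoid_def)

lemma in_Obj_biset_cat: "groupoid H \<Longrightarrow> groupoid G \<Longrightarrow> X \<in> Obj (biset_cat H G) \<longleftrightarrow> biset H G X"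
  by (simp add: biset_cat_simps biset_def)

lemma biset_homD:
  assumes "f \<in> Hom (biset_cat H G) X' X" "biset H G X'" "biset H G X"
    and "\<eta> \<in> Obj H" "\<gamma> \<in> Obj G" "x \<in> omap X' (\<eta>, \<gamma>)"
  shows "f (\<eta>, \<gamma>) x \<in> omap X (\<eta>, \<gamma>)"
    and "\<gamma>' \<in> Obj G \<Longrightarrow> g \<in> Hom G \<gamma> \<gamma>' \<Longrightarrow> f (\<eta>, \<gamma>') (lact H X' \<eta> \<gamma> \<gamma>' g x) = lact H X \<eta> \<gamma> \<gamma>' g (f (\<eta>, \<gamma>) x)"
    and "\<eta>' \<in> Obj H \<Longrightarrow> h \<in> Hom H \<eta>' \<eta> \<Longrightarrow> f (\<eta>', \<gamma>) (ract G X' \<gamma> \<eta> \<eta>' h x) = ract G X \<gamma> \<eta> \<eta>' h (f (\<eta>, \<gamma>) x)"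
proof -
  interpret X': biset H G X' by fact
  interpret X: biset H G X by fact
  interpret f: nat_trans "prod_cat (op_cat H) G" set_cat X' X f
    using assms(1) by (simp add: biset_cat_def)
  show "f (\<eta>, \<gamma>) x \<in> omap X (\<eta>, \<gamma>)"
    using f.component_in_Hom[of "(\<eta>, \<gamma>)"] assms by auto
  show "f (\<eta>, \<gamma>') (lact H X' \<eta> \<gamma> \<gamma>' g x) = lact H X \<eta> \<gamma> \<gamma>' g (f (\<eta>, \<gamma>) x)"
    if "\<gamma>' \<in> Obj G" "g \<in> Hom G \<gamma> \<gamma>'"
    using fun_cong[OF f.naturality[of "(\<eta>, \<gamma>)" "(\<eta>, \<gamma>')" "(Ident H \<eta>, g)"], of x] assms that
    by (simp add: compose_eq lact_eq)
  show "f (\<eta>', \<gamma>) (ract G X' \<gamma> \<eta> \<eta>' h x) = ract G X \<gamma> \<eta> \<eta>' h (f (\<eta>, \<gamma>) x)"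
    if "\<eta>' \<in> Obj H" "h \<in> Hom H \<eta>' \<eta>"
    using fun_cong[OF f.naturality[of "(\<eta>, \<gamma>)" "(\<eta>', \<gamma>)" "(h, Ident G \<gamma>)"], of x] assms that
    by (simp add: compose_eq ract_eq)
qed

lemma biset_homD_ext:
  assumes "f \<in> Hom (biset_cat H G) X' X"
  shows "f \<in> extensional (Obj H \<times> Obj G)"
    "\<eta> \<in> Obj H \<Longrightarrow> \<gamma> \<in> Obj G \<Longrightarrow> f (\<eta>, \<gamma>) \<in> omap X' (\<eta>, \<gamma>) \<rightarrow>\<^sub>E omap X (\<eta>, \<gamma>)"
proof -
  show "f \<in> extensional (Obj H \<times> Obj G)" using assms by (simp add: biset_cat_def)
  interpret f: nat_trans "prod_cat (op_cat H) G" set_cat X' X f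
    using assms(1) by (simp add: biset_cat_def)
  show "f (\<eta>, \<gamma>) \<in> omap X' (\<eta>, \<gamma>) \<rightarrow>\<^sub>E omap X (\<eta>, \<gamma>)" if "\<eta> \<in> Obj H" "\<gamma> \<in> Obj G"
    using f.component_in_Hom[of "(\<eta>, \<gamma>)"] that by simp
qed

text \<open>The pair (h, g) acts as g followed by h, so naturality on the product category reduces
  to equivariance on each side.\<close>

lemma biset_homI:
  assumes "biset H G X'" "biset H G X" and ext: "f \<in> extensional (Obj H \<times> Obj G)"
    and f: "\<And>\<eta> \<gamma>. \<lbrakk>\<eta> \<in> Obj H; \<gamma> \<in> Obj G\<rbrakk> \<Longrightarrow> f (\<eta>, \<gamma>) \<in> omap X' (\<eta>, \<gamma>) \<rightarrow>\<^sub>E omap X (\<eta>, \<gamma>)"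
    and l: "\<And>\<eta> \<gamma> \<gamma>' g x. \<lbrakk>\<eta> \<in> Obj H; \<gamma> \<in> Obj G; \<gamma>' \<in> Obj G; g \<in> Hom G \<gamma> \<gamma>'; x \<in> omap X' (\<eta>, \<gamma>)\<rbrakk>
      \<Longrightarrow> f (\<eta>, \<gamma>') (lact H X' \<eta> \<gamma> \<gamma>' g x) = lact H X \<eta> \<gamma> \<gamma>' g (f (\<eta>, \<gamma>) x)"
    and r: "\<And>\<eta> \<eta>' \<gamma> h x. \<lbrakk>\<eta> \<in> Obj H; \<eta>' \<in> Obj H; \<gamma> \<in> Obj G; h \<in> Hom H \<eta>' \<eta>; x \<in> omap X' (\<eta>, \<gamma>)\<rbrakk>
      \<Longrightarrow> f (\<eta>', \<gamma>) (ract G X' \<gamma> \<eta> \<eta>' h x) = ract G X \<gamma> \<eta> \<eta>' h (f (\<eta>, \<gamma>) x)"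
  shows "f \<in> Hom (biset_cat H G) X' X"
proof -
  interpret X': biset H G X' by fact
  interpret X: biset H G X by fact
  have "nat_trans (prod_cat (op_cat H) G) set_cat X' X f"
  proof
    fix p assume "p \<in> Obj (prod_cat (op_cat H) G)"
    then show "f p \<in> Hom set_cat (omap X' p) (omap X p)" using f by (cases p) auto
  next
    fix p p' u assume *: "p \<in> Obj (prod_cat (op_cat H) G)" "p' \<in> Obj (prod_cat (op_cat H) G)"
      "u \<in> Hom (prod_cat (op_cat H) G) p p'"
    obtain \<eta> \<gamma> \<eta>' \<gamma>' h g where p: "p = (\<eta>, \<gamma>)" "p' = (\<eta>', \<gamma>')" "u = (h, g)" by (cases p; cases p'; cases u)
    have "f (\<eta>', \<gamma>') (amap X' (\<eta>, \<gamma>) (\<eta>', \<gamma>') (h, g) x) = amap X (\<eta>, \<gamma>) (\<eta>', \<gamma>') (h, g) (f (\<eta>, \<gamma>) x)"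
      if "x \<in> omap X' (\<eta>, \<gamma>)" for x
      using * that p PiE_mem[OF f] by (simp add: X'.act_eq X.act_eq l r)
    then show "Comp set_cat (omap X' p) (omap X' p') (omap X p') (f p') (amap X' p p' u)
      = Comp set_cat (omap X' p) (omap X p) (omap X p') (amap X p p' u) (f p)"
      using * p by (auto simp: compose_def fun_eq_iff)
  qed
  then show ?thesis using ext by (simp add: biset_cat_def)
qed

lemma biset_hom_eqI:
  assumes "f \<in> Hom (biset_cat H G) X' X" "g \<in> Hom (biset_cat H G) X' X"
    and "\<And>\<eta> \<gamma> x. \<lbrakk>\<eta> \<in> Obj H; \<gamma> \<in> Obj G; x \<in> omap X' (\<eta>, \<gamma>)\<rbrakk> \<Longrightarrow> f (\<eta>, \<gamma>) x = g (\<eta>, \<gamma>) x"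
  shows "f = g"
proof (rule extensionalityI[OF biset_homD_ext(1)[OF assms(1)] biset_homD_ext(1)[OF assms(2)]])
  fix p assume "p \<in> Obj H \<times> Obj G"
  then obtain \<eta> \<gamma> where p: "p = (\<eta>, \<gamma>)" "\<eta> \<in> Obj H" "\<gamma> \<in> Obj G" by auto
  show "f p = g p"
    unfolding p by (rule PiE_ext[OF biset_homD_ext(2)[OF assms(1) p(2,3)] biset_homD_ext(2)[OF assms(2) p(2,3)]])
      (use assms(3) p in auto)
qed

lemma biset_comp_apply:
  "\<lbrakk>\<eta> \<in> Obj H; \<gamma> \<in> Obj G; x \<in> omap X (\<eta>, \<gamma>)\<rbrakk> \<Longrightarrow> Comp (biset_cat H G) X Y Z g f (\<eta>, \<gamma>) x = g (\<eta>, \<gamma>) (f (\<eta>, \<gamma>) x)"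
  "\<lbrakk>\<eta> \<in> Obj H; \<gamma> \<in> Obj G; x \<in> omap X (\<eta>, \<gamma>)\<rbrakk> \<Longrightarrow> Ident (biset_cat H G) X (\<eta>, \<gamma>) x = x"
  by (simp_all add: biset_cat_simps compose_eq)

text \<open>The pointwise inverses are equivariant: both sides of each equivariance law have the
  same image under the injective equivariant \<open>f\<close>.\<close>

lemma biset_isoI:
  assumes X': "biset H G X'" and X: "biset H G X" and f: "f \<in> Hom (biset_cat H G) X' X"
    and bij: "\<And>\<eta> \<gamma>. \<lbrakk>\<eta> \<in> Obj H; \<gamma> \<in> Obj G\<rbrakk> \<Longrightarrow> bij_betw (f (\<eta>, \<gamma>)) (omap X' (\<eta>, \<gamma>)) (omap X (\<eta>, \<gamma>))"
  shows "iso_arr (biset_cat H G) X' X f"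
proof -
  interpret X': biset H G X' by fact
  interpret X: biset H G X by fact
  interpret category "biset_cat H G" using category_biset_cat X'.H.groupoid_axioms X'.G.groupoid_axioms .
  have ob: "X' \<in> Obj (biset_cat H G)" "X \<in> Obj (biset_cat H G)"
    using X X' X'.H.groupoid_axioms X'.G.groupoid_axioms by (simp_all add: in_Obj_biset_cat)
  define i where "i = (\<lambda>p\<in>Obj H \<times> Obj G. \<lambda>x\<in>omap X p. inv_into (omap X' p) (f p) x)"
  have i: "i (\<eta>, \<gamma>) x \<in> omap X' (\<eta>, \<gamma>)" "f (\<eta>, \<gamma>) (i (\<eta>, \<gamma>) x) = x"
    if "\<eta> \<in> Obj H" "\<gamma> \<in> Obj G" "x \<in> omap X (\<eta>, \<gamma>)" for \<eta> \<gamma> x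
    using bij[OF that(1,2)] that by (auto simp: i_def bij_betw_def intro: inv_into_into f_inv_into_f)
  have inj: "x = y" if "\<eta> \<in> Obj H" "\<gamma> \<in> Obj G" "x \<in> omap X' (\<eta>, \<gamma>)" "y \<in> omap X' (\<eta>, \<gamma>)" "f (\<eta>, \<gamma>) x = f (\<eta>, \<gamma>) y" for \<eta> \<gamma> x y
    using bij[OF that(1,2)] that by (meson bij_betw_def inj_onD)
  have ih: "i \<in> Hom (biset_cat H G) X X'"
  proof (rule biset_homI[OF X X'])
    show "i \<in> extensional (Obj H \<times> Obj G)" by (simp add: i_def)
    show "i (\<eta>, \<gamma>) \<in> omap X (\<eta>, \<gamma>) \<rightarrow>\<^sub>E omap X' (\<eta>, \<gamma>)" if "\<eta> \<in> Obj H" "\<gamma> \<in> Obj G" for \<eta> \<gamma>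
      using i(1)[OF that] that by (auto simp: i_def)
  next
    fix \<eta> \<gamma> \<gamma>' g x assume *: "\<eta> \<in> Obj H" "\<gamma> \<in> Obj G" "\<gamma>' \<in> Obj G" "g \<in> Hom G \<gamma> \<gamma>'" "x \<in> omap X (\<eta>, \<gamma>)"
    show "i (\<eta>, \<gamma>') (lact H X \<eta> \<gamma> \<gamma>' g x) = lact H X' \<eta> \<gamma> \<gamma>' g (i (\<eta>, \<gamma>) x)"
      by (rule inj[of \<eta> \<gamma>']) (use * i in \<open>simp_all add: biset_homD[OF f X' X]\<close>)
  next
    fix \<eta> \<eta>' \<gamma> h x assume *: "\<eta> \<in> Obj H" "\<eta>' \<in> Obj H" "\<gamma> \<in> Obj G" "h \<in> Hom H \<eta>' \<eta>" "x \<in> omap X (\<eta>, \<gamma>)"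
    show "i (\<eta>', \<gamma>) (ract G X \<gamma> \<eta> \<eta>' h x) = ract G X' \<gamma> \<eta> \<eta>' h (i (\<eta>, \<gamma>) x)"
      by (rule inj[of \<eta>' \<gamma>]) (use * i in \<open>simp_all add: biset_homD[OF f X' X]\<close>)
  qed
  have "Comp (biset_cat H G) X' X X' i f = Ident (biset_cat H G) X'"
  proof (rule biset_hom_eqI[OF Comp_in_Hom[OF ob(1,2,1) f ih] Ident_in_Hom[OF ob(1)]])
    fix \<eta> \<gamma> x assume *: "\<eta> \<in> Obj H" "\<gamma> \<in> Obj G" "x \<in> omap X' (\<eta>, \<gamma>)"
    show "Comp (biset_cat H G) X' X X' i f (\<eta>, \<gamma>) x = Ident (biset_cat H G) X' (\<eta>, \<gamma>) x"
      unfolding biset_comp_apply[OF *] using * biset_homD(1)[OF f X' X *] by (intro inj[OF *(1,2) i(1) *(3) i(2)])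
  qed
  moreover have "Comp (biset_cat H G) X X' X f i = Ident (biset_cat H G) X"
    by (rule biset_hom_eqI[OF Comp_in_Hom[OF ob(2,1,2) ih f] Ident_in_Hom[OF ob(2)]])
      (simp add: biset_comp_apply i)
  ultimately show ?thesis using f ih by (auto simp: iso_arr_def)
qed

section \<open>Tensor products of bi-sets\<close>

locale biset_pair = X: biset H G X + Y: biset K H Y
  for K H G :: "'u::universe grpd" and X Y :: "'u biset"
begin

abbreviation cls :: "'u \<Rightarrow> 'u \<Rightarrow> 'u \<Rightarrow> 'u \<Rightarrow> 'u \<Rightarrow> 'u" where
  "cls \<kappa> \<gamma> \<eta> x y \<equiv> biset_tensor_class K H G X Y \<kappa> \<gamma> (utriple \<eta> x y)"

text \<open>The relation "one arrow h : \<eta> \<rightarrow> \<eta>' with x = x' h and y' = h y" is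
  reflexive, transitive and, as \<open>H\<close> is a groupoid, symmetric. It contains the
  generators of the tensor relation, so no zigzags remain.\<close>

lemma tensor_rel_iff:
  assumes ob: "\<kappa> \<in> Obj K" "\<gamma> \<in> Obj G" and t: "\<eta> \<in> Obj H" "x \<in> omap X (\<eta>, \<gamma>)" "y \<in> omap Y (\<kappa>, \<eta>)"
  shows "(utriple \<eta> x y, t') \<in> tensor_rel H (lower_part G X \<gamma>) (upper_part K Y \<kappa>) \<longleftrightarrow>
    (\<exists>\<eta>'\<in>Obj H. \<exists>x'\<in>omap X (\<eta>', \<gamma>). \<exists>y'\<in>omap Y (\<kappa>, \<eta>'). t' = utriple \<eta>' x' y' \<and>
      (\<exists>h\<in>Hom H \<eta> \<eta>'. x = ract G X \<gamma> \<eta>' \<eta> h x' \<and> y' = lact K Y \<kappa> \<eta> \<eta>' h y))" (is "?L \<longleftrightarrow> ?R")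
proof
  assume L: ?L
  let ?A = "{utriple \<eta> x y | \<eta> x y. \<eta> \<in> Obj H \<and> x \<in> omap X (\<eta>, \<gamma>) \<and> y \<in> omap Y (\<kappa>, \<eta>)}"
  let ?E = "\<lambda>t t'. \<exists>h\<in>Hom H (u1 t) (u1 t'). u2 t = ract G X \<gamma> (u1 t') (u1 t) h (u2 t') \<and>
     u3 t' = lact K Y \<kappa> (u1 t) (u1 t') h (u3 t)"
  from L have "t' \<in> ?A \<and> ?E (utriple \<eta> x y) t'"
    unfolding tensor_rel_def part_simps
  proof (rule eqv_mono_equivp, goal_cases)
    case 1 then show ?case using t by blast
  next
    case (2 s t)
    then obtain \<eta> \<eta>' h x y where *: "\<eta> \<in> Obj H" "\<eta>' \<in> Obj H" "h \<in> Hom H \<eta>' \<eta>" "x \<in> omap X (\<eta>, \<gamma>)" "y \<in> omap Y (\<kappa>, \<eta>')"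
      and st: "s = utriple \<eta>' (ract G X \<gamma> \<eta> \<eta>' h x) y" "t = utriple \<eta> x (lact K Y \<kappa> \<eta>' \<eta> h y)" by blast
    have "s \<in> ?A" "t \<in> ?A" unfolding st using * ob by (auto intro!: X.ract_in Y.lact_in)
    then show ?case using * st by auto
  next
    case (3 s) then show ?case using ob by (auto intro!: bexI[of _ "Ident H (u1 s)"])
  next
    case (4 s t)
    then obtain h where h: "h \<in> Hom H (u1 s) (u1 t)" "u2 s = ract G X \<gamma> (u1 t) (u1 s) h (u2 t)"
       "u3 t = lact K Y \<kappa> (u1 s) (u1 t) h (u3 s)" by blast
    have "u1 s \<in> Obj H" "u3 s \<in> omap Y (\<kappa>, u1 s)" "u1 t \<in> Obj H" "u2 t \<in> omap X (u1 t, \<gamma>)" using 4 by auto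
    then show ?case using h ob by (intro bexI[of _ "inv_arr H (u1 s) (u1 t) h"]) simp_all
  next
    case (5 s t r)
    then obtain h k where "h \<in> Hom H (u1 s) (u1 t)" "u2 s = ract G X \<gamma> (u1 t) (u1 s) h (u2 t)"
       "u3 t = lact K Y \<kappa> (u1 s) (u1 t) h (u3 s)" "k \<in> Hom H (u1 t) (u1 r)" "u2 t = ract G X \<gamma> (u1 r) (u1 t) k (u2 r)"
       "u3 r = lact K Y \<kappa> (u1 t) (u1 r) k (u3 t)" by blast
    then show ?case using 5 ob by (auto intro!: bexI[of _ "Comp H (u1 s) (u1 t) (u1 r) k h"])
  qed
  then show ?R by auto
next
  assume ?R
  then show ?L unfolding tensor_rel_def using ob t by (intro in_eqv) auto
qed

text \<open>Related elements have the same related elements, so the choice of a representative gives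
  the same result for both; conversely each element is related to its chosen representative.\<close>

lemma cls_eq_iff:
  assumes ob: "\<kappa> \<in> Obj K" "\<gamma> \<in> Obj G" and t: "\<eta> \<in> Obj H" "x \<in> omap X (\<eta>, \<gamma>)" "y \<in> omap Y (\<kappa>, \<eta>)"
     and t': "\<eta>' \<in> Obj H" "x' \<in> omap X (\<eta>', \<gamma>)" "y' \<in> omap Y (\<kappa>, \<eta>')"
  shows "cls \<kappa> \<gamma> \<eta> x y = cls \<kappa> \<gamma> \<eta>' x' y' \<longleftrightarrow>
    (\<exists>h\<in>Hom H \<eta> \<eta>'. x = ract G X \<gamma> \<eta>' \<eta> h x' \<and> y' = lact K Y \<kappa> \<eta> \<eta>' h y)"
proof -
  let ?r = "tensor_rel H (lower_part G X \<gamma>) (upper_part K Y \<kappa>)"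
  have eq: "equiv UNIV ?r" unfolding tensor_rel_def by (rule equiv_eqv)
  have c: "(t, biset_tensor_class K H G X Y \<kappa> \<gamma> t) \<in> ?r" for t
    unfolding biset_tensor_class_def tensor_class_def by (rule someI[of _ t]) (use eq in \<open>auto simp: equiv_def refl_on_def\<close>)
  have "cls \<kappa> \<gamma> \<eta> x y = cls \<kappa> \<gamma> \<eta>' x' y' \<longleftrightarrow> (utriple \<eta> x y, utriple \<eta>' x' y') \<in> ?r"
  proof
    assume "cls \<kappa> \<gamma> \<eta> x y = cls \<kappa> \<gamma> \<eta>' x' y'"
    then show "(utriple \<eta> x y, utriple \<eta>' x' y') \<in> ?r"
      using c[of "utriple \<eta> x y"] c[of "utriple \<eta>' x' y'"] eq by (auto dest: equivE elim: symE transE simp: equiv_def)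
  next
    assume "(utriple \<eta> x y, utriple \<eta>' x' y') \<in> ?r"
    then have "(utriple \<eta> x y, t) \<in> ?r \<longleftrightarrow> (utriple \<eta>' x' y', t) \<in> ?r" for t
      using eq by (meson equiv_def symD transD)
    then show "cls \<kappa> \<gamma> \<eta> x y = cls \<kappa> \<gamma> \<eta>' x' y'"
      unfolding biset_tensor_class_def tensor_class_def by simp
  qed
  also have "\<dots> \<longleftrightarrow> (\<exists>h\<in>Hom H \<eta> \<eta>'. x = ract G X \<gamma> \<eta>' \<eta> h x' \<and> y' = lact K Y \<kappa> \<eta> \<eta>' h y)"
    unfolding tensor_rel_iff[OF ob t] using t' by auto
  finally show ?thesis .
qed

lemma cls_rep:
  assumes ob: "\<kappa> \<in> Obj K" "\<gamma> \<in> Obj G" and t: "\<eta> \<in> Obj H" "x \<in> omap X (\<eta>, \<gamma>)" "y \<in> omap Y (\<kappa>, \<eta>)"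
  obtains \<eta>' x' y' h where "cls \<kappa> \<gamma> \<eta> x y = utriple \<eta>' x' y'" "\<eta>' \<in> Obj H" "x' \<in> omap X (\<eta>', \<gamma>)" "y' \<in> omap Y (\<kappa>, \<eta>')"
    "h \<in> Hom H \<eta> \<eta>'" "x = ract G X \<gamma> \<eta>' \<eta> h x'" "y' = lact K Y \<kappa> \<eta> \<eta>' h y"
proof -
  let ?r = "tensor_rel H (lower_part G X \<gamma>) (upper_part K Y \<kappa>)"
  have eq: "equiv UNIV ?r" unfolding tensor_rel_def by (rule equiv_eqv)
  have "(utriple \<eta> x y, cls \<kappa> \<gamma> \<eta> x y) \<in> ?r"
    unfolding biset_tensor_class_def tensor_class_def
    by (rule someI[of _ "utriple \<eta> x y"]) (use eq in \<open>auto simp: equiv_def refl_on_def\<close>)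
  then show ?thesis unfolding tensor_rel_iff[OF ob t] using that by blast
qed

lemma tensor_omap: "omap (biset_tensor K H G X Y) (\<kappa>, \<gamma>) =
    {cls \<kappa> \<gamma> \<eta> x y | \<eta> x y. \<eta> \<in> Obj H \<and> x \<in> omap X (\<eta>, \<gamma>) \<and> y \<in> omap Y (\<kappa>, \<eta>)}"
  by (auto simp: biset_tensor_def tensor_set_def biset_tensor_class_def)

lemma cls_in [simp]: "\<lbrakk>\<eta> \<in> Obj H; x \<in> omap X (\<eta>, \<gamma>); y \<in> omap Y (\<kappa>, \<eta>)\<rbrakk>
    \<Longrightarrow> cls \<kappa> \<gamma> \<eta> x y \<in> omap (biset_tensor K H G X Y) (\<kappa>, \<gamma>)"
  unfolding tensor_omap by blast

lemma tensorE:
  assumes "z \<in> omap (biset_tensor K H G X Y) (\<kappa>, \<gamma>)"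
  obtains \<eta> x y where "z = cls \<kappa> \<gamma> \<eta> x y" "\<eta> \<in> Obj H" "x \<in> omap X (\<eta>, \<gamma>)" "y \<in> omap Y (\<kappa>, \<eta>)"
  using assms unfolding tensor_omap by blast

text \<open>The universal property of the tensor product in the encoding by representatives. A map
  out of it is defined through the components of the stored representative, and a balanced
  \<open>f\<close> has the same value on every other one.\<close>

lemma cls_lift:
  assumes ob: "\<kappa> \<in> Obj K" "\<gamma> \<in> Obj G" and t: "\<eta> \<in> Obj H" "x \<in> omap X (\<eta>, \<gamma>)" "y \<in> omap Y (\<kappa>, \<eta>)"
    and resp: "\<And>\<eta> \<eta>' h x y. \<lbrakk>\<eta> \<in> Obj H; \<eta>' \<in> Obj H; h \<in> Hom H \<eta>' \<eta>; x \<in> omap X (\<eta>, \<gamma>); y \<in> omap Y (\<kappa>, \<eta>')\<rbrakk>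
      \<Longrightarrow> f \<eta>' (ract G X \<gamma> \<eta> \<eta>' h x) y = f \<eta> x (lact K Y \<kappa> \<eta>' \<eta> h y)"
  shows "f (u1 (cls \<kappa> \<gamma> \<eta> x y)) (u2 (cls \<kappa> \<gamma> \<eta> x y)) (u3 (cls \<kappa> \<gamma> \<eta> x y)) = f \<eta> x y"
proof -
  obtain \<eta>' x' y' h where *: "cls \<kappa> \<gamma> \<eta> x y = utriple \<eta>' x' y'" "\<eta>' \<in> Obj H" "x' \<in> omap X (\<eta>', \<gamma>)" "y' \<in> omap Y (\<kappa>, \<eta>')"
    "h \<in> Hom H \<eta> \<eta>'" "x = ract G X \<gamma> \<eta>' \<eta> h x'" "y' = lact K Y \<kappa> \<eta> \<eta>' h y"
    using cls_rep[OF ob t] .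
  show ?thesis using resp[OF *(2) t(1) *(5,3) t(3)] by (simp add: *(1) flip: *(6,7))
qed

lemma cls_slide: "\<lbrakk>\<kappa> \<in> Obj K; \<gamma> \<in> Obj G; \<eta> \<in> Obj H; \<eta>' \<in> Obj H; h \<in> Hom H \<eta>' \<eta>; x \<in> omap X (\<eta>, \<gamma>); y \<in> omap Y (\<kappa>, \<eta>')\<rbrakk>
  \<Longrightarrow> cls \<kappa> \<gamma> \<eta>' (ract G X \<gamma> \<eta> \<eta>' h x) y = cls \<kappa> \<gamma> \<eta> x (lact K Y \<kappa> \<eta>' \<eta> h y)"
  by (subst cls_eq_iff) auto

lemma tensor_act:
  assumes ob: "\<kappa> \<in> Obj K" "\<gamma> \<in> Obj G" "\<kappa>' \<in> Obj K" "\<gamma>' \<in> Obj G" "k \<in> Hom K \<kappa>' \<kappa>" "g \<in> Hom G \<gamma> \<gamma>'"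
    and t: "\<eta> \<in> Obj H" "x \<in> omap X (\<eta>, \<gamma>)" "y \<in> omap Y (\<kappa>, \<eta>)"
  shows "amap (biset_tensor K H G X Y) (\<kappa>, \<gamma>) (\<kappa>', \<gamma>') (k, g) (cls \<kappa> \<gamma> \<eta> x y)
    = cls \<kappa>' \<gamma>' \<eta> (lact H X \<eta> \<gamma> \<gamma>' g x) (ract H Y \<eta> \<kappa> \<kappa>' k y)"
proof -
  have "amap (biset_tensor K H G X Y) (\<kappa>, \<gamma>) (\<kappa>', \<gamma>') (k, g) (cls \<kappa> \<gamma> \<eta> x y)
    = (\<lambda>\<eta> x y. cls \<kappa>' \<gamma>' \<eta> (lact H X \<eta> \<gamma> \<gamma>' g x) (ract H Y \<eta> \<kappa> \<kappa>' k y))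
      (u1 (cls \<kappa> \<gamma> \<eta> x y)) (u2 (cls \<kappa> \<gamma> \<eta> x y)) (u3 (cls \<kappa> \<gamma> \<eta> x y))"
    using cls_in[OF t] by (simp add: biset_tensor_def)
  also have "\<dots> = cls \<kappa>' \<gamma>' \<eta> (lact H X \<eta> \<gamma> \<gamma>' g x) (ract H Y \<eta> \<kappa> \<kappa>' k y)"
    by (rule cls_lift[OF ob(1,2) t]) (use ob in \<open>simp add: cls_slide\<close>)
  finally show ?thesis .
qed

lemma biset_tensor:
  assumes "small (Obj H)"
  shows "biset K G (biset_tensor K H G X Y)"
proof (rule bisetI[OF Y.H.groupoid_axioms X.G.groupoid_axioms])
  fix \<kappa> \<gamma> assume ob: "\<kappa> \<in> Obj K" "\<gamma> \<in> Obj G"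
  have "small (\<Union>\<eta>\<in>Obj H. \<Union>x\<in>omap X (\<eta>, \<gamma>). (\<lambda>y. cls \<kappa> \<gamma> \<eta> x y) ` omap Y (\<kappa>, \<eta>))"
    using assms ob by (intro small_UN small_image X.small_El Y.small_El)
  then show "small (omap (biset_tensor K H G X Y) (\<kappa>, \<gamma>))"
    by (rule small_subset) (auto simp: tensor_omap)
next
  fix \<kappa> \<kappa>' \<gamma> \<gamma>' k g assume *: "\<kappa> \<in> Obj K" "\<kappa>' \<in> Obj K" "\<gamma> \<in> Obj G" "\<gamma>' \<in> Obj G" "k \<in> Hom K \<kappa>' \<kappa>" "g \<in> Hom G \<gamma> \<gamma>'"
  show "amap (biset_tensor K H G X Y) (\<kappa>, \<gamma>) (\<kappa>', \<gamma>') (k, g)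
    \<in> omap (biset_tensor K H G X Y) (\<kappa>, \<gamma>) \<rightarrow>\<^sub>E omap (biset_tensor K H G X Y) (\<kappa>', \<gamma>')"
  proof (rule PiE_I)
    fix z assume "z \<in> omap (biset_tensor K H G X Y) (\<kappa>, \<gamma>)"
    then show "amap (biset_tensor K H G X Y) (\<kappa>, \<gamma>) (\<kappa>', \<gamma>') (k, g) z \<in> omap (biset_tensor K H G X Y) (\<kappa>', \<gamma>')"
      using * by (auto elim!: tensorE simp: tensor_act)
  qed (simp add: biset_tensor_def)
qed (auto elim!: tensorE simp: tensor_act)

end

context biset_pair
begin

lemma biset_tensor_lact [simp]:
  assumes "\<kappa> \<in> Obj K" "\<gamma> \<in> Obj G" "\<gamma>' \<in> Obj G" "g \<in> Hom G \<gamma> \<gamma>'"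
    and "\<eta> \<in> Obj H" "x \<in> omap X (\<eta>, \<gamma>)" "y \<in> omap Y (\<kappa>, \<eta>)"
  shows "lact K (biset_tensor K H G X Y) \<kappa> \<gamma> \<gamma>' g (cls \<kappa> \<gamma> \<eta> x y) = cls \<kappa> \<gamma>' \<eta> (lact H X \<eta> \<gamma> \<gamma>' g x) y"
  unfolding lact_eq[of K] using assms by (simp add: tensor_act)

lemma biset_tensor_ract [simp]:
  assumes "\<kappa> \<in> Obj K" "\<kappa>' \<in> Obj K" "\<gamma> \<in> Obj G" "k \<in> Hom K \<kappa>' \<kappa>"
    and "\<eta> \<in> Obj H" "x \<in> omap X (\<eta>, \<gamma>)" "y \<in> omap Y (\<kappa>, \<eta>)"
  shows "ract G (biset_tensor K H G X Y) \<gamma> \<kappa> \<kappa>' k (cls \<kappa> \<gamma> \<eta> x y) = cls \<kappa>' \<gamma> \<eta> x (ract H Y \<eta> \<kappa> \<kappa>' k y)"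
  unfolding ract_eq[of G] using assms by (simp add: tensor_act)

end

section \<open>Freeness and finite generation in terms of elements\<close>

lemma (in biset) finitely_generated_iff:
  assumes \<eta>: "\<eta> \<in> Obj H"
  shows "finitely_generated G (upper_part H X \<eta>) \<longleftrightarrow>
    (\<exists>R. finite R \<and> R \<subseteq> (SIGMA \<gamma>:Obj G. omap X (\<eta>, \<gamma>)) \<and>
      (\<forall>\<gamma>\<in>Obj G. \<forall>x\<in>omap X (\<eta>, \<gamma>). \<exists>b\<in>R. \<exists>g\<in>Hom G \<gamma> (fst b). snd b = lact H X \<eta> \<gamma> (fst b) g x))"
proof -
  let ?A = "SIGMA \<gamma>:Obj G. omap X (\<eta>, \<gamma>)"
  let ?E = "\<lambda>a b. \<exists>g\<in>Hom G (fst a) (fst b). snd b = lact H X \<eta> (fst a) (fst b) g (snd a)"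
  let ?r = "{((\<gamma>', x), (\<gamma>, lact H X \<eta> \<gamma>' \<gamma> g x)) | \<gamma>' \<gamma> g x.
            \<gamma>' \<in> Obj G \<and> \<gamma> \<in> Obj G \<and> g \<in> Hom G \<gamma>' \<gamma> \<and> x \<in> omap X (\<eta>, \<gamma>')}"
  have E: "(a, b) \<in> eqv ?r \<longleftrightarrow> ?E a b" if "a \<in> ?A" "b \<in> ?A" for a b
  proof
    assume "(a, b) \<in> eqv ?r"
    then have "b \<in> ?A \<and> ?E a b"
    proof (rule eqv_mono_equivp[OF _ that(1)], goal_cases)
      case (1 x y) then show ?case using \<eta> by auto
    next
      case (2 x) then show ?case using \<eta> by (intro bexI[of _ "Ident G (fst x)"]) auto
    next
      case (3 x y)
      then obtain g where g: "g \<in> Hom G (fst x) (fst y)" "snd y = lact H X \<eta> (fst x) (fst y) g (snd x)" by blast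
      have "fst x \<in> Obj G" "fst y \<in> Obj G" "snd x \<in> omap X (\<eta>, fst x)" using 3 by auto
      then show ?case using g \<eta> by (intro bexI[of _ "inv_arr G (fst x) (fst y) g"]) simp_all
    next
      case (4 x y z)
      then obtain g h where "g \<in> Hom G (fst x) (fst y)" "snd y = lact H X \<eta> (fst x) (fst y) g (snd x)"
        "h \<in> Hom G (fst y) (fst z)" "snd z = lact H X \<eta> (fst y) (fst z) h (snd y)" by blast
      then show ?case using 4 \<eta> by (intro bexI[of _ "Comp G (fst x) (fst y) (fst z) h g"]) auto
    qed
    then show "?E a b" ..
  next
    assume "?E a b"
    then have "(a, b) \<in> ?r" using that by (cases a; cases b) auto
    then show "(a, b) \<in> eqv ?r" by (rule in_eqv)
  qed
  have "finitely_generated G (upper_part H X \<eta>) \<longleftrightarrow> finite (?A // eqv ?r)"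
    by (simp add: finitely_generated_def colim_def)
  also have "\<dots> \<longleftrightarrow> (\<exists>R. finite R \<and> R \<subseteq> ?A \<and> (\<forall>a\<in>?A. \<exists>b\<in>R. ?E a b))"
    unfolding finite_quotient_eqv_iff by (intro ex_cong1 conj_cong refl) (use E in blast)
  finally have 1: "finitely_generated G (upper_part H X \<eta>) \<longleftrightarrow>
    (\<exists>R. finite R \<and> R \<subseteq> ?A \<and> (\<forall>a\<in>?A. \<exists>b\<in>R. ?E a b))" .
  have "(\<forall>a\<in>?A. P a) \<longleftrightarrow> (\<forall>\<gamma>\<in>Obj G. \<forall>x\<in>omap X (\<eta>, \<gamma>). P (\<gamma>, x))" for P by auto
  from 1[unfolded this] show ?thesis unfolding fst_conv snd_conv .
qed

lemma (in biset) free_iff: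
  "free_gset G (upper_part H X \<eta>) \<longleftrightarrow> (\<forall>\<gamma>\<in>Obj G. \<forall>\<gamma>'\<in>Obj G. \<forall>x\<in>omap X (\<eta>, \<gamma>'). \<forall>g\<in>Hom G \<gamma>' \<gamma>. \<forall>g'\<in>Hom G \<gamma>' \<gamma>.
     lact H X \<eta> \<gamma>' \<gamma> g x = lact H X \<eta> \<gamma>' \<gamma> g' x \<longrightarrow> g = g')"
  by (simp add: free_gset_def inj_on_def)

context biset_pair
begin

text \<open>Freeness: from [g x, y] = [g' x, y] one obtains h with y = h y and g x = (g' x) h.
  Freeness of \<open>Y\<close> gives h = 1, and freeness of \<open>X\<close> gives g = g'.
  Generation: if the elements b generate \<open>Y\<close> at \<kappa>, then each b is paired with
  generators of \<open>X\<close> at the object of b.\<close>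

lemma admissible_tensor:
  assumes H: "small (Obj H)" and X: "admissible H G X" and Y: "admissible K H Y"
  shows "admissible K G (biset_tensor K H G X Y)"
proof -
  interpret T: biset K G "biset_tensor K H G X Y" using biset_tensor[OF H] .
  show ?thesis unfolding admissible_def
  proof (intro ballI conjI)
    fix \<kappa> assume \<kappa>: "\<kappa> \<in> Obj K"
    show "free_gset G (upper_part K (biset_tensor K H G X Y) \<kappa>)" unfolding T.free_iff
    proof (intro ballI impI)
      fix \<gamma> \<gamma>' z g g' assume *: "\<gamma> \<in> Obj G" "\<gamma>' \<in> Obj G" "g \<in> Hom G \<gamma>' \<gamma>" "g' \<in> Hom G \<gamma>' \<gamma>"
        and z: "z \<in> omap (biset_tensor K H G X Y) (\<kappa>, \<gamma>')"
        and eq: "lact K (biset_tensor K H G X Y) \<kappa> \<gamma>' \<gamma> g z = lact K (biset_tensor K H G X Y) \<kappa> \<gamma>' \<gamma> g' z"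
      from z obtain \<eta> x y where z: "z = cls \<kappa> \<gamma>' \<eta> x y" "\<eta> \<in> Obj H" "x \<in> omap X (\<eta>, \<gamma>')" "y \<in> omap Y (\<kappa>, \<eta>)"
        by (rule tensorE)
      have "cls \<kappa> \<gamma> \<eta> (lact H X \<eta> \<gamma>' \<gamma> g x) y = cls \<kappa> \<gamma> \<eta> (lact H X \<eta> \<gamma>' \<gamma> g' x) y"
        using eq * z \<kappa> by simp
      then obtain h where h: "h \<in> Hom H \<eta> \<eta>" "lact H X \<eta> \<gamma>' \<gamma> g x = ract G X \<gamma> \<eta> \<eta> h (lact H X \<eta> \<gamma>' \<gamma> g' x)"
        "y = lact K Y \<kappa> \<eta> \<eta> h y" using * z \<kappa> by (auto simp: cls_eq_iff)
      have "h = Ident H \<eta>"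
        using Y \<kappa> z h unfolding admissible_def Y.free_iff by (metis X.H.Ident_in_Hom Y.lact_Ident)
      then have "lact H X \<eta> \<gamma>' \<gamma> g x = lact H X \<eta> \<gamma>' \<gamma> g' x" using h * z by simp
      then show "g = g'" using X z * unfolding admissible_def X.free_iff by blast
    qed
    have "finitely_generated H (upper_part K Y \<kappa>)" using Y \<kappa> by (simp add: admissible_def)
    from this[unfolded Y.finitely_generated_iff[OF \<kappa>]] obtain R where "finite R \<and> R \<subseteq> (SIGMA \<eta>:Obj H. omap Y (\<kappa>, \<eta>)) \<and>
      (\<forall>\<eta>\<in>Obj H. \<forall>y\<in>omap Y (\<kappa>, \<eta>). \<exists>b\<in>R. \<exists>h\<in>Hom H \<eta> (fst b). snd b = lact K Y \<kappa> \<eta> (fst b) h y)"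
      by (rule exE)
    then have R: "finite R" "R \<subseteq> (SIGMA \<eta>:Obj H. omap Y (\<kappa>, \<eta>))"
      "\<And>\<eta> y. \<eta> \<in> Obj H \<Longrightarrow> y \<in> omap Y (\<kappa>, \<eta>) \<Longrightarrow> \<exists>b\<in>R. \<exists>h\<in>Hom H \<eta> (fst b). snd b = lact K Y \<kappa> \<eta> (fst b) h y" by auto
    have "\<exists>Q. finite Q \<and> Q \<subseteq> (SIGMA \<gamma>:Obj G. omap X (\<eta>, \<gamma>)) \<and>
      (\<forall>\<gamma>\<in>Obj G. \<forall>x\<in>omap X (\<eta>, \<gamma>). \<exists>b\<in>Q. \<exists>g\<in>Hom G \<gamma> (fst b). snd b = lact H X \<eta> \<gamma> (fst b) g x)" if "\<eta> \<in> Obj H" for \<eta>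
    proof -
      have "finitely_generated G (upper_part H X \<eta>)" using X that by (simp add: admissible_def)
      then show ?thesis unfolding X.finitely_generated_iff[OF that] .
    qed
    from bchoice[OF ballI[OF this]] obtain Q where "\<forall>\<eta>\<in>Obj H. finite (Q \<eta>) \<and> Q \<eta> \<subseteq> (SIGMA \<gamma>:Obj G. omap X (\<eta>, \<gamma>)) \<and>
      (\<forall>\<gamma>\<in>Obj G. \<forall>x\<in>omap X (\<eta>, \<gamma>). \<exists>b\<in>Q \<eta>. \<exists>g\<in>Hom G \<gamma> (fst b). snd b = lact H X \<eta> \<gamma> (fst b) g x)" by (rule exE)
    then have Q: "\<And>\<eta>. \<eta> \<in> Obj H \<Longrightarrow> finite (Q \<eta>)" "\<And>\<eta>. \<eta> \<in> Obj H \<Longrightarrow> Q \<eta> \<subseteq> (SIGMA \<gamma>:Obj G. omap X (\<eta>, \<gamma>))"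
      "\<And>\<eta> \<gamma> x. \<lbrakk>\<eta> \<in> Obj H; \<gamma> \<in> Obj G; x \<in> omap X (\<eta>, \<gamma>)\<rbrakk> \<Longrightarrow> \<exists>b\<in>Q \<eta>. \<exists>g\<in>Hom G \<gamma> (fst b). snd b = lact H X \<eta> \<gamma> (fst b) g x"
      by auto
    let ?R = "\<Union>b\<in>R. (\<lambda>a. (fst a, cls \<kappa> (fst a) (fst b) (snd a) (snd b))) ` Q (fst b)"
    show "finitely_generated G (upper_part K (biset_tensor K H G X Y) \<kappa>)"
      unfolding T.finitely_generated_iff[OF \<kappa>]
    proof (intro exI[of _ ?R] conjI ballI)
      show "finite ?R" using R Q by (intro finite_UN_I finite_imageI) auto
      show "?R \<subseteq> (SIGMA \<gamma>:Obj G. omap (biset_tensor K H G X Y) (\<kappa>, \<gamma>))"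
      proof
        fix c assume "c \<in> ?R"
        then obtain b a where c: "b \<in> R" "a \<in> Q (fst b)" "c = (fst a, cls \<kappa> (fst a) (fst b) (snd a) (snd b))" by blast
        then have b: "fst b \<in> Obj H" "snd b \<in> omap Y (\<kappa>, fst b)" using R(2) by auto
        have "a \<in> (SIGMA \<gamma>:Obj G. omap X (fst b, \<gamma>))" by (rule subsetD[OF Q(2)[OF b(1)] c(2)])
        then have "fst a \<in> Obj G" "snd a \<in> omap X (fst b, fst a)" by auto
        then show "c \<in> (SIGMA \<gamma>:Obj G. omap (biset_tensor K H G X Y) (\<kappa>, \<gamma>))" using b c by auto
      qed
      fix \<gamma> z assume \<gamma>: "\<gamma> \<in> Obj G" and "z \<in> omap (biset_tensor K H G X Y) (\<kappa>, \<gamma>)"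
      then obtain \<eta> x y where z: "z = cls \<kappa> \<gamma> \<eta> x y" "\<eta> \<in> Obj H" "x \<in> omap X (\<eta>, \<gamma>)" "y \<in> omap Y (\<kappa>, \<eta>)"
        by (elim tensorE)
      obtain b h where b: "b \<in> R" "h \<in> Hom H \<eta> (fst b)" "snd b = lact K Y \<kappa> \<eta> (fst b) h y"
        using R(3)[OF z(2,4)] by blast
      have b': "fst b \<in> Obj H" "snd b \<in> omap Y (\<kappa>, fst b)" using R(2) b by auto
      \<comment> \<open>Moving y to its generator b = h y requires moving x backwards along h:
        [x, y] = [x h^-1, b].\<close>
      define x' where "x' = ract G X \<gamma> \<eta> (fst b) (inv_arr H \<eta> (fst b) h) x"
      have x': "x' \<in> omap X (fst b, \<gamma>)" "x = ract G X \<gamma> (fst b) \<eta> h x'" using b b' z \<gamma> by (simp_all add: x'_def)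
      have zz: "z = cls \<kappa> \<gamma> (fst b) x' (snd b)"
        unfolding z(1) by (subst cls_eq_iff) (use \<kappa> \<gamma> z b b' x' in auto)
      obtain a g where a: "a \<in> Q (fst b)" "g \<in> Hom G \<gamma> (fst a)" "snd a = lact H X (fst b) \<gamma> (fst a) g x'"
        using Q(3)[OF b'(1) \<gamma> x'(1)] by blast
      have a': "fst a \<in> Obj G" using a Q(2)[OF b'(1)] by auto
      have c: "(fst a, cls \<kappa> (fst a) (fst b) (snd a) (snd b)) \<in> ?R"
        by (rule UN_I[OF b(1)], rule image_eqI[OF refl a(1)])
      show "\<exists>c\<in>?R. \<exists>g\<in>Hom G \<gamma> (fst c). snd c = lact K (biset_tensor K H G X Y) \<kappa> \<gamma> (fst c) g z"
        by (rule bexI[OF _ c], rule bexI[of _ g]) (use a a' b' \<gamma> \<kappa> x' in \<open>simp_all add: zz\<close>)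
    qed
  qed
qed

end

section \<open>Functoriality of the tensor product\<close>

lemma tensor_map_cls:
  assumes P': "biset_pair K H G X' Y'" and P: "biset_pair K H G X Y"
    and f: "f \<in> Hom (biset_cat H G) X' X" and g: "g \<in> Hom (biset_cat K H) Y' Y"
    and ob: "\<kappa> \<in> Obj K" "\<gamma> \<in> Obj G" and t: "\<eta> \<in> Obj H" "x \<in> omap X' (\<eta>, \<gamma>)" "y \<in> omap Y' (\<kappa>, \<eta>)"
  shows "biset_tensor_map K H G X' Y' X Y f g (\<kappa>, \<gamma>) (biset_tensor_class K H G X' Y' \<kappa> \<gamma> (utriple \<eta> x y))
    = biset_tensor_class K H G X Y \<kappa> \<gamma> (utriple \<eta> (f (\<eta>, \<gamma>) x) (g (\<kappa>, \<eta>) y))"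
proof -
  interpret P': biset_pair K H G X' Y' by fact
  interpret P: biset_pair K H G X Y by fact
  note fD = biset_homD[OF f P'.X.biset_axioms P.X.biset_axioms]
    and gD = biset_homD[OF g P'.Y.biset_axioms P.Y.biset_axioms]
  have "biset_tensor_map K H G X' Y' X Y f g (\<kappa>, \<gamma>) (P'.cls \<kappa> \<gamma> \<eta> x y)
    = (\<lambda>\<eta> x y. P.cls \<kappa> \<gamma> \<eta> (f (\<eta>, \<gamma>) x) (g (\<kappa>, \<eta>) y))
      (u1 (P'.cls \<kappa> \<gamma> \<eta> x y)) (u2 (P'.cls \<kappa> \<gamma> \<eta> x y)) (u3 (P'.cls \<kappa> \<gamma> \<eta> x y))"
    using P'.cls_in[OF t] ob by (simp add: biset_tensor_map_def)
  also have "\<dots> = P.cls \<kappa> \<gamma> \<eta> (f (\<eta>, \<gamma>) x) (g (\<kappa>, \<eta>) y)"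
    by (rule P'.cls_lift[OF ob t]) (use ob in \<open>simp add: fD gD P.cls_slide\<close>)
  finally show ?thesis .
qed

lemma tensor_map_in_Hom:
  assumes P': "biset_pair K H G X' Y'" and P: "biset_pair K H G X Y" and H: "small (Obj H)"
    and f: "f \<in> Hom (biset_cat H G) X' X" and g: "g \<in> Hom (biset_cat K H) Y' Y"
  shows "biset_tensor_map K H G X' Y' X Y f g
    \<in> Hom (biset_cat K G) (biset_tensor K H G X' Y') (biset_tensor K H G X Y)"
proof -
  interpret P': biset_pair K H G X' Y' by fact
  interpret P: biset_pair K H G X Y by fact
  note fD = biset_homD[OF f P'.X.biset_axioms P.X.biset_axioms]
    and gD = biset_homD[OF g P'.Y.biset_axioms P.Y.biset_axioms]
  show ?thesis
  proof (rule biset_homI[OF P'.biset_tensor[OF H] P.biset_tensor[OF H]])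
    show "biset_tensor_map K H G X' Y' X Y f g \<in> extensional (Obj K \<times> Obj G)"
      by (simp add: biset_tensor_map_def)
    show "biset_tensor_map K H G X' Y' X Y f g (\<kappa>, \<gamma>) \<in> omap (biset_tensor K H G X' Y') (\<kappa>, \<gamma>) \<rightarrow>\<^sub>E omap (biset_tensor K H G X Y) (\<kappa>, \<gamma>)"
      if ob: "\<kappa> \<in> Obj K" "\<gamma> \<in> Obj G" for \<kappa> \<gamma>
    proof (rule PiE_I)
      fix z assume "z \<in> omap (biset_tensor K H G X' Y') (\<kappa>, \<gamma>)"
      then show "biset_tensor_map K H G X' Y' X Y f g (\<kappa>, \<gamma>) z \<in> omap (biset_tensor K H G X Y) (\<kappa>, \<gamma>)"
        using ob by (auto elim!: P'.tensorE simp: tensor_map_cls[OF P' P f g] fD gD)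
    qed (use ob in \<open>simp add: biset_tensor_map_def\<close>)
  qed (auto elim!: P'.tensorE simp: tensor_map_cls[OF P' P f g] fD gD)
qed

subsection \<open>Units\<close>

lemma unit_biset_omap [simp]: "omap (unit_biset G) (\<gamma>', \<gamma>) = Hom G \<gamma>' \<gamma>"
  by (simp add: unit_biset_def)

lemma biset_unit:
  assumes "small_groupoid G"
  shows "biset G G (unit_biset G)"
proof -
  interpret G: small_groupoid G by fact
  show ?thesis
    by (rule bisetI) (auto simp: G.groupoid_axioms G.small_Hom, auto simp: unit_biset_def)
qed

lemma (in small_groupoid) unit_act [simp]:
  assumes "\<gamma> \<in> Obj G" "\<gamma>' \<in> Obj G" "f \<in> Hom G \<gamma>' \<gamma>"
  shows "\<delta> \<in> Obj G \<Longrightarrow> g \<in> Hom G \<gamma> \<delta> \<Longrightarrow> lact G (unit_biset G) \<gamma>' \<gamma> \<delta> g f = Comp G \<gamma>' \<gamma> \<delta> g f"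
    "\<delta>' \<in> Obj G \<Longrightarrow> k \<in> Hom G \<delta>' \<gamma>' \<Longrightarrow> ract G (unit_biset G) \<gamma> \<gamma>' \<delta>' k f = Comp G \<delta>' \<gamma>' \<gamma> f k"
  unfolding lact_eq ract_eq using assms by (simp_all add: unit_biset_def)

lemma admissible_unit:
  assumes "small_groupoid G"
  shows "admissible G G (unit_biset G)"
proof -
  interpret G: small_groupoid G by fact
  interpret biset G G "unit_biset G" using biset_unit[OF assms] .
  have "finitely_generated G (upper_part G (unit_biset G) \<gamma>)" if "\<gamma> \<in> Obj G" for \<gamma>
    unfolding finitely_generated_iff[OF that]
  \<comment> \<open>The identity of \<gamma> generates: an arrow x out of \<gamma> is carried to it
    by x^-1.\<close>
  proof (intro exI[of _ "{(\<gamma>, Ident G \<gamma>)}"] conjI ballI)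
    fix \<delta> x assume "\<delta> \<in> Obj G" "x \<in> omap (unit_biset G) (\<gamma>, \<delta>)"
    then show "\<exists>b\<in>{(\<gamma>, Ident G \<gamma>)}. \<exists>g\<in>Hom G \<delta> (fst b). snd b = lact G (unit_biset G) \<gamma> \<delta> (fst b) g x"
      using that by (auto intro!: bexI[of _ "inv_arr G \<gamma> \<delta> x"])
  qed (use that in auto)
  moreover have "free_gset G (upper_part G (unit_biset G) \<gamma>)" if "\<gamma> \<in> Obj G" for \<gamma>
    unfolding free_iff using that by (auto dest: G.cancel_right)
  ultimately show ?thesis by (simp add: admissible_def)
qed

subsection \<open>Associator and unitors\<close>

text \<open>Smallness of the two middle object sets keeps the values of the iterated tensor products
  small, so that these are bi-sets again.\<close>

locale biset_chain = XY: biset_pair K H G X Y + YZ: biset_pair L K H Y Z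
  for L K H G :: "'u::universe grpd" and X Y Z :: "'u biset" +
  assumes small_ObH: "small (Obj H)" and small_ObK: "small (Obj K)"
begin

sublocale XY_Z: biset_pair L K G "biset_tensor K H G X Y" Z
  using XY.biset_tensor[OF small_ObH] YZ.Y.biset_axioms by (rule biset_pair.intro)

sublocale X_YZ: biset_pair L H G X "biset_tensor L K H Y Z"
  using XY.X.biset_axioms YZ.biset_tensor[OF small_ObK] by (rule biset_pair.intro)

lemma tensor3E:
  assumes "w \<in> omap (biset_tensor L K G (biset_tensor K H G X Y) Z) (\<mu>, \<gamma>)"
  obtains \<eta> \<kappa> x y z where "w = XY_Z.cls \<mu> \<gamma> \<kappa> (XY.cls \<kappa> \<gamma> \<eta> x y) z"
    "\<eta> \<in> Obj H" "\<kappa> \<in> Obj K" "x \<in> omap X (\<eta>, \<gamma>)" "y \<in> omap Y (\<kappa>, \<eta>)" "z \<in> omap Z (\<mu>, \<kappa>)"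
  using assms by (elim XY_Z.tensorE XY.tensorE) auto

text \<open>\<open>biset_assoc\<close> reads the representative of a representative, so balance is
  verified twice: over \<open>H\<close> for the inner class with \<kappa> and z fixed, which is
  \<open>f\<close>, and then over \<open>K\<close> for the outer class.\<close>

lemma assoc_cls [simp]:
  assumes ob: "\<mu> \<in> Obj L" "\<gamma> \<in> Obj G" and t: "\<eta> \<in> Obj H" "\<kappa> \<in> Obj K" "x \<in> omap X (\<eta>, \<gamma>)" "y \<in> omap Y (\<kappa>, \<eta>)" "z \<in> omap Z (\<mu>, \<kappa>)"
  shows "biset_assoc L K H G X Y Z (\<mu>, \<gamma>) (XY_Z.cls \<mu> \<gamma> \<kappa> (XY.cls \<kappa> \<gamma> \<eta> x y) z)
    = X_YZ.cls \<mu> \<gamma> \<eta> x (YZ.cls \<mu> \<eta> \<kappa> y z)"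
proof -
  let ?f = "\<lambda>\<kappa> c z. X_YZ.cls \<mu> \<gamma> (u1 c) (u2 c) (YZ.cls \<mu> (u1 c) \<kappa> (u3 c) z)"
  have f: "?f \<kappa> (XY.cls \<kappa> \<gamma> \<eta> x y) z = X_YZ.cls \<mu> \<gamma> \<eta> x (YZ.cls \<mu> \<eta> \<kappa> y z)"
    if t: "\<eta> \<in> Obj H" "\<kappa> \<in> Obj K" "x \<in> omap X (\<eta>, \<gamma>)" "y \<in> omap Y (\<kappa>, \<eta>)" "z \<in> omap Z (\<mu>, \<kappa>)" for \<eta> \<kappa> x y z
    by (rule XY.cls_lift[where f = "\<lambda>\<eta> x y. X_YZ.cls \<mu> \<gamma> \<eta> x (YZ.cls \<mu> \<eta> \<kappa> y z)", OF t(2) ob(2) t(1,3,4)])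
      (use ob t in \<open>simp add: X_YZ.cls_slide\<close>)
  have "biset_assoc L K H G X Y Z (\<mu>, \<gamma>) (XY_Z.cls \<mu> \<gamma> \<kappa> (XY.cls \<kappa> \<gamma> \<eta> x y) z)
    = ?f (u1 (XY_Z.cls \<mu> \<gamma> \<kappa> (XY.cls \<kappa> \<gamma> \<eta> x y) z)) (u2 (XY_Z.cls \<mu> \<gamma> \<kappa> (XY.cls \<kappa> \<gamma> \<eta> x y) z))
       (u3 (XY_Z.cls \<mu> \<gamma> \<kappa> (XY.cls \<kappa> \<gamma> \<eta> x y) z))"
    using ob t by (simp add: biset_assoc_def)
  also have "\<dots> = ?f \<kappa> (XY.cls \<kappa> \<gamma> \<eta> x y) z"
  proof (rule XY_Z.cls_lift[OF ob t(2)])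
    fix \<kappa> \<kappa>' k c z assume *: "\<kappa> \<in> Obj K" "\<kappa>' \<in> Obj K" "k \<in> Hom K \<kappa>' \<kappa>" "c \<in> omap (biset_tensor K H G X Y) (\<kappa>, \<gamma>)"
      "z \<in> omap Z (\<mu>, \<kappa>')"
    from *(4) obtain \<eta> x y where c: "c = XY.cls \<kappa> \<gamma> \<eta> x y" "\<eta> \<in> Obj H" "x \<in> omap X (\<eta>, \<gamma>)" "y \<in> omap Y (\<kappa>, \<eta>)"
      by (rule XY.tensorE)
    have "?f \<kappa>' (ract G (biset_tensor K H G X Y) \<gamma> \<kappa> \<kappa>' k c) z = ?f \<kappa>' (XY.cls \<kappa>' \<gamma> \<eta> x (ract H Y \<eta> \<kappa> \<kappa>' k y)) z"
      using * c ob by simp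
    also have "\<dots> = X_YZ.cls \<mu> \<gamma> \<eta> x (YZ.cls \<mu> \<eta> \<kappa>' (ract H Y \<eta> \<kappa> \<kappa>' k y) z)" by (rule f) (use * c in auto)
    also have "\<dots> = X_YZ.cls \<mu> \<gamma> \<eta> x (YZ.cls \<mu> \<eta> \<kappa> y (lact L Z \<mu> \<kappa>' \<kappa> k z))" using * c ob by (simp add: YZ.cls_slide)
    also have "\<dots> = ?f \<kappa> c (lact L Z \<mu> \<kappa>' \<kappa> k z)" unfolding c by (rule f[symmetric]) (use * c ob in auto)
    finally show "?f \<kappa>' (ract G (biset_tensor K H G X Y) \<gamma> \<kappa> \<kappa>' k c) z = ?f \<kappa> c (lact L Z \<mu> \<kappa>' \<kappa> k z)" .
  qed (use t in auto)
  also have "\<dots> = X_YZ.cls \<mu> \<gamma> \<eta> x (YZ.cls \<mu> \<eta> \<kappa> y z)" by (rule f[OF t])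
  finally show ?thesis .
qed

lemma assoc_in_Hom: "biset_assoc L K H G X Y Z \<in> Hom (biset_cat L G)
    (biset_tensor L K G (biset_tensor K H G X Y) Z) (biset_tensor L H G X (biset_tensor L K H Y Z))"
proof (rule biset_homI[OF XY_Z.biset_tensor[OF small_ObK] X_YZ.biset_tensor[OF small_ObH]])
  show "biset_assoc L K H G X Y Z \<in> extensional (Obj L \<times> Obj G)" by (simp add: biset_assoc_def)
  show "biset_assoc L K H G X Y Z (\<mu>, \<gamma>) \<in> omap (biset_tensor L K G (biset_tensor K H G X Y) Z) (\<mu>, \<gamma>) \<rightarrow>\<^sub>E
      omap (biset_tensor L H G X (biset_tensor L K H Y Z)) (\<mu>, \<gamma>)" if ob: "\<mu> \<in> Obj L" "\<gamma> \<in> Obj G" for \<mu> \<gamma>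
  proof (rule PiE_I)
    fix w assume "w \<in> omap (biset_tensor L K G (biset_tensor K H G X Y) Z) (\<mu>, \<gamma>)"
    then show "biset_assoc L K H G X Y Z (\<mu>, \<gamma>) w \<in> omap (biset_tensor L H G X (biset_tensor L K H Y Z)) (\<mu>, \<gamma>)"
      using ob by (auto elim!: tensor3E)
  qed (use ob in \<open>simp add: biset_assoc_def\<close>)
qed (auto elim!: tensor3E)

text \<open>For injectivity, equality of [x, [y, z]] and [x', [y', z']] is unwound from outside: an
  arrow h over \<open>H\<close> relates x and x', and then an arrow k over \<open>K\<close> relates
  the inner classes. Sliding along k first and along h second gives equality of [[x, y], z] and
  [[x', y'], z'].\<close>

lemma assoc_iso: "iso_arr (biset_cat L G) (biset_tensor L K G (biset_tensor K H G X Y) Z)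
    (biset_tensor L H G X (biset_tensor L K H Y Z)) (biset_assoc L K H G X Y Z)"
proof (rule biset_isoI[OF XY_Z.biset_tensor[OF small_ObK] X_YZ.biset_tensor[OF small_ObH] assoc_in_Hom])
  fix \<mu> \<gamma> assume ob: "\<mu> \<in> Obj L" "\<gamma> \<in> Obj G"
  show "bij_betw (biset_assoc L K H G X Y Z (\<mu>, \<gamma>)) (omap (biset_tensor L K G (biset_tensor K H G X Y) Z) (\<mu>, \<gamma>))
      (omap (biset_tensor L H G X (biset_tensor L K H Y Z)) (\<mu>, \<gamma>))"
  proof (rule bij_betw_imageI)
    show "biset_assoc L K H G X Y Z (\<mu>, \<gamma>) ` omap (biset_tensor L K G (biset_tensor K H G X Y) Z) (\<mu>, \<gamma>) =
      omap (biset_tensor L H G X (biset_tensor L K H Y Z)) (\<mu>, \<gamma>)"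
    proof (intro equalityI subsetI)
      fix w assume "w \<in> biset_assoc L K H G X Y Z (\<mu>, \<gamma>) ` omap (biset_tensor L K G (biset_tensor K H G X Y) Z) (\<mu>, \<gamma>)"
      then show "w \<in> omap (biset_tensor L H G X (biset_tensor L K H Y Z)) (\<mu>, \<gamma>)" using ob by (auto elim!: tensor3E)
    next
      fix w assume "w \<in> omap (biset_tensor L H G X (biset_tensor L K H Y Z)) (\<mu>, \<gamma>)"
      then obtain \<eta> \<kappa> x y z where w: "w = X_YZ.cls \<mu> \<gamma> \<eta> x (YZ.cls \<mu> \<eta> \<kappa> y z)"
        "\<eta> \<in> Obj H" "\<kappa> \<in> Obj K" "x \<in> omap X (\<eta>, \<gamma>)" "y \<in> omap Y (\<kappa>, \<eta>)" "z \<in> omap Z (\<mu>, \<kappa>)"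
        by (elim X_YZ.tensorE YZ.tensorE) auto
      show "w \<in> biset_assoc L K H G X Y Z (\<mu>, \<gamma>) ` omap (biset_tensor L K G (biset_tensor K H G X Y) Z) (\<mu>, \<gamma>)"
        by (rule image_eqI[of _ _ "XY_Z.cls \<mu> \<gamma> \<kappa> (XY.cls \<kappa> \<gamma> \<eta> x y) z"]) (use w ob in auto)
    qed
    show "inj_on (biset_assoc L K H G X Y Z (\<mu>, \<gamma>)) (omap (biset_tensor L K G (biset_tensor K H G X Y) Z) (\<mu>, \<gamma>))"
    proof (rule inj_onI)
      fix w w' assume eq: "biset_assoc L K H G X Y Z (\<mu>, \<gamma>) w = biset_assoc L K H G X Y Z (\<mu>, \<gamma>) w'"
        and "w \<in> omap (biset_tensor L K G (biset_tensor K H G X Y) Z) (\<mu>, \<gamma>)"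
          "w' \<in> omap (biset_tensor L K G (biset_tensor K H G X Y) Z) (\<mu>, \<gamma>)"
      then obtain \<eta> \<kappa> x y z \<eta>' \<kappa>' x' y' z' where w: "w = XY_Z.cls \<mu> \<gamma> \<kappa> (XY.cls \<kappa> \<gamma> \<eta> x y) z"
        "\<eta> \<in> Obj H" "\<kappa> \<in> Obj K" "x \<in> omap X (\<eta>, \<gamma>)" "y \<in> omap Y (\<kappa>, \<eta>)" "z \<in> omap Z (\<mu>, \<kappa>)"
        and w': "w' = XY_Z.cls \<mu> \<gamma> \<kappa>' (XY.cls \<kappa>' \<gamma> \<eta>' x' y') z'"
        "\<eta>' \<in> Obj H" "\<kappa>' \<in> Obj K" "x' \<in> omap X (\<eta>', \<gamma>)" "y' \<in> omap Y (\<kappa>', \<eta>')" "z' \<in> omap Z (\<mu>, \<kappa>')"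
        by (elim tensor3E)
      have "X_YZ.cls \<mu> \<gamma> \<eta> x (YZ.cls \<mu> \<eta> \<kappa> y z) = X_YZ.cls \<mu> \<gamma> \<eta>' x' (YZ.cls \<mu> \<eta>' \<kappa>' y' z')"
        using eq w w' ob by simp
      then obtain h where h: "h \<in> Hom H \<eta> \<eta>'" "x = ract G X \<gamma> \<eta>' \<eta> h x'"
        "YZ.cls \<mu> \<eta>' \<kappa>' y' z' = lact L (biset_tensor L K H Y Z) \<mu> \<eta> \<eta>' h (YZ.cls \<mu> \<eta> \<kappa> y z)"
        using w w' ob by (subst (asm) X_YZ.cls_eq_iff) auto
      have "YZ.cls \<mu> \<eta>' \<kappa>' y' z' = YZ.cls \<mu> \<eta>' \<kappa> (lact K Y \<kappa> \<eta> \<eta>' h y) z" using h w w' ob by simp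
      then obtain k where k: "k \<in> Hom K \<kappa>' \<kappa>" "y' = ract H Y \<eta>' \<kappa> \<kappa>' k (lact K Y \<kappa> \<eta> \<eta>' h y)" "z = lact L Z \<mu> \<kappa>' \<kappa> k z'"
        using w w' ob h by (subst (asm) YZ.cls_eq_iff) auto
      have "w = XY_Z.cls \<mu> \<gamma> \<kappa>' (ract G (biset_tensor K H G X Y) \<gamma> \<kappa> \<kappa>' k (XY.cls \<kappa> \<gamma> \<eta> x y)) z'"
        unfolding w(1) k(3) using k w w' ob by (subst XY_Z.cls_slide) auto
      also have "ract G (biset_tensor K H G X Y) \<gamma> \<kappa> \<kappa>' k (XY.cls \<kappa> \<gamma> \<eta> x y) = XY.cls \<kappa>' \<gamma> \<eta> (ract G X \<gamma> \<eta>' \<eta> h x') (ract H Y \<eta> \<kappa> \<kappa>' k y)"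
        using k w w'(3) ob h by simp
      also have "\<dots> = XY.cls \<kappa>' \<gamma> \<eta>' x' (lact K Y \<kappa>' \<eta> \<eta>' h (ract H Y \<eta> \<kappa> \<kappa>' k y))"
        by (rule XY.cls_slide) (use k w w' ob h in auto)
      also have "lact K Y \<kappa>' \<eta> \<eta>' h (ract H Y \<eta> \<kappa> \<kappa>' k y) = y'" using k(1,2) w(2-6) w'(2,3) h(1) by simp
      finally show "w = w'" unfolding w' .
    qed
  qed
qed

end

lemma biset_pair_lunit: "small_groupoid G \<Longrightarrow> biset H G X \<Longrightarrow> biset_pair H G G (unit_biset G) X"
  and biset_pair_runit: "small_groupoid H \<Longrightarrow> biset H G X \<Longrightarrow> biset_pair H H G X (unit_biset H)"
  by (auto intro: biset_pair.intro biset_unit)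

context
  fixes H G :: "'u::universe grpd" and X
  assumes G: "small_groupoid G" and X: "biset H G X"
begin

interpretation G: small_groupoid G by (rule G)
interpretation X: biset H G X by (rule X)
interpretation P: biset_pair H G G "unit_biset G" X using biset_pair_lunit[OF G X] .

lemma lunit_cls:
  assumes ob: "\<eta> \<in> Obj H" "\<gamma> \<in> Obj G" and t: "\<gamma>' \<in> Obj G" "g \<in> Hom G \<gamma>' \<gamma>" "x \<in> omap X (\<eta>, \<gamma>')"
  shows "biset_lunit H G X (\<eta>, \<gamma>) (biset_tensor_class H G G (unit_biset G) X \<eta> \<gamma> (utriple \<gamma>' g x)) = lact H X \<eta> \<gamma>' \<gamma> g x"
proof -
  have "biset_lunit H G X (\<eta>, \<gamma>) (P.cls \<eta> \<gamma> \<gamma>' g x) = (\<lambda>\<gamma>' g x. lact H X \<eta> \<gamma>' \<gamma> g x)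
     (u1 (P.cls \<eta> \<gamma> \<gamma>' g x)) (u2 (P.cls \<eta> \<gamma> \<gamma>' g x)) (u3 (P.cls \<eta> \<gamma> \<gamma>' g x))"
    using ob t by (simp add: biset_lunit_def)
  also have "\<dots> = lact H X \<eta> \<gamma>' \<gamma> g x"
    by (rule P.cls_lift[OF ob]) (use ob t in auto)
  finally show ?thesis .
qed

lemma lunit_in_Hom: "biset_lunit H G X \<in> Hom (biset_cat H G) (biset_tensor H G G (unit_biset G) X) X"
proof (rule biset_homI[OF P.biset_tensor[OF G.small_Obj] X])
  show "biset_lunit H G X \<in> extensional (Obj H \<times> Obj G)" by (simp add: biset_lunit_def)
  show "biset_lunit H G X (\<eta>, \<gamma>) \<in> omap (biset_tensor H G G (unit_biset G) X) (\<eta>, \<gamma>) \<rightarrow>\<^sub>E omap X (\<eta>, \<gamma>)"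
    if ob: "\<eta> \<in> Obj H" "\<gamma> \<in> Obj G" for \<eta> \<gamma>
  proof (rule PiE_I)
    fix z assume "z \<in> omap (biset_tensor H G G (unit_biset G) X) (\<eta>, \<gamma>)"
    then show "biset_lunit H G X (\<eta>, \<gamma>) z \<in> omap X (\<eta>, \<gamma>)" using ob by (auto elim!: P.tensorE simp: lunit_cls)
  qed (use ob in \<open>simp add: biset_lunit_def\<close>)
qed (auto elim!: P.tensorE simp: lunit_cls)

lemma lunit_iso: "iso_arr (biset_cat H G) (biset_tensor H G G (unit_biset G) X) X (biset_lunit H G X)"
proof (rule biset_isoI[OF P.biset_tensor[OF G.small_Obj] X lunit_in_Hom])
  fix \<eta> \<gamma> assume ob: "\<eta> \<in> Obj H" "\<gamma> \<in> Obj G"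
  show "bij_betw (biset_lunit H G X (\<eta>, \<gamma>)) (omap (biset_tensor H G G (unit_biset G) X) (\<eta>, \<gamma>)) (omap X (\<eta>, \<gamma>))"
  proof (rule bij_betw_imageI)
    show "biset_lunit H G X (\<eta>, \<gamma>) ` omap (biset_tensor H G G (unit_biset G) X) (\<eta>, \<gamma>) = omap X (\<eta>, \<gamma>)"
    proof (intro equalityI subsetI)
      fix x assume "x \<in> biset_lunit H G X (\<eta>, \<gamma>) ` omap (biset_tensor H G G (unit_biset G) X) (\<eta>, \<gamma>)"
      then show "x \<in> omap X (\<eta>, \<gamma>)" using ob by (auto elim!: P.tensorE simp: lunit_cls)
    next
      fix x assume "x \<in> omap X (\<eta>, \<gamma>)"
      then show "x \<in> biset_lunit H G X (\<eta>, \<gamma>) ` omap (biset_tensor H G G (unit_biset G) X) (\<eta>, \<gamma>)"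
        by (intro image_eqI[of _ _ "P.cls \<eta> \<gamma> \<gamma> (Ident G \<gamma>) x"]) (use ob in \<open>auto simp: lunit_cls\<close>)
    qed
    show "inj_on (biset_lunit H G X (\<eta>, \<gamma>)) (omap (biset_tensor H G G (unit_biset G) X) (\<eta>, \<gamma>))"
    proof (rule inj_onI)
      fix z z' assume eq: "biset_lunit H G X (\<eta>, \<gamma>) z = biset_lunit H G X (\<eta>, \<gamma>) z'"
        and "z \<in> omap (biset_tensor H G G (unit_biset G) X) (\<eta>, \<gamma>)" "z' \<in> omap (biset_tensor H G G (unit_biset G) X) (\<eta>, \<gamma>)"
      then obtain \<gamma>1 g1 x1 \<gamma>2 g2 x2 where z: "z = P.cls \<eta> \<gamma> \<gamma>1 g1 x1" "\<gamma>1 \<in> Obj G" "g1 \<in> Hom G \<gamma>1 \<gamma>" "x1 \<in> omap X (\<eta>, \<gamma>1)"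
        and z': "z' = P.cls \<eta> \<gamma> \<gamma>2 g2 x2" "\<gamma>2 \<in> Obj G" "g2 \<in> Hom G \<gamma>2 \<gamma>" "x2 \<in> omap X (\<eta>, \<gamma>2)"
        by (elim P.tensorE) simp
      have e: "lact H X \<eta> \<gamma>1 \<gamma> g1 x1 = lact H X \<eta> \<gamma>2 \<gamma> g2 x2" using eq z z' ob by (simp add: lunit_cls)
      \<comment> \<open>From g1 x1 = g2 x2 it follows that g2^-1 g1 carries x1 to x2, while g1 = g2
        (g2^-1 g1).\<close>
      show "z = z'" unfolding z(1) z'(1)
        by (subst P.cls_eq_iff) (use z z' ob e in \<open>auto intro!: bexI[of _ "Comp G \<gamma>1 \<gamma> \<gamma>2 (inv_arr G \<gamma>2 \<gamma> g2) g1"]\<close>)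
    qed
  qed
qed

end

context
  fixes H G :: "'u::universe grpd" and X
  assumes H: "small_groupoid H" and X: "biset H G X"
begin

interpretation H: small_groupoid H by (rule H)
interpretation X: biset H G X by (rule X)
interpretation P: biset_pair H H G X "unit_biset H" using biset_pair_runit[OF H X] .

lemma runit_cls:
  assumes ob: "\<eta> \<in> Obj H" "\<gamma> \<in> Obj G" and t: "\<eta>' \<in> Obj H" "x \<in> omap X (\<eta>', \<gamma>)" "h \<in> Hom H \<eta> \<eta>'"
  shows "biset_runit H G X (\<eta>, \<gamma>) (biset_tensor_class H H G X (unit_biset H) \<eta> \<gamma> (utriple \<eta>' x h)) = ract G X \<gamma> \<eta>' \<eta> h x"
proof -
  have "biset_runit H G X (\<eta>, \<gamma>) (P.cls \<eta> \<gamma> \<eta>' x h) = (\<lambda>\<eta>' x h. ract G X \<gamma> \<eta>' \<eta> h x)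
     (u1 (P.cls \<eta> \<gamma> \<eta>' x h)) (u2 (P.cls \<eta> \<gamma> \<eta>' x h)) (u3 (P.cls \<eta> \<gamma> \<eta>' x h))"
    using ob t by (simp add: biset_runit_def)
  also have "\<dots> = ract G X \<gamma> \<eta>' \<eta> h x"
    by (rule P.cls_lift[OF ob]) (use ob t in auto)
  finally show ?thesis .
qed

lemma runit_in_Hom: "biset_runit H G X \<in> Hom (biset_cat H G) (biset_tensor H H G X (unit_biset H)) X"
proof (rule biset_homI[OF P.biset_tensor[OF H.small_Obj] X])
  show "biset_runit H G X \<in> extensional (Obj H \<times> Obj G)" by (simp add: biset_runit_def)
  show "biset_runit H G X (\<eta>, \<gamma>) \<in> omap (biset_tensor H H G X (unit_biset H)) (\<eta>, \<gamma>) \<rightarrow>\<^sub>E omap X (\<eta>, \<gamma>)"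
    if ob: "\<eta> \<in> Obj H" "\<gamma> \<in> Obj G" for \<eta> \<gamma>
  proof (rule PiE_I)
    fix z assume "z \<in> omap (biset_tensor H H G X (unit_biset H)) (\<eta>, \<gamma>)"
    then show "biset_runit H G X (\<eta>, \<gamma>) z \<in> omap X (\<eta>, \<gamma>)" using ob by (auto elim!: P.tensorE simp: runit_cls)
  qed (use ob in \<open>simp add: biset_runit_def\<close>)
qed (auto elim!: P.tensorE simp: runit_cls)

lemma runit_iso: "iso_arr (biset_cat H G) (biset_tensor H H G X (unit_biset H)) X (biset_runit H G X)"
proof (rule biset_isoI[OF P.biset_tensor[OF H.small_Obj] X runit_in_Hom])
  fix \<eta> \<gamma> assume ob: "\<eta> \<in> Obj H" "\<gamma> \<in> Obj G"
  show "bij_betw (biset_runit H G X (\<eta>, \<gamma>)) (omap (biset_tensor H H G X (unit_biset H)) (\<eta>, \<gamma>)) (omap X (\<eta>, \<gamma>))"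
  proof (rule bij_betw_imageI)
    show "biset_runit H G X (\<eta>, \<gamma>) ` omap (biset_tensor H H G X (unit_biset H)) (\<eta>, \<gamma>) = omap X (\<eta>, \<gamma>)"
    proof (intro equalityI subsetI)
      fix x assume "x \<in> biset_runit H G X (\<eta>, \<gamma>) ` omap (biset_tensor H H G X (unit_biset H)) (\<eta>, \<gamma>)"
      then show "x \<in> omap X (\<eta>, \<gamma>)" using ob by (auto elim!: P.tensorE simp: runit_cls)
    next
      fix x assume "x \<in> omap X (\<eta>, \<gamma>)"
      then show "x \<in> biset_runit H G X (\<eta>, \<gamma>) ` omap (biset_tensor H H G X (unit_biset H)) (\<eta>, \<gamma>)"
        by (intro image_eqI[of _ _ "P.cls \<eta> \<gamma> \<eta> x (Ident H \<eta>)"]) (use ob in \<open>auto simp: runit_cls\<close>)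
    qed
    show "inj_on (biset_runit H G X (\<eta>, \<gamma>)) (omap (biset_tensor H H G X (unit_biset H)) (\<eta>, \<gamma>))"
    proof (rule inj_onI)
      fix z z' assume eq: "biset_runit H G X (\<eta>, \<gamma>) z = biset_runit H G X (\<eta>, \<gamma>) z'"
        and "z \<in> omap (biset_tensor H H G X (unit_biset H)) (\<eta>, \<gamma>)" "z' \<in> omap (biset_tensor H H G X (unit_biset H)) (\<eta>, \<gamma>)"
      then obtain \<eta>1 x1 h1 \<eta>2 x2 h2 where z: "z = P.cls \<eta> \<gamma> \<eta>1 x1 h1" "\<eta>1 \<in> Obj H" "x1 \<in> omap X (\<eta>1, \<gamma>)" "h1 \<in> Hom H \<eta> \<eta>1"
        and z': "z' = P.cls \<eta> \<gamma> \<eta>2 x2 h2" "\<eta>2 \<in> Obj H" "x2 \<in> omap X (\<eta>2, \<gamma>)" "h2 \<in> Hom H \<eta> \<eta>2"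
        by (elim P.tensorE) simp
      have e: "ract G X \<gamma> \<eta>1 \<eta> h1 x1 = ract G X \<gamma> \<eta>2 \<eta> h2 x2" using eq z z' ob by (simp add: runit_cls)
      then have "x1 = ract G X \<gamma> \<eta> \<eta>1 (inv_arr H \<eta> \<eta>1 h1) (ract G X \<gamma> \<eta>2 \<eta> h2 x2)" using z z' ob by (simp flip: e)
      \<comment> \<open>The arrow h2 h1^-1 from \<eta>1 to \<eta>2 carries h1 to h2, and x1 is x2
        acted on by it.\<close>
      then show "z = z'" unfolding z(1) z'(1)
        by (subst P.cls_eq_iff) (use z(2-) z'(2-) ob in \<open>auto intro!: bexI[of _ "Comp H \<eta>1 \<eta> \<eta>2 h2 (inv_arr H \<eta> \<eta>1 h1)"]\<close>)
    qed
  qed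
qed

end

section \<open>The bicategory of bi-sets\<close>

lemma burnside_simps [simp]:
  "BOb burnside_bicat = {G. small_groupoid G}"
  "BHom burnside_bicat H G = core (full_subcat (biset_cat H G) (admissible H G))"
  "omap (BComp burnside_bicat K H G) (X, Y) = biset_tensor K H G X Y"
  "amap (BComp burnside_bicat K H G) (X', Y') (X, Y) (f, g) = biset_tensor_map K H G X' Y' X Y f g"
  "BUnit burnside_bicat = unit_biset" "BAssoc burnside_bicat = biset_assoc"
  "BLUnit burnside_bicat = biset_lunit" "BRUnit burnside_bicat = biset_runit"
  by (simp_all add: burnside_bicat_def)

lemma burnside_onecell:
  assumes "small_groupoid H" "small_groupoid G"
  shows "X \<in> onecells burnside_bicat H G \<longleftrightarrow> biset H G X \<and> admissible H G X"
proof -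
  interpret H: small_groupoid H by fact
  interpret G: small_groupoid G by fact
  show ?thesis using in_Obj_biset_cat[OF H.groupoid_axioms G.groupoid_axioms] by auto
qed

text \<open>A composite in \<open>biset_cat\<close> is determined by its source and the two maps.
  This allows two sides of a diagram that run through different intermediate bi-sets to be compared
  on elements.\<close>

lemma biset_comp_eqI:
  assumes "\<And>\<eta> \<gamma> x. \<lbrakk>\<eta> \<in> Obj H; \<gamma> \<in> Obj G; x \<in> omap X (\<eta>, \<gamma>)\<rbrakk>
     \<Longrightarrow> g (\<eta>, \<gamma>) (f (\<eta>, \<gamma>) x) = g' (\<eta>, \<gamma>) (f' (\<eta>, \<gamma>) x)"
  shows "Comp (biset_cat H G) X Y Z g f = Comp (biset_cat H G) X Y' Z' g' f'"
  using assms by (auto simp: biset_cat_simps compose_def fun_eq_iff restrict_def)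

lemma category_burnside_hom:
  assumes "small_groupoid H" "small_groupoid G"
  shows "category (full_subcat (biset_cat H G) (admissible H G))"
  using assms by (auto intro!: category_full_subcat category_biset_cat small_groupoid.axioms(1)
      simp: small_groupoid_def groupoid_def groupoid_axioms_def small_groupoid_axioms_def)

lemma functor_biset_tensor:
  assumes K: "small_groupoid K" and H: "small_groupoid H" and G: "small_groupoid G"
  shows "is_functor (prod_cat (full_subcat (biset_cat H G) (admissible H G)) (full_subcat (biset_cat K H) (admissible K H)))
     (full_subcat (biset_cat K G) (admissible K G)) (BComp burnside_bicat K H G)"
proof -
  interpret K: small_groupoid K by fact
  interpret H: small_groupoid H by fact
  interpret G: small_groupoid G by fact
  interpret HG: category "biset_cat H G" using category_biset_cat H.groupoid_axioms G.groupoid_axioms .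
  interpret KH: category "biset_cat K H" using category_biset_cat K.groupoid_axioms H.groupoid_axioms .
  interpret KG: category "biset_cat K G" using category_biset_cat K.groupoid_axioms G.groupoid_axioms .
  have ob: "X \<in> Obj (biset_cat H G) \<longleftrightarrow> biset H G X" "Y \<in> Obj (biset_cat K H) \<longleftrightarrow> biset K H Y"
    "Z \<in> Obj (biset_cat K G) \<longleftrightarrow> biset K G Z" for X Y Z
    using in_Obj_biset_cat K.groupoid_axioms H.groupoid_axioms G.groupoid_axioms by blast+
  have obT: "biset_tensor K H G X Y \<in> Obj (biset_cat K G)" if "biset H G X" "biset K H Y" for X Y
    unfolding ob using biset_pair.biset_tensor[OF biset_pair.intro[OF that] H.small_Obj] .
  show ?thesis
  proof (unfold_locales, goal_cases)
    case (1 p)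
    then show ?case
      by (auto simp: ob[symmetric] intro!: obT biset_pair.admissible_tensor[OF biset_pair.intro H.small_Obj])
  next
    case (2 p p' u)
    then show ?case
      by (cases p; cases p'; cases u) (auto simp: ob intro!: tensor_map_in_Hom biset_pair.intro H.small_Obj)
  next
    case (3 p)
    then obtain X Y where p: "p = (X, Y)" and X: "biset H G X" and Y: "biset K H Y" by (auto simp: ob)
    interpret P: biset_pair K H G X Y using X Y by (rule biset_pair.intro)
    have id: "Ident (biset_cat H G) X \<in> Hom (biset_cat H G) X X" "Ident (biset_cat K H) Y \<in> Hom (biset_cat K H) Y Y"
      using X Y by (simp_all add: ob)
    have "biset_tensor_map K H G X Y X Y (Ident (biset_cat H G) X) (Ident (biset_cat K H) Y)
      = Ident (biset_cat K G) (biset_tensor K H G X Y)"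
    proof (rule biset_hom_eqI[OF tensor_map_in_Hom[OF P.biset_pair_axioms P.biset_pair_axioms H.small_Obj id] KG.Ident_in_Hom[OF obT[OF X Y]]])
      fix \<kappa> \<gamma> z assume *: "\<kappa> \<in> Obj K" "\<gamma> \<in> Obj G" "z \<in> omap (biset_tensor K H G X Y) (\<kappa>, \<gamma>)"
      then show "biset_tensor_map K H G X Y X Y (Ident (biset_cat H G) X) (Ident (biset_cat K H) Y) (\<kappa>, \<gamma>) z
        = Ident (biset_cat K G) (biset_tensor K H G X Y) (\<kappa>, \<gamma>) z"
        by (auto elim!: P.tensorE simp: tensor_map_cls[OF P.biset_pair_axioms P.biset_pair_axioms id] biset_comp_apply)
    qed
    then show ?case by (simp add: p)
  next
    case (4 p p' p'' u v)
    then obtain X Y X' Y' X'' Y'' f g f' g' where p: "p = (X, Y)" "p' = (X', Y')" "p'' = (X'', Y'')" "u = (f, g)" "v = (f', g')"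
      and X: "biset H G X" "biset H G X'" "biset H G X''" and Y: "biset K H Y" "biset K H Y'" "biset K H Y''"
      and f: "f \<in> Hom (biset_cat H G) X X'" "f' \<in> Hom (biset_cat H G) X' X''"
      and g: "g \<in> Hom (biset_cat K H) Y Y'" "g' \<in> Hom (biset_cat K H) Y' Y''"
      by (cases p; cases p'; cases p''; cases u; cases v) (auto simp: ob)
    note P = biset_pair.intro[OF X(1) Y(1)] biset_pair.intro[OF X(2) Y(2)] biset_pair.intro[OF X(3) Y(3)]
    have ff: "Comp (biset_cat H G) X X' X'' f' f \<in> Hom (biset_cat H G) X X''"
      "Comp (biset_cat K H) Y Y' Y'' g' g \<in> Hom (biset_cat K H) Y Y''"
      by (rule HG.Comp_in_Hom KH.Comp_in_Hom; use f g X Y in \<open>simp add: ob\<close>)+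
    note m = tensor_map_in_Hom[OF P(1,2) H.small_Obj f(1) g(1)] tensor_map_in_Hom[OF P(2,3) H.small_Obj f(2) g(2)]
    have "biset_tensor_map K H G X Y X'' Y'' (Comp (biset_cat H G) X X' X'' f' f) (Comp (biset_cat K H) Y Y' Y'' g' g)
      = Comp (biset_cat K G) (biset_tensor K H G X Y) (biset_tensor K H G X' Y') (biset_tensor K H G X'' Y'')
         (biset_tensor_map K H G X' Y' X'' Y'' f' g') (biset_tensor_map K H G X Y X' Y' f g)"
    proof (rule biset_hom_eqI[OF tensor_map_in_Hom[OF P(1,3) H.small_Obj ff] KG.Comp_in_Hom[OF obT obT obT m]])
      fix \<kappa> \<gamma> z assume *: "\<kappa> \<in> Obj K" "\<gamma> \<in> Obj G" "z \<in> omap (biset_tensor K H G X Y) (\<kappa>, \<gamma>)"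
      then show "biset_tensor_map K H G X Y X'' Y'' (Comp (biset_cat H G) X X' X'' f' f) (Comp (biset_cat K H) Y Y' Y'' g' g) (\<kappa>, \<gamma>) z
        = Comp (biset_cat K G) (biset_tensor K H G X Y) (biset_tensor K H G X' Y') (biset_tensor K H G X'' Y'')
         (biset_tensor_map K H G X' Y' X'' Y'' f' g') (biset_tensor_map K H G X Y X' Y' f g) (\<kappa>, \<gamma>) z"
        using biset_homD[OF f(1) X(1,2)] biset_homD[OF g(1) Y(1,2)]
        by (auto elim!: biset_pair.tensorE[OF P(1)] simp: tensor_map_cls[OF P(1,3) ff] tensor_map_cls[OF P(1,2) f(1) g(1)]
           tensor_map_cls[OF P(2,3) f(2) g(2)] biset_comp_apply biset_pair.cls_in[OF P(1)])
    qed (use X Y in auto)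
    then show ?case by (simp add: p)
  qed
qed

lemma biset_assoc_natural:
  assumes C': "biset_chain L K H G X' Y' Z'" and C: "biset_chain L K H G X Y Z"
    and f: "f \<in> Hom (biset_cat H G) X' X" and g: "g \<in> Hom (biset_cat K H) Y' Y" and h: "h \<in> Hom (biset_cat L K) Z' Z"
  shows "Comp (biset_cat L G) (biset_tensor L K G (biset_tensor K H G X' Y') Z')
            (biset_tensor L K G (biset_tensor K H G X Y) Z) (biset_tensor L H G X (biset_tensor L K H Y Z))
            (biset_assoc L K H G X Y Z)
            (biset_tensor_map L K G (biset_tensor K H G X' Y') Z' (biset_tensor K H G X Y) Z
               (biset_tensor_map K H G X' Y' X Y f g) h)
        = Comp (biset_cat L G) (biset_tensor L K G (biset_tensor K H G X' Y') Z')
            (biset_tensor L H G X' (biset_tensor L K H Y' Z')) (biset_tensor L H G X (biset_tensor L K H Y Z))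
            (biset_tensor_map L H G X' (biset_tensor L K H Y' Z') X (biset_tensor L K H Y Z) f
               (biset_tensor_map L K H Y' Z' Y Z g h))
            (biset_assoc L K H G X' Y' Z')"
proof -
  interpret C': biset_chain L K H G X' Y' Z' by fact
  interpret C: biset_chain L K H G X Y Z by fact
  note fg = tensor_map_in_Hom[OF C'.XY.biset_pair_axioms C.XY.biset_pair_axioms C.small_ObH f g]
    and gh = tensor_map_in_Hom[OF C'.YZ.biset_pair_axioms C.YZ.biset_pair_axioms C.small_ObK g h]
  note D = biset_homD(1)[OF f C'.XY.X.biset_axioms C.XY.X.biset_axioms] biset_homD(1)[OF g C'.XY.Y.biset_axioms C.XY.Y.biset_axioms]
    biset_homD(1)[OF h C'.YZ.Y.biset_axioms C.YZ.Y.biset_axioms]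
  note M = tensor_map_cls[OF C'.XY.biset_pair_axioms C.XY.biset_pair_axioms f g]
    tensor_map_cls[OF C'.YZ.biset_pair_axioms C.YZ.biset_pair_axioms g h]
    tensor_map_cls[OF C'.XY_Z.biset_pair_axioms C.XY_Z.biset_pair_axioms fg h]
    tensor_map_cls[OF C'.X_YZ.biset_pair_axioms C.X_YZ.biset_pair_axioms f gh]
  show ?thesis
    by (rule biset_comp_eqI) (auto elim!: C'.tensor3E simp: M D)
qed

lemma biset_chainI:
  assumes "biset H G X" "biset K H Y" "biset L K Z" "small (Obj H)" "small (Obj K)"
  shows "biset_chain L K H G X Y Z"
  using assms by (auto intro!: biset_chain.intro biset_pair.intro biset_chain_axioms.intro)

text \<open>The structure maps have explicit values on pure tensors, and every element of a tensor
  product is one. The coherence laws therefore become identities between iterated pure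
  tensors.\<close>

theorem bicategory_burnside: "bicategory (burnside_bicat :: ('u::universe grpd, 'u biset, 'u \<times> 'u \<Rightarrow> 'u \<Rightarrow> 'u) bicat)"
proof (rule bicategory.intro, goal_cases)
  case (1 H G)
  then show ?case using category_core[OF category_burnside_hom] by simp
next
  case (2 K H G)
  then show ?case using is_functor_prod_core[OF category_burnside_hom category_burnside_hom functor_biset_tensor] by simp
next
  case (3 G)
  then have "small_groupoid G" by simp
  then show ?case using biset_unit admissible_unit burnside_onecell by (metis burnside_simps(5))
next
  case (4 L K H G X Y Z)
  then have G: "small_groupoid L" "small_groupoid K" "small_groupoid H" "small_groupoid G" by simp_all
  have X: "biset H G X" "biset K H Y" "biset L K Z" "admissible H G X" "admissible K H Y" "admissible L K Z"
    using 4(5-7) burnside_onecell G by blast+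
  interpret biset_chain L K H G X Y Z
    using X G by (intro biset_chainI) (auto simp: small_groupoid.small_Obj)
  have "category (full_subcat (biset_cat L G) (admissible L G))" using category_burnside_hom G by blast
  moreover have "biset_tensor L K G (biset_tensor K H G X Y) Z \<in> onecells burnside_bicat L G"
    "biset_tensor L H G X (biset_tensor L K H Y Z) \<in> onecells burnside_bicat L G"
    unfolding burnside_onecell[OF G(1,4)]
    using X XY_Z.biset_tensor X_YZ.biset_tensor XY_Z.admissible_tensor X_YZ.admissible_tensor XY.admissible_tensor YZ.admissible_tensor
      small_ObH small_ObK by auto
  ultimately show ?case using assoc_iso iso_arr_core by fastforce
next
  case (5 L K H G X' X f Y' Y g Z' Z h)
  then have G: "small_groupoid L" "small_groupoid K" "small_groupoid H" "small_groupoid G" by simp_all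
  have X: "biset H G X'" "biset H G X" "biset K H Y'" "biset K H Y" "biset L K Z'" "biset L K Z"
    using 5 burnside_onecell G by blast+
  note s = small_groupoid.small_Obj[OF G(3)] small_groupoid.small_Obj[OF G(2)]
  show ?case using 5(7,10,13)
    biset_assoc_natural[OF biset_chainI[OF X(1,3,5) s] biset_chainI[OF X(2,4,6) s], of f g h]
    by (simp add: iso_arr_in_Hom)
next
  case (6 H G X)
  then have G: "small_groupoid H" "small_groupoid G" by simp_all
  have X: "biset H G X" "admissible H G X" using 6(3) burnside_onecell[OF G] by blast+
  have "category (full_subcat (biset_cat H G) (admissible H G))" using category_burnside_hom G by blast
  moreover have "biset_tensor H G G (unit_biset G) X \<in> onecells burnside_bicat H G"
    unfolding burnside_onecell[OF G]
    using biset_pair.biset_tensor[OF biset_pair_lunit[OF G(2) X(1)] small_groupoid.small_Obj[OF G(2)]]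
      biset_pair.admissible_tensor[OF biset_pair_lunit[OF G(2) X(1)] small_groupoid.small_Obj[OF G(2)] admissible_unit[OF G(2)] X(2)] by blast
  ultimately show ?case using lunit_iso[OF G(2) X(1)] iso_arr_core 6(3) by fastforce
next
  case (7 H G X' X f)
  then have G: "small_groupoid H" "small_groupoid G" by simp_all
  have X: "biset H G X'" "biset H G X" using 7 burnside_onecell[OF G] by blast+
  note P = biset_pair_lunit[OF G(2) X(1)] biset_pair_lunit[OF G(2) X(2)]
  have f: "f \<in> Hom (biset_cat H G) X' X" using 7(5) by (simp add: iso_arr_in_Hom)
  have id: "Ident (biset_cat G G) (unit_biset G) \<in> Hom (biset_cat G G) (unit_biset G) (unit_biset G)"
    using category.Ident_in_Hom[OF category_biset_cat] in_Obj_biset_cat biset_unit[OF G(2)] by (metis biset_def)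
  show ?case unfolding burnside_simps core_simps full_subcat_simps
    by (rule biset_comp_eqI)
      (auto elim!: biset_pair.tensorE[OF P(1)] simp: tensor_map_cls[OF P id f] lunit_cls[OF G(2) X(1)] lunit_cls[OF G(2) X(2)]
        biset_comp_apply biset_homD[OF f X])
next
  case (8 H G X)
  then have G: "small_groupoid H" "small_groupoid G" by simp_all
  have X: "biset H G X" "admissible H G X" using 8(3) burnside_onecell[OF G] by blast+
  have "category (full_subcat (biset_cat H G) (admissible H G))" using category_burnside_hom G by blast
  moreover have "biset_tensor H H G X (unit_biset H) \<in> onecells burnside_bicat H G"
    unfolding burnside_onecell[OF G]
    using biset_pair.biset_tensor[OF biset_pair_runit[OF G(1) X(1)] small_groupoid.small_Obj[OF G(1)]]
      biset_pair.admissible_tensor[OF biset_pair_runit[OF G(1) X(1)] small_groupoid.small_Obj[OF G(1)] X(2) admissible_unit[OF G(1)]] by blast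
  ultimately show ?case using runit_iso[OF G(1) X(1)] iso_arr_core 8(3) by fastforce
next
  case (9 H G X' X f)
  then have G: "small_groupoid H" "small_groupoid G" by simp_all
  have X: "biset H G X'" "biset H G X" using 9 burnside_onecell[OF G] by blast+
  note P = biset_pair_runit[OF G(1) X(1)] biset_pair_runit[OF G(1) X(2)]
  have f: "f \<in> Hom (biset_cat H G) X' X" using 9(5) by (simp add: iso_arr_in_Hom)
  have id: "Ident (biset_cat H H) (unit_biset H) \<in> Hom (biset_cat H H) (unit_biset H) (unit_biset H)"
    using category.Ident_in_Hom[OF category_biset_cat] in_Obj_biset_cat biset_unit[OF G(1)] by (metis biset_def)
  show ?case unfolding burnside_simps core_simps full_subcat_simps
    by (rule biset_comp_eqI)
      (auto elim!: biset_pair.tensorE[OF P(1)] simp: tensor_map_cls[OF P f id] runit_cls[OF G(1) X(1)] runit_cls[OF G(1) X(2)]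
        biset_comp_apply biset_homD[OF f X])
next
  case (10 K H G X Y)
  then have G: "small_groupoid K" "small_groupoid H" "small_groupoid G" by simp_all
  interpret H: small_groupoid H by (rule G)
  have X: "biset H G X" "biset K H Y" using 10(4,5) burnside_onecell G by blast+
  interpret C: biset_chain K H H G X "unit_biset H" Y
    by (intro biset_chainI X biset_unit[OF G(2)] H.small_Obj)
  interpret P: biset_pair K H G X Y using X by (rule biset_pair.intro)
  have gpd: "groupoid K" "groupoid H" "groupoid G" using X by (simp_all add: biset_def)
  have id: "Ident (biset_cat H G) X \<in> Hom (biset_cat H G) X X" "Ident (biset_cat K H) Y \<in> Hom (biset_cat K H) Y Y"
    using category.Ident_in_Hom[OF category_biset_cat] in_Obj_biset_cat X gpd by blast+
  note l = lunit_in_Hom[OF G(2) X(2)] and r = runit_in_Hom[OF G(2) X(1)]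
  note M = tensor_map_cls[OF C.X_YZ.biset_pair_axioms P.biset_pair_axioms id(1) l]
    tensor_map_cls[OF C.XY_Z.biset_pair_axioms P.biset_pair_axioms r id(2)]
  have T: "biset_tensor K H G (biset_tensor H H G X (unit_biset H)) Y \<in> Obj (biset_cat K G)"
    "biset_tensor K H G X (biset_tensor K H H (unit_biset H) Y) \<in> Obj (biset_cat K G)" "biset_tensor K H G X Y \<in> Obj (biset_cat K G)"
    using in_Obj_biset_cat gpd C.XY_Z.biset_tensor C.X_YZ.biset_tensor P.biset_tensor H.small_Obj by blast+
  show ?case unfolding burnside_simps core_simps full_subcat_simps
  proof (rule biset_hom_eqI)
    show "Comp (biset_cat K G) (biset_tensor K H G (biset_tensor H H G X (unit_biset H)) Y)
       (biset_tensor K H G X (biset_tensor K H H (unit_biset H) Y)) (biset_tensor K H G X Y)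
       (biset_tensor_map K H G X (biset_tensor K H H (unit_biset H) Y) X Y (Ident (biset_cat H G) X) (biset_lunit K H Y))
       (biset_assoc K H H G X (unit_biset H) Y)
      \<in> Hom (biset_cat K G) (biset_tensor K H G (biset_tensor H H G X (unit_biset H)) Y) (biset_tensor K H G X Y)"
      by (rule category.Comp_in_Hom[OF category_biset_cat[OF gpd(1,3)] T C.assoc_in_Hom
            tensor_map_in_Hom[OF C.X_YZ.biset_pair_axioms P.biset_pair_axioms H.small_Obj id(1) l]])
    show "biset_tensor_map K H G (biset_tensor H H G X (unit_biset H)) Y X Y (biset_runit H G X) (Ident (biset_cat K H) Y)
      \<in> Hom (biset_cat K G) (biset_tensor K H G (biset_tensor H H G X (unit_biset H)) Y) (biset_tensor K H G X Y)"
      by (rule tensor_map_in_Hom[OF C.XY_Z.biset_pair_axioms P.biset_pair_axioms H.small_Obj r id(2)])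
    fix \<kappa> \<gamma> w assume *: "\<kappa> \<in> Obj K" "\<gamma> \<in> Obj G" "w \<in> omap (biset_tensor K H G (biset_tensor H H G X (unit_biset H)) Y) (\<kappa>, \<gamma>)"
    from *(3) obtain \<eta> \<eta>' x h y where w: "w = C.XY_Z.cls \<kappa> \<gamma> \<eta>' (C.XY.cls \<eta>' \<gamma> \<eta> x h) y"
      "\<eta> \<in> Obj H" "\<eta>' \<in> Obj H" "x \<in> omap X (\<eta>, \<gamma>)" "h \<in> Hom H \<eta>' \<eta>" "y \<in> omap Y (\<kappa>, \<eta>')"
      by (elim C.tensor3E) simp
    show "Comp (biset_cat K G) (biset_tensor K H G (biset_tensor H H G X (unit_biset H)) Y)
       (biset_tensor K H G X (biset_tensor K H H (unit_biset H) Y)) (biset_tensor K H G X Y)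
       (biset_tensor_map K H G X (biset_tensor K H H (unit_biset H) Y) X Y (Ident (biset_cat H G) X) (biset_lunit K H Y))
       (biset_assoc K H H G X (unit_biset H) Y) (\<kappa>, \<gamma>) w
      = biset_tensor_map K H G (biset_tensor H H G X (unit_biset H)) Y X Y (biset_runit H G X) (Ident (biset_cat K H) Y) (\<kappa>, \<gamma>) w"
      \<comment> \<open>The element [[x, h], y] goes to [x, h y] through the associator and the left
        unitor, and to [x h, y] through the right unitor; the triangle is the balancing
        relation.\<close>
      unfolding biset_comp_apply(1)[OF *] using w * P.cls_slide[OF *(1,2) w(2,3,5,4,6)]
      by (simp add: M biset_comp_apply lunit_cls[OF G(2) X(2)] runit_cls[OF G(2) X(1)])
  qed
next
  case (11 M L K H G W X Y Z)
  then have G: "small_groupoid M" "small_groupoid L" "small_groupoid K" "small_groupoid H" "small_groupoid G" by simp_all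
  note s = small_groupoid.small_Obj[OF G(2)] small_groupoid.small_Obj[OF G(3)] small_groupoid.small_Obj[OF G(4)]
  have B: "biset H G W" "biset K H X" "biset L K Y" "biset M L Z" using 11(6-9) burnside_onecell G by blast+
  have gpd: "groupoid M" "groupoid L" "groupoid K" "groupoid H" "groupoid G" using B by (simp_all add: biset_def)
  interpret WXY: biset_chain L K H G W X Y using B s by (intro biset_chainI)
  interpret XYZ: biset_chain M L K H X Y Z using B s by (intro biset_chainI)
  interpret WX_Y_Z: biset_chain M L K G "biset_tensor K H G W X" Y Z
    using B s by (intro biset_chainI WXY.XY.biset_tensor)
  interpret W_X_YZ: biset_chain M K H G W X "biset_tensor M L K Y Z"
    using B s by (intro biset_chainI XYZ.YZ.biset_tensor)
  interpret W_XY_Z: biset_chain M L H G W "biset_tensor L K H X Y" Z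
    using B s by (intro biset_chainI WXY.YZ.biset_tensor)
  have id: "Ident (biset_cat H G) W \<in> Hom (biset_cat H G) W W" "Ident (biset_cat M L) Z \<in> Hom (biset_cat M L) Z Z"
    using category.Ident_in_Hom[OF category_biset_cat] in_Obj_biset_cat B gpd by blast+
  note M = tensor_map_cls[OF WX_Y_Z.XY_Z.biset_pair_axioms W_XY_Z.XY_Z.biset_pair_axioms WXY.assoc_in_Hom id(2)]
    tensor_map_cls[OF W_XY_Z.X_YZ.biset_pair_axioms W_X_YZ.X_YZ.biset_pair_axioms id(1) XYZ.assoc_in_Hom]
  show ?case unfolding burnside_simps core_simps full_subcat_simps
  proof (rule biset_comp_eqI)
    fix \<mu> \<gamma> w assume *: "\<mu> \<in> Obj M" "\<gamma> \<in> Obj G"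
      "w \<in> omap (biset_tensor M L G (biset_tensor L K G (biset_tensor K H G W X) Y) Z) (\<mu>, \<gamma>)"
    from *(3) obtain \<kappa> l v y z where 1: "w = WX_Y_Z.XY_Z.cls \<mu> \<gamma> l (WXY.XY_Z.cls l \<gamma> \<kappa> v y) z"
      "\<kappa> \<in> Obj K" "l \<in> Obj L" "v \<in> omap (biset_tensor K H G W X) (\<kappa>, \<gamma>)" "y \<in> omap Y (l, \<kappa>)" "z \<in> omap Z (\<mu>, l)"
      by (rule WX_Y_Z.tensor3E)
    from 1(4) obtain \<eta> u x where 2: "v = WXY.XY.cls \<kappa> \<gamma> \<eta> u x" "\<eta> \<in> Obj H" "u \<in> omap W (\<eta>, \<gamma>)" "x \<in> omap X (\<kappa>, \<eta>)"
      by (rule WXY.XY.tensorE)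
    \<comment> \<open>Both paths send [[[u, x], y], z] to [u, [x, [y, z]]].\<close>
    show "biset_assoc M K H G W X (biset_tensor M L K Y Z) (\<mu>, \<gamma>)
         (biset_assoc M L K G (biset_tensor K H G W X) Y Z (\<mu>, \<gamma>) w)
      = biset_tensor_map M H G W (biset_tensor M L H (biset_tensor L K H X Y) Z) W (biset_tensor M K H X (biset_tensor M L K Y Z))
          (Ident (biset_cat H G) W) (biset_assoc M L K H X Y Z) (\<mu>, \<gamma>)
         (Comp (biset_cat M G) (biset_tensor M L G (biset_tensor L K G (biset_tensor K H G W X) Y) Z)
            (biset_tensor M L G (biset_tensor L H G W (biset_tensor L K H X Y)) Z)
            (biset_tensor M H G W (biset_tensor M L H (biset_tensor L K H X Y) Z))
            (biset_assoc M L H G W (biset_tensor L K H X Y) Z)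
            (biset_tensor_map M L G (biset_tensor L K G (biset_tensor K H G W X) Y) Z (biset_tensor L H G W (biset_tensor L K H X Y)) Z
              (biset_assoc L K H G W X Y) (Ident (biset_cat M L) Z)) (\<mu>, \<gamma>) w)"
      unfolding biset_comp_apply(1)[OF *] using 1(2-) 2 *(1,2) by (simp add: 1(1) M biset_comp_apply(2))
  qed
qed

section \<open>Double translation groupoids\<close>

lemma translation_simps [simp]:
  "utriple \<gamma> x \<eta> \<in> Ob (translation_span H G X) \<longleftrightarrow> \<gamma> \<in> Obj G \<and> \<eta> \<in> Obj H \<and> x \<in> omap X (\<eta>, \<gamma>)"
  "u \<in> Ar (translation_span H G X) a b \<longleftrightarrow> (\<exists>g h. u = upair g h \<and> g \<in> Hom G (u1 a) (u1 b) \<and> h \<in> Hom H (u3 a) (u3 b) \<and>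
      lact H X (u3 a) (u1 a) (u1 b) g (u2 a) = ract G X (u1 b) (u3 b) (u3 a) h (u2 b))"
  "Cp (translation_span H G X) a b c v u = upair (Comp G (u1 a) (u1 b) (u1 c) (ufst v) (ufst u))
      (Comp H (u3 a) (u3 b) (u3 c) (usnd v) (usnd u))"
  "Ide (translation_span H G X) a = upair (Ident G (u1 a)) (Ident H (u3 a))"
  "Lo (translation_span H G X) a = u3 a" "La (translation_span H G X) a b u = usnd u"
  "Ro (translation_span H G X) a = u1 a" "Ra (translation_span H G X) a b u = ufst u"
  by (auto simp: translation_span_def translation_groupoid_def)

lemma translation_ObE:
  assumes "a \<in> Ob (translation_span H G X)"
  obtains \<gamma> x \<eta> where "a = utriple \<gamma> x \<eta>" "\<gamma> \<in> Obj G" "\<eta> \<in> Obj H" "x \<in> omap X (\<eta>, \<gamma>)"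
  using assms by (auto simp: translation_span_def translation_groupoid_def)

lemma (in biset) translation_comp:
  assumes ob: "\<eta> \<in> Obj H" "\<eta>' \<in> Obj H" "\<eta>'' \<in> Obj H" "\<gamma> \<in> Obj G" "\<gamma>' \<in> Obj G" "\<gamma>'' \<in> Obj G"
    and x: "x \<in> omap X (\<eta>, \<gamma>)" "x' \<in> omap X (\<eta>', \<gamma>')" "x'' \<in> omap X (\<eta>'', \<gamma>'')"
    and g: "g \<in> Hom G \<gamma> \<gamma>'" "g' \<in> Hom G \<gamma>' \<gamma>''" and h: "h \<in> Hom H \<eta> \<eta>'" "h' \<in> Hom H \<eta>' \<eta>''"
    and e: "lact H X \<eta> \<gamma> \<gamma>' g x = ract G X \<gamma>' \<eta>' \<eta> h x'" "lact H X \<eta>' \<gamma>' \<gamma>'' g' x' = ract G X \<gamma>'' \<eta>'' \<eta>' h' x''"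
  shows "lact H X \<eta> \<gamma> \<gamma>'' (Comp G \<gamma> \<gamma>' \<gamma>'' g' g) x = ract G X \<gamma>'' \<eta>'' \<eta> (Comp H \<eta> \<eta>' \<eta>'' h' h) x''"
  using ob x g h by (simp add: e)

lemma (in biset) translation_inv:
  assumes ob: "\<eta> \<in> Obj H" "\<eta>' \<in> Obj H" "\<gamma> \<in> Obj G" "\<gamma>' \<in> Obj G"
    and x: "x \<in> omap X (\<eta>, \<gamma>)" "x' \<in> omap X (\<eta>', \<gamma>')"
    and g: "g \<in> Hom G \<gamma> \<gamma>'" and h: "h \<in> Hom H \<eta> \<eta>'" and e: "lact H X \<eta> \<gamma> \<gamma>' g x = ract G X \<gamma>' \<eta>' \<eta> h x'"
  shows "lact H X \<eta>' \<gamma>' \<gamma> (inv_arr G \<gamma> \<gamma>' g) x' = ract G X \<gamma> \<eta> \<eta>' (inv_arr H \<eta> \<eta>' h) x"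
proof -
  have "x' = ract G X \<gamma>' \<eta> \<eta>' (inv_arr H \<eta> \<eta>' h) (lact H X \<eta> \<gamma> \<gamma>' g x)" using ob x g h by (simp add: e)
  also have "lact H X \<eta>' \<gamma>' \<gamma> (inv_arr G \<gamma> \<gamma>' g) \<dots> = ract G X \<gamma> \<eta> \<eta>' (inv_arr H \<eta> \<eta>' h) x"
    using ob x g h by simp
  finally show ?thesis .
qed

lemma groupoid_translation:
  assumes X: "biset H G X"
  shows "groupoid (apex (translation_span H G X))"
proof -
  interpret X: biset H G X by fact
  show ?thesis
    unfolding translation_span_def translation_groupoid_def span.simps
  proof (rule groupoid_pair_cat[OF X.G.groupoid_axioms X.H.groupoid_axioms], goal_cases)
    case (4 a b c f f' g g') then show ?case by (auto intro!: X.translation_comp)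
  next
    case (5 a b f g) then show ?case by (auto intro!: X.translation_inv)
  qed auto
qed

text \<open>Two arrows (g1, h) and (g2, h) between the same objects satisfy g1 x = x' h = g2 x, and
  freeness gives g1 = g2.\<close>

lemma faithful_translation:
  assumes X: "biset H G X" and adm: "admissible H G X"
  shows "faithful_span H G (translation_span H G X)"
proof -
  interpret X: biset H G X by fact
  interpret groupoid "apex (translation_span H G X)" using groupoid_translation[OF X] .
  show ?thesis
  proof (unfold_locales, goal_cases)
    case (9 a b f g)
    then obtain \<gamma> x \<eta> \<gamma>' x' \<eta>' g1 h1 g2 where *: "a = utriple \<gamma> x \<eta>" "\<gamma> \<in> Obj G" "\<eta> \<in> Obj H" "x \<in> omap X (\<eta>, \<gamma>)"
      "b = utriple \<gamma>' x' \<eta>'" "\<gamma>' \<in> Obj G" "\<eta>' \<in> Obj H" "x' \<in> omap X (\<eta>', \<gamma>')"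
      "f = upair g1 h1" "g = upair g2 h1" "g1 \<in> Hom G \<gamma> \<gamma>'" "g2 \<in> Hom G \<gamma> \<gamma>'"
      "lact H X \<eta> \<gamma> \<gamma>' g1 x = lact H X \<eta> \<gamma> \<gamma>' g2 x"
      by (auto elim!: translation_ObE)
    then have "g1 = g2" using adm unfolding admissible_def X.free_iff by blast
    then show ?case using * by simp
  qed (auto elim!: translation_ObE)
qed

text \<open>An arrow h : \<eta> \<rightarrow> \<eta>' lifts to (1, h) with target (\<gamma>, x h^-1,
  \<eta>'). The arrows of the fiber over \<eta> are the pairs (g, 1), so its components are the
  orbits of the \<open>G\<close>-set at \<eta>, and generators of that set represent them.\<close>

lemma correspondence_translation:
  assumes H: "small_groupoid H" and G: "small_groupoid G" and X: "biset H G X" and adm: "admissible H G X"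
  shows "correspondence H G (translation_span H G X)"
proof -
  interpret H: small_groupoid H by fact
  interpret G: small_groupoid G by fact
  interpret X: biset H G X by fact
  interpret T: faithful_span H G "translation_span H G X" using faithful_translation[OF X adm] .
  have "small_groupoid (apex (translation_span H G X))"
    unfolding translation_span_def translation_groupoid_def span.simps
  proof (rule small_groupoid_pair_cat)
    have "small {utriple \<gamma> x \<eta> |\<gamma> x \<eta>. \<gamma> \<in> Obj G \<and> \<eta> \<in> Obj H \<and> x \<in> omap X (\<eta>, \<gamma>)}"
      by (rule small_utriple[OF G.small_Obj H.small_Obj]) (rule X.small_El)
    then show "small {utriple \<gamma> x \<eta> |\<gamma> x \<eta>. \<gamma> \<in> Obj G \<and> \<eta> \<in> Obj H \<and> x \<in> omap X (\<eta>, \<gamma>)}" .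
  qed (use T.A.groupoid_axioms H G in \<open>auto simp: translation_span_def translation_groupoid_def\<close>)
  moreover have "fibration (apex (translation_span H G X)) H (lleg (translation_span H G X))"
    unfolding fibration_def
  proof (intro ballI)
    fix a \<eta>' h assume "a \<in> Ob (translation_span H G X)" and h: "\<eta>' \<in> Obj H" "h \<in> Hom H (Lo (translation_span H G X) a) \<eta>'"
    then obtain \<gamma> x \<eta> where a: "a = utriple \<gamma> x \<eta>" "\<gamma> \<in> Obj G" "\<eta> \<in> Obj H" "x \<in> omap X (\<eta>, \<gamma>)" by (elim translation_ObE)
    then show "\<exists>b\<in>Ob (translation_span H G X). Lo (translation_span H G X) b = \<eta>' \<and>
      (\<exists>l\<in>Ar (translation_span H G X) a b. La (translation_span H G X) a b l = h)"
      using h by (intro bexI[of _ "utriple \<gamma> (ract G X \<gamma> \<eta> \<eta>' (inv_arr H \<eta> \<eta>' h) x) \<eta>'"] conjI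
          bexI[of _ "upair (Ident G \<gamma>) h"]) auto
  qed
  moreover have "finite (components (fiber (apex (translation_span H G X)) H (lleg (translation_span H G X)) \<eta>))"
    if \<eta>: "\<eta> \<in> Obj H" for \<eta>
  proof -
    have "finitely_generated G (upper_part H X \<eta>)" using adm \<eta> by (simp add: admissible_def)
    from this[unfolded X.finitely_generated_iff[OF \<eta>]] obtain R where "finite R \<and> R \<subseteq> (SIGMA \<gamma>:Obj G. omap X (\<eta>, \<gamma>)) \<and>
      (\<forall>\<gamma>\<in>Obj G. \<forall>x\<in>omap X (\<eta>, \<gamma>). \<exists>b\<in>R. \<exists>g\<in>Hom G \<gamma> (fst b). snd b = lact H X \<eta> \<gamma> (fst b) g x)" by (rule exE)
    then have R: "finite R" "R \<subseteq> (SIGMA \<gamma>:Obj G. omap X (\<eta>, \<gamma>))"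
      "\<And>\<gamma> x. \<gamma> \<in> Obj G \<Longrightarrow> x \<in> omap X (\<eta>, \<gamma>) \<Longrightarrow> \<exists>b\<in>R. \<exists>g\<in>Hom G \<gamma> (fst b). snd b = lact H X \<eta> \<gamma> (fst b) g x" by auto
    let ?R = "(\<lambda>b. utriple (fst b) (snd b) \<eta>) ` R"
    show ?thesis
      unfolding finite_components_fiber_iff[OF T.A.groupoid_axioms H.groupoid_axioms T.q.is_functor_axioms \<eta>]
    proof (intro exI[of _ ?R] conjI ballI impI)
      show "finite ?R" using R by simp
      show "?R \<subseteq> {a \<in> Ob (translation_span H G X). Lo (translation_span H G X) a = \<eta>}" using R(2) \<eta> by auto
      fix a assume a: "a \<in> Ob (translation_span H G X)" "Lo (translation_span H G X) a = \<eta>"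
      then obtain \<gamma> x where a: "a = utriple \<gamma> x \<eta>" "\<gamma> \<in> Obj G" "x \<in> omap X (\<eta>, \<gamma>)" by (auto elim!: translation_ObE)
      obtain b g where b: "b \<in> R" "g \<in> Hom G \<gamma> (fst b)" "snd b = lact H X \<eta> \<gamma> (fst b) g x" using R(3)[OF a(2,3)] by blast
      have "fst b \<in> Obj G" using R(2) b by auto
      then show "\<exists>b\<in>?R. \<exists>l\<in>Ar (translation_span H G X) a b. La (translation_span H G X) a b l = Ident H \<eta>"
        using a b \<eta> by (intro bexI[OF _ imageI[OF b(1)]] bexI[of _ "upair g (Ident H \<eta>)"]) auto
    qed
  qed
  moreover have "l = l'" if "l \<in> Hom (fiber (apex (translation_span H G X)) H (lleg (translation_span H G X)) \<eta>) a b"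
    "l' \<in> Hom (fiber (apex (translation_span H G X)) H (lleg (translation_span H G X)) \<eta>) a b"
    "a \<in> Obj (fiber (apex (translation_span H G X)) H (lleg (translation_span H G X)) \<eta>)"
    "b \<in> Obj (fiber (apex (translation_span H G X)) H (lleg (translation_span H G X)) \<eta>)" for l l' a b \<eta>
    using that T.faithful[of a b l l'] unfolding fiber_def by (simp del: translation_simps)
  ultimately show ?thesis
    unfolding correspondence_def weak_finite_cover_def
    using T.p.is_functor_axioms T.q.is_functor_axioms by blast
qed

subsection \<open>The functors on morphism categories\<close>

definition translation_map :: "('u::universe \<times> 'u \<Rightarrow> 'u \<Rightarrow> 'u) \<Rightarrow> ('u, 'u, 'u, 'u) fctr" where
  "translation_map f = \<lparr>omap = (\<lambda>a. utriple (u1 a) (f (u3 a, u1 a) (u2 a)) (u3 a)), amap = (\<lambda>a b m. m)\<rparr>"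

lemma translation_map_simps [simp]:
  "omap (translation_map f) a = utriple (u1 a) (f (u3 a, u1 a) (u2 a)) (u3 a)" "amap (translation_map f) a b m = m"
  by (simp_all add: translation_map_def)

lemma Phi_simps [simp]:
  "omap (Phi H G) X = translation_span H G X"
  "amap (Phi H G) X' X f = strict_class H G (translation_span H G X') (translation_span H G X) (translation_map f)"
  by (simp_all add: Phi_def strict_class_def translation_map_def)

lemma strict_map_translation:
  assumes X': "biset H G X'" and X: "biset H G X" and f: "f \<in> Hom (biset_cat H G) X' X"
  shows "strict_map (translation_span H G X') (translation_span H G X) (translation_map f)"
proof -
  interpret X': biset H G X' by fact
  interpret X: biset H G X by fact
  note D = biset_homD[OF f X' X]
  have "is_functor (apex (translation_span H G X')) (apex (translation_span H G X)) (translation_map f)"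
  proof (unfold_locales, goal_cases)
    case (1 a) then show ?case using D(1) by (auto elim!: translation_ObE)
  next
    case (2 a b m)
    then obtain \<gamma> x \<eta> \<gamma>' x' \<eta>' g h where *: "a = utriple \<gamma> x \<eta>" "\<gamma> \<in> Obj G" "\<eta> \<in> Obj H" "x \<in> omap X' (\<eta>, \<gamma>)"
      "b = utriple \<gamma>' x' \<eta>'" "\<gamma>' \<in> Obj G" "\<eta>' \<in> Obj H" "x' \<in> omap X' (\<eta>', \<gamma>')"
      "m = upair g h" "g \<in> Hom G \<gamma> \<gamma>'" "h \<in> Hom H \<eta> \<eta>'" "lact H X' \<eta> \<gamma> \<gamma>' g x = ract G X' \<gamma>' \<eta>' \<eta> h x'"
      by (auto elim!: translation_ObE)
    then show ?case using D(2)[of \<eta> \<gamma> x \<gamma>' g] D(3)[of \<eta>' \<gamma>' x' \<eta> h] by simp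
  qed (auto elim!: translation_ObE)
  then show ?thesis by (auto simp: strict_map_def elim!: translation_ObE)
qed

text \<open>\<open>Phi\<close> is first studied on all morphisms of admissible bi-sets, with values
  in \<open>corr_cat\<close>; \<open>is_functor_core\<close> later restricts it to the
  isomorphisms.\<close>

lemma is_functor_Phi:
  assumes H: "small_groupoid H" and G: "small_groupoid G"
  shows "is_functor (full_subcat (biset_cat H G) (admissible H G)) (corr_cat H G) (Phi H G)"
proof -
  interpret H: small_groupoid H by fact
  interpret G: small_groupoid G by fact
  interpret C: category "biset_cat H G" using category_biset_cat H.groupoid_axioms G.groupoid_axioms .
  have ob: "X \<in> Obj (biset_cat H G) \<longleftrightarrow> biset H G X" for X
    using in_Obj_biset_cat H.groupoid_axioms G.groupoid_axioms by blast
  show ?thesis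
  proof (unfold_locales, goal_cases)
    case (1 X) then show ?case using correspondence_translation[OF H G] by (simp add: ob)
  next
    case (2 X' X f)
    then have "biset H G X'" "admissible H G X'" "biset H G X" "admissible H G X" "f \<in> Hom (biset_cat H G) X' X" by (auto simp: ob)
    then show ?case unfolding Phi_simps by (intro strict_class_in_Hom faithful_translation strict_map_translation)
  next
    case (3 X)
    then have X: "biset H G X" "admissible H G X" by (auto simp: ob)
    have i: "Ident (biset_cat H G) X \<in> Hom (biset_cat H G) X X" using X by (simp add: ob)
    show ?case unfolding Phi_simps full_subcat_simps corr_cat_simps(3) strict_class_def[symmetric]
      by (rule strict_class_eqI[OF faithful_translation[OF X] faithful_translation[OF X] strict_map_translation[OF X(1,1) i] strict_map_id])
        (auto elim!: translation_ObE simp: biset_comp_apply)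
  next
    case (4 X1 X2 X3 f g)
    then have X: "biset H G X1" "admissible H G X1" "biset H G X2" "admissible H G X2" "biset H G X3" "admissible H G X3"
      and f: "f \<in> Hom (biset_cat H G) X1 X2" and g: "g \<in> Hom (biset_cat H G) X2 X3" by (auto simp: ob)
    have gf: "Comp (biset_cat H G) X1 X2 X3 g f \<in> Hom (biset_cat H G) X1 X3" using X f g by (intro C.Comp_in_Hom) (auto simp: ob)
    note F = faithful_translation[OF X(1,2)] faithful_translation[OF X(3,4)] faithful_translation[OF X(5,6)]
      and t = strict_map_translation[OF X(1,3) f] strict_map_translation[OF X(3,5) g]
    show ?case unfolding Phi_simps full_subcat_simps strict_class_comp[OF F t]
      by (rule strict_class_eqI[OF F(1,3) strict_map_translation[OF X(1,5) gf] strict_map_comp[OF t]])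
        (auto elim!: translation_ObE simp: biset_comp_apply)
  qed
qed

text \<open>An equivalence between (1, t, 1) and (1, t', 1) supplies at (\<gamma>, x, \<eta>) an
  arrow from f x to f' x with both components identities, and such an arrow forces f x = f'
  x.\<close>

lemma Phi_faithful:
  assumes X': "biset H G X'" "admissible H G X'" and X: "biset H G X" "admissible H G X"
    and f: "f \<in> Hom (biset_cat H G) X' X" "f' \<in> Hom (biset_cat H G) X' X"
    and eq: "amap (Phi H G) X' X f = amap (Phi H G) X' X f'"
  shows "f = f'"
proof (rule biset_hom_eqI[OF f])
  interpret X: biset H G X by fact
  note F = faithful_translation[OF X'] faithful_translation[OF X]
  fix \<eta> \<gamma> x assume *: "\<eta> \<in> Obj H" "\<gamma> \<in> Obj G" "x \<in> omap X' (\<eta>, \<gamma>)"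
  have "pointwise_equiv H G (translation_span H G X') (translation_span H G X)
    (strict_triple H G (translation_span H G X') (translation_map f)) (strict_triple H G (translation_span H G X') (translation_map f'))"
    using eq triple_class_eq_iff[OF F is_triple_strict[OF F strict_map_translation[OF X'(1) X(1) f(1)]]
        is_triple_strict[OF F strict_map_translation[OF X'(1) X(1) f(2)]]] by (simp add: strict_class_def)
  then obtain m where "m \<in> Ar (translation_span H G X) (utriple \<gamma> (f (\<eta>, \<gamma>) x) \<eta>) (utriple \<gamma> (f' (\<eta>, \<gamma>) x) \<eta>)"
    "Comp H \<eta> \<eta> \<eta> (usnd m) (Ident H \<eta>) = Ident H \<eta>" "Comp G \<gamma> \<gamma> \<gamma> (ufst m) (Ident G \<gamma>) = Ident G \<gamma>"
    unfolding strict_triple_def pointwise_equiv.simps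
    using * by (auto simp del: translation_simps(2) dest!: bspec[where x = "utriple \<gamma> x \<eta>"])
  then show "f (\<eta>, \<gamma>) x = f' (\<eta>, \<gamma>) x"
    using * biset_homD(1)[OF f(1) X'(1) X(1) *] biset_homD(1)[OF f(2) X'(1) X(1) *] by auto
qed

text \<open>Let t send (\<gamma>, x, \<eta>) to (\<gamma>1, x1, \<eta>1). The only possible preimage
  has f x = \<theta>^-1 x1 \<phi>, because the arrow of the translation groupoid realising the
  equivalence must be (\<theta>, \<phi>).\<close>

lemma Phi_full:
  assumes X': "biset H G X'" "admissible H G X'" and X: "biset H G X" "admissible H G X"
    and c: "c \<in> Hom (corr_cat H G) (translation_span H G X') (translation_span H G X)"
  shows "\<exists>f\<in>Hom (biset_cat H G) X' X. amap (Phi H G) X' X f = c"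
proof -
  interpret X': biset H G X' by fact
  interpret X: biset H G X by fact
  let ?T' = "translation_span H G X'" and ?T = "translation_span H G X"
  note F = faithful_translation[OF X'] faithful_translation[OF X]
  obtain \<phi> t \<theta> where u: "is_triple H G ?T' ?T (\<phi>, t, \<theta>)" and c: "c = triple_class H G ?T' ?T (\<phi>, t, \<theta>)" using c by auto
  interpret u: span_triple H G ?T' ?T \<phi> t \<theta> using is_triple_iff[OF F] u by blast
  define f where "f = (\<lambda>p\<in>Obj H \<times> Obj G. \<lambda>x\<in>omap X' p. let a = utriple (snd p) x (fst p); b = omap t a in
     lact H X (fst p) (u1 b) (snd p) (inv_arr G (snd p) (u1 b) (\<theta> a)) (ract G X (u1 b) (u3 b) (fst p) (\<phi> a) (u2 b)))"
  have fx: "f (\<eta>, \<gamma>) x \<in> omap X (\<eta>, \<gamma>) \<and> (\<exists>\<gamma>1 x1 \<eta>1. omap t (utriple \<gamma> x \<eta>) = utriple \<gamma>1 x1 \<eta>1 \<and> \<gamma>1 \<in> Obj G \<and> \<eta>1 \<in> Obj H \<and>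
      x1 \<in> omap X (\<eta>1, \<gamma>1) \<and> \<theta> (utriple \<gamma> x \<eta>) \<in> Hom G \<gamma> \<gamma>1 \<and> \<phi> (utriple \<gamma> x \<eta>) \<in> Hom H \<eta> \<eta>1 \<and>
      f (\<eta>, \<gamma>) x = lact H X \<eta> \<gamma>1 \<gamma> (inv_arr G \<gamma> \<gamma>1 (\<theta> (utriple \<gamma> x \<eta>))) (ract G X \<gamma>1 \<eta>1 \<eta> (\<phi> (utriple \<gamma> x \<eta>)) x1))"
    if *: "\<eta> \<in> Obj H" "\<gamma> \<in> Obj G" "x \<in> omap X' (\<eta>, \<gamma>)" for \<eta> \<gamma> x
  proof -
    let ?a = "utriple \<gamma> x \<eta>"
    have a: "?a \<in> Ob ?T'" using * by simp
    then have "omap t ?a \<in> Ob ?T" by simp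
    then obtain \<gamma>1 x1 \<eta>1 where b: "omap t ?a = utriple \<gamma>1 x1 \<eta>1" "\<gamma>1 \<in> Obj G" "\<eta>1 \<in> Obj H" "x1 \<in> omap X (\<eta>1, \<gamma>1)"
      by (rule translation_ObE)
    have \<theta>: "\<theta> ?a \<in> Hom G \<gamma> \<gamma>1" "\<phi> ?a \<in> Hom H \<eta> \<eta>1" using u.r.in_Hom[OF a] u.l.in_Hom[OF a] b by auto
    have "f (\<eta>, \<gamma>) x = lact H X \<eta> \<gamma>1 \<gamma> (inv_arr G \<gamma> \<gamma>1 (\<theta> ?a)) (ract G X \<gamma>1 \<eta>1 \<eta> (\<phi> ?a) x1)"
      using * by (simp add: f_def b Let_def)
    moreover have "lact H X \<eta> \<gamma>1 \<gamma> (inv_arr G \<gamma> \<gamma>1 (\<theta> ?a)) (ract G X \<gamma>1 \<eta>1 \<eta> (\<phi> ?a) x1) \<in> omap X (\<eta>, \<gamma>)"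
      using * b \<theta> by (intro X.lact_in X.ract_in) auto
    ultimately show ?thesis using b \<theta> by metis
  qed
  \<comment> \<open>Compatibility with an arbitrary arrow (g, h) of the translation groupoid
    contains both equivariance laws: h = 1 gives the left one and g = 1 the right one.\<close>
  have key: "lact H X \<eta> \<gamma> \<gamma>' g (f (\<eta>, \<gamma>) x) = ract G X \<gamma>' \<eta>' \<eta> h (f (\<eta>', \<gamma>') x')"
    if *: "\<eta> \<in> Obj H" "\<gamma> \<in> Obj G" "x \<in> omap X' (\<eta>, \<gamma>)" and w1: "\<eta>' \<in> Obj H" "\<gamma>' \<in> Obj G" "x' \<in> omap X' (\<eta>', \<gamma>')"
      and g: "g \<in> Hom G \<gamma> \<gamma>'" and h: "h \<in> Hom H \<eta> \<eta>'" and e: "lact H X' \<eta> \<gamma> \<gamma>' g x = ract G X' \<gamma>' \<eta>' \<eta> h x'" for \<eta> \<gamma> x \<eta>' \<gamma>' x' g h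
  proof -
    let ?a = "utriple \<gamma> x \<eta>" and ?b = "utriple \<gamma>' x' \<eta>'"
    have ab: "?a \<in> Ob ?T'" "?b \<in> Ob ?T'" "upair g h \<in> Ar ?T' ?a ?b" using * w1 g h e by auto
    obtain \<gamma>1 x1 \<eta>1 where 1: "omap t ?a = utriple \<gamma>1 x1 \<eta>1" "\<gamma>1 \<in> Obj G" "\<eta>1 \<in> Obj H"
      "x1 \<in> omap X (\<eta>1, \<gamma>1)" "\<theta> ?a \<in> Hom G \<gamma> \<gamma>1" "\<phi> ?a \<in> Hom H \<eta> \<eta>1"
      "f (\<eta>, \<gamma>) x = lact H X \<eta> \<gamma>1 \<gamma> (inv_arr G \<gamma> \<gamma>1 (\<theta> ?a)) (ract G X \<gamma>1 \<eta>1 \<eta> (\<phi> ?a) x1)"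
      using fx[OF *] by blast
    obtain \<gamma>2 x2 \<eta>2 where 2: "omap t ?b = utriple \<gamma>2 x2 \<eta>2" "\<gamma>2 \<in> Obj G" "\<eta>2 \<in> Obj H"
      "x2 \<in> omap X (\<eta>2, \<gamma>2)" "\<theta> ?b \<in> Hom G \<gamma>' \<gamma>2" "\<phi> ?b \<in> Hom H \<eta>' \<eta>2"
      "f (\<eta>', \<gamma>') x' = lact H X \<eta>' \<gamma>2 \<gamma>' (inv_arr G \<gamma>' \<gamma>2 (\<theta> ?b)) (ract G X \<gamma>2 \<eta>2 \<eta>' (\<phi> ?b) x2)"
      using fx[OF w1] by blast
    have "amap t ?a ?b (upair g h) \<in> Ar ?T (omap t ?a) (omap t ?b)" using u.l.t.amap_in_Hom[OF ab] .
    then obtain g1 h1 where gh: "amap t ?a ?b (upair g h) = upair g1 h1" "g1 \<in> Hom G \<gamma>1 \<gamma>2" "h1 \<in> Hom H \<eta>1 \<eta>2"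
      "lact H X \<eta>1 \<gamma>1 \<gamma>2 g1 x1 = ract G X \<gamma>2 \<eta>2 \<eta>1 h1 x2" unfolding 1 2 by auto
    \<comment> \<open>Naturality of \<phi> and \<theta> at (g, h), where t (g, h) = (g1,
      h1).\<close>
    have n: "Comp H \<eta> \<eta>' \<eta>2 (\<phi> ?b) h = Comp H \<eta> \<eta>1 \<eta>2 h1 (\<phi> ?a)" "Comp G \<gamma> \<gamma>' \<gamma>2 (\<theta> ?b) g = Comp G \<gamma> \<gamma>1 \<gamma>2 g1 (\<theta> ?a)"
      using u.l.nat[OF ab] u.r.nat[OF ab] by (simp_all add: 1 2 gh del: u.l.nat_eq u.r.nat_eq)
    have n': "Comp G \<gamma>1 \<gamma> \<gamma>' g (inv_arr G \<gamma> \<gamma>1 (\<theta> ?a)) = Comp G \<gamma>1 \<gamma>2 \<gamma>' (inv_arr G \<gamma>' \<gamma>2 (\<theta> ?b)) g1"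
      by (rule X'.G.square_inv[OF n(2)]) (use 1 2 gh * w1 g in auto)
    have "lact H X \<eta> \<gamma> \<gamma>' g (f (\<eta>, \<gamma>) x) = lact H X \<eta> \<gamma>1 \<gamma>' (Comp G \<gamma>1 \<gamma> \<gamma>' g (inv_arr G \<gamma> \<gamma>1 (\<theta> ?a))) (ract G X \<gamma>1 \<eta>1 \<eta> (\<phi> ?a) x1)"
      unfolding 1(7) using 1(2-6) * w1 g by (intro X.lact_Comp[symmetric] X.ract_in) auto
    also have "\<dots> = lact H X \<eta> \<gamma>2 \<gamma>' (inv_arr G \<gamma>' \<gamma>2 (\<theta> ?b)) (ract G X \<gamma>2 \<eta>1 \<eta> (\<phi> ?a) (lact H X \<eta>1 \<gamma>1 \<gamma>2 g1 x1))"
      unfolding n' using 1(2-6) 2(2-6) * w1 gh by simp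
    also have "\<dots> = lact H X \<eta> \<gamma>2 \<gamma>' (inv_arr G \<gamma>' \<gamma>2 (\<theta> ?b)) (ract G X \<gamma>2 \<eta>2 \<eta> (Comp H \<eta> \<eta>1 \<eta>2 h1 (\<phi> ?a)) x2)"
      unfolding gh(4) using 1(2-6) 2(2-6) * w1 gh by simp
    also have "\<dots> = ract G X \<gamma>' \<eta>' \<eta> h (f (\<eta>', \<gamma>') x')"
      unfolding n(1)[symmetric] 2(7) using 1(2-6) 2(2-6) * w1 h by simp
    finally show ?thesis .
  qed
  have f: "f \<in> Hom (biset_cat H G) X' X"
  proof (rule biset_homI[OF X'(1) X(1)])
    show "f \<in> extensional (Obj H \<times> Obj G)" by (simp add: f_def)
    show "f (\<eta>, \<gamma>) \<in> omap X' (\<eta>, \<gamma>) \<rightarrow>\<^sub>E omap X (\<eta>, \<gamma>)" if "\<eta> \<in> Obj H" "\<gamma> \<in> Obj G" for \<eta> \<gamma>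
      by (rule PiE_I) (use fx[OF that] that in \<open>auto simp: f_def\<close>)
  next
    fix \<eta> \<gamma> \<gamma>' g x assume *: "\<eta> \<in> Obj H" "\<gamma> \<in> Obj G" "\<gamma>' \<in> Obj G" "g \<in> Hom G \<gamma> \<gamma>'" "x \<in> omap X' (\<eta>, \<gamma>)"
    have "lact H X \<eta> \<gamma> \<gamma>' g (f (\<eta>, \<gamma>) x) = ract G X \<gamma>' \<eta> \<eta> (Ident H \<eta>) (f (\<eta>, \<gamma>') (lact H X' \<eta> \<gamma> \<gamma>' g x))"
      by (rule key) (use * in auto)
    then show "f (\<eta>, \<gamma>') (lact H X' \<eta> \<gamma> \<gamma>' g x) = lact H X \<eta> \<gamma> \<gamma>' g (f (\<eta>, \<gamma>) x)"
      using * fx[OF *(1,3), of "lact H X' \<eta> \<gamma> \<gamma>' g x"] by simp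
  next
    fix \<eta> \<eta>' \<gamma> h x assume *: "\<eta> \<in> Obj H" "\<eta>' \<in> Obj H" "\<gamma> \<in> Obj G" "h \<in> Hom H \<eta>' \<eta>" "x \<in> omap X' (\<eta>, \<gamma>)"
    have "lact H X \<eta>' \<gamma> \<gamma> (Ident G \<gamma>) (f (\<eta>', \<gamma>) (ract G X' \<gamma> \<eta> \<eta>' h x)) = ract G X \<gamma> \<eta> \<eta>' h (f (\<eta>, \<gamma>) x)"
      by (rule key) (use * in auto)
    then show "f (\<eta>', \<gamma>) (ract G X' \<gamma> \<eta> \<eta>' h x) = ract G X \<gamma> \<eta> \<eta>' h (f (\<eta>, \<gamma>) x)"
      using * fx[OF *(2,3), of "ract G X' \<gamma> \<eta> \<eta>' h x"] by simp
  qed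
  have st: "is_triple H G ?T' ?T (strict_triple H G ?T' (translation_map f))"
    by (rule is_triple_strict[OF F strict_map_translation[OF X'(1) X(1) f]])
  have "pointwise_equiv H G ?T' ?T (strict_triple H G ?T' (translation_map f)) (\<phi>, t, \<theta>)"
    unfolding strict_triple_def pointwise_equiv.simps
  proof
    fix a assume "a \<in> Ob ?T'"
    then obtain \<gamma> x \<eta> where a: "a = utriple \<gamma> x \<eta>" and *: "\<eta> \<in> Obj H" "\<gamma> \<in> Obj G" "x \<in> omap X' (\<eta>, \<gamma>)" by (rule translation_ObE)
    obtain \<gamma>1 x1 \<eta>1 where 1: "omap t a = utriple \<gamma>1 x1 \<eta>1" "\<gamma>1 \<in> Obj G" "\<eta>1 \<in> Obj H"
      "x1 \<in> omap X (\<eta>1, \<gamma>1)" "\<theta> a \<in> Hom G \<gamma> \<gamma>1" "\<phi> a \<in> Hom H \<eta> \<eta>1"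
      "f (\<eta>, \<gamma>) x = lact H X \<eta> \<gamma>1 \<gamma> (inv_arr G \<gamma> \<gamma>1 (\<theta> a)) (ract G X \<gamma>1 \<eta>1 \<eta> (\<phi> a) x1)"
      using fx[OF *] unfolding a by blast
    have aa: "u1 a = \<gamma>" "u2 a = x" "u3 a = \<eta>" by (simp_all add: a)
    have "upair (\<theta> a) (\<phi> a) \<in> Ar ?T (utriple \<gamma> (f (\<eta>, \<gamma>) x) \<eta>) (omap t a)"
      unfolding translation_simps utriple_simps 1 using 1(2-6) *
      by (intro exI[of _ "\<theta> a"] exI[of _ "\<phi> a"] conjI refl) (simp_all add: X.ract_in del: X.lact_ract)
    then show "\<exists>m\<in>Ar ?T (omap (translation_map f) a) (omap t a).
      Comp H (Lo ?T' a) (Lo ?T (omap (translation_map f) a)) (Lo ?T (omap t a))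
        (La ?T (omap (translation_map f) a) (omap t a) m) (Ident H (Lo ?T' a)) = \<phi> a \<and>
      Comp G (Ro ?T' a) (Ro ?T (omap (translation_map f) a)) (Ro ?T (omap t a))
        (Ra ?T (omap (translation_map f) a) (omap t a) m) (Ident G (Ro ?T' a)) = \<theta> a"
      using 1(1-6) * by (intro bexI[of _ "upair (\<theta> a) (\<phi> a)"]) (simp_all add: aa)
  qed
  then have "amap (Phi H G) X' X f = c"
    unfolding Phi_simps strict_class_def c triple_class_eq_iff[OF F st u] .
  then show ?thesis using f by blast
qed

subsection \<open>The bi-set of a correspondence\<close>

text \<open>A correspondence $H \leftarrow L \to G$ arises from the tensor product over \<open>L\<close> of the bi-sets
  $G(p-,-)$ and $H(-,q-)$; the pair $[g, h]$ at \<open>\<lambda>\<close> with $h : \eta \to q\lambda$ and $g : p\lambda \to \gamma$ is an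
  element of its value at $(\eta, \gamma)$.\<close>

definition right_biset :: "'u::universe grpd \<Rightarrow> 'u span \<Rightarrow> 'u biset" where
  "right_biset G S = \<lparr>omap = (\<lambda>(a, \<gamma>). Hom G (Ro S a) \<gamma>),
     amap = (\<lambda>(a, \<gamma>) (a', \<gamma>') (l, g). \<lambda>f\<in>Hom G (Ro S a) \<gamma>.
       Comp G (Ro S a') \<gamma> \<gamma>' g (Comp G (Ro S a') (Ro S a) \<gamma> f (Ra S a' a l)))\<rparr>"

definition left_biset :: "'u::universe grpd \<Rightarrow> 'u span \<Rightarrow> 'u biset" where
  "left_biset H S = \<lparr>omap = (\<lambda>(\<eta>, a). Hom H \<eta> (Lo S a)),
     amap = (\<lambda>(\<eta>, a) (\<eta>', a') (h, l). \<lambda>f\<in>Hom H \<eta> (Lo S a).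
       Comp H \<eta>' (Lo S a) (Lo S a') (La S a a' l) (Comp H \<eta>' \<eta> (Lo S a) f h))\<rparr>"

definition span_biset :: "'u::universe grpd \<Rightarrow> 'u grpd \<Rightarrow> 'u span \<Rightarrow> 'u biset" where
  "span_biset H G S = biset_tensor H (apex S) G (right_biset G S) (left_biset H S)"

lemma leg_biset_omap [simp]:
  "omap (right_biset G S) (a, \<gamma>) = Hom G (Ro S a) \<gamma>" "omap (left_biset H S) (\<eta>, a) = Hom H \<eta> (Lo S a)"
  by (simp_all add: right_biset_def left_biset_def)

locale small_corr = H: small_groupoid H + G: small_groupoid G + A: small_groupoid "apex S" + faithful_span H G S
  for H G :: "'u::universe grpd" and S :: "'u span" +
  assumes corr: "correspondence H G S"
begin

lemma biset_right: "biset (apex S) G (right_biset G S)"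
  by (rule bisetI) (auto simp: A.groupoid_axioms G.groupoid_axioms G.small_Hom, auto simp: right_biset_def)

lemma biset_left: "biset H (apex S) (left_biset H S)"
  by (rule bisetI) (auto simp: H.groupoid_axioms A.groupoid_axioms H.small_Hom, auto simp: left_biset_def)

sublocale P: biset_pair H "apex S" G "right_biset G S" "left_biset H S"
  using biset_right biset_left by (rule biset_pair.intro)

lemma leg_act [simp]:
  "\<lbrakk>a \<in> Ob S; \<gamma> \<in> Obj G; f \<in> Hom G (Ro S a) \<gamma>; \<gamma>' \<in> Obj G; g \<in> Hom G \<gamma> \<gamma>'\<rbrakk>
    \<Longrightarrow> lact (apex S) (right_biset G S) a \<gamma> \<gamma>' g f = Comp G (Ro S a) \<gamma> \<gamma>' g f"
  "\<lbrakk>a \<in> Ob S; \<gamma> \<in> Obj G; f \<in> Hom G (Ro S a) \<gamma>; a' \<in> Ob S; l \<in> Ar S a' a\<rbrakk>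
    \<Longrightarrow> ract G (right_biset G S) \<gamma> a a' l f = Comp G (Ro S a') (Ro S a) \<gamma> f (Ra S a' a l)"
  "\<lbrakk>a \<in> Ob S; \<eta> \<in> Obj H; k \<in> Hom H \<eta> (Lo S a); a' \<in> Ob S; l \<in> Ar S a a'\<rbrakk>
    \<Longrightarrow> lact H (left_biset H S) \<eta> a a' l k = Comp H \<eta> (Lo S a) (Lo S a') (La S a a' l) k"
  "\<lbrakk>a \<in> Ob S; \<eta> \<in> Obj H; k \<in> Hom H \<eta> (Lo S a); \<eta>' \<in> Obj H; h \<in> Hom H \<eta>' \<eta>\<rbrakk>
    \<Longrightarrow> ract (apex S) (left_biset H S) a \<eta> \<eta>' h k = Comp H \<eta>' \<eta> (Lo S a) k h"
  unfolding lact_eq ract_eq by (simp_all add: right_biset_def left_biset_def)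

lemma admissible_right: "admissible (apex S) G (right_biset G S)"
  unfolding admissible_def
proof (intro ballI conjI)
  fix a assume a: "a \<in> Ob S"
  show "free_gset G (upper_part (apex S) (right_biset G S) a)"
    unfolding P.X.free_iff using a by (auto dest: G.cancel_right)
  show "finitely_generated G (upper_part (apex S) (right_biset G S) a)"
    unfolding P.X.finitely_generated_iff[OF a]
  proof (intro exI[of _ "{(Ro S a, Ident G (Ro S a))}"] conjI ballI)
    fix \<gamma> f assume "\<gamma> \<in> Obj G" "f \<in> omap (right_biset G S) (a, \<gamma>)"
    then show "\<exists>b\<in>{(Ro S a, Ident G (Ro S a))}. \<exists>g\<in>Hom G \<gamma> (fst b). snd b = lact (apex S) (right_biset G S) a \<gamma> (fst b) g f"
      using a by (auto intro!: bexI[of _ "inv_arr G (Ro S a) \<gamma> f"])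
  qed (use a in auto)
qed

text \<open>All parts of the weak finite cover property enter here. Faithfulness of q is freeness of
  the action of the apex. For generation, let k : \<eta> \<rightarrow> q a; the fibration lifts k^-1
  to an arrow from a into the fiber over \<eta>, and a further arrow of that fiber reaches one of
  finitely many representatives b. Together they carry k to the identity of \<eta> at b.\<close>

lemma admissible_left: "admissible H (apex S) (left_biset H S)"
  unfolding admissible_def
proof (intro ballI conjI)
  fix \<eta> assume \<eta>: "\<eta> \<in> Obj H"
  show "free_gset (apex S) (upper_part H (left_biset H S) \<eta>)"
    unfolding P.Y.free_iff using \<eta> by (auto dest: faithful_cancel)
  have "finite (components (fiber (apex S) H (lleg S) \<eta>))"
    using corr \<eta> by (simp add: correspondence_def weak_finite_cover_def)
  from this[unfolded finite_components_fiber_iff[OF A.groupoid_axioms H.groupoid_axioms q.is_functor_axioms \<eta>]]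
  obtain R where "finite R \<and> R \<subseteq> {a \<in> Ob S. Lo S a = \<eta>} \<and>
      (\<forall>a\<in>Ob S. Lo S a = \<eta> \<longrightarrow> (\<exists>b\<in>R. \<exists>l\<in>Ar S a b. La S a b l = Ident H \<eta>))" by (rule exE)
  then have R: "finite R" "R \<subseteq> {a \<in> Ob S. Lo S a = \<eta>}"
     "\<And>a. a \<in> Ob S \<Longrightarrow> Lo S a = \<eta> \<Longrightarrow> \<exists>b\<in>R. \<exists>l\<in>Ar S a b. La S a b l = Ident H \<eta>" by simp_all
  show "finitely_generated (apex S) (upper_part H (left_biset H S) \<eta>)"
    unfolding P.Y.finitely_generated_iff[OF \<eta>]
  proof (intro exI[of _ "(\<lambda>b. (b, Ident H \<eta>)) ` R"] conjI ballI)
    fix a k assume a: "a \<in> Ob S" and "k \<in> omap (left_biset H S) (\<eta>, a)"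
    then have k: "k \<in> Hom H \<eta> (Lo S a)" by simp
    have "fibration (apex S) H (lleg S)" using corr by (simp add: correspondence_def weak_finite_cover_def)
    then obtain a' l where a': "a' \<in> Ob S" "Lo S a' = \<eta>" "l \<in> Ar S a a'" "La S a a' l = inv_arr H \<eta> (Lo S a) k"
      unfolding fibration_def using a k \<eta> by (metis H.inv_in_Hom q.omap_in_Obj)
    obtain b l' where b: "b \<in> R" "l' \<in> Ar S a' b" "La S a' b l' = Ident H \<eta>" using R(3)[OF a'(1,2)] by blast
    have b': "b \<in> Ob S" "Lo S b = \<eta>" using R b by auto
    show "\<exists>c\<in>(\<lambda>b. (b, Ident H \<eta>)) ` R. \<exists>l\<in>Ar S a (fst c). snd c = lact H (left_biset H S) \<eta> a (fst c) l k"
      by (rule bexI[OF _ imageI[OF b(1)]], rule bexI[of _ "Cp S a a' b l' l"]) (use a k a' b b' \<eta> in simp_all)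
  qed (use R \<eta> in auto)
qed

lemma biset_span_biset: "biset H G (span_biset H G S)"
  unfolding span_biset_def using P.biset_tensor[OF A.small_Obj] .

lemma admissible_span_biset: "admissible H G (span_biset H G S)"
  unfolding span_biset_def using P.admissible_tensor[OF A.small_Obj admissible_right admissible_left] .

end

lemma small_corrI:
  assumes "small_groupoid H" "small_groupoid G" "correspondence H G S"
  shows "small_corr H G S"
  using assms correspondence_faithful[OF assms]
  by (auto simp: small_corr_def small_corr_axioms_def correspondence_def)

text \<open>The comparison of a correspondence with the translation groupoid of its bi-set: an
  object a is sent to the class of the pair of identities at a.\<close>

definition span_unit :: "'u::universe grpd \<Rightarrow> 'u grpd \<Rightarrow> 'u span \<Rightarrow> ('u, 'u, 'u, 'u) fctr" where
  "span_unit H G S = \<lparr>omap = (\<lambda>a. utriple (Ro S a)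
      (biset_tensor_class H (apex S) G (right_biset G S) (left_biset H S) (Lo S a) (Ro S a)
        (utriple a (Ident G (Ro S a)) (Ident H (Lo S a)))) (Lo S a)),
     amap = (\<lambda>a b l. upair (Ra S a b l) (La S a b l))\<rparr>"

context small_corr
begin

lemma span_unit_simps [simp]:
  "omap (span_unit H G S) a = utriple (Ro S a) (P.cls (Lo S a) (Ro S a) a (Ident G (Ro S a)) (Ident H (Lo S a))) (Lo S a)"
  "amap (span_unit H G S) a b l = upair (Ra S a b l) (La S a b l)"
  by (simp_all add: span_unit_def)

lemma span_biset_act [simp]:
  "\<lbrakk>\<eta> \<in> Obj H; \<gamma> \<in> Obj G; \<gamma>' \<in> Obj G; g \<in> Hom G \<gamma> \<gamma>'; a \<in> Ob S; f \<in> Hom G (Ro S a) \<gamma>; k \<in> Hom H \<eta> (Lo S a)\<rbrakk>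
    \<Longrightarrow> lact H (span_biset H G S) \<eta> \<gamma> \<gamma>' g (P.cls \<eta> \<gamma> a f k) = P.cls \<eta> \<gamma>' a (Comp G (Ro S a) \<gamma> \<gamma>' g f) k"
  "\<lbrakk>\<eta> \<in> Obj H; \<eta>' \<in> Obj H; \<gamma> \<in> Obj G; h \<in> Hom H \<eta>' \<eta>; a \<in> Ob S; f \<in> Hom G (Ro S a) \<gamma>; k \<in> Hom H \<eta> (Lo S a)\<rbrakk>
    \<Longrightarrow> ract G (span_biset H G S) \<gamma> \<eta> \<eta>' h (P.cls \<eta> \<gamma> a f k) = P.cls \<eta>' \<gamma> a f (Comp H \<eta>' \<eta> (Lo S a) k h)"
  unfolding span_biset_def by simp_all

lemma span_cls_in [simp]:
  "\<lbrakk>a \<in> Ob S; f \<in> Hom G (Ro S a) \<gamma>; k \<in> Hom H \<eta> (Lo S a)\<rbrakk> \<Longrightarrow> P.cls \<eta> \<gamma> a f k \<in> omap (span_biset H G S) (\<eta>, \<gamma>)"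
  unfolding span_biset_def by simp

lemma span_cls_eq_iff:
  assumes "\<eta> \<in> Obj H" "\<gamma> \<in> Obj G" "a \<in> Ob S" "f \<in> Hom G (Ro S a) \<gamma>" "k \<in> Hom H \<eta> (Lo S a)"
    "a' \<in> Ob S" "f' \<in> Hom G (Ro S a') \<gamma>" "k' \<in> Hom H \<eta> (Lo S a')"
  shows "P.cls \<eta> \<gamma> a f k = P.cls \<eta> \<gamma> a' f' k' \<longleftrightarrow>
    (\<exists>l\<in>Ar S a a'. f = Comp G (Ro S a) (Ro S a') \<gamma> f' (Ra S a a' l) \<and> k' = Comp H \<eta> (Lo S a) (Lo S a') (La S a a' l) k)"
  by (subst P.cls_eq_iff) (use assms in auto)

lemma span_bisetE:
  assumes "z \<in> omap (span_biset H G S) (\<eta>, \<gamma>)"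
  obtains a f k where "z = P.cls \<eta> \<gamma> a f k" "a \<in> Ob S" "f \<in> Hom G (Ro S a) \<gamma>" "k \<in> Hom H \<eta> (Lo S a)"
  using assms unfolding span_biset_def by (elim P.tensorE) simp

text \<open>Compatibility with an arrow l of the apex is the equation [p l, 1] = [1, q l], witnessed
  by l itself.\<close>

lemma strict_map_span_unit: "strict_map S (translation_span H G (span_biset H G S)) (span_unit H G S)"
proof -
  have "is_functor (apex S) (apex (translation_span H G (span_biset H G S))) (span_unit H G S)"
  proof (unfold_locales, goal_cases)
    case (2 a b l)
    then have "P.cls (Lo S a) (Ro S b) a (Ra S a b l) (Ident H (Lo S a)) = P.cls (Lo S a) (Ro S b) b (Ident G (Ro S b)) (La S a b l)"
      by (subst span_cls_eq_iff) (auto intro!: bexI[of _ l])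
    then show ?case using 2 by simp
  qed auto
  then show ?thesis by (auto simp: strict_map_def)
qed

lemma faithful_translation_span_biset: "faithful_span H G (translation_span H G (span_biset H G S))"
  by (rule faithful_translation[OF biset_span_biset admissible_span_biset])

text \<open>Fullness: an arrow (g, h) between the images of a and b means [g, 1] = [1, h], and the
  single arrow l witnessing this has p l = g and q l = h. Essential surjectivity: the object over
  [f, k] at a is reached from the image of a by (f, k^-1).\<close>

lemma iso_span_unit:
  "iso_arr (corr_cat H G) S (translation_span H G (span_biset H G S))
     (strict_class H G S (translation_span H G (span_biset H G S)) (span_unit H G S))"
  unfolding strict_class_def strict_triple_def
proof (rule iso_arr_corrI[OF faithful_span_axioms faithful_translation_span_biset])
  show "is_triple H G S (translation_span H G (span_biset H G S)) (\<lambda>a. Ident H (Lo S a), span_unit H G S, \<lambda>a. Ident G (Ro S a))"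
    using is_triple_strict[OF faithful_span_axioms faithful_translation_span_biset strict_map_span_unit]
    by (simp add: strict_triple_def)
next
  fix a b m assume ab: "a \<in> Ob S" "b \<in> Ob S"
    and "m \<in> Ar (translation_span H G (span_biset H G S)) (omap (span_unit H G S) a) (omap (span_unit H G S) b)"
  then obtain g h where m: "m = upair g h" "g \<in> Hom G (Ro S a) (Ro S b)" "h \<in> Hom H (Lo S a) (Lo S b)"
    "P.cls (Lo S a) (Ro S b) a g (Ident H (Lo S a)) = P.cls (Lo S a) (Ro S b) b (Ident G (Ro S b)) h" by auto
  then obtain l where "l \<in> Ar S a b" "g = Ra S a b l" "h = La S a b l"
    using ab by (subst (asm) span_cls_eq_iff) auto
  then show "\<exists>f\<in>Ar S a b. amap (span_unit H G S) a b f = m" using m by auto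
next
  fix b assume "b \<in> Ob (translation_span H G (span_biset H G S))"
  then obtain \<gamma> z \<eta> where b: "b = utriple \<gamma> z \<eta>" "\<gamma> \<in> Obj G" "\<eta> \<in> Obj H" "z \<in> omap (span_biset H G S) (\<eta>, \<gamma>)"
    by (rule translation_ObE)
  from b(4) obtain a f k where z: "z = P.cls \<eta> \<gamma> a f k" "a \<in> Ob S" "f \<in> Hom G (Ro S a) \<gamma>" "k \<in> Hom H \<eta> (Lo S a)" by (rule span_bisetE)
  have "upair f (inv_arr H \<eta> (Lo S a) k) \<in> Ar (translation_span H G (span_biset H G S)) (omap (span_unit H G S) a) b"
    using b z by simp
  then show "\<exists>a\<in>Ob S. Ar (translation_span H G (span_biset H G S)) (omap (span_unit H G S) a) b \<noteq> {}" using z(2) by blast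
qed

end

text \<open>Every 2-cell becomes strict after composition with the isomorphism given by
  \<^const>\<open>span_unit\<close>, which reduces naturality statements to strict maps.\<close>

lemma strictify:
  assumes H: "small_groupoid H" and G: "small_groupoid G" and S': "correspondence H G S'" and S: "correspondence H G S"
    and c: "c \<in> Hom (corr_cat H G) S' S"
  shows "\<exists>T e d. correspondence H G T \<and> strict_map S T e \<and> iso_arr (corr_cat H G) S T (strict_class H G S T e) \<and>
    strict_map S' T d \<and> Comp (corr_cat H G) S' S T (strict_class H G S T e) c = strict_class H G S' T d"
proof -
  interpret S: small_corr H G S using small_corrI[OF H G S] .
  note F = correspondence_faithful[OF H G S'] S.faithful_span_axioms S.faithful_translation_span_biset
  obtain \<phi> t \<theta> where u: "is_triple H G S' S (\<phi>, t, \<theta>)" and c: "c = triple_class H G S' S (\<phi>, t, \<theta>)" using c by auto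
  interpret u: span_triple H G S' S \<phi> t \<theta> using is_triple_iff[OF F(1,2)] u by blast
  let ?T = "translation_span H G (span_biset H G S)"
  \<comment> \<open>The pair [\<theta>^-1, \<phi>] at t a lies over the objects p' a and q' a, so
    the transformations move into the object and the legs commute strictly.\<close>
  define d where "d = \<lparr>omap = (\<lambda>a. utriple (Ro S' a) (S.P.cls (Lo S' a) (Ro S' a) (omap t a)
      (inv_arr G (Ro S' a) (Ro S (omap t a)) (\<theta> a)) (\<phi> a)) (Lo S' a)),
     amap = (\<lambda>a b f. upair (Ra S' a b f) (La S' a b f))\<rparr>"
  have d_simps [simp]: "omap d a = utriple (Ro S' a) (S.P.cls (Lo S' a) (Ro S' a) (omap t a)
      (inv_arr G (Ro S' a) (Ro S (omap t a)) (\<theta> a)) (\<phi> a)) (Lo S' a)" "amap d a b f = upair (Ra S' a b f) (La S' a b f)" for a b f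
    by (simp_all add: d_def)
  have "is_functor (apex S') (apex ?T) d"
  proof (unfold_locales, goal_cases)
    case (2 a b f)
    have "S.P.cls (Lo S' a) (Ro S' b) (omap t a) (Comp G (Ro S (omap t a)) (Ro S' a) (Ro S' b) (Ra S' a b f) (inv_arr G (Ro S' a) (Ro S (omap t a)) (\<theta> a))) (\<phi> a)
      = S.P.cls (Lo S' a) (Ro S' b) (omap t b) (inv_arr G (Ro S' b) (Ro S (omap t b)) (\<theta> b)) (Comp H (Lo S' a) (Lo S' b) (Lo S (omap t b)) (\<phi> b) (La S' a b f))"
    proof (subst S.span_cls_eq_iff)
      show "\<exists>l\<in>Ar S (omap t a) (omap t b).
        Comp G (Ro S (omap t a)) (Ro S' a) (Ro S' b) (Ra S' a b f) (inv_arr G (Ro S' a) (Ro S (omap t a)) (\<theta> a))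
        = Comp G (Ro S (omap t a)) (Ro S (omap t b)) (Ro S' b) (inv_arr G (Ro S' b) (Ro S (omap t b)) (\<theta> b)) (Ra S (omap t a) (omap t b) l) \<and>
        Comp H (Lo S' a) (Lo S' b) (Lo S (omap t b)) (\<phi> b) (La S' a b f)
        = Comp H (Lo S' a) (Lo S (omap t a)) (Lo S (omap t b)) (La S (omap t a) (omap t b) l) (\<phi> a)"
        by (rule bexI[of _ "amap t a b f"], rule conjI, rule S.G.square_inv) (use 2 in auto)
    qed (use 2 in \<open>auto simp del: u.l.nat u.l.nat_eq\<close>)
    then show ?case using 2 by (simp del: u.l.nat u.l.nat_eq)
  qed auto
  then have d: "strict_map S' ?T d" by (auto simp: strict_map_def)
  note st = is_triple_strict[OF F(2,3) S.strict_map_span_unit] is_triple_strict[OF F(1,3) d]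
  have "pointwise_equiv H G S' ?T (triple_comp H G S' S ?T (strict_triple H G S (span_unit H G S)) (\<phi>, t, \<theta>)) (strict_triple H G S' d)"
    unfolding strict_triple_def triple_comp.simps pointwise_equiv.simps
  proof
    fix a assume a: "a \<in> Ob S'"
    \<comment> \<open>From [1, 1] at t a the arrow (\<theta>^-1, \<phi>^-1) leads to
      [\<theta>^-1, \<phi>], and it turns the components \<phi> and \<theta> of the composite into
      identities.\<close>
    have m: "upair (inv_arr G (Ro S' a) (Ro S (omap t a)) (\<theta> a)) (inv_arr H (Lo S' a) (Lo S (omap t a)) (\<phi> a))
       \<in> Ar ?T (omap (comp_fctr (span_unit H G S) t) a) (omap d a)" using a by simp
    show "\<exists>m\<in>Ar ?T (omap (comp_fctr (span_unit H G S) t) a) (omap d a).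
      Comp H (Lo S' a) (Lo ?T (omap (comp_fctr (span_unit H G S) t) a)) (Lo ?T (omap d a))
        (La ?T (omap (comp_fctr (span_unit H G S) t) a) (omap d a) m)
        (Comp H (Lo S' a) (Lo S (omap t a)) (Lo ?T (omap (span_unit H G S) (omap t a))) (Ident H (Lo S (omap t a))) (\<phi> a)) = Ident H (Lo S' a) \<and>
      Comp G (Ro S' a) (Ro ?T (omap (comp_fctr (span_unit H G S) t) a)) (Ro ?T (omap d a))
        (Ra ?T (omap (comp_fctr (span_unit H G S) t) a) (omap d a) m)
        (Comp G (Ro S' a) (Ro S (omap t a)) (Ro ?T (omap (span_unit H G S) (omap t a))) (Ident G (Ro S (omap t a))) (\<theta> a)) = Ident G (Ro S' a)"
      by (rule bexI[OF _ m]) (use a in simp)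
  qed
  then have "Comp (corr_cat H G) S' S ?T (strict_class H G S ?T (span_unit H G S)) c = strict_class H G S' ?T d"
    unfolding c strict_class_def corr_comp_class[OF F u st(1)] triple_class_eq_iff[OF F(1,3) is_triple_comp[OF F u st(1)] st(2)] .
  then show ?thesis
    using d S.strict_map_span_unit S.iso_span_unit correspondence_translation[OF H G S.biset_span_biset S.admissible_span_biset] by blast
qed

text \<open>Passing to cores leaves fullness to be checked: a preimage of an invertible 2-cell is
  invertible because \<open>Phi\<close> is fully faithful on all 2-cells. Essential surjectivity is
  the inverse of \<open>iso_span_unit\<close>.\<close>

lemma equivalence_Phi:
  assumes H: "small_groupoid H" and G: "small_groupoid G"
  shows "equivalence_of_categories (core (full_subcat (biset_cat H G) (admissible H G))) (core (corr_cat H G)) (Phi H G)"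
proof -
  let ?B = "full_subcat (biset_cat H G) (admissible H G)"
  have ob: "X \<in> Obj ?B \<longleftrightarrow> biset H G X \<and> admissible H G X" for X using burnside_onecell[OF H G] by simp
  note cB = category_burnside_hom[OF H G] and F = is_functor_Phi[OF H G] and cC = category_corr_cat[OF H G]
  have full: "\<exists>f\<in>Hom ?B X' X. amap (Phi H G) X' X f = c"
    if "X' \<in> Obj ?B" "X \<in> Obj ?B" "c \<in> Hom (corr_cat H G) (omap (Phi H G) X') (omap (Phi H G) X)" for X' X c
    using Phi_full[of H G X' X c] that(1,2)[unfolded ob] that(3) by simp
  have faithful: "f = f'" if "X' \<in> Obj ?B" "X \<in> Obj ?B" "f \<in> Hom ?B X' X" "f' \<in> Hom ?B X' X"
    "amap (Phi H G) X' X f = amap (Phi H G) X' X f'" for X' X f f'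
    using Phi_faithful[of H G X' X f f'] that(1,2)[unfolded ob] that(3-5) by simp
  show ?thesis
  proof (rule equivalence_of_categoriesI[OF category_core[OF cB] category_core[OF cC] is_functor_core[OF cB F]])
    fix X' X c assume *: "X' \<in> Obj (core ?B)" "X \<in> Obj (core ?B)" "c \<in> Hom (core (corr_cat H G)) (omap (Phi H G) X') (omap (Phi H G) X)"
    then have **: "X' \<in> Obj ?B" "X \<in> Obj ?B" and c: "iso_arr (corr_cat H G) (omap (Phi H G) X') (omap (Phi H G) X) c" by simp_all
    obtain f where f: "f \<in> Hom ?B X' X" "amap (Phi H G) X' X f = c" using full[OF ** iso_arr_in_Hom[OF c]] by blast
    have "iso_arr ?B X' X f"
      by (rule ff_reflects_iso[OF cB F full faithful ** f(1)]) (use c f in auto)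
    then show "\<exists>f\<in>Hom (core ?B) X' X. amap (Phi H G) X' X f = c" using f by auto
  next
    fix X' X f f' assume "X' \<in> Obj (core ?B)" "X \<in> Obj (core ?B)" "f \<in> Hom (core ?B) X' X" "f' \<in> Hom (core ?B) X' X"
      "amap (Phi H G) X' X f = amap (Phi H G) X' X f'"
    then show "f = f'" using faithful[of X' X f f'] by (simp add: iso_arr_in_Hom)
  next
    fix S assume "S \<in> Obj (core (corr_cat H G))"
    then have S: "correspondence H G S" by simp
    interpret S: small_corr H G S using small_corrI[OF H G S] .
    interpret C: category "corr_cat H G" by (rule cC)
    have T: "translation_span H G (span_biset H G S) \<in> Obj (corr_cat H G)"
      using correspondence_translation[OF H G S.biset_span_biset S.admissible_span_biset] by simp
    have "\<exists>e. iso_arr (corr_cat H G) (translation_span H G (span_biset H G S)) S e"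
      using C.iso_arr_inv_arr[OF S.iso_span_unit] T S by auto
    then show "\<exists>X\<in>Obj (core ?B). \<exists>e. iso_arr (core (corr_cat H G)) (omap (Phi H G) X) S e"
      using S.biset_span_biset S.admissible_span_biset iso_arr_core[OF cC T] S ob by (intro bexI[of _ "span_biset H G S"]) auto
  qed
qed

section \<open>The bicategory of correspondences\<close>

lemma correspondence_bicat_simps [simp]:
  "BOb correspondence_bicat = {G. small_groupoid G}"
  "BHom correspondence_bicat H G = core (corr_cat H G)"
  "omap (BComp correspondence_bicat H G F) (A, B) = pullback_span A B"
  "amap (BComp correspondence_bicat H G F) (A', B') (A, B) (c, d) = corr_hcomp H G F A' B' A B c d"
  "BUnit correspondence_bicat = unit_span" "BAssoc correspondence_bicat = corr_assoc"
  "BLUnit correspondence_bicat = corr_lunit" "BRUnit correspondence_bicat = corr_runit"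
  by (simp_all add: correspondence_bicat_def)

lemma corr_Ident: "Ident (corr_cat H G) S = strict_class H G S S id_fctr"
  by (simp add: strict_class_def)

lemma unit_span_simps [simp]: "apex (unit_span G) = G" "lleg (unit_span G) = id_fctr" "rleg (unit_span G) = id_fctr"
  by (simp_all add: unit_span_def)

text \<open>The fiber of the identity functor over \<gamma> has the single object \<gamma> and a
  single arrow.\<close>

lemma correspondence_unit:
  assumes G: "small_groupoid G"
  shows "correspondence G G (unit_span G)"
proof -
  interpret G: small_groupoid G by fact
  have "finite (components (fiber G G id_fctr \<gamma>))" if "\<gamma> \<in> Obj G" for \<gamma>
    unfolding finite_components_fiber_iff[OF G.groupoid_axioms G.groupoid_axioms is_functor_id that]
    using that by (intro exI[of _ "{\<gamma>}"]) auto
  then show ?thesis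
    using G is_functor_id by (auto simp: correspondence_def weak_finite_cover_def fibration_def fiber_def)
qed

section \<open>Functoriality of horizontal composition\<close>

lemma corr_hcomp_exists:
  assumes G: "small_groupoid H" "small_groupoid G" "small_groupoid F"
    and A: "correspondence G F A'" "correspondence G F A" and B: "correspondence H G B'" "correspondence H G B"
    and u: "is_triple G F A' A u" and v: "is_triple H G B' B v"
  obtains w where "is_triple H F (pullback_span A' B') (pullback_span A B) w" "hcomp_rel H G F A' B' A B u v w"
    "corr_hcomp H G F A' B' A B (triple_class G F A' A u) (triple_class H G B' B v)
      = triple_class H F (pullback_span A' B') (pullback_span A B) w"
proof -
  note F = correspondence_faithful[OF G(2,3) A(1)] correspondence_faithful[OF G(2,3) A(2)]
    correspondence_faithful[OF G(1,2) B(1)] correspondence_faithful[OF G(1,2) B(2)]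
  have "fibration (apex A) G (lleg A)" using A(2) by (simp add: correspondence_def weak_finite_cover_def)
  then show ?thesis using hcomp_rel_exists[OF F u v] corr_hcomp_class[OF F u v] that by blast
qed

lemma corr_hcomp_in_Hom:
  assumes G: "small_groupoid H" "small_groupoid G" "small_groupoid F"
    and A: "correspondence G F A'" "correspondence G F A" and B: "correspondence H G B'" "correspondence H G B"
    and c: "c \<in> Hom (corr_cat G F) A' A" and d: "d \<in> Hom (corr_cat H G) B' B"
  shows "corr_hcomp H G F A' B' A B c d \<in> Hom (corr_cat H F) (pullback_span A' B') (pullback_span A B)"
proof -
  obtain u v where "is_triple G F A' A u" "c = triple_class G F A' A u" "is_triple H G B' B v" "d = triple_class H G B' B v"
    using c d unfolding corr_cat_simps by blast
  then show ?thesis using corr_hcomp_exists[OF G A B, of u v] unfolding corr_cat_simps by blast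
qed

text \<open>The composite of related representatives is related to the composites of the arguments
  by \<open>hcomp_rel_comp\<close>, and one related representative determines the class.\<close>

lemma corr_hcomp_comp:
  assumes G: "small_groupoid H" "small_groupoid G" "small_groupoid F"
    and A: "correspondence G F A1" "correspondence G F A2" "correspondence G F A3"
    and B: "correspondence H G B1" "correspondence H G B2" "correspondence H G B3"
    and c: "c \<in> Hom (corr_cat G F) A1 A2" "c' \<in> Hom (corr_cat G F) A2 A3"
    and d: "d \<in> Hom (corr_cat H G) B1 B2" "d' \<in> Hom (corr_cat H G) B2 B3"
  shows "corr_hcomp H G F A1 B1 A3 B3 (Comp (corr_cat G F) A1 A2 A3 c' c) (Comp (corr_cat H G) B1 B2 B3 d' d)
    = Comp (corr_cat H F) (pullback_span A1 B1) (pullback_span A2 B2) (pullback_span A3 B3)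
       (corr_hcomp H G F A2 B2 A3 B3 c' d') (corr_hcomp H G F A1 B1 A2 B2 c d)"
proof -
  note FA = correspondence_faithful[OF G(2,3) A(1)] correspondence_faithful[OF G(2,3) A(2)] correspondence_faithful[OF G(2,3) A(3)]
    and FB = correspondence_faithful[OF G(1,2) B(1)] correspondence_faithful[OF G(1,2) B(2)] correspondence_faithful[OF G(1,2) B(3)]
  note FP = pullback_faithful[OF FA(1) FB(1)] pullback_faithful[OF FA(2) FB(2)] pullback_faithful[OF FA(3) FB(3)]
  obtain u u' where u: "is_triple G F A1 A2 u" "is_triple G F A2 A3 u'" and cu: "c = triple_class G F A1 A2 u" "c' = triple_class G F A2 A3 u'"
    using c unfolding corr_cat_simps by blast
  obtain v v' where v: "is_triple H G B1 B2 v" "is_triple H G B2 B3 v'" and dv: "d = triple_class H G B1 B2 v" "d' = triple_class H G B2 B3 v'"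
    using d unfolding corr_cat_simps by blast
  obtain w where w: "is_triple H F (pullback_span A1 B1) (pullback_span A2 B2) w" "hcomp_rel H G F A1 B1 A2 B2 u v w"
    "corr_hcomp H G F A1 B1 A2 B2 c d = triple_class H F (pullback_span A1 B1) (pullback_span A2 B2) w"
    using corr_hcomp_exists[OF G A(1,2) B(1,2) u(1) v(1)] unfolding cu dv by blast
  obtain w' where w': "is_triple H F (pullback_span A2 B2) (pullback_span A3 B3) w'" "hcomp_rel H G F A2 B2 A3 B3 u' v' w'"
    "corr_hcomp H G F A2 B2 A3 B3 c' d' = triple_class H F (pullback_span A2 B2) (pullback_span A3 B3) w'"
    using corr_hcomp_exists[OF G A(2,3) B(2,3) u(2) v(2)] unfolding cu dv by blast
  note t = is_triple_comp[OF FA u] is_triple_comp[OF FB v] is_triple_comp[OF FP w(1) w'(1)]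
  show ?thesis
    unfolding w(3) w'(3) unfolding cu dv corr_comp_class[OF FA u] corr_comp_class[OF FB v] corr_comp_class[OF FP w(1) w'(1)]
    by (rule corr_hcomp_class[OF FA(1,3) FB(1,3) t hcomp_rel_comp[OF FA FB u v w(1) w'(1) w(2) w'(2)]])
qed

lemma functor_corr_hcomp:
  assumes G: "small_groupoid H" "small_groupoid G" "small_groupoid F"
  shows "is_functor (prod_cat (corr_cat G F) (corr_cat H G)) (corr_cat H F) (BComp correspondence_bicat H G F)"
proof (unfold_locales, goal_cases)
  case (1 p)
  then show ?case using correspondence_pullback[OF G(3,2,1)] by (cases p) simp
next
  case (2 p p' u)
  then show ?case
    by (cases p; cases p'; cases u) (simp del: corr_cat_simps(2), intro corr_hcomp_in_Hom[OF G], simp_all del: corr_cat_simps(2))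
next
  case (3 p)
  then obtain A B where p: "p = (A, B)" and A: "correspondence G F A" and B: "correspondence H G B" by (cases p) auto
  note F = correspondence_faithful[OF G(2,3) A] correspondence_faithful[OF G(1,2) B]
  show ?case
    unfolding p prod_cat_simps correspondence_bicat_simps corr_Ident
      corr_hcomp_strict[OF F(1,1,2,2) strict_map_id strict_map_id]
    by (rule strict_class_eqI[OF pullback_faithful[OF F] pullback_faithful[OF F] strict_map_pullback[OF strict_map_id strict_map_id] strict_map_id])
      (auto elim!: pullback_ObE)
next
  case (4 p p' p'' u v)
  then show ?case
    by (cases p; cases p'; cases p''; cases u; cases v) (simp del: corr_cat_simps(2) add: corr_hcomp_comp[OF G])
qed

lemma iso_arr_strict:
  assumes F: "faithful_span H G S'" "faithful_span H G S" and t: "strict_map S' S t"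
    and full: "\<And>a b g. \<lbrakk>a \<in> Ob S'; b \<in> Ob S'; g \<in> Ar S (omap t a) (omap t b)\<rbrakk> \<Longrightarrow> \<exists>f\<in>Ar S' a b. amap t a b f = g"
    and surj: "\<And>b. b \<in> Ob S \<Longrightarrow> \<exists>a\<in>Ob S'. Ar S (omap t a) b \<noteq> {}"
  shows "iso_arr (corr_cat H G) S' S (strict_class H G S' S t)"
  using is_triple_strict[OF F t] unfolding strict_class_def strict_triple_def
  by (rule iso_arr_corrI[OF F _ full surj])

lemma iso_arr_strict_surj:
  assumes F: "faithful_span H G S'" "faithful_span H G S" and t: "strict_map S' S t"
    and full: "\<And>a b g. \<lbrakk>a \<in> Ob S'; b \<in> Ob S'; g \<in> Ar S (omap t a) (omap t b)\<rbrakk> \<Longrightarrow> \<exists>f\<in>Ar S' a b. amap t a b f = g"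
    and surj: "\<And>b. b \<in> Ob S \<Longrightarrow> \<exists>a\<in>Ob S'. omap t a = b"
  shows "iso_arr (corr_cat H G) S' S (strict_class H G S' S t)"
proof (rule iso_arr_strict[OF F t full])
  interpret S: faithful_span H G S by fact
  fix b assume "b \<in> Ob S"
  then show "\<exists>a\<in>Ob S'. Ar S (omap t a) b \<noteq> {}" using surj S.A.Ident_in_Hom by fastforce
qed

section \<open>Associator and unitors of correspondences\<close>

definition assoc_map :: "('u::universe, 'u, 'u, 'u) fctr" where
  "assoc_map = \<lparr>omap = (\<lambda>a. upair (ufst (ufst a)) (upair (usnd (ufst a)) (usnd a))),
           amap = (\<lambda>a b f. upair (ufst (ufst f)) (upair (usnd (ufst f)) (usnd f)))\<rparr>"

lemma assoc_map_simps [simp]: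
  "omap assoc_map a = upair (ufst (ufst a)) (upair (usnd (ufst a)) (usnd a))"
  "amap assoc_map a b f = upair (ufst (ufst f)) (upair (usnd (ufst f)) (usnd f))"
  by (simp_all add: assoc_map_def)

lemma strict_map_assoc:
  "strict_map (pullback_span (pullback_span X Y) Z) (pullback_span X (pullback_span Y Z)) assoc_map"
proof -
  have "is_functor (apex (pullback_span (pullback_span X Y) Z)) (apex (pullback_span X (pullback_span Y Z))) assoc_map"
    by unfold_locales (auto elim!: pullback_ObE)
  then show ?thesis by (auto simp: strict_map_def elim!: pullback_ObE)
qed

lemma strict_map_lunit: "strict_map (pullback_span (unit_span G) X) X (right_proj usnd)"
proof -
  have "is_functor (apex (pullback_span (unit_span G) X)) (apex X) (right_proj usnd)"
    by unfold_locales (auto elim!: pullback_ObE)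
  then show ?thesis by (auto simp: strict_map_def elim!: pullback_ObE)
qed

lemma strict_map_runit: "strict_map (pullback_span X (unit_span H)) X (left_proj ufst)"
proof -
  have "is_functor (apex (pullback_span X (unit_span H))) (apex X) (left_proj ufst)"
    by unfold_locales (auto elim!: pullback_ObE)
  then show ?thesis by (auto simp: strict_map_def elim!: pullback_ObE)
qed

lemma corr_structure_strict:
  "corr_assoc L K H G X Y Z = strict_class L G (pullback_span (pullback_span X Y) Z) (pullback_span X (pullback_span Y Z)) assoc_map"
  "corr_lunit H G X = strict_class H G (pullback_span (unit_span G) X) X (right_proj usnd)"
  "corr_runit H G X = strict_class H G (pullback_span X (unit_span H)) X (left_proj ufst)"
  by (simp_all add: corr_assoc_def corr_lunit_def corr_runit_def strict_class_def assoc_map_def)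

context
  fixes H G :: "'u::universe grpd" and X
  assumes X: "faithful_span H G X" and U: "faithful_span G G (unit_span G)" "faithful_span H H (unit_span H)"
begin

interpretation X: faithful_span H G X by (rule X)

lemma iso_lunit: "iso_arr (corr_cat H G) (pullback_span (unit_span G) X) X (corr_lunit H G X)"
  unfolding corr_structure_strict
proof (rule iso_arr_strict_surj[OF pullback_faithful[OF U(1) X] X strict_map_lunit])
  fix a b g assume "a \<in> Ob (pullback_span (unit_span G) X)" "b \<in> Ob (pullback_span (unit_span G) X)"
    "g \<in> Ar X (omap (right_proj usnd) a) (omap (right_proj usnd) b)"
  then show "\<exists>f\<in>Ar (pullback_span (unit_span G) X) a b. amap (right_proj usnd) a b f = g"
    by (intro bexI[of _ "upair (Ra X (usnd a) (usnd b) g) g"]) (auto elim!: pullback_ObE)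
next
  fix b assume "b \<in> Ob X"
  then show "\<exists>a\<in>Ob (pullback_span (unit_span G) X). omap (right_proj usnd) a = b"
    by (intro bexI[of _ "upair (Ro X b) b"]) auto
qed

lemma iso_runit: "iso_arr (corr_cat H G) (pullback_span X (unit_span H)) X (corr_runit H G X)"
  unfolding corr_structure_strict
proof (rule iso_arr_strict_surj[OF pullback_faithful[OF X U(2)] X strict_map_runit])
  fix a b g assume "a \<in> Ob (pullback_span X (unit_span H))" "b \<in> Ob (pullback_span X (unit_span H))"
    "g \<in> Ar X (omap (left_proj ufst) a) (omap (left_proj ufst) b)"
  then show "\<exists>f\<in>Ar (pullback_span X (unit_span H)) a b. amap (left_proj ufst) a b f = g"
    by (intro bexI[of _ "upair g (La X (ufst a) (ufst b) g)"]) (auto elim!: pullback_ObE)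
next
  fix b assume "b \<in> Ob X"
  then show "\<exists>a\<in>Ob (pullback_span X (unit_span H)). omap (left_proj ufst) a = b"
    by (intro bexI[of _ "upair b (Lo X b)"]) auto
qed

end

lemma iso_assoc:
  assumes X: "faithful_span H G X" and Y: "faithful_span K H Y" and Z: "faithful_span L K Z"
  shows "iso_arr (corr_cat L G) (pullback_span (pullback_span X Y) Z) (pullback_span X (pullback_span Y Z)) (corr_assoc L K H G X Y Z)"
  unfolding corr_structure_strict
proof (rule iso_arr_strict_surj[OF pullback_faithful[OF pullback_faithful[OF X Y] Z] pullback_faithful[OF X pullback_faithful[OF Y Z]] strict_map_assoc])
  fix a b g assume "a \<in> Ob (pullback_span (pullback_span X Y) Z)" "b \<in> Ob (pullback_span (pullback_span X Y) Z)"
    "g \<in> Ar (pullback_span X (pullback_span Y Z)) (omap assoc_map a) (omap assoc_map b)"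
  then show "\<exists>f\<in>Ar (pullback_span (pullback_span X Y) Z) a b. amap assoc_map a b f = g"
    by (intro bexI[of _ "upair (upair (ufst g) (ufst (usnd g))) (usnd (usnd g))"]) (auto elim!: pullback_ObE)
next
  fix b assume "b \<in> Ob (pullback_span X (pullback_span Y Z))"
  then show "\<exists>a\<in>Ob (pullback_span (pullback_span X Y) Z). omap assoc_map a = b"
    by (intro bexI[of _ "upair (upair (ufst b) (ufst (usnd b))) (usnd (usnd b))"]) (auto elim!: pullback_ObE)
qed

text \<open>Let the isomorphism e make both e and e f = d strict. Naturality holds for the strict
  classes e and d by comparison on objects; functoriality of horizontal composition splits the
  square for d into those for f and e. The square for e and its invertibility then leave the square
  for f.\<close>

lemma corr_lunit_natural:
  assumes G: "small_groupoid H" "small_groupoid G" and X: "correspondence H G X'" "correspondence H G X"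
    and f: "f \<in> Hom (corr_cat H G) X' X"
  shows "Comp (corr_cat H G) (pullback_span (unit_span G) X') (pullback_span (unit_span G) X) X (corr_lunit H G X)
      (corr_hcomp H G G (unit_span G) X' (unit_span G) X (Ident (corr_cat G G) (unit_span G)) f)
    = Comp (corr_cat H G) (pullback_span (unit_span G) X') X' X f (corr_lunit H G X')"
proof -
  let ?U = "unit_span G" and ?C = "corr_cat H G" and ?i = "Ident (corr_cat G G) (unit_span G)"
  interpret C: category ?C using category_corr_cat[OF G] .
  interpret U: category "corr_cat G G" using category_corr_cat[OF G(2,2)] .
  obtain T e d where T: "correspondence H G T" and e: "strict_map X T e" "iso_arr ?C X T (strict_class H G X T e)"
    and d: "strict_map X' T d" "Comp ?C X' X T (strict_class H G X T e) f = strict_class H G X' T d"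
    using strictify[OF G X f] by blast
  let ?e = "strict_class H G X T e" and ?d = "strict_class H G X' T d"
  note U = correspondence_unit[OF G(2)]
  note P = correspondence_pullback[OF G(2,2,1) U X(1)] correspondence_pullback[OF G(2,2,1) U X(2)] correspondence_pullback[OF G(2,2,1) U T]
  note F = correspondence_faithful[OF G X(1)] correspondence_faithful[OF G X(2)] correspondence_faithful[OF G T]
    and FU = correspondence_faithful[OF G(2,2) U]
    and FP = correspondence_faithful[OF G P(1)] correspondence_faithful[OF G P(2)] correspondence_faithful[OF G P(3)]
  have i: "?i \<in> Hom (corr_cat G G) ?U ?U" using U U.Ident_in_Hom by (simp del: corr_cat_simps(2,3))
  have ii: "Comp (corr_cat G G) ?U ?U ?U ?i ?i = ?i" using i U by (intro U.Comp_Ident_left) auto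
  \<comment> \<open>The strict case: both sides are strict maps that send a pair to the image of its
    second component.\<close>
  have nat: "Comp ?C (pullback_span ?U S') S' S (strict_class H G S' S t) (corr_lunit H G S')
      = Comp ?C (pullback_span ?U S') (pullback_span ?U S) S (corr_lunit H G S) (corr_hcomp H G G ?U S' ?U S ?i (strict_class H G S' S t))"
    if S: "correspondence H G S'" "correspondence H G S" and t: "strict_map S' S t" for S' S t
  proof -
    note FS = correspondence_faithful[OF G S(1)] correspondence_faithful[OF G S(2)]
    note FPS = pullback_faithful[OF FU FS(1)] pullback_faithful[OF FU FS(2)]
    note m = strict_map_pullback[OF strict_map_id t]
    show ?thesis
      unfolding corr_Ident corr_structure_strict corr_hcomp_strict[OF FU FU FS strict_map_id t]
        strict_class_comp[OF FPS(1) FS strict_map_lunit t] strict_class_comp[OF FPS FS(2) m strict_map_lunit]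
      by (rule strict_class_eqI[OF FPS(1) FS(2) strict_map_comp[OF strict_map_lunit t] strict_map_comp[OF m strict_map_lunit]]) auto
  qed
  have l: "corr_lunit H G S \<in> Hom ?C (pullback_span ?U S) S" if "correspondence H G S" for S
    unfolding corr_structure_strict using that G
    by (intro strict_class_in_Hom strict_map_lunit correspondence_faithful correspondence_pullback[OF G(2,2,1) U])
  have ee: "?e \<in> Hom ?C X T" using e(2) by (rule iso_arr_in_Hom)
  note hf = corr_hcomp_in_Hom[OF G(1,2,2) U U X i f] and he = corr_hcomp_in_Hom[OF G(1,2,2) U U X(2) T i ee]
  show ?thesis
  proof (rule C.iso_arr_cancel[OF e(2)])
    have "Comp ?C (pullback_span ?U X') X T ?e (Comp ?C (pullback_span ?U X') (pullback_span ?U X) X (corr_lunit H G X) (corr_hcomp H G G ?U X' ?U X ?i f))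
      = Comp ?C (pullback_span ?U X') (pullback_span ?U X) T (Comp ?C (pullback_span ?U X) X T ?e (corr_lunit H G X)) (corr_hcomp H G G ?U X' ?U X ?i f)"
      by (rule C.Comp_assoc[symmetric]) (use P X T l hf ee in \<open>auto simp del: corr_cat_simps(2)\<close>)
    also have "\<dots> = Comp ?C (pullback_span ?U X') (pullback_span ?U T) T (corr_lunit H G T)
       (Comp ?C (pullback_span ?U X') (pullback_span ?U X) (pullback_span ?U T) (corr_hcomp H G G ?U X ?U T ?i ?e) (corr_hcomp H G G ?U X' ?U X ?i f))"
      unfolding nat[OF X(2) T e(1)] by (rule C.Comp_assoc) (use P X T l hf he in \<open>auto simp del: corr_cat_simps(2)\<close>)
    also have "\<dots> = Comp ?C (pullback_span ?U X') (pullback_span ?U T) T (corr_lunit H G T) (corr_hcomp H G G ?U X' ?U T ?i ?d)"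
      unfolding corr_hcomp_comp[OF G(1,2,2) U U U X T i i f ee, symmetric] ii d(2) ..
    also have "\<dots> = Comp ?C (pullback_span ?U X') X' T (Comp ?C X' X T ?e f) (corr_lunit H G X')"
      unfolding nat[OF X(1) T d(1), symmetric] d(2) ..
    also have "\<dots> = Comp ?C (pullback_span ?U X') X T ?e (Comp ?C (pullback_span ?U X') X' X f (corr_lunit H G X'))"
      by (rule C.Comp_assoc) (use P X T l f ee in \<open>auto simp del: corr_cat_simps(2)\<close>)
    finally show "Comp ?C (pullback_span ?U X') X T ?e (Comp ?C (pullback_span ?U X') (pullback_span ?U X) X (corr_lunit H G X) (corr_hcomp H G G ?U X' ?U X ?i f)) = \<dots>" .
    show "Comp ?C (pullback_span ?U X') (pullback_span ?U X) X (corr_lunit H G X) (corr_hcomp H G G ?U X' ?U X ?i f) \<in> Hom ?C (pullback_span ?U X') X"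
      "Comp ?C (pullback_span ?U X') X' X f (corr_lunit H G X') \<in> Hom ?C (pullback_span ?U X') X"
      by (rule C.Comp_in_Hom; use P X l f hf in \<open>auto simp del: corr_cat_simps(2)\<close>)+
  qed (use P X T in auto)
qed

text \<open>The argument for the left unitor, with the strictified 2-cell now in the first factor of
  the pullback.\<close>

lemma corr_runit_natural:
  assumes G: "small_groupoid H" "small_groupoid G" and X: "correspondence H G X'" "correspondence H G X"
    and f: "f \<in> Hom (corr_cat H G) X' X"
  shows "Comp (corr_cat H G) (pullback_span X' (unit_span H)) (pullback_span X (unit_span H)) X (corr_runit H G X)
      (corr_hcomp H H G X' (unit_span H) X (unit_span H) f (Ident (corr_cat H H) (unit_span H)))
    = Comp (corr_cat H G) (pullback_span X' (unit_span H)) X' X f (corr_runit H G X')"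
proof -
  let ?U = "unit_span H" and ?C = "corr_cat H G" and ?i = "Ident (corr_cat H H) (unit_span H)"
  interpret C: category ?C using category_corr_cat[OF G] .
  interpret U: category "corr_cat H H" using category_corr_cat[OF G(1,1)] .
  obtain T e d where T: "correspondence H G T" and e: "strict_map X T e" "iso_arr ?C X T (strict_class H G X T e)"
    and d: "strict_map X' T d" "Comp ?C X' X T (strict_class H G X T e) f = strict_class H G X' T d"
    using strictify[OF G X f] by blast
  let ?e = "strict_class H G X T e" and ?d = "strict_class H G X' T d"
  note U = correspondence_unit[OF G(1)]
  note P = correspondence_pullback[OF G(2,1,1) X(1) U] correspondence_pullback[OF G(2,1,1) X(2) U] correspondence_pullback[OF G(2,1,1) T U]
  note FU = correspondence_faithful[OF G(1,1) U]
  have i: "?i \<in> Hom (corr_cat H H) ?U ?U" using U U.Ident_in_Hom by (simp del: corr_cat_simps(2,3))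
  have ii: "Comp (corr_cat H H) ?U ?U ?U ?i ?i = ?i" using i U by (intro U.Comp_Ident_left) auto
  have nat: "Comp ?C (pullback_span S' ?U) S' S (strict_class H G S' S t) (corr_runit H G S')
      = Comp ?C (pullback_span S' ?U) (pullback_span S ?U) S (corr_runit H G S) (corr_hcomp H H G S' ?U S ?U (strict_class H G S' S t) ?i)"
    if S: "correspondence H G S'" "correspondence H G S" and t: "strict_map S' S t" for S' S t
  proof -
    note FS = correspondence_faithful[OF G S(1)] correspondence_faithful[OF G S(2)]
    note FPS = pullback_faithful[OF FS(1) FU] pullback_faithful[OF FS(2) FU]
    note m = strict_map_pullback[OF t strict_map_id]
    show ?thesis
      unfolding corr_Ident corr_structure_strict corr_hcomp_strict[OF FS FU FU t strict_map_id]
        strict_class_comp[OF FPS(1) FS strict_map_runit t] strict_class_comp[OF FPS FS(2) m strict_map_runit]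
      by (rule strict_class_eqI[OF FPS(1) FS(2) strict_map_comp[OF strict_map_runit t] strict_map_comp[OF m strict_map_runit]]) auto
  qed
  have l: "corr_runit H G S \<in> Hom ?C (pullback_span S ?U) S" if "correspondence H G S" for S
    unfolding corr_structure_strict using that G
    by (intro strict_class_in_Hom strict_map_runit correspondence_faithful correspondence_pullback[OF G(2,1,1) _ U])
  have ee: "?e \<in> Hom ?C X T" using e(2) by (rule iso_arr_in_Hom)
  note hf = corr_hcomp_in_Hom[OF G(1,1,2) X U U f i] and he = corr_hcomp_in_Hom[OF G(1,1,2) X(2) T U U ee i]
  show ?thesis
  proof (rule C.iso_arr_cancel[OF e(2)])
    have "Comp ?C (pullback_span X' ?U) X T ?e (Comp ?C (pullback_span X' ?U) (pullback_span X ?U) X (corr_runit H G X) (corr_hcomp H H G X' ?U X ?U f ?i))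
      = Comp ?C (pullback_span X' ?U) (pullback_span X ?U) T (Comp ?C (pullback_span X ?U) X T ?e (corr_runit H G X)) (corr_hcomp H H G X' ?U X ?U f ?i)"
      by (rule C.Comp_assoc[symmetric]) (use P X T l hf ee in \<open>auto simp del: corr_cat_simps(2)\<close>)
    also have "\<dots> = Comp ?C (pullback_span X' ?U) (pullback_span T ?U) T (corr_runit H G T)
       (Comp ?C (pullback_span X' ?U) (pullback_span X ?U) (pullback_span T ?U) (corr_hcomp H H G X ?U T ?U ?e ?i) (corr_hcomp H H G X' ?U X ?U f ?i))"
      unfolding nat[OF X(2) T e(1)] by (rule C.Comp_assoc) (use P X T l hf he in \<open>auto simp del: corr_cat_simps(2)\<close>)
    also have "\<dots> = Comp ?C (pullback_span X' ?U) (pullback_span T ?U) T (corr_runit H G T) (corr_hcomp H H G X' ?U T ?U ?d ?i)"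
      unfolding corr_hcomp_comp[OF G(1,1,2) X T U U U f ee i i, symmetric] ii d(2) ..
    also have "\<dots> = Comp ?C (pullback_span X' ?U) X' T (Comp ?C X' X T ?e f) (corr_runit H G X')"
      unfolding nat[OF X(1) T d(1), symmetric] d(2) ..
    also have "\<dots> = Comp ?C (pullback_span X' ?U) X T ?e (Comp ?C (pullback_span X' ?U) X' X f (corr_runit H G X'))"
      by (rule C.Comp_assoc) (use P X T l f ee in \<open>auto simp del: corr_cat_simps(2)\<close>)
    finally show "Comp ?C (pullback_span X' ?U) X T ?e (Comp ?C (pullback_span X' ?U) (pullback_span X ?U) X (corr_runit H G X) (corr_hcomp H H G X' ?U X ?U f ?i)) = \<dots>" .
    show "Comp ?C (pullback_span X' ?U) (pullback_span X ?U) X (corr_runit H G X) (corr_hcomp H H G X' ?U X ?U f ?i) \<in> Hom ?C (pullback_span X' ?U) X"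
      "Comp ?C (pullback_span X' ?U) X' X f (corr_runit H G X') \<in> Hom ?C (pullback_span X' ?U) X"
      by (rule C.Comp_in_Hom; use P X l f hf in \<open>auto simp del: corr_cat_simps(2)\<close>)+
  qed (use P X T in auto)
qed

text \<open>The three 2-cells are strictified separately by e1, e2 and e3. The naturality square for
  strict classes is compared on objects, and the horizontal composite of e1, e2 and e3 is cancelled
  at the end.\<close>

lemma corr_assoc_natural:
  assumes G: "small_groupoid L" "small_groupoid K" "small_groupoid H" "small_groupoid G"
    and X: "correspondence H G X'" "correspondence H G X" and Y: "correspondence K H Y'" "correspondence K H Y"
    and Z: "correspondence L K Z'" "correspondence L K Z"
    and f: "f \<in> Hom (corr_cat H G) X' X" and g: "g \<in> Hom (corr_cat K H) Y' Y" and h: "h \<in> Hom (corr_cat L K) Z' Z"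
  shows "Comp (corr_cat L G) (pullback_span (pullback_span X' Y') Z') (pullback_span (pullback_span X Y) Z) (pullback_span X (pullback_span Y Z))
      (corr_assoc L K H G X Y Z)
      (corr_hcomp L K G (pullback_span X' Y') Z' (pullback_span X Y) Z (corr_hcomp K H G X' Y' X Y f g) h)
    = Comp (corr_cat L G) (pullback_span (pullback_span X' Y') Z') (pullback_span X' (pullback_span Y' Z')) (pullback_span X (pullback_span Y Z))
      (corr_hcomp L H G X' (pullback_span Y' Z') X (pullback_span Y Z) f (corr_hcomp L K H Y' Z' Y Z g h))
      (corr_assoc L K H G X' Y' Z')"
proof -
  let ?C = "corr_cat L G"
  let ?l = "\<lambda>X Y Z. pullback_span (pullback_span X Y) Z" and ?r = "\<lambda>X Y Z. pullback_span X (pullback_span Y Z)"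
  let ?hl = "\<lambda>X' Y' Z' X Y Z f g h. corr_hcomp L K G (pullback_span X' Y') Z' (pullback_span X Y) Z (corr_hcomp K H G X' Y' X Y f g) h"
  let ?hr = "\<lambda>X' Y' Z' X Y Z f g h. corr_hcomp L H G X' (pullback_span Y' Z') X (pullback_span Y Z) f (corr_hcomp L K H Y' Z' Y Z g h)"
  let ?a = "corr_assoc L K H G"
  interpret C: category ?C using category_corr_cat[OF G(1,4)] .
  have P: "correspondence K G (pullback_span X Y)" "correspondence L H (pullback_span Y Z)"
      "correspondence L G (?l X Y Z)" "correspondence L G (?r X Y Z)"
    if "correspondence H G X" "correspondence K H Y" "correspondence L K Z" for X Y Z
    by (intro correspondence_pullback[OF G(4,3,2)] correspondence_pullback[OF G(3,2,1)] correspondence_pullback[OF G(4,2,1)]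
        correspondence_pullback[OF G(4,3,1)] that)+
  have a: "?a X Y Z \<in> Hom ?C (?l X Y Z) (?r X Y Z)"
    if "correspondence H G X" "correspondence K H Y" "correspondence L K Z" for X Y Z
    unfolding corr_structure_strict
    by (intro strict_class_in_Hom strict_map_assoc correspondence_faithful[OF G(1,4)] P that)
  have hl: "?hl X' Y' Z' X Y Z f g h \<in> Hom ?C (?l X' Y' Z') (?l X Y Z)"
    and hr: "?hr X' Y' Z' X Y Z f g h \<in> Hom ?C (?r X' Y' Z') (?r X Y Z)"
    if "correspondence H G X'" "correspondence K H Y'" "correspondence L K Z'" "correspondence H G X" "correspondence K H Y" "correspondence L K Z"
      "f \<in> Hom (corr_cat H G) X' X" "g \<in> Hom (corr_cat K H) Y' Y" "h \<in> Hom (corr_cat L K) Z' Z" for X' Y' Z' X Y Z f g h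
    by (rule corr_hcomp_in_Hom[OF G(1,2,4) P(1)[OF that(1,2,3)] P(1)[OF that(4,5,6)] that(3,6)
          corr_hcomp_in_Hom[OF G(2,3,4) that(1,4,2,5,7,8)] that(9)],
        rule corr_hcomp_in_Hom[OF G(1,3,4) that(1,4) P(2)[OF that(1,2,3)] P(2)[OF that(4,5,6)]
          that(7) corr_hcomp_in_Hom[OF G(1,2,3) that(2,5,3,6,8,9)]])
  have nat: "Comp ?C (?l X' Y' Z') (?l X Y Z) (?r X Y Z) (?a X Y Z) (?hl X' Y' Z' X Y Z (strict_class H G X' X s) (strict_class K H Y' Y t) (strict_class L K Z' Z u))
    = Comp ?C (?l X' Y' Z') (?r X' Y' Z') (?r X Y Z) (?hr X' Y' Z' X Y Z (strict_class H G X' X s) (strict_class K H Y' Y t) (strict_class L K Z' Z u)) (?a X' Y' Z')"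
    if X: "correspondence H G X'" "correspondence K H Y'" "correspondence L K Z'" "correspondence H G X" "correspondence K H Y" "correspondence L K Z"
      and s: "strict_map X' X s" and t: "strict_map Y' Y t" and u: "strict_map Z' Z u" for X' Y' Z' X Y Z s t u
  proof -
    note FX = correspondence_faithful[OF G(3,4) X(1)] correspondence_faithful[OF G(3,4) X(4)]
      and FY = correspondence_faithful[OF G(2,3) X(2)] correspondence_faithful[OF G(2,3) X(5)]
      and FZ = correspondence_faithful[OF G(1,2) X(3)] correspondence_faithful[OF G(1,2) X(6)]
    note FXY = pullback_faithful[OF FX(1) FY(1)] pullback_faithful[OF FX(2) FY(2)]
      and FYZ = pullback_faithful[OF FY(1) FZ(1)] pullback_faithful[OF FY(2) FZ(2)]
    note Fl = pullback_faithful[OF FXY(1) FZ(1)] pullback_faithful[OF FXY(2) FZ(2)]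
      and Fr = pullback_faithful[OF FX(1) FYZ(1)] pullback_faithful[OF FX(2) FYZ(2)]
    note m = strict_map_pullback[OF strict_map_pullback[OF s t] u] strict_map_pullback[OF s strict_map_pullback[OF t u]]
    show ?thesis
      unfolding corr_structure_strict corr_hcomp_strict[OF FX FY s t] corr_hcomp_strict[OF FY FZ t u]
        corr_hcomp_strict[OF FXY FZ strict_map_pullback[OF s t] u] corr_hcomp_strict[OF FX FYZ s strict_map_pullback[OF t u]]
        strict_class_comp[OF Fl Fr(2) m(1) strict_map_assoc] strict_class_comp[OF Fl(1) Fr strict_map_assoc m(2)]
      by (rule strict_class_eqI[OF Fl(1) Fr(2) strict_map_comp[OF m(1) strict_map_assoc] strict_map_comp[OF strict_map_assoc m(2)]]) auto
  qed
  have comp: "?hl X1 Y1 Z1 X3 Y3 Z3 (Comp (corr_cat H G) X1 X2 X3 f' f) (Comp (corr_cat K H) Y1 Y2 Y3 g' g) (Comp (corr_cat L K) Z1 Z2 Z3 h' h)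
      = Comp ?C (?l X1 Y1 Z1) (?l X2 Y2 Z2) (?l X3 Y3 Z3) (?hl X2 Y2 Z2 X3 Y3 Z3 f' g' h') (?hl X1 Y1 Z1 X2 Y2 Z2 f g h)"
    "?hr X1 Y1 Z1 X3 Y3 Z3 (Comp (corr_cat H G) X1 X2 X3 f' f) (Comp (corr_cat K H) Y1 Y2 Y3 g' g) (Comp (corr_cat L K) Z1 Z2 Z3 h' h)
      = Comp ?C (?r X1 Y1 Z1) (?r X2 Y2 Z2) (?r X3 Y3 Z3) (?hr X2 Y2 Z2 X3 Y3 Z3 f' g' h') (?hr X1 Y1 Z1 X2 Y2 Z2 f g h)"
    if X: "correspondence H G X1" "correspondence H G X2" "correspondence H G X3" and Y: "correspondence K H Y1" "correspondence K H Y2" "correspondence K H Y3"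
      and Z: "correspondence L K Z1" "correspondence L K Z2" "correspondence L K Z3"
      and f: "f \<in> Hom (corr_cat H G) X1 X2" "f' \<in> Hom (corr_cat H G) X2 X3" and g: "g \<in> Hom (corr_cat K H) Y1 Y2" "g' \<in> Hom (corr_cat K H) Y2 Y3"
      and h: "h \<in> Hom (corr_cat L K) Z1 Z2" "h' \<in> Hom (corr_cat L K) Z2 Z3" for X1 X2 X3 Y1 Y2 Y3 Z1 Z2 Z3 f f' g g' h h'
    unfolding corr_hcomp_comp[OF G(2,3,4) X Y f g] corr_hcomp_comp[OF G(1,2,3) Y Z g h]
    by (rule corr_hcomp_comp[OF G(1,2,4) P(1)[OF X(1) Y(1) Z(1)] P(1)[OF X(2) Y(2) Z(2)] P(1)[OF X(3) Y(3) Z(3)] Z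
          corr_hcomp_in_Hom[OF G(2,3,4) X(1,2) Y(1,2) f(1) g(1)] corr_hcomp_in_Hom[OF G(2,3,4) X(2,3) Y(2,3) f(2) g(2)] h],
        rule corr_hcomp_comp[OF G(1,3,4) X P(2)[OF X(1) Y(1) Z(1)] P(2)[OF X(2) Y(2) Z(2)] P(2)[OF X(3) Y(3) Z(3)] f
          corr_hcomp_in_Hom[OF G(1,2,3) Y(1,2) Z(1,2) g(1) h(1)] corr_hcomp_in_Hom[OF G(1,2,3) Y(2,3) Z(2,3) g(2) h(2)]])
  obtain T1 e1 d1 where T1: "correspondence H G T1" and e1: "strict_map X T1 e1" "iso_arr (corr_cat H G) X T1 (strict_class H G X T1 e1)"
    and d1: "strict_map X' T1 d1" "Comp (corr_cat H G) X' X T1 (strict_class H G X T1 e1) f = strict_class H G X' T1 d1"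
    using strictify[OF G(3,4) X f] by blast
  obtain T2 e2 d2 where T2: "correspondence K H T2" and e2: "strict_map Y T2 e2" "iso_arr (corr_cat K H) Y T2 (strict_class K H Y T2 e2)"
    and d2: "strict_map Y' T2 d2" "Comp (corr_cat K H) Y' Y T2 (strict_class K H Y T2 e2) g = strict_class K H Y' T2 d2"
    using strictify[OF G(2,3) Y g] by blast
  obtain T3 e3 d3 where T3: "correspondence L K T3" and e3: "strict_map Z T3 e3" "iso_arr (corr_cat L K) Z T3 (strict_class L K Z T3 e3)"
    and d3: "strict_map Z' T3 d3" "Comp (corr_cat L K) Z' Z T3 (strict_class L K Z T3 e3) h = strict_class L K Z' T3 d3"
    using strictify[OF G(1,2) Z h] by blast
  let ?e1 = "strict_class H G X T1 e1" and ?e2 = "strict_class K H Y T2 e2" and ?e3 = "strict_class L K Z T3 e3"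
  note ee = e1(2)[THEN iso_arr_in_Hom] e2(2)[THEN iso_arr_in_Hom] e3(2)[THEN iso_arr_in_Hom]
  \<comment> \<open>Horizontal composition is a functor on the product of the cores, so composites
    of isomorphisms are isomorphisms; this makes the final cancellation legitimate.\<close>
  have iso_h: "iso_arr (corr_cat H F) (pullback_span A' B') (pullback_span A B) (corr_hcomp H G F A' B' A B c d)"
    if g: "small_groupoid H" "small_groupoid G" "small_groupoid F" and *: "correspondence G F A'" "correspondence G F A" "correspondence H G B'" "correspondence H G B"
      "iso_arr (corr_cat G F) A' A c" "iso_arr (corr_cat H G) B' B d" for H G F :: "'a grpd" and A' A B' B c d
    using is_functor.amap_in_Hom[OF is_functor_prod_core[OF category_corr_cat[OF g(2,3)] category_corr_cat[OF g(1,2)] functor_corr_hcomp[OF g]],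
        of "(A', B')" "(A, B)" "(c, d)"] * by simp
  have E: "iso_arr ?C (?r X Y Z) (?r T1 T2 T3) (?hr X Y Z T1 T2 T3 ?e1 ?e2 ?e3)"
    by (rule iso_h[OF G(1,3,4) X(2) T1 P(2)[OF X(2) Y(2) Z(2)] P(2)[OF T1 T2 T3] e1(2)
          iso_h[OF G(1,2,3) Y(2) T2 Z(2) T3 e2(2) e3(2)]])
  note ob = P(3,4)[OF X(1) Y(1) Z(1)] P(3,4)[OF X(2) Y(2) Z(2)] P(3,4)[OF T1 T2 T3]
  note aa = a[OF X(1) Y(1) Z(1)] a[OF X(2) Y(2) Z(2)] a[OF T1 T2 T3]
  note hfgh = hl[OF X(1) Y(1) Z(1) X(2) Y(2) Z(2) f g h] hr[OF X(1) Y(1) Z(1) X(2) Y(2) Z(2) f g h]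
    and he = hl[OF X(2) Y(2) Z(2) T1 T2 T3 ee] hr[OF X(2) Y(2) Z(2) T1 T2 T3 ee]
  show ?thesis
  proof (rule C.iso_arr_cancel[OF E])
    have "Comp ?C (?l X' Y' Z') (?r X Y Z) (?r T1 T2 T3) (?hr X Y Z T1 T2 T3 ?e1 ?e2 ?e3)
        (Comp ?C (?l X' Y' Z') (?l X Y Z) (?r X Y Z) (?a X Y Z) (?hl X' Y' Z' X Y Z f g h))
      = Comp ?C (?l X' Y' Z') (?l X Y Z) (?r T1 T2 T3)
          (Comp ?C (?l X Y Z) (?r X Y Z) (?r T1 T2 T3) (?hr X Y Z T1 T2 T3 ?e1 ?e2 ?e3) (?a X Y Z)) (?hl X' Y' Z' X Y Z f g h)"
      by (rule C.Comp_assoc[symmetric]) (use ob aa hfgh he in \<open>auto simp del: corr_cat_simps(2)\<close>)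
    also have "\<dots> = Comp ?C (?l X' Y' Z') (?l T1 T2 T3) (?r T1 T2 T3) (?a T1 T2 T3)
         (Comp ?C (?l X' Y' Z') (?l X Y Z) (?l T1 T2 T3) (?hl X Y Z T1 T2 T3 ?e1 ?e2 ?e3) (?hl X' Y' Z' X Y Z f g h))"
      unfolding nat[OF X(2) Y(2) Z(2) T1 T2 T3 e1(1) e2(1) e3(1), symmetric]
      by (rule C.Comp_assoc) (use ob aa hfgh he in \<open>auto simp del: corr_cat_simps(2)\<close>)
    also have "\<dots> = Comp ?C (?l X' Y' Z') (?r X' Y' Z') (?r T1 T2 T3)
         (Comp ?C (?r X' Y' Z') (?r X Y Z) (?r T1 T2 T3) (?hr X Y Z T1 T2 T3 ?e1 ?e2 ?e3) (?hr X' Y' Z' X Y Z f g h)) (?a X' Y' Z')"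
      unfolding comp(1)[OF X T1 Y T2 Z T3 f ee(1) g ee(2) h ee(3), symmetric] comp(2)[OF X T1 Y T2 Z T3 f ee(1) g ee(2) h ee(3), symmetric] d1(2) d2(2) d3(2)
      by (rule nat[OF X(1) Y(1) Z(1) T1 T2 T3 d1(1) d2(1) d3(1)])
    also have "\<dots> = Comp ?C (?l X' Y' Z') (?r X Y Z) (?r T1 T2 T3) (?hr X Y Z T1 T2 T3 ?e1 ?e2 ?e3)
        (Comp ?C (?l X' Y' Z') (?r X' Y' Z') (?r X Y Z) (?hr X' Y' Z' X Y Z f g h) (?a X' Y' Z'))"
      by (rule C.Comp_assoc) (use ob aa hfgh he in \<open>auto simp del: corr_cat_simps(2)\<close>)
    finally show "Comp ?C (?l X' Y' Z') (?r X Y Z) (?r T1 T2 T3) (?hr X Y Z T1 T2 T3 ?e1 ?e2 ?e3)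
        (Comp ?C (?l X' Y' Z') (?l X Y Z) (?r X Y Z) (?a X Y Z) (?hl X' Y' Z' X Y Z f g h)) = \<dots>" .
    show "Comp ?C (?l X' Y' Z') (?l X Y Z) (?r X Y Z) (?a X Y Z) (?hl X' Y' Z' X Y Z f g h) \<in> Hom ?C (?l X' Y' Z') (?r X Y Z)"
      "Comp ?C (?l X' Y' Z') (?r X' Y' Z') (?r X Y Z) (?hr X' Y' Z' X Y Z f g h) (?a X' Y' Z') \<in> Hom ?C (?l X' Y' Z') (?r X Y Z)"
      by (rule C.Comp_in_Hom; use ob aa hfgh in \<open>auto simp del: corr_cat_simps(2)\<close>)+
  qed (use ob in auto)
qed

text \<open>In the triangle and the pentagon every 2-cell is strict, so each law compares two
  rearrangements of nested pairs. Naturality of the structure 2-cells is where general triples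
  enter.\<close>

theorem bicategory_correspondence: "bicategory (correspondence_bicat :: ('u::universe grpd, 'u span, 'u triple set) bicat)"
proof (rule bicategory.intro, goal_cases)
  case (1 H G)
  then show ?case using category_core[OF category_corr_cat] by simp
next
  case (2 K H G)
  then show ?case using is_functor_prod_core[OF category_corr_cat category_corr_cat functor_corr_hcomp] by simp
next
  case (3 G)
  then show ?case using correspondence_unit by simp
next
  case (4 L K H G X Y Z)
  then have G: "small_groupoid L" "small_groupoid K" "small_groupoid H" "small_groupoid G" by simp_all
  have X: "correspondence H G X" "correspondence K H Y" "correspondence L K Z" using 4 by simp_all
  have "iso_arr (corr_cat L G) (pullback_span (pullback_span X Y) Z) (pullback_span X (pullback_span Y Z)) (corr_assoc L K H G X Y Z)"
    by (intro iso_assoc correspondence_faithful G X)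
  moreover have "correspondence L G (pullback_span (pullback_span X Y) Z)" "correspondence L G (pullback_span X (pullback_span Y Z))"
    using correspondence_pullback G X by blast+
  ultimately show ?case using iso_arr_core[OF category_corr_cat[OF G(1,4)]] by simp
next
  case (5 L K H G X' X f Y' Y g Z' Z h)
  then have G: "small_groupoid L" "small_groupoid K" "small_groupoid H" "small_groupoid G" by simp_all
  have X: "correspondence H G X'" "correspondence H G X" "correspondence K H Y'" "correspondence K H Y" "correspondence L K Z'" "correspondence L K Z"
    using 5 by simp_all
  have f: "f \<in> Hom (corr_cat H G) X' X" "g \<in> Hom (corr_cat K H) Y' Y" "h \<in> Hom (corr_cat L K) Z' Z"
    using 5(7,10,13) by (simp_all add: iso_arr_in_Hom del: corr_cat_simps(2))
  show ?case using corr_assoc_natural[OF G X f] by simp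
next
  case (6 H G X)
  then have G: "small_groupoid H" "small_groupoid G" and X: "correspondence H G X" by simp_all
  have "iso_arr (corr_cat H G) (pullback_span (unit_span G) X) X (corr_lunit H G X)"
    by (intro iso_lunit correspondence_faithful correspondence_unit G X)
  then show ?case using iso_arr_core[OF category_corr_cat[OF G]] correspondence_pullback[OF G(2,2,1) correspondence_unit[OF G(2)] X] X by simp
next
  case (7 H G X' X f)
  then have G: "small_groupoid H" "small_groupoid G" and X: "correspondence H G X'" "correspondence H G X" by simp_all
  have f: "f \<in> Hom (corr_cat H G) X' X" using 7(5) by (simp add: iso_arr_in_Hom del: corr_cat_simps(2))
  show ?case using corr_lunit_natural[OF G X f] by simp
next
  case (8 H G X)
  then have G: "small_groupoid H" "small_groupoid G" and X: "correspondence H G X" by simp_all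
  have "iso_arr (corr_cat H G) (pullback_span X (unit_span H)) X (corr_runit H G X)"
    by (intro iso_runit correspondence_faithful correspondence_unit G X)
  then show ?case using iso_arr_core[OF category_corr_cat[OF G]] correspondence_pullback[OF G(2,1,1) X correspondence_unit[OF G(1)]] X by simp
next
  case (9 H G X' X f)
  then have G: "small_groupoid H" "small_groupoid G" and X: "correspondence H G X'" "correspondence H G X" by simp_all
  have f: "f \<in> Hom (corr_cat H G) X' X" using 9(5) by (simp add: iso_arr_in_Hom del: corr_cat_simps(2))
  show ?case using corr_runit_natural[OF G X f] by simp
next
  case (10 K H G X Y)
  then have G: "small_groupoid K" "small_groupoid H" "small_groupoid G" and X: "correspondence H G X" and Y: "correspondence K H Y" by simp_all
  note F = correspondence_faithful[OF G(2,3) X] correspondence_faithful[OF G(2,2) correspondence_unit[OF G(2)]] correspondence_faithful[OF G(1,2) Y]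
  note FP = pullback_faithful[OF F(1,3)] pullback_faithful[OF F(1,2)] pullback_faithful[OF F(2,3)]
  note FQ = pullback_faithful[OF FP(2) F(3)] pullback_faithful[OF F(1) FP(3)]
  note m = strict_map_pullback[OF strict_map_id strict_map_lunit] strict_map_pullback[OF strict_map_runit strict_map_id]
  show ?case
    unfolding correspondence_bicat_simps core_simps corr_Ident corr_structure_strict
      corr_hcomp_strict[OF F(1,1) FP(3) F(3) strict_map_id strict_map_lunit]
      corr_hcomp_strict[OF FP(2) F(1) F(3,3) strict_map_runit strict_map_id]
      strict_class_comp[OF FQ FP(1) strict_map_assoc m(1)]
    by (rule strict_class_eqI[OF FQ(1) FP(1) strict_map_comp[OF strict_map_assoc m(1)] m(2)]) auto
next
  case (11 M L K H G W X Y Z)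
  then have G: "small_groupoid M" "small_groupoid L" "small_groupoid K" "small_groupoid H" "small_groupoid G"
    and W: "correspondence H G W" "correspondence K H X" "correspondence L K Y" "correspondence M L Z" by simp_all
  note F = correspondence_faithful[OF G(4,5) W(1)] correspondence_faithful[OF G(3,4) W(2)]
    correspondence_faithful[OF G(2,3) W(3)] correspondence_faithful[OF G(1,2) W(4)]
  note WX = pullback_faithful[OF F(1,2)] and XY = pullback_faithful[OF F(2,3)] and YZ = pullback_faithful[OF F(3,4)]
  note WX_Y = pullback_faithful[OF WX F(3)] and W_XY = pullback_faithful[OF F(1) XY]
    and XY_Z = pullback_faithful[OF XY F(4)] and X_YZ = pullback_faithful[OF F(2) YZ]
  note P = pullback_faithful[OF WX_Y F(4)] pullback_faithful[OF WX YZ] pullback_faithful[OF F(1) X_YZ]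
    pullback_faithful[OF W_XY F(4)] pullback_faithful[OF F(1) XY_Z]
  note m = strict_map_pullback[OF strict_map_assoc strict_map_id] strict_map_pullback[OF strict_map_id strict_map_assoc]
  show ?case
    unfolding correspondence_bicat_simps core_simps corr_Ident corr_structure_strict
      corr_hcomp_strict[OF F(1,1) XY_Z X_YZ strict_map_id strict_map_assoc]
      corr_hcomp_strict[OF WX_Y W_XY F(4,4) strict_map_assoc strict_map_id]
      strict_class_comp[OF P(1,2,3) strict_map_assoc strict_map_assoc]
      strict_class_comp[OF P(1,4,5) m(1) strict_map_assoc]
      strict_class_comp[OF P(1,5,3) strict_map_comp[OF m(1) strict_map_assoc] m(2)]
    by (rule strict_class_eqI[OF P(1,3) strict_map_comp[OF strict_map_assoc strict_map_assoc]
          strict_map_comp[OF strict_map_comp[OF m(1) strict_map_assoc] m(2)]]) auto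
qed

section \<open>The pseudofunctor\<close>

text \<open>The comparison from the pullback of GXH and HYK to the translation groupoid of the
  tensor product: the objects (\<gamma>, x, \<eta>) and (\<eta>, y, \<kappa>) give (\<gamma>,
  [x, y], \<kappa>), and the middle arrow of H is forgotten.\<close>

definition tensor_map :: "'u::universe grpd \<Rightarrow> 'u grpd \<Rightarrow> 'u grpd \<Rightarrow> 'u biset \<Rightarrow> 'u biset \<Rightarrow> ('u, 'u, 'u, 'u) fctr" where
  "tensor_map K H G X Y = \<lparr>
     omap = (\<lambda>a. utriple (u1 (ufst a)) (biset_tensor_class K H G X Y (u3 (usnd a)) (u1 (ufst a))
        (utriple (u3 (ufst a)) (u2 (ufst a)) (u2 (usnd a)))) (u3 (usnd a))),
     amap = (\<lambda>a b f. upair (ufst (ufst f)) (usnd (usnd f)))\<rparr>"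

definition unit_map :: "'u::universe grpd \<Rightarrow> ('u, 'u, 'u, 'u) fctr" where
  "unit_map G = \<lparr>omap = (\<lambda>\<gamma>. utriple \<gamma> (Ident G \<gamma>) \<gamma>), amap = (\<lambda>a b g. upair g g)\<rparr>"

lemma unit_map_simps [simp]:
  "omap (unit_map G) \<gamma> = utriple \<gamma> (Ident G \<gamma>) \<gamma>" "amap (unit_map G) a b g = upair g g"
  by (simp_all add: unit_map_def)

lemma tensor_map_simps [simp]:
  "omap (tensor_map K H G X Y) a = utriple (u1 (ufst a)) (biset_tensor_class K H G X Y (u3 (usnd a)) (u1 (ufst a))
        (utriple (u3 (ufst a)) (u2 (ufst a)) (u2 (usnd a)))) (u3 (usnd a))"
  "amap (tensor_map K H G X Y) a b f = upair (ufst (ufst f)) (usnd (usnd f))"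
  by (simp_all add: tensor_map_def)

lemma translation_pullback_ObE:
  assumes "a \<in> Ob (pullback_span (translation_span H G X) (translation_span K H Y))"
  obtains \<gamma> x \<eta> y \<kappa> where "a = upair (utriple \<gamma> x \<eta>) (utriple \<eta> y \<kappa>)" "\<gamma> \<in> Obj G" "\<eta> \<in> Obj H" "\<kappa> \<in> Obj K"
    "x \<in> omap X (\<eta>, \<gamma>)" "y \<in> omap Y (\<kappa>, \<eta>)"
  using assms by (elim pullback_ObE translation_ObE) simp

context biset_pair
begin

text \<open>For an arrow with components g, h and k the pair (g, k) is again an arrow, since
  [g x, y] = [x' h, y] = [x', h y] = [x', y' k].\<close>

lemma strict_map_tensor:
  "strict_map (pullback_span (translation_span H G X) (translation_span K H Y))
     (translation_span K G (biset_tensor K H G X Y)) (tensor_map K H G X Y)"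
proof -
  let ?P = "pullback_span (translation_span H G X) (translation_span K H Y)"
  have "is_functor (apex ?P) (apex (translation_span K G (biset_tensor K H G X Y))) (tensor_map K H G X Y)"
  proof (unfold_locales, goal_cases)
    case (2 a b f)
    obtain \<gamma> x \<eta> y \<kappa> where a: "a = upair (utriple \<gamma> x \<eta>) (utriple \<eta> y \<kappa>)" "\<gamma> \<in> Obj G" "\<eta> \<in> Obj H" "\<kappa> \<in> Obj K"
      "x \<in> omap X (\<eta>, \<gamma>)" "y \<in> omap Y (\<kappa>, \<eta>)" using 2(1) by (rule translation_pullback_ObE)
    obtain \<gamma>' x' \<eta>' y' \<kappa>' where b: "b = upair (utriple \<gamma>' x' \<eta>') (utriple \<eta>' y' \<kappa>')" "\<gamma>' \<in> Obj G" "\<eta>' \<in> Obj H" "\<kappa>' \<in> Obj K"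
      "x' \<in> omap X (\<eta>', \<gamma>')" "y' \<in> omap Y (\<kappa>', \<eta>')" using 2(2) by (rule translation_pullback_ObE)
    obtain g h k where f: "f = upair (upair g h) (upair h k)" "g \<in> Hom G \<gamma> \<gamma>'" "h \<in> Hom H \<eta> \<eta>'" "k \<in> Hom K \<kappa> \<kappa>'"
      "lact H X \<eta> \<gamma> \<gamma>' g x = ract G X \<gamma>' \<eta>' \<eta> h x'" "lact K Y \<kappa> \<eta> \<eta>' h y = ract H Y \<eta>' \<kappa>' \<kappa> k y'"
      using 2(3) unfolding a b by auto
    have "cls \<kappa> \<gamma>' \<eta> (lact H X \<eta> \<gamma> \<gamma>' g x) y = cls \<kappa> \<gamma>' \<eta>' x' (ract H Y \<eta>' \<kappa>' \<kappa> k y')"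
      unfolding f(5) f(6)[symmetric] by (rule cls_slide) (use a b f in auto)
    then show ?case unfolding a(1) b(1) f(1) using a(2-) b(2-) f(2-4) by simp
  qed (auto elim!: translation_pullback_ObE)
  then show ?thesis by (auto simp: strict_map_def elim!: translation_pullback_ObE)
qed

text \<open>Fullness recovers the forgotten middle arrow: an arrow (g, k) of the target says
  [g x, y] = [x', y' k], and the arrow h witnessing this equality completes (g, k) to an arrow of
  the pullback. Every class has a pure representative, so objects are hit exactly.\<close>

lemma iso_tensor:
  assumes "small (Obj H)" and X: "admissible H G X" and Y: "admissible K H Y"
  shows "iso_arr (corr_cat K G) (pullback_span (translation_span H G X) (translation_span K H Y))
     (translation_span K G (biset_tensor K H G X Y))
     (strict_class K G (pullback_span (translation_span H G X) (translation_span K H Y))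
     (translation_span K G (biset_tensor K H G X Y)) (tensor_map K H G X Y))"
proof (rule iso_arr_strict_surj)
  let ?P = "pullback_span (translation_span H G X) (translation_span K H Y)"
  show "faithful_span K G ?P"
    by (rule pullback_faithful[OF faithful_translation[OF X.biset_axioms X] faithful_translation[OF Y.biset_axioms Y]])
  show "faithful_span K G (translation_span K G (biset_tensor K H G X Y))"
    by (rule faithful_translation[OF biset_tensor[OF assms(1)] admissible_tensor[OF assms]])
  show "strict_map ?P (translation_span K G (biset_tensor K H G X Y)) (tensor_map K H G X Y)" by (rule strict_map_tensor)
next
  fix a b m assume "a \<in> Ob (pullback_span (translation_span H G X) (translation_span K H Y))"
    and "b \<in> Ob (pullback_span (translation_span H G X) (translation_span K H Y))"
    and m: "m \<in> Ar (translation_span K G (biset_tensor K H G X Y)) (omap (tensor_map K H G X Y) a) (omap (tensor_map K H G X Y) b)"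
  then obtain \<gamma> x \<eta> y \<kappa> \<gamma>' x' \<eta>' y' \<kappa>' where a: "a = upair (utriple \<gamma> x \<eta>) (utriple \<eta> y \<kappa>)" "\<gamma> \<in> Obj G" "\<eta> \<in> Obj H" "\<kappa> \<in> Obj K"
      "x \<in> omap X (\<eta>, \<gamma>)" "y \<in> omap Y (\<kappa>, \<eta>)"
    and b: "b = upair (utriple \<gamma>' x' \<eta>') (utriple \<eta>' y' \<kappa>')" "\<gamma>' \<in> Obj G" "\<eta>' \<in> Obj H" "\<kappa>' \<in> Obj K"
      "x' \<in> omap X (\<eta>', \<gamma>')" "y' \<in> omap Y (\<kappa>', \<eta>')" by (elim translation_pullback_ObE) simp
  from m obtain g k where gk: "m = upair g k" "g \<in> Hom G \<gamma> \<gamma>'" "k \<in> Hom K \<kappa> \<kappa>'"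
    "cls \<kappa> \<gamma>' \<eta> (lact H X \<eta> \<gamma> \<gamma>' g x) y = cls \<kappa> \<gamma>' \<eta>' x' (ract H Y \<eta>' \<kappa>' \<kappa> k y')" using a b by auto
  then obtain h where "h \<in> Hom H \<eta> \<eta>'" "lact H X \<eta> \<gamma> \<gamma>' g x = ract G X \<gamma>' \<eta>' \<eta> h x'" "ract H Y \<eta>' \<kappa>' \<kappa> k y' = lact K Y \<kappa> \<eta> \<eta>' h y"
    using a b by (subst (asm) cls_eq_iff) auto
  then show "\<exists>f\<in>Ar (pullback_span (translation_span H G X) (translation_span K H Y)) a b. amap (tensor_map K H G X Y) a b f = m"
    using gk a b by (intro bexI[of _ "upair (upair g h) (upair h k)"]) auto
next
  fix b assume "b \<in> Ob (translation_span K G (biset_tensor K H G X Y))"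
  then obtain \<gamma> z \<kappa> where b: "b = utriple \<gamma> z \<kappa>" "\<gamma> \<in> Obj G" "\<kappa> \<in> Obj K" "z \<in> omap (biset_tensor K H G X Y) (\<kappa>, \<gamma>)"
    by (rule translation_ObE)
  from b(4) obtain \<eta> x y where "z = cls \<kappa> \<gamma> \<eta> x y" "\<eta> \<in> Obj H" "x \<in> omap X (\<eta>, \<gamma>)" "y \<in> omap Y (\<kappa>, \<eta>)" by (rule tensorE)
  then show "\<exists>a\<in>Ob (pullback_span (translation_span H G X) (translation_span K H Y)). omap (tensor_map K H G X Y) a = b"
    using b by (intro bexI[of _ "upair (utriple \<gamma> x \<eta>) (utriple \<eta> y \<kappa>)"]) auto
qed

end

lemma strict_map_unit:
  assumes "small_groupoid G"
  shows "strict_map (unit_span G) (translation_span G G (unit_biset G)) (unit_map G)"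
proof -
  interpret G: small_groupoid G by fact
  have "is_functor (apex (unit_span G)) (apex (translation_span G G (unit_biset G))) (unit_map G)"
    by unfold_locales auto
  then show ?thesis by (auto simp: strict_map_def)
qed

text \<open>Only objects of the form (\<gamma>, 1, \<gamma>) are hit, but an object (\<gamma>, f,
  \<gamma>') receives the arrow (f, 1) from (\<gamma>', 1, \<gamma>'). Fullness holds because an
  arrow (g, h) between two such objects has g = h.\<close>

lemma iso_unit:
  assumes G: "small_groupoid G"
  shows "iso_arr (corr_cat G G) (unit_span G) (translation_span G G (unit_biset G))
    (strict_class G G (unit_span G) (translation_span G G (unit_biset G)) (unit_map G))"
proof -
  interpret G: small_groupoid G by fact
  show ?thesis
  proof (rule iso_arr_strict)
    show "faithful_span G G (unit_span G)" by (rule correspondence_faithful[OF G G correspondence_unit[OF G]])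
    show "faithful_span G G (translation_span G G (unit_biset G))" by (rule faithful_translation[OF biset_unit[OF G] admissible_unit[OF G]])
    show "strict_map (unit_span G) (translation_span G G (unit_biset G)) (unit_map G)" by (rule strict_map_unit[OF G])
    fix a b g assume "a \<in> Ob (unit_span G)" "b \<in> Ob (unit_span G)"
      "g \<in> Ar (translation_span G G (unit_biset G)) (omap (unit_map G) a) (omap (unit_map G) b)"
    then show "\<exists>f\<in>Ar (unit_span G) a b. amap (unit_map G) a b f = g" by auto
  next
    fix b assume "b \<in> Ob (translation_span G G (unit_biset G))"
    then obtain \<gamma> f \<gamma>' where b: "b = utriple \<gamma> f \<gamma>'" "\<gamma> \<in> Obj G" "\<gamma>' \<in> Obj G" "f \<in> Hom G \<gamma>' \<gamma>"
      by (auto elim: translation_ObE)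
    then have "upair f (Ident G \<gamma>') \<in> Ar (translation_span G G (unit_biset G)) (omap (unit_map G) \<gamma>') b" by simp
    then show "\<exists>a\<in>Ob (unit_span G). Ar (translation_span G G (unit_biset G)) (omap (unit_map G) a) b \<noteq> {}"
      using b(3) by (intro bexI[of _ \<gamma>']) (auto simp del: translation_simps(2))
  qed
qed

section \<open>The structure 2-cells and coherence of the pseudofunctor\<close>

definition Phi_morphism ::
  "('u::universe grpd, 'u biset, 'u \<times> 'u \<Rightarrow> 'u \<Rightarrow> 'u, 'u grpd, 'u span, 'u triple set) bimor" where
  "Phi_morphism = \<lparr>Mob = (\<lambda>G. G), Mhom = Phi,
     Mcomp = (\<lambda>K H G X Y. strict_class K G (pullback_span (translation_span H G X) (translation_span K H Y))
       (translation_span K G (biset_tensor K H G X Y)) (tensor_map K H G X Y)),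
     Munit = (\<lambda>G. strict_class G G (unit_span G) (translation_span G G (unit_biset G)) (unit_map G))\<rparr>"

lemma Phi_morphism_simps [simp]:
  "Mob Phi_morphism G = G" "Mhom Phi_morphism = Phi"
  "Mcomp Phi_morphism K H G X Y = strict_class K G (pullback_span (translation_span H G X) (translation_span K H Y))
       (translation_span K G (biset_tensor K H G X Y)) (tensor_map K H G X Y)"
  "Munit Phi_morphism G = strict_class G G (unit_span G) (translation_span G G (unit_biset G)) (unit_map G)"
  by (simp_all add: Phi_morphism_def)

lemma burnside_twocell: "f \<in> twocells burnside_bicat H G X' X \<Longrightarrow> f \<in> Hom (biset_cat H G) X' X"
  by (simp add: iso_arr_in_Hom)

text \<open>Both composites are strict maps sending the pair of x and y to the class
  [f x, g y].\<close>

lemma Phi_tensor_natural: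
  assumes G: "small_groupoid K" "small_groupoid H" "small_groupoid G"
    and X: "biset H G X'" "admissible H G X'" "biset H G X" "admissible H G X"
    and Y: "biset K H Y'" "admissible K H Y'" "biset K H Y" "admissible K H Y"
    and f: "f \<in> Hom (biset_cat H G) X' X" and g: "g \<in> Hom (biset_cat K H) Y' Y"
  shows "Comp (corr_cat K G) (pullback_span (translation_span H G X') (translation_span K H Y'))
      (pullback_span (translation_span H G X) (translation_span K H Y)) (translation_span K G (biset_tensor K H G X Y))
      (strict_class K G (pullback_span (translation_span H G X) (translation_span K H Y))
         (translation_span K G (biset_tensor K H G X Y)) (tensor_map K H G X Y))
      (corr_hcomp K H G (translation_span H G X') (translation_span K H Y') (translation_span H G X) (translation_span K H Y)
         (strict_class H G (translation_span H G X') (translation_span H G X) (translation_map f))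
         (strict_class K H (translation_span K H Y') (translation_span K H Y) (translation_map g)))
    = Comp (corr_cat K G) (pullback_span (translation_span H G X') (translation_span K H Y'))
      (translation_span K G (biset_tensor K H G X' Y')) (translation_span K G (biset_tensor K H G X Y))
      (strict_class K G (translation_span K G (biset_tensor K H G X' Y')) (translation_span K G (biset_tensor K H G X Y))
         (translation_map (biset_tensor_map K H G X' Y' X Y f g)))
      (strict_class K G (pullback_span (translation_span H G X') (translation_span K H Y'))
         (translation_span K G (biset_tensor K H G X' Y')) (tensor_map K H G X' Y'))"
proof -
  note sH = small_groupoid.small_Obj[OF G(2)]
  interpret P': biset_pair K H G X' Y' using X(1) Y(1) by (rule biset_pair.intro)
  interpret P: biset_pair K H G X Y using X(3) Y(3) by (rule biset_pair.intro)
  note FX = faithful_translation[OF X(1,2)] faithful_translation[OF X(3,4)]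
    and FY = faithful_translation[OF Y(1,2)] faithful_translation[OF Y(3,4)]
  note FP = pullback_faithful[OF FX(1) FY(1)] pullback_faithful[OF FX(2) FY(2)]
  note FT = faithful_translation[OF P'.biset_tensor[OF sH] P'.admissible_tensor[OF sH X(2) Y(2)]]
    faithful_translation[OF P.biset_tensor[OF sH] P.admissible_tensor[OF sH X(4) Y(4)]]
  note tf = strict_map_translation[OF X(1,3) f] and tg = strict_map_translation[OF Y(1,3) g]
    and tfg = strict_map_translation[OF P'.biset_tensor[OF sH] P.biset_tensor[OF sH]
        tensor_map_in_Hom[OF P'.biset_pair_axioms P.biset_pair_axioms sH f g]]
  note m = strict_map_pullback[OF tf tg]
  show ?thesis
    unfolding corr_hcomp_strict[OF FX FY tf tg] strict_class_comp[OF FP FT(2) m P.strict_map_tensor]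
      strict_class_comp[OF FP(1) FT P'.strict_map_tensor tfg]
    by (rule strict_class_eqI[OF FP(1) FT(2) strict_map_comp[OF m P.strict_map_tensor] strict_map_comp[OF P'.strict_map_tensor tfg]])
      (auto elim!: translation_pullback_ObE simp: tensor_map_cls[OF P'.biset_pair_axioms P.biset_pair_axioms f g])
qed

text \<open>All 2-cells in the coherence conditions are strict, so objects are compared. In the
  associativity law x, y and z yield [x, [y, z]] along both paths. In the unit laws the inserted
  identity gives [1, x] or [x, 1], which the unitor of bi-sets returns to x.\<close>

theorem bicat_morphism_Phi: "bicat_morphism burnside_bicat correspondence_bicat Phi_morphism"
proof (intro bicat_morphism.intro bicat_morphism_axioms.intro bicategory_burnside bicategory_correspondence, goal_cases)
  case (1 G) then show ?case by simp
next
  case (2 H G)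
  then show ?case using is_functor_core[OF category_burnside_hom is_functor_Phi] by simp
next
  case (3 K H G X Y)
  then have G: "small_groupoid K" "small_groupoid H" "small_groupoid G" by simp_all
  have X: "biset H G X" "admissible H G X" and Y: "biset K H Y" "admissible K H Y"
    using 3(4,5) burnside_onecell G by blast+
  show ?case using biset_pair.iso_tensor[OF biset_pair.intro[OF X(1) Y(1)] small_groupoid.small_Obj[OF G(2)] X(2) Y(2)] by simp
next
  case (4 G) then show ?case using iso_unit by simp
next
  case (5 K H G X' X f Y' Y g)
  then have G: "small_groupoid K" "small_groupoid H" "small_groupoid G" by simp_all
  have X: "biset H G X'" "admissible H G X'" "biset H G X" "admissible H G X"
    and Y: "biset K H Y'" "admissible K H Y'" "biset K H Y" "admissible K H Y"
    using 5(4,5,7,8) burnside_onecell G by blast+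
  show ?case using Phi_tensor_natural[OF G X Y burnside_twocell[OF 5(6)] burnside_twocell[OF 5(9)]] by simp
next
  case (6 L K H G X Y Z G' H' K' L' FX FY FZ FXY FYZ FXY_Z FX_YZ)
  then have G: "small_groupoid L" "small_groupoid K" "small_groupoid H" "small_groupoid G" by simp_all
  have X: "biset H G X" "admissible H G X" and Y: "biset K H Y" "admissible K H Y" and Z: "biset L K Z" "admissible L K Z"
    using 6(5-7) burnside_onecell G by blast+
  note sH = small_groupoid.small_Obj[OF G(3)] and sK = small_groupoid.small_Obj[OF G(2)]
  interpret C: biset_chain L K H G X Y Z using X(1) Y(1) Z(1) sH sK by (rule biset_chainI)
  note XY = C.XY.biset_tensor[OF sH] C.XY.admissible_tensor[OF sH X(2) Y(2)]
    and YZ = C.YZ.biset_tensor[OF sK] C.YZ.admissible_tensor[OF sK Y(2) Z(2)]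
  note XY_Z = C.XY_Z.biset_tensor[OF sK] C.XY_Z.admissible_tensor[OF sK XY(2) Z(2)]
    and X_YZ = C.X_YZ.biset_tensor[OF sH] C.X_YZ.admissible_tensor[OF sH X(2) YZ(2)]
  note F = faithful_translation[OF X] faithful_translation[OF Y] faithful_translation[OF Z]
    and FXY = faithful_translation[OF XY] and FYZ = faithful_translation[OF YZ]
    and FT = faithful_translation[OF XY_Z] faithful_translation[OF X_YZ]
  note P = pullback_faithful[OF pullback_faithful[OF F(1,2)] F(3)] pullback_faithful[OF FXY F(3)]
    pullback_faithful[OF F(1) pullback_faithful[OF F(2,3)]] pullback_faithful[OF F(1) FYZ]
  note m1 = strict_map_pullback[OF C.XY.strict_map_tensor strict_map_id] and m2 = C.XY_Z.strict_map_tensor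
    and m3 = strict_map_translation[OF XY_Z(1) X_YZ(1) C.assoc_in_Hom]
    and m5 = strict_map_pullback[OF strict_map_id C.YZ.strict_map_tensor] and m6 = C.X_YZ.strict_map_tensor
  show ?case
    unfolding 6(8-18) Phi_morphism_simps Phi_simps burnside_simps correspondence_bicat_simps core_simps corr_Ident corr_structure_strict
      corr_hcomp_strict[OF pullback_faithful[OF F(1,2)] FXY F(3,3) C.XY.strict_map_tensor strict_map_id]
      corr_hcomp_strict[OF F(1,1) pullback_faithful[OF F(2,3)] FYZ strict_map_id C.YZ.strict_map_tensor]
      strict_class_comp[OF P(1,2) FT(1) m1 m2] strict_class_comp[OF P(1) FT strict_map_comp[OF m1 m2] m3]
      strict_class_comp[OF P(1,3,4) strict_map_assoc m5] strict_class_comp[OF P(1,4) FT(2) strict_map_comp[OF strict_map_assoc m5] m6]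
    by (rule strict_class_eqI[OF P(1) FT(2) strict_map_comp[OF strict_map_comp[OF m1 m2] m3]
          strict_map_comp[OF strict_map_comp[OF strict_map_assoc m5] m6]])
      (auto elim!: pullback_ObE translation_ObE)
next
  case (7 H G X G' H' FX F1 F1X)
  then have G: "small_groupoid H" "small_groupoid G" by simp_all
  have X: "biset H G X" "admissible H G X" using 7(3) burnside_onecell[OF G] by blast+
  note s = small_groupoid.small_Obj[OF G(2)] and U = biset_unit[OF G(2)] admissible_unit[OF G(2)]
  interpret G: small_groupoid G by (rule G)
  interpret X: biset H G X by (rule X)
  interpret C: biset_pair H G G "unit_biset G" X using biset_pair_lunit[OF G(2) X(1)] .
  note UX = C.biset_tensor[OF s] C.admissible_tensor[OF s U(2) X(2)]
  note F = faithful_translation[OF X] faithful_translation[OF U] faithful_translation[OF UX]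
    correspondence_faithful[OF G(2,2) correspondence_unit[OF G(2)]]
  note P = pullback_faithful[OF F(4,1)] pullback_faithful[OF F(2,1)]
  note m1 = strict_map_pullback[OF strict_map_unit[OF G(2)] strict_map_id] and m2 = C.strict_map_tensor
    and m3 = strict_map_translation[OF UX(1) X(1) lunit_in_Hom[OF G(2) X(1)]]
  show ?case
    unfolding 7(4-8) Phi_morphism_simps Phi_simps burnside_simps correspondence_bicat_simps core_simps corr_Ident corr_structure_strict
      corr_hcomp_strict[OF F(4,2,1,1) strict_map_unit[OF G(2)] strict_map_id]
      strict_class_comp[OF P F(3) m1 m2] strict_class_comp[OF P(1) F(3,1) strict_map_comp[OF m1 m2] m3]
    by (rule strict_class_eqI[OF P(1) F(1) strict_map_comp[OF strict_map_comp[OF m1 m2] m3] strict_map_lunit])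
      (auto elim!: pullback_ObE translation_ObE simp: lunit_cls[OF G(2) X(1)])
next
  case (8 H G X G' H' FX F1 FX1)
  then have G: "small_groupoid H" "small_groupoid G" by simp_all
  have X: "biset H G X" "admissible H G X" using 8(3) burnside_onecell[OF G] by blast+
  note s = small_groupoid.small_Obj[OF G(1)] and U = biset_unit[OF G(1)] admissible_unit[OF G(1)]
  interpret H: small_groupoid H by (rule G)
  interpret X: biset H G X by (rule X)
  interpret C: biset_pair H H G X "unit_biset H" using biset_pair_runit[OF G(1) X(1)] .
  note XU = C.biset_tensor[OF s] C.admissible_tensor[OF s X(2) U(2)]
  note F = faithful_translation[OF X] faithful_translation[OF U] faithful_translation[OF XU]
    correspondence_faithful[OF G(1,1) correspondence_unit[OF G(1)]]
  note P = pullback_faithful[OF F(1,4)] pullback_faithful[OF F(1,2)]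
  note m1 = strict_map_pullback[OF strict_map_id strict_map_unit[OF G(1)]] and m2 = C.strict_map_tensor
    and m3 = strict_map_translation[OF XU(1) X(1) runit_in_Hom[OF G(1) X(1)]]
  show ?case
    unfolding 8(4-8) Phi_morphism_simps Phi_simps burnside_simps correspondence_bicat_simps core_simps corr_Ident corr_structure_strict
      corr_hcomp_strict[OF F(1,1,4,2) strict_map_id strict_map_unit[OF G(1)]]
      strict_class_comp[OF P F(3) m1 m2] strict_class_comp[OF P(1) F(3,1) strict_map_comp[OF m1 m2] m3]
    by (rule strict_class_eqI[OF P(1) F(1) strict_map_comp[OF strict_map_comp[OF m1 m2] m3] strict_map_runit])
      (auto elim!: pullback_ObE translation_ObE simp: runit_cls[OF G(1) X(1)])
qed

text \<open>The local equivalences and the invertibility of the structure 2-cells are established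
  separately. Surjectivity on objects reduces to the internal equivalence of each groupoid with
  itself.\<close>

theorem bi_equivalence_Phi: "bi_equivalence burnside_bicat correspondence_bicat Phi_morphism"
proof (intro bi_equivalence.intro bicat_homomorphism.intro bicat_morphism_Phi bicat_homomorphism_axioms.intro
    bi_equivalence_axioms.intro, goal_cases)
  case (1 K H G X Y)
  then have G: "small_groupoid K" "small_groupoid H" "small_groupoid G" by simp_all
  have X: "biset H G X" "admissible H G X" and Y: "biset K H Y" "admissible K H Y"
    using 1(4,5) burnside_onecell G by blast+
  note p = biset_pair.intro[OF X(1) Y(1)] and s = small_groupoid.small_Obj[OF G(2)]
  have "correspondence K G (pullback_span (translation_span H G X) (translation_span K H Y))"
    by (rule correspondence_pullback[OF G(3,2,1) correspondence_translation[OF G(2,3) X] correspondence_translation[OF G(1,2) Y]])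
  moreover have "correspondence K G (translation_span K G (biset_tensor K H G X Y))"
    by (rule correspondence_translation[OF G(1,3) biset_pair.biset_tensor[OF p s] biset_pair.admissible_tensor[OF p s X(2) Y(2)]])
  ultimately show ?case
    using biset_pair.iso_tensor[OF p s X(2) Y(2)] iso_arr_core[OF category_corr_cat[OF G(1,3)]] by simp
next
  case (2 G)
  then have G: "small_groupoid G" by simp
  show ?case
    using iso_unit[OF G] iso_arr_core[OF category_corr_cat[OF G G]] correspondence_unit[OF G]
      correspondence_translation[OF G G biset_unit[OF G] admissible_unit[OF G]] by simp
next
  case (3 H G)
  then show ?case using equivalence_Phi by simp
next
  case (4 G)
  then have G: "small_groupoid G" by simp
  note U = correspondence_unit[OF G] and FU = correspondence_faithful[OF G G correspondence_unit[OF G]]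
  \<comment> \<open>The unit correspondence serves as both 1-cells of the internal equivalence, and
    its left unitor as both isomorphisms.\<close>
  have "iso_arr (core (corr_cat G G)) (pullback_span (unit_span G) (unit_span G)) (unit_span G) (corr_lunit G G (unit_span G))"
    using iso_lunit[OF FU FU FU] iso_arr_core[OF category_corr_cat[OF G G]] U correspondence_pullback[OF G G G U U] by simp
  then have "internally_equivalent correspondence_bicat G G"
    unfolding internally_equivalent_def isomorphic_def using U by (intro bexI[of _ "unit_span G"]) auto
  then show ?case using G by auto
qed

theorem theorem5p2:
  shows "\<exists>F. bicat_morphism (burnside_bicat :: ('u::universe grpd, 'u biset, 'u \<times> 'u \<Rightarrow> 'u \<Rightarrow> 'u) bicat)
               (correspondence_bicat :: ('u grpd, 'u span, 'u triple set) bicat) F \<and>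
             (\<forall>G\<in>BOb burnside_bicat. Mob F G = G) \<and>
             (\<forall>H\<in>BOb burnside_bicat. \<forall>G\<in>BOb burnside_bicat. Mhom F H G = Phi H G) \<and>
             bi_equivalence burnside_bicat correspondence_bicat F"
  using bicat_morphism_Phi bi_equivalence_Phi by (intro exI[of _ Phi_morphism]) simp

end
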